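(* Let $F$ be an element of the Selberg class $S$, with degree $d_F$. For $\sigma\in\mathbb{R}$ and $T\ge 2$ let $N_F(\sigma,T)$ denote the number of non-trivial zeros $\varrho=\beta+i\gamma$ of $F$ (counted with multiplicity) with $\beta\ge\sigma$ and $|\gamma|\le T$. Then for every $\varepsilon>0$ and every $0<\eta\le 1/10$, $$N_F(1-\eta,T)\ll_{\varepsilon,F} T^{\max(d_F,2)\,\eta+\varepsilon},$$ where the implied constant depends only on $\varepsilon$ and $F$.
   Context: The Selberg class $S$ consists of Dirichlet series $F(s)=\sum_{n\ge1}a(n)n^{-s}$ (with $s=\sigma+it$) satisfying: (i) $F(s)$ converges absolutely for $\sigma>1$; (ii) $(s-1)^mF(s)$ is an entire function of finite order for some integer $m\ge0$; (iii) $F$ satisfies the functional equation $\Phi(s)=\omega\overline{\Phi(1-\bar s)}$, where $|\omega|=1$ and $\Phi(s)=Q^s\prod_{j=1}^r\Gamma(\lambda_js+\mu_j)F(s)$ with $Q>0$, $\lambda_j>0$, $\mathrm{Re}\,\mu_j\ge0$; (iv) (Ramanujan condition) $a(n)\ll n^{\varepsilon}$ for every $\varepsilon>0$; (v) $\log F(s)=\sum_p\sum_{m\ge1}b(p^m)p^{-ms}$ is a Dirichlet series with $b(p^m)\ll (p^m)^{\vartheta}$ for some $\vartheta<1/2$. The degree of $F$ is $d_F=2\sum_{j=1}^r\lambda_j$ (an invariant of $F$). Non-trivial zeros of $F$ are its zeros in the strip $0\le \sigma\le 1$ (i.e. those not coming from poles of the gamma factors). *)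

theory Defs
  imports "HOL-Complex_Analysis.Complex_Analysis"
begin

text \<open>
  An element of the Selberg class is represented by a function on all of the complex plane, namely
  the meromorphic continuation of its Dirichlet series. At the possible pole \<open>s = 1\<close> its value
  is the junk value \<open>0\<close> (the convention of \<open>nicely_meromorphic_on\<close>).
\<close>

definition dirichlet_term :: "(nat \<Rightarrow> complex) \<Rightarrow> complex \<Rightarrow> nat \<Rightarrow> complex" where
  "dirichlet_term a s n = a n * of_nat n powr (-s)"

definition has_dirichlet_series :: "(complex \<Rightarrow> complex) \<Rightarrow> (nat \<Rightarrow> complex) \<Rightarrow> bool" where
  "has_dirichlet_series F a \<longleftrightarrow>
     (\<forall>s. Re s > 1 \<longrightarrow>
        (\<lambda>n. norm (dirichlet_term a s n)) summable_on {1..} \<and>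
        (dirichlet_term a s has_sum F s) {1..})"

definition entire_of_finite_order :: "(complex \<Rightarrow> complex) \<Rightarrow> bool" where
  "entire_of_finite_order G \<longleftrightarrow>
     G holomorphic_on UNIV \<and>
     (\<exists>\<rho>::real. (\<lambda>s. norm (G s)) \<in> O[at_infinity](\<lambda>s. exp (norm s powr \<rho>)))"

definition has_selberg_continuation :: "(complex \<Rightarrow> complex) \<Rightarrow> bool" where
  "has_selberg_continuation F \<longleftrightarrow>
     F nicely_meromorphic_on UNIV \<and>
     (\<exists>(m::nat) G. entire_of_finite_order G \<and> (\<forall>s. s \<noteq> 1 \<longrightarrow> G s = (s - 1) ^ m * F s))"

definition completed_function ::
    "(complex \<Rightarrow> complex) \<Rightarrow> real \<Rightarrow> nat \<Rightarrow> (nat \<Rightarrow> real) \<Rightarrow> (nat \<Rightarrow> complex) \<Rightarrow> complex \<Rightarrow> complex" where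
  "completed_function F Q r lam mu s =
     of_real Q powr s * (\<Prod>j=1..r. Gamma (of_real (lam j) * s + mu j)) * F s"

text \<open>
  The functional equation is an identity of meromorphic functions. It is stated pointwise away from
  the points where either side involves a pole of a Gamma factor or the possible pole of \<open>F\<close>, since
  there the library functions take junk values. The excluded points form a discrete set.
\<close>

definition selberg_functional_equation ::
    "(complex \<Rightarrow> complex) \<Rightarrow> complex \<Rightarrow> real \<Rightarrow> nat \<Rightarrow> (nat \<Rightarrow> real) \<Rightarrow> (nat \<Rightarrow> complex) \<Rightarrow> bool" where
  "selberg_functional_equation F \<omega> Q r lam mu \<longleftrightarrow>
     norm \<omega> = 1 \<and> Q > 0 \<and> (\<forall>j\<in>{1..r}. lam j > 0 \<and> Re (mu j) \<ge> 0) \<and>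
     (\<forall>s. s \<noteq> 0 \<and> s \<noteq> 1 \<and>
          (\<forall>j\<in>{1..r}. of_real (lam j) * s + mu j \<notin> \<int>\<^sub>\<le>\<^sub>0 \<and>
                        of_real (lam j) * (1 - cnj s) + mu j \<notin> \<int>\<^sub>\<le>\<^sub>0) \<longrightarrow>
        completed_function F Q r lam mu s =
          \<omega> * cnj (completed_function F Q r lam mu (1 - cnj s)))"

definition ramanujan_condition :: "(nat \<Rightarrow> complex) \<Rightarrow> bool" where
  "ramanujan_condition a \<longleftrightarrow>
     (\<forall>\<epsilon>>0. (\<lambda>n. norm (a n)) \<in> O(\<lambda>n. real n powr \<epsilon>))"

text \<open>
  The logarithm of \<open>F\<close> is expressed by saying that the exponential of the series is \<open>F\<close>; the series
  has no constant term, so it tends to \<open>0\<close> as \<open>Re s\<close> tends to infinity, which fixes the branch.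
\<close>

definition selberg_log_series :: "(complex \<Rightarrow> complex) \<Rightarrow> bool" where
  "selberg_log_series F \<longleftrightarrow>
     (\<exists>b :: nat \<Rightarrow> complex.
        (\<exists>\<theta> C :: real. \<theta> < 1/2 \<and>
           (\<forall>p m. prime p \<and> m \<ge> 1 \<longrightarrow> norm (b (p ^ m)) \<le> C * real (p ^ m) powr \<theta>)) \<and>
        (\<forall>s. Re s > 1 \<longrightarrow>
           (\<exists>L. ((\<lambda>(p, m). dirichlet_term b s (p ^ m)) has_sum L) ({p. prime p} \<times> {1..}) \<and>
                exp L = F s)))"

definition selberg_class :: "(complex \<Rightarrow> complex) set" where
  "selberg_class =
     {F. (\<exists>a. has_dirichlet_series F a \<and> ramanujan_condition a) \<and>
         has_selberg_continuation F \<and>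
         (\<exists>\<omega> Q r lam mu. selberg_functional_equation F \<omega> Q r lam mu) \<and>
         selberg_log_series F}"

text \<open>
  The data of the functional equation are not unique, hence the degree is a relation; that it is
  single-valued on the Selberg class is a theorem which the definition does not presuppose.
\<close>

definition has_selberg_degree :: "(complex \<Rightarrow> complex) \<Rightarrow> real \<Rightarrow> bool" where
  "has_selberg_degree F d \<longleftrightarrow>
     (\<exists>\<omega> Q r lam mu. selberg_functional_equation F \<omega> Q r lam mu \<and> d = 2 * (\<Sum>j=1..r. lam j))"

text \<open>The condition on poles discards the junk zero at a pole.\<close>

definition nontrivial_zeros :: "(complex \<Rightarrow> complex) \<Rightarrow> complex set" where
  "nontrivial_zeros F = {s. F s = 0 \<and> \<not> is_pole F s \<and> 0 \<le> Re s \<and> Re s \<le> 1}"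

definition zero_count :: "(complex \<Rightarrow> complex) \<Rightarrow> real \<Rightarrow> real \<Rightarrow> nat" where
  "zero_count F \<sigma> T =
     (\<Sum>\<rho> | \<rho> \<in> nontrivial_zeros F \<and> Re \<rho> \<ge> \<sigma> \<and> \<bar>Im \<rho>\<bar> \<le> T. nat (zorder F \<rho>))"

text \<open>
  The sum above is never degenerate: its index set is finite and every summand is positive.
\<close>

lemma selberg_class_avoid_zero:
  assumes "F \<in> selberg_class"
  shows "\<forall>\<^sub>\<approx>s\<in>UNIV. F s \<noteq> 0"
proof -
  have mero: "F nicely_meromorphic_on UNIV"
    using assms by (auto simp: selberg_class_def has_selberg_continuation_def)
  have "selberg_log_series F"
    using assms by (auto simp: selberg_class_def)
  then obtain b :: "nat \<Rightarrow> complex" where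
    b: "\<And>s. Re s > 1 \<Longrightarrow>
          \<exists>L. ((\<lambda>(p, m). dirichlet_term b s (p ^ m)) has_sum L) ({p. prime p} \<times> {1..}) \<and> exp L = F s"
    unfolding selberg_log_series_def by blast
  have "F 2 \<noteq> 0"
    using b[of 2] by (metis exp_not_eq_zero one_less_numeral_iff complex_Re_numeral semiring_norm(76))
  then show ?thesis
    using nicely_meromorphic_imp_constant_or_avoid[OF mero, of 0] by auto
qed

lemma finite_counted_zeros:
  assumes "F \<in> selberg_class"
  shows "finite {\<rho>. \<rho> \<in> nontrivial_zeros F \<and> Re \<rho> \<ge> \<sigma> \<and> \<bar>Im \<rho>\<bar> \<le> T}"
proof -
  have "{s. F s = 0} sparse_in UNIV"
    using selberg_class_avoid_zero[OF assms] by (simp add: eventually_cosparse)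
  then have "finite (cbox (Complex 0 (-T)) (Complex 1 T) \<inter> {s. F s = 0})"
    by (metis compact_cbox sparse_in_compact_finite sparse_in_subset subset_UNIV)
  then show ?thesis
    by (rule finite_subset[rotated])
       (auto simp: nontrivial_zeros_def in_cbox_complex_iff)
qed

lemma zorder_nontrivial_zero_pos:
  assumes "F \<in> selberg_class" "\<rho> \<in> nontrivial_zeros F"
  shows "zorder F \<rho> > 0"
proof -
  have "F nicely_meromorphic_on UNIV"
    using assms by (auto simp: selberg_class_def has_selberg_continuation_def)
  then have ana: "F analytic_on {\<rho>}"
    using assms(2) nicely_meromorphic_on_imp_analytic_at by (auto simp: nontrivial_zeros_def)
  have "\<forall>\<^sub>F s in at \<rho>. F s \<noteq> 0"
    using selberg_class_avoid_zero[OF assms(1)]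
    by (metis UNIV_I eventually_cosparse_imp_eventually_at eventually_mono)
  then show ?thesis
    using ana assms(2) zorder_pos_iff'[OF ana] 
    by (auto simp: nontrivial_zeros_def eventually_frequently)
qed

end

theory Submission
  imports Defs "HOL-Number_Theory.Prime_Powers" "HOL-Real_Asymp.Real_Asymp"
begin

text \<open>
  Write \<open>D = max d 2 / 2\<close> and let \<open>\<rho> = \<beta> + i\<gamma>\<close> be a zero with \<open>\<beta> \<ge> 9/10\<close>. By the Euler product there is a
  Dirichlet series \<open>g\<close> such that \<open>F\<close> times \<open>g\<close> converges absolutely and stays away from zero for
  \<open>Re s \<ge> 4/5\<close>. Let \<open>M\<close> be \<open>g\<close> truncated at \<open>T\<^sup>\<delta>\<close>, and integrate
  \<open>F(\<rho> + w) M(\<rho> + w) T\<^bsup>D w\<^esup> exp(w\<^sup>2) / w\<close> over a vertical line far to the right. The zero removes the pole at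
  \<open>w = 0\<close>, so the line can be moved far to the left, where the functional equation applies. The dual
  series beyond \<open>T\<^bsup>D + 2\<delta>\<^esup>\<close> is negligible there; the rest is moved to the critical line. Hence either a
  Dirichlet polynomial supported on \<open>(T\<^sup>\<delta>, T\<^bsup>D + \<delta>\<^esup>]\<close> is large at \<open>\<rho>\<close>, or a mean over
  \<open>\<bar>t - \<gamma>\<bar> \<le> T\<^sup>\<delta>\<close> of the dual polynomial on the critical line is at least about \<open>T\<^bsup>D (\<beta> - 1/2)\<^esup>\<close>.

  The second case is counted by the mean value theorem for Dirichlet polynomials. In the first case
  a dyadic block is raised to a power, so that its length \<open>M\<close> is at least \<open>T\<^bsup>1/2\<^esup>\<close>. The Halasz--Montgomery
  inequality with the van der Corput bound \<open>M/t + M\<^bsup>1/2\<^esup> t\<^bsup>1/6\<^esup>\<close> for \<open>\<Sum> n\<^bsup>it\<^esup>\<close>, applied in short windows, then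
  gives \<open>M\<^bsup>2 - 2\<sigma>\<^esup> + T M\<^bsup>11 - 14\<sigma>\<^esup>\<close> up to \<open>T\<^sup>\<epsilon>\<close>. The last term is at most \<open>T\<^bsup>2 - 2\<sigma>\<^esup>\<close> exactly
  because \<open>\<sigma> \<ge> 9/10\<close>.
\<close>

section \<open>Van der Corput estimates for exponential sums\<close>

text \<open>For general degree no good moment of \<open>F\<close> on the critical line is known. At
  height T the analytic conductor is about \<open>T powr d\<close>, so both sums have length near
  its square root, \<open>T powr D\<close> if d \<ge> 2. The floor D \<ge> 1 is there because a mean
  square over an interval of length T costs at least T, and the large values bound contains
  \<open>T powr (2 - 2 * \<sigma>)\<close>. The factor \<open>g\<close> inverts the primes only. The
  logarithm may have coefficients as large as \<open>(p ^ m) powr \<theta>\<close>, so no Ramanujan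
  bound for 1/F is at hand, whereas the coefficients at primes are those of \<open>F\<close>, and
  the exponential of their negatives inherits the bound. The higher prime powers form a series that
  converges absolutely at 4/5. The Gaussian permits a cut at height \<open>T powr \<delta>\<close>.
  Only zeros at least twice that high are detected, and only one per window of that size is counted;
  Jensen's bound supplies the remaining ones.\<close>

lemma sin_pi_ge:
  fixes x \<Delta> :: real
  assumes "0 \<le> \<Delta>" "\<Delta> \<le> x" "x \<le> 1 - \<Delta>"
  shows "2 * \<Delta> \<le> sin (pi * x)"
proof -
  have half: "2 * y \<le> sin (pi * y)" if "0 \<le> y" "y \<le> 1/2" for y :: real
  proof -
    have "concave_on {0..pi} sin"
      by (rule f''_le0_imp_concave[where f' = cos and f'' = "\<lambda>x. - sin x"])
         (auto intro!: derivative_eq_intros sin_ge_zero)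
    \<comment> \<open>The graph of sine lies above its chord from 0 to pi/2, and
      \<open>pi * y\<close> is the point of parameter \<open>2 * y\<close> on that interval.\<close>
    from concave_onD[OF this, of "2*y" 0 "pi/2"] that
    show ?thesis by (simp add: mult.commute)
  qed
  show ?thesis
  proof (cases "x \<le> 1/2")
    case True
    then show ?thesis using half[of x] assms by linarith
  next
    case False
    have "sin (pi * x) = sin (pi * (1 - x))"
      by (simp add: right_diff_distrib sin_diff)
    then show ?thesis using half[of "1 - x"] assms False by auto
  qed
qed

text \<open>The real part does not depend on the angle. In a summation by parts with these
  coefficients only cotangents vary, and they are monotone in the angle.\<close>

lemma inverse_one_minus_cis:
  assumes "sin (\<theta>/2) \<noteq> 0"
  shows "1 / (1 - cis \<theta>) = 1/2 + \<i> / 2 * of_real (cot (\<theta>/2))"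
proof -
  define s c where "s = sin (\<theta>/2)" and "c = cos (\<theta>/2)"
  have sc: "s^2 + c^2 = 1" by (simp add: s_def c_def)
  have th: "cos \<theta> = 1 - 2 * s^2" "sin \<theta> = 2 * s * c"
    using cos_double_sin[of "\<theta>/2"] sin_double[of "\<theta>/2"] by (simp_all add: s_def c_def)
  have s0: "s \<noteq> 0" using assms by (simp add: s_def)
  have "(1 - cis \<theta>) * (1/2 + \<i> / 2 * of_real (c/s)) = 1"
  proof (rule complex_eqI)
    have "Re ((1 - cis \<theta>) * (1/2 + \<i> / 2 * of_real (c/s))) = s^2 + c^2"
      using s0 by (simp add: th power2_eq_square field_simps)
    then show "Re ((1 - cis \<theta>) * (1/2 + \<i> / 2 * of_real (c/s))) = Re 1" using sc by simp
    show "Im ((1 - cis \<theta>) * (1/2 + \<i> / 2 * of_real (c/s))) = Im 1"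
      using s0 by (simp add: th power2_eq_square field_simps)
  qed
  moreover from this have "1 - cis \<theta> \<noteq> 0" by auto
  ultimately show ?thesis
    by (simp add: field_simps cot_def s_def c_def)
qed

text \<open>The difference \<open>cot x - cot y\<close> equals \<open>sin (y - x)\<close> divided by
  \<open>sin x * sin y\<close>.\<close>

lemma cot_antimono_pi:
  fixes x y :: real
  assumes "0 < x" "x \<le> y" "y < pi"
  shows "cot y \<le> cot x"
proof -
  have "sin x > 0" "sin y > 0" using assms by (auto intro!: sin_gt_zero)
  moreover have "sin (y - x) \<ge> 0" using assms by (intro sin_ge_zero) auto
  ultimately show ?thesis
    by (simp add: cot_def divide_simps sin_diff algebra_simps)
qed

text \<open>The Kusmin-Landau inequality. Each term is \<open>C n\<close> times the difference of
  two neighbouring terms, with \<open>C n\<close> the inverse of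
  \<open>1 - cis (2 * pi * d n)\<close>. Summation by parts leaves the variation of
  \<open>C\<close>, which telescopes because the differences \<open>d\<close> are monotone.\<close>

lemma kusmin_landau_0:
  fixes f :: "nat \<Rightarrow> real" and \<Delta> :: real
  assumes D: "0 < \<Delta>" and D2: "\<Delta> \<le> 1/2" and ab: "a \<le> b"
    and bd: "\<And>n. a \<le> n \<Longrightarrow> n < b \<Longrightarrow> \<Delta> \<le> f (Suc n) - f n \<and> f (Suc n) - f n \<le> 1 - \<Delta>"
    and mono: "\<And>n. a \<le> n \<Longrightarrow> Suc n < b \<Longrightarrow> f (Suc n) - f n \<le> f (Suc (Suc n)) - f (Suc n)"
  shows "norm (\<Sum>n=a..b. cis (2 * pi * f n)) \<le> 2 / \<Delta>"
proof (cases "a = b")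
  case True
  then show ?thesis using D D2 by (simp add: field_simps)
next
  case False
  define z where "z n = cis (2 * pi * f n)" for n
  define d where "d n = f (Suc n) - f n" for n
  define c where "c n = cot (pi * d n)" for n
  define C where "C n = 1/2 + \<i> / 2 * of_real (c n)" for n
  have bd': "\<Delta> \<le> d n" "d n \<le> 1 - \<Delta>" "2 * \<Delta> \<le> sin (pi * d n)" if "a \<le> n" "n < b" for n
    using bd[OF that] sin_pi_ge[of \<Delta> "d n"] D by (auto simp: d_def)
  have zC: "z n = C n * (z n - z (Suc n))" if "a \<le> n" "n < b" for n
  proof -
    have s: "sin (pi * d n) \<noteq> 0" using bd'(3)[OF that] D by linarith
    have eq: "1 / (1 - cis (2 * pi * d n)) = C n"
      using inverse_one_minus_cis[of "2 * pi * d n"] s by (simp add: C_def c_def)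
    have C0: "C n \<noteq> 0" by (simp add: C_def complex_eq_iff)
    then have n1: "1 - cis (2 * pi * d n) \<noteq> 0" using eq by auto
    have "z n - z (Suc n) = z n * (1 - cis (2 * pi * d n))"
      by (simp add: z_def d_def algebra_simps cis_mult)
    then have "C n * (z n - z (Suc n)) = z n" using n1 by (simp flip: eq)
    then show ?thesis by simp
  qed
  have c_le: "\<bar>c n\<bar> \<le> 1 / (2 * \<Delta>)" if "a \<le> n" "n < b" for n
  proof -
    have "\<bar>c n\<bar> = \<bar>cos (pi * d n)\<bar> / \<bar>sin (pi * d n)\<bar>"
      by (simp add: c_def cot_def)
    also have "\<dots> \<le> 1 / (2 * \<Delta>)"
      using bd'(3)[OF that] D by (intro frac_le) auto
    finally show ?thesis .
  qed
  have C_le: "norm (C n) \<le> 1/2 + 1 / (4 * \<Delta>)" if "a \<le> n" "n < b" for n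
  proof -
    have "norm (C n) \<le> 1/2 + \<bar>c n\<bar> / 2"
      unfolding C_def by (rule order_trans[OF norm_triangle_ineq]) (simp add: norm_mult norm_divide)
    then show ?thesis using c_le[OF that] by simp
  qed
  have c_dec: "c (Suc n) \<le> c n" if "a \<le> n" "Suc n < b" for n
    unfolding c_def
  proof (rule cot_antimono_pi)
    show "0 < pi * d n" using bd'(1)[of n] that D by simp
    show "pi * d n \<le> pi * d (Suc n)" using mono[OF that] by (simp add: d_def)
    show "pi * d (Suc n) < pi" using bd'(2)[of "Suc n"] that D by simp
  qed
  \<comment> \<open>The error of the summation by parts is at most the total variation of
    \<open>C\<close> so far, which is half the decrease of \<open>c\<close>.\<close>
  have main: "norm ((\<Sum>n=a..<Suc (a+k). z n) + C (a+k) * z (Suc (a+k)) - C a * z a) \<le> (c a - c (a+k)) / 2"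
    if "a + k < b" for k
    using that
  proof (induction k)
    case 0
    then show ?case using zC[of a] by (simp add: algebra_simps)
  next
    case (Suc k)
    define m where "m = Suc (a+k)"
    have m: "a \<le> m" "m < b" "a + Suc k = m" "a \<le> a + k" "Suc (a+k) < b" using Suc.prems by (auto simp: m_def)
    have "(\<Sum>n=a..<Suc m. z n) + C m * z (Suc m) - C a * z a =
          ((\<Sum>n=a..<m. z n) + C (a+k) * z m - C a * z a) + (C m - C (a+k)) * z m"
      using zC[OF m(1,2)] m(1) by (simp add: algebra_simps)
    also have "norm \<dots> \<le> (c a - c (a+k)) / 2 + norm ((C m - C (a+k)) * z m)"
      using Suc by (intro norm_triangle_mono) (auto simp: m_def)
    also have "norm ((C m - C (a+k)) * z m) = (c (a+k) - c m) / 2"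
    proof -
      have "C m - C (a+k) = \<i> / 2 * of_real (c m - c (a+k))" by (simp add: C_def algebra_simps)
      then have "norm (C m - C (a+k)) = \<bar>c m - c (a+k)\<bar> / 2"
        by (simp only: norm_mult norm_divide norm_of_real) simp
      then have "norm ((C m - C (a+k)) * z m) = \<bar>c m - c (a+k)\<bar> / 2"
        by (simp add: norm_mult z_def)
      then show ?thesis using c_dec[OF m(4,5)] by (simp add: m_def)
    qed
    finally show ?case using m(3) by (simp add: m_def diff_divide_distrib)
  qed
  define k where "k = b - 1 - a"
  have k: "a + k = b - 1" "Suc (a + k) = b" "a + k < b" using False ab by (auto simp: k_def)
  define S where "S = (\<Sum>n=a..<b. z n)"
  have "norm (S + C (b-1) * z b - C a * z a) \<le> (c a - c (b-1)) / 2"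
    using main[OF k(3)] unfolding k(2) unfolding k(1) S_def .
  also have "\<dots> \<le> 1 / (2 * \<Delta>)"
  proof -
    have "a < b" "a \<le> b - 1" "b - 1 < b" using False ab by auto
    then have "\<bar>c a\<bar> \<le> 1 / (2 * \<Delta>)" "\<bar>c (b-1)\<bar> \<le> 1 / (2 * \<Delta>)" using c_le by blast+
    then show ?thesis using abs_le_D1[of "c a"] abs_le_D2[of "c (b-1)"] by argo
  qed
  finally have 1: "norm (S + C (b-1) * z b - C a * z a) \<le> 1 / (2 * \<Delta>)" .
  have "(\<Sum>n=a..b. z n) = S + z b"
  proof -
    have "{a..b} = insert b {a..<b}" using ab by auto
    then show ?thesis by (simp add: S_def add.commute)
  qed
  also have "\<dots> = (S + C (b-1) * z b - C a * z a) + (C a * z a - C (b-1) * z b + z b)" by simp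
  also have "norm \<dots> \<le> 1 / (2*\<Delta>) + ((1/2 + 1 / (4 * \<Delta>)) + (1/2 + 1 / (4 * \<Delta>)) + 1)"
  proof (intro norm_triangle_mono[OF 1] norm_triangle_mono order_trans[OF norm_triangle_ineq4] add_mono)
    show "norm (C a * z a) \<le> 1/2 + 1 / (4 * \<Delta>)" "norm (C (b-1) * z b) \<le> 1/2 + 1 / (4 * \<Delta>)"
      using C_le[of a] C_le[of "b-1"] False ab by (auto simp: norm_mult z_def)
  qed (auto simp: z_def)
  also have "\<dots> = 1 / \<Delta> + 2" using D by (simp add: field_simps)
  \<comment> \<open>By \<Delta> \<le> 1/2 the number 2 is at most 1 / \<Delta>.\<close>
  also have "\<dots> \<le> 2 / \<Delta> + 0" using D D2 by (simp add: field_simps)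
  finally show ?thesis by (simp add: z_def)
qed

text \<open>Subtracting \<open>k * n\<close> from the phase changes no term and moves the
  differences into the unit interval.\<close>

lemma kusmin_landau:
  fixes f :: "nat \<Rightarrow> real" and \<Delta> :: real and k :: int
  assumes D: "0 < \<Delta>" and D2: "\<Delta> \<le> 1/2" and ab: "a \<le> b"
    and bd: "\<And>n. a \<le> n \<Longrightarrow> n < b \<Longrightarrow> k + \<Delta> \<le> f (Suc n) - f n \<and> f (Suc n) - f n \<le> k + 1 - \<Delta>"
    and mono: "\<And>n. a \<le> n \<Longrightarrow> Suc n < b \<Longrightarrow> f (Suc n) - f n \<le> f (Suc (Suc n)) - f (Suc n)"
  shows "norm (\<Sum>n=a..b. cis (2 * pi * f n)) \<le> 2 / \<Delta>"
proof -
  have "cis (2 * pi * (f n - k * n)) = cis (2 * pi * f n)" for n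
  proof -
    have "cis (2 * pi * (f n - k * n)) = cis (2 * pi * f n) * cis (2 * pi * of_int (- k * int n))"
      by (simp add: cis_mult algebra_simps)
    then show ?thesis by (simp only: cis_multiple_2pi[OF Ints_of_int]) simp
  qed
  moreover have "norm (\<Sum>n=a..b. cis (2 * pi * (f n - k * n))) \<le> 2 / \<Delta>"
  proof (rule kusmin_landau_0[OF D D2 ab])
    fix n assume n: "a \<le> n" "n < b"
    show "\<Delta> \<le> (f (Suc n) - k * Suc n) - (f n - k * n) \<and> (f (Suc n) - k * Suc n) - (f n - k * n) \<le> 1 - \<Delta>"
      using bd[OF n] by (simp add: algebra_simps)
  next
    fix n assume n: "a \<le> n" "Suc n < b"
    show "(f (Suc n) - k * Suc n) - (f n - k * n) \<le> (f (Suc (Suc n)) - k * Suc (Suc n)) - (f (Suc n) - k * Suc n)"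
      using mono[OF n] by (simp add: algebra_simps)
  qed
  ultimately show ?thesis by simp
qed

section \<open>The second derivative test\<close>

lemma convex_nat_set_eq:
  fixes S :: "nat set"
  assumes "finite S" "S \<noteq> {}" "\<And>x y z. x \<in> S \<Longrightarrow> z \<in> S \<Longrightarrow> x \<le> y \<Longrightarrow> y \<le> z \<Longrightarrow> y \<in> S"
  shows "S = {Min S..Max S}"
proof (rule set_eqI, rule iffI)
  fix y assume "y \<in> {Min S..Max S}"
  then show "y \<in> S" using assms(3)[OF Min_in[OF assms(1,2)] Max_in[OF assms(1,2)], of y] by simp
next
  fix y assume "y \<in> S"
  then show "y \<in> {Min S..Max S}" using assms(1) by simp
qed

text \<open>Serves to count the indices whose phase difference lies close to an integer:
  \<open>d\<close> gains at least \<open>lam\<close> per index, so a short range of values holds few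
  of them.\<close>

lemma card_spaced_le:
  fixes S :: "nat set" and d :: "nat \<Rightarrow> real"
  assumes "finite S" "0 < lam" "0 \<le> l"
    and inc: "\<And>m n. m \<in> S \<Longrightarrow> n \<in> S \<Longrightarrow> m \<le> n \<Longrightarrow> lam * (real n - real m) \<le> d n - d m"
    and rng: "\<And>m n. m \<in> S \<Longrightarrow> n \<in> S \<Longrightarrow> d n - d m \<le> l"
  shows "real (card S) \<le> l / lam + 1"
proof (cases "S = {}")
  case True
  then show ?thesis using assms by simp
next
  case False
  let ?m = "Min S" and ?M = "Max S"
  have in_S: "?m \<in> S" "?M \<in> S" "?m \<le> ?M" using False assms(1) by auto
  have "S \<subseteq> {?m..?M}" using assms(1) by auto
  then have "card S \<le> card {?m..?M}" by (intro card_mono) auto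
  then have "real (card S) \<le> real ?M - real ?m + 1" using in_S(3) by auto
  moreover have "lam * (real ?M - real ?m) \<le> l"
    using inc[OF in_S] rng[OF in_S(1,2)] by linarith
  then have "real ?M - real ?m \<le> l / lam" using assms(2) by (simp add: field_simps)
  ultimately show ?thesis by simp
qed

text \<open>Van der Corput's argument: the first differences increase at a controlled rate, so they
  stay near an integer only briefly. There the sum is estimated trivially, in between by
  Kusmin-Landau, once for every integer part that occurs.\<close>

lemma second_derivative_test:
  fixes f :: "nat \<Rightarrow> real" and lam h :: real
  assumes lam: "0 < lam" "lam \<le> 1" and h: "h \<ge> 1" and ab: "a \<le> b"
    and bd: "\<And>n. a \<le> n \<Longrightarrow> Suc n < b \<Longrightarrow>
               lam \<le> (f (Suc (Suc n)) - f (Suc n)) - (f (Suc n) - f n) \<and>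
               (f (Suc (Suc n)) - f (Suc n)) - (f (Suc n) - f n) \<le> h * lam"
  shows "norm (\<Sum>n=a..b. cis (2 * pi * f n)) \<le> 8 * h * (real b - real a) * sqrt lam + 16 / sqrt lam + 1"
proof -
  define d where "d n = f (Suc n) - f n" for n
  define z where "z n = cis (2 * pi * f n)" for n
  \<comment> \<open>The trivial part has length about \<Delta> / lam and Kusmin-Landau costs about 1
    / \<Delta>; this choice balances the two.\<close>
  define \<Delta> where "\<Delta> = sqrt lam / 2"
  have s: "0 < sqrt lam" "sqrt lam \<le> 1" "sqrt lam * sqrt lam = lam" using lam by auto
  have \<Delta>: "0 < \<Delta>" "\<Delta> \<le> 1/2" using s by (auto simp: \<Delta>_def)
  have step: "lam \<le> d (Suc n) - d n \<and> d (Suc n) - d n \<le> h * lam" if "a \<le> n" "Suc n < b" for n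
    using bd[OF that] by (simp add: d_def)
  have steps: "lam * real j \<le> d (n + j) - d n \<and> d (n + j) - d n \<le> h * lam * real j" if "a \<le> n" "n + j < b" for n j
    using that
  proof (induction j)
    case (Suc j)
    then show ?case using step[of "n + j"] by (auto simp: algebra_simps)
  qed simp
  have inc: "lam * (real n - real m) \<le> d n - d m \<and> d n - d m \<le> h * lam * (real n - real m)"
    if "a \<le> m" "m \<le> n" "n < b" for m n
    using steps[of m "n - m"] that by (simp add: of_nat_diff)
  have dmono: "d m \<le> d n" if "a \<le> m" "m \<le> n" "n < b" for m n
  proof -
    have "0 \<le> lam * (real n - real m)" using lam that by simp
    then show ?thesis using inc[OF that] by linarith
  qed
  \<comment> \<open>The index b is set apart because \<open>d b\<close> would involve f at b + 1;
    its single term is added at the end.\<close>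
  define I where "I = {a..<b}"
  have finI: "finite I" by (simp add: I_def)
  define B where "B = 2 * (\<Delta> / lam + 1) + (2 / \<Delta> + 1)"
  have B0: "B > 0" unfolding B_def using \<Delta> lam by (intro add_pos_pos mult_pos_pos divide_pos_pos) auto
  have per_k: "norm (\<Sum>n | n \<in> I \<and> \<lfloor>d n\<rfloor> = k. z n) \<le> B" for k
  proof -
    define P where "P = {n \<in> I. \<lfloor>d n\<rfloor> = k \<and> d n < k + \<Delta>}"
    define Q where "Q = {n \<in> I. \<lfloor>d n\<rfloor> = k \<and> d n > k + 1 - \<Delta>}"
    define G where "G = {n \<in> I. \<lfloor>d n\<rfloor> = k \<and> k + \<Delta> \<le> d n \<and> d n \<le> k + 1 - \<Delta>}"
    have fin: "finite P" "finite Q" "finite G" using finI by (auto simp: P_def Q_def G_def)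
    have inc': "lam * (real n - real m) \<le> d n - d m" if "m \<in> I" "n \<in> I" "m \<le> n" for m n
      using inc[of m n] that by (auto simp: I_def)
    have cP: "real (card P) \<le> \<Delta> / lam + 1"
    proof (rule card_spaced_le[OF fin(1) lam(1), where d = d])
      fix m n assume "m \<in> P" "n \<in> P"
      then show "d n - d m \<le> \<Delta>" unfolding P_def by simp linarith
    qed (use \<Delta> inc' in \<open>auto simp: P_def\<close>)
    have cQ: "real (card Q) \<le> \<Delta> / lam + 1"
    proof (rule card_spaced_le[OF fin(2) lam(1), where d = d])
      fix m n assume "m \<in> Q" "n \<in> Q"
      then show "d n - d m \<le> \<Delta>" unfolding Q_def by simp linarith
    qed (use \<Delta> inc' in \<open>auto simp: Q_def\<close>)
    have nG: "norm (\<Sum>n\<in>G. z n) \<le> 2 / \<Delta> + 1"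
    proof (cases "G = {}")
      case True
      then show ?thesis using \<Delta> by simp
    next
      case False
      have conv: "y \<in> G" if "x \<in> G" "w \<in> G" "x \<le> y" "y \<le> w" for x y w
      proof -
        have "d x \<le> d y" "d y \<le> d w" "a \<le> y" "y < b" using that by (auto simp: G_def I_def intro!: dmono)
        moreover have "k + \<Delta> \<le> d x" "d w \<le> k + 1 - \<Delta>" using that by (auto simp: G_def)
        ultimately have 1: "k + \<Delta> \<le> d y" "d y \<le> k + 1 - \<Delta>" "y \<in> I" by (auto simp: I_def)
        moreover have "\<lfloor>d y\<rfloor> = k" using 1 \<Delta>(1) by (intro floor_unique) auto
        ultimately show ?thesis by (simp add: G_def)
      qed
      define c e where "c = Min G" and "e = Max G"
      have G: "G = {c..e}" unfolding c_def e_def by (rule convex_nat_set_eq[OF fin(3) False conv])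
      have ce: "c \<le> e" "c \<in> G" "e \<in> G" using fin(3) False by (auto simp: c_def e_def)
      have eb: "a \<le> c" "e < b" using ce by (auto simp: G_def I_def)
      \<comment> \<open>The differences with index in c..e involve the terms up to
        \<open>Suc e\<close>; the surplus term is removed again at the cost of 1.\<close>
      have "norm (\<Sum>n=c..Suc e. z n) \<le> 2 / \<Delta>" unfolding z_def
      proof (rule kusmin_landau[OF \<Delta>])
        fix n assume "c \<le> n" "n < Suc e"
        then have "n \<in> G" using G by simp
        then show "k + \<Delta> \<le> f (Suc n) - f n \<and> f (Suc n) - f n \<le> k + 1 - \<Delta>" by (simp add: G_def d_def)
      next
        fix n assume n: "c \<le> n" "Suc n < Suc e"
        then show "f (Suc n) - f n \<le> f (Suc (Suc n)) - f (Suc n)" using dmono[of n "Suc n"] eb by (simp add: d_def)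
      qed (use ce in auto)
      moreover have "(\<Sum>n\<in>G. z n) = (\<Sum>n=c..Suc e. z n) - z (Suc e)" using ce by (simp add: G)
      moreover have "norm ((\<Sum>n=c..Suc e. z n) - z (Suc e)) \<le> norm (\<Sum>n=c..Suc e. z n) + norm (z (Suc e))"
        by (rule norm_triangle_ineq4)
      moreover have "norm (z (Suc e)) = 1" by (simp add: z_def)
      ultimately show ?thesis by (metis add.commute add_le_cancel_left order_trans)
    qed
    have nP: "norm (\<Sum>n\<in>S. z n) \<le> real (card S)" for S
      by (rule order_trans[OF norm_sum]) (simp add: z_def)
    have "{n. n \<in> I \<and> \<lfloor>d n\<rfloor> = k} = (P \<union> Q) \<union> G" by (auto simp: P_def Q_def G_def)
    moreover have "P \<inter> Q = {}" "(P \<union> Q) \<inter> G = {}" using \<Delta> by (auto simp: P_def Q_def G_def)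
    ultimately have "(\<Sum>n | n \<in> I \<and> \<lfloor>d n\<rfloor> = k. z n) = sum z P + sum z Q + sum z G"
      using fin by (simp add: sum.union_disjoint)
    also have "norm \<dots> \<le> real (card P) + real (card Q) + (2/\<Delta> + 1)"
      by (intro norm_triangle_mono nP nG)
    also have "\<dots> \<le> B" using cP cQ by (simp add: B_def)
    finally show ?thesis .
  qed
  define N where "N = real b - real a"
  have N0: "N \<ge> 0" using ab by (simp add: N_def)
  \<comment> \<open>The differences grow by at most \<open>h * lam * N\<close> in all, so their
    integer parts take at most two more values than that.\<close>
  have num_k: "real (card ((\<lambda>n. \<lfloor>d n\<rfloor>) ` I)) \<le> h * lam * N + 2"
  proof (cases "a = b")
    case True
    then show ?thesis using h lam N0 by (simp add: I_def)
  next
    case False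
    have "(\<lambda>n. \<lfloor>d n\<rfloor>) ` I \<subseteq> {\<lfloor>d a\<rfloor>..\<lfloor>d (b-1)\<rfloor>}"
      using ab by (auto simp: I_def intro!: floor_mono dmono)
    then have "card ((\<lambda>n. \<lfloor>d n\<rfloor>) ` I) \<le> nat (\<lfloor>d (b-1)\<rfloor> - \<lfloor>d a\<rfloor> + 1)"
      using card_mono[of "{\<lfloor>d a\<rfloor>..\<lfloor>d (b-1)\<rfloor>}"] by (simp add: algebra_simps)
    moreover have da: "d a \<le> d (b-1)" using False ab by (intro dmono) auto
    ultimately have "real (card ((\<lambda>n. \<lfloor>d n\<rfloor>) ` I)) \<le> \<lfloor>d (b-1)\<rfloor> - \<lfloor>d a\<rfloor> + 1"
      using floor_mono[OF da] by linarith
    also have "\<dots> \<le> d (b-1) - d a + 2" by linarith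
    also have "d (b-1) - d a \<le> h * lam * (real (b-1) - real a)" using inc[of a "b-1"] False ab by simp
    also have "\<dots> \<le> h * lam * N" using h lam by (intro mult_left_mono) (auto simp: N_def)
    finally show ?thesis by simp
  qed
  have B8: "B \<le> 8 / sqrt lam"
  proof -
    have "\<Delta> / lam = 1 / (2 * sqrt lam)" "2 / \<Delta> = 4 / sqrt lam"
      using s by (simp_all add: \<Delta>_def field_simps)
    moreover have "1 \<le> 1 / sqrt lam" using s by simp
    ultimately show ?thesis unfolding B_def by (simp add: field_simps)
  qed
  have "(\<Sum>n\<in>I. z n) = (\<Sum>k\<in>(\<lambda>n. \<lfloor>d n\<rfloor>) ` I. \<Sum>n | n \<in> I \<and> \<lfloor>d n\<rfloor> = k. z n)"
    by (rule sum.image_gen[OF finI])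
  also have "norm \<dots> \<le> (\<Sum>k\<in>(\<lambda>n. \<lfloor>d n\<rfloor>) ` I. B)"
    by (intro sum_norm_le per_k)
  also have "\<dots> = real (card ((\<lambda>n. \<lfloor>d n\<rfloor>) ` I)) * B" by simp
  also have "\<dots> \<le> (h * lam * N + 2) * B" using num_k B0 by (intro mult_right_mono) auto
  also have "(h * lam * N + 2) * B \<le> (h * lam * N + 2) * (8 / sqrt lam)"
    using h lam N0 B8 by (intro mult_left_mono) auto
  also have "\<dots> = 8 * h * N * sqrt lam + 16 / sqrt lam"
  proof -
    have "(h * (q * q) * N + 2) * (8 / q) = 8 * h * N * q + 16 / q" if "q > 0" for q
      using that by (simp add: field_simps)
    from this[OF s(1)] show ?thesis unfolding s(3) .
  qed
  finally have "norm (\<Sum>n\<in>I. z n) \<le> 8 * h * N * sqrt lam + 16 / sqrt lam" .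
  moreover have "(\<Sum>n=a..b. z n) = (\<Sum>n\<in>I. z n) + z b"
  proof -
    have "{a..b} = insert b I" using ab by (auto simp: I_def)
    then show ?thesis using finI by (simp add: I_def add.commute)
  qed
  moreover have "norm ((\<Sum>n\<in>I. z n) + z b) \<le> norm (\<Sum>n\<in>I. z n) + norm (z b)" by (rule norm_triangle_ineq)
  moreover have "norm (z b) = 1" by (simp add: z_def)
  ultimately have "norm (\<Sum>n=a..b. z n) \<le> 8 * h * (real b - real a) * sqrt lam + 16 / sqrt lam + 1"
    unfolding N_def by simp
  then show ?thesis by (simp only: z_def)
qed

section \<open>Weyl differencing\<close>

text \<open>With p and q the roots of n and n + 1, the square of q - p being nonnegative gives 1/q
  \<le> 2(q - p), and the right-hand side telescopes.\<close>

lemma sum_inverse_sqrt_le: "(\<Sum>h=1..n. 1 / sqrt (real h)) \<le> 2 * sqrt (real n)"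
proof (induction n)
  case (Suc n)
  define p q where "p = sqrt (real n)" and "q = sqrt (real (Suc n))"
  have pq: "q^2 = p^2 + 1" "p \<le> q" "q > 0" by (auto simp: p_def q_def)
  have "0 \<le> (q - p)^2" by simp
  then have "1 \<le> 2 * (q - p) * q" using pq(1) by (simp add: power2_eq_square algebra_simps)
  then have "1 / q \<le> 2 * (q - p)" using pq(3) by (simp add: field_simps)
  moreover have "(\<Sum>h=1..Suc n. 1 / sqrt (real h)) = (\<Sum>h=1..n. 1 / sqrt (real h)) + 1 / q"
    by (simp add: q_def)
  ultimately have "(\<Sum>h=1..Suc n. 1 / sqrt (real h)) \<le> 2 * p + 2 * (q - p)"
    using Suc by (simp only: p_def)
  then show ?case by (simp add: q_def)
qed auto

text \<open>The Weyl-van der Corput inequality. Adding H translates of the sequence multiplies its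
  sum by H but spreads it over a window of only \<open>b - a + H\<close> places; Cauchy-Schwarz over
  the window leaves correlations at distances below H.\<close>

lemma weyl_vdc:
  fixes z :: "nat \<Rightarrow> complex" and H :: nat
  assumes fin: "finite S" and z1: "\<And>n. n \<in> S \<Longrightarrow> norm (z n) \<le> 1" and S: "S \<subseteq> {a..b}" and ab: "a \<le> b" and H: "H > 0"
  shows "real H * (norm (\<Sum>n\<in>S. z n))\<^sup>2 \<le> 
     real (b - a + H) * (real (card S) + 2 * (\<Sum>h=1..<H. norm (\<Sum>n | n \<in> S \<and> n + h \<in> S. z (n + h) * cnj (z n))))"
proof -
  define w where "w n = (if n \<in> S then z n else 0)" for n
  define v where "v m k = (if k \<le> m then w (m - k) else 0)" for m k :: nat
  define T where "T h = (\<Sum>n | n \<in> S \<and> n + h \<in> S. z (n + h) * cnj (z n))" for h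
  define J where "J = {a..<b+H}"
  have sum_v: "(\<Sum>m\<in>J. v m k) = (\<Sum>n\<in>S. z n)" if "k < H" for k
  proof -
    have "(\<Sum>n\<in>S. z n) = (\<Sum>m\<in>(\<lambda>n. n + k) ` S. v m k)"
      by (subst sum.reindex) (auto simp: v_def w_def)
    also have "\<dots> = (\<Sum>m\<in>J. v m k)"
    proof (rule sum.mono_neutral_left)
      show "(\<lambda>n. n + k) ` S \<subseteq> J" using S that by (fastforce simp: J_def)
      show "\<forall>i\<in>J - (\<lambda>n. n + k) ` S. v i k = 0"
      proof
        fix i assume i: "i \<in> J - (\<lambda>n. n + k) ` S"
        show "v i k = 0"
        proof (cases "k \<le> i \<and> i - k \<in> S")
          case True
          then have "i = (i - k) + k" "i - k \<in> S" by auto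
          then show ?thesis using i by blast
        qed (auto simp: v_def w_def)
      qed
    qed (simp add: J_def)
    finally show ?thesis by simp
  qed
  have cross: "(\<Sum>m\<in>J. v m k * cnj (v m l)) = T (l - k)" if "k \<le> l" "l < H" for k l
  proof -
    define P where "P = {n. n \<in> S \<and> n + (l - k) \<in> S}"
    have "T (l - k) = (\<Sum>m\<in>(\<lambda>n. n + l) ` P. v m k * cnj (v m l))"
      unfolding T_def P_def using that by (subst sum.reindex) (auto simp: v_def w_def)
    also have "\<dots> = (\<Sum>m\<in>J. v m k * cnj (v m l))"
    proof (rule sum.mono_neutral_left)
      show "(\<lambda>n. n + l) ` P \<subseteq> J" using S that by (fastforce simp: J_def P_def)
      show "\<forall>i\<in>J - (\<lambda>n. n + l) ` P. v i k * cnj (v i l) = 0"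
      proof
        fix i assume i: "i \<in> J - (\<lambda>n. n + l) ` P"
        show "v i k * cnj (v i l) = 0"
        proof (cases "l \<le> i \<and> i - l \<in> S \<and> i - k \<in> S")
          case True
          then have "i = (i - l) + l" "i - l \<in> P" using that by (auto simp: P_def)
          then show ?thesis using i by blast
        qed (use that in \<open>auto simp: v_def w_def\<close>)
      qed
    qed (simp add: J_def)
    finally show ?thesis by simp
  qed
  have cross': "norm (\<Sum>m\<in>J. v m k * cnj (v m l)) = norm (T (if k \<le> l then l - k else k - l))" if "k < H" "l < H" for k l
  proof (cases "k \<le> l")
    case True then show ?thesis using cross[of k l] that by simp
  next
    case False
    have "(\<Sum>m\<in>J. v m k * cnj (v m l)) = cnj (\<Sum>m\<in>J. v m l * cnj (v m k))" by (simp add: mult.commute)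
    also have "(\<Sum>m\<in>J. v m l * cnj (v m k)) = T (k - l)" using False that by (intro cross) auto
    finally show ?thesis using False by (simp only: complex_mod_cnj if_False)
  qed
  have T0: "norm (T 0) \<le> real (card S)"
  proof -
    have "T 0 = (\<Sum>n\<in>S. z n * cnj (z n))" by (simp add: T_def)
    also have "norm \<dots> \<le> (\<Sum>n\<in>S. 1)"
      by (rule sum_norm_le) (simp add: norm_mult mult_le_one z1)
    finally have "norm (T 0) \<le> (\<Sum>n\<in>S. 1)" .
    then show ?thesis by simp
  qed
  define A where "A = (\<Sum>h=1..<H. norm (T h))"
  \<comment> \<open>For fixed k each distance h > 0 arises from at most two values of l, one on each
    side.\<close>
  have row: "(\<Sum>l<H. norm (T (if k \<le> l then l - k else k - l))) \<le> real (card S) + 2 * A" if "k < H" for k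
  proof -
    have un: "{..<H} = insert k ({..<k} \<union> {k<..<H})" using that by auto
    have "(\<Sum>l<H. norm (T (if k \<le> l then l - k else k - l))) = 
        norm (T 0) + ((\<Sum>l<k. norm (T (k - l))) + (\<Sum>l\<in>{k<..<H}. norm (T (l - k))))"
    proof -
      have "(\<Sum>l\<in>{..<k} \<union> {k<..<H}. norm (T (if k \<le> l then l - k else k - l))) =
         (\<Sum>l<k. norm (T (k - l))) + (\<Sum>l\<in>{k<..<H}. norm (T (l - k)))"
        by (subst sum.union_disjoint) (auto intro!: sum.cong)
      then show ?thesis unfolding un by (subst sum.insert) auto
    qed
    also have "(\<Sum>l<k. norm (T (k - l))) = (\<Sum>h=1..<Suc k. norm (T h))"
      by (rule sum.reindex_bij_witness[of _ "\<lambda>h. k - h" "\<lambda>l. k - l"]) auto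
    also have "\<dots> \<le> A" unfolding A_def using that by (intro sum_mono2) auto
    also have "(\<Sum>l\<in>{k<..<H}. norm (T (l - k))) = (\<Sum>h=1..<H-k. norm (T h))"
      by (rule sum.reindex_bij_witness[of _ "\<lambda>h. h + k" "\<lambda>l. l - k"]) auto
    also have "\<dots> \<le> A" unfolding A_def using that by (intro sum_mono2) auto
    finally show ?thesis using T0 by simp
  qed
  have V: "(\<Sum>m\<in>J. (norm (\<Sum>k<H. v m k))\<^sup>2) \<le> real H * (real (card S) + 2 * A)"
  proof -
    have "complex_of_real (\<Sum>m\<in>J. (norm (\<Sum>k<H. v m k))\<^sup>2) = (\<Sum>m\<in>J. (\<Sum>k<H. v m k) * cnj (\<Sum>l<H. v m l))"
      by (simp only: of_real_sum complex_norm_square)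
    also have "\<dots> = (\<Sum>m\<in>J. \<Sum>k<H. \<Sum>l<H. v m k * cnj (v m l))"
      by (simp add: sum_product)
    also have "\<dots> = (\<Sum>k<H. \<Sum>m\<in>J. \<Sum>l<H. v m k * cnj (v m l))" by (rule sum.swap)
    also have "\<dots> = (\<Sum>k<H. \<Sum>l<H. \<Sum>m\<in>J. v m k * cnj (v m l))" by (intro sum.cong refl sum.swap)
    finally have eq: "complex_of_real (\<Sum>m\<in>J. (norm (\<Sum>k<H. v m k))\<^sup>2) = (\<Sum>k<H. \<Sum>l<H. \<Sum>m\<in>J. v m k * cnj (v m l))" .
    have "(\<Sum>m\<in>J. (norm (\<Sum>k<H. v m k))\<^sup>2) = norm (complex_of_real (\<Sum>m\<in>J. (norm (\<Sum>k<H. v m k))\<^sup>2))"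
      by (simp only: norm_of_real) (simp add: sum_nonneg)
    also have "\<dots> \<le> (\<Sum>k<H. \<Sum>l<H. norm (\<Sum>m\<in>J. v m k * cnj (v m l)))"
      unfolding eq by (intro sum_norm_le) auto
    also have "\<dots> \<le> (\<Sum>k<H. real (card S) + 2 * A)"
    proof (rule sum_mono)
      fix k assume k: "k \<in> {..<H}"
      then have "(\<Sum>l<H. norm (\<Sum>m\<in>J. v m k * cnj (v m l))) = (\<Sum>l<H. norm (T (if k \<le> l then l - k else k - l)))"
        by (intro sum.cong refl) (simp add: cross')
      then show "(\<Sum>l<H. norm (\<Sum>m\<in>J. v m k * cnj (v m l))) \<le> real (card S) + 2 * A"
        using row[of k] k by simp
    qed
    finally show ?thesis by simp
  qed
  have "real H * norm (\<Sum>n\<in>S. z n) = norm (\<Sum>m\<in>J. \<Sum>k<H. v m k)"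
    by (subst sum.swap) (simp add: sum_v norm_mult)
  also have "\<dots> \<le> (\<Sum>m\<in>J. 1 * norm (\<Sum>k<H. v m k))" by (simp add: norm_sum)
  finally have "(real H * norm (\<Sum>n\<in>S. z n))\<^sup>2 \<le> (\<Sum>m\<in>J. 1 * norm (\<Sum>k<H. v m k))\<^sup>2"
    by (intro power_mono) auto
  also have "\<dots> \<le> (\<Sum>m\<in>J. 1\<^sup>2) * (\<Sum>m\<in>J. (norm (\<Sum>k<H. v m k))\<^sup>2)"
    by (rule Cauchy_Schwarz_ineq_sum)
  also have "(\<Sum>m\<in>J. 1\<^sup>2) = real (b - a + H)" using ab by (simp add: J_def)
  also have "real (b - a + H) * (\<Sum>m\<in>J. (norm (\<Sum>k<H. v m k))\<^sup>2) \<le> real (b - a + H) * (real H * (real (card S) + 2 * A))"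
    by (intro mult_left_mono V) auto
  finally have "real H * (real H * (norm (\<Sum>n\<in>S. z n))\<^sup>2) \<le> real H * (real (b - a + H) * (real (card S) + 2 * A))"
    by (simp add: power2_eq_square mult_ac mult_left_mono)
  then show ?thesis using H unfolding A_def T_def by simp
qed

section \<open>Exponential sums with logarithmic phase\<close>

text \<open>The mean value theorem is applied twice, to x \<mapsto> \<phi>(x + 1) - \<phi>(x) and
  then to \<phi>'.\<close>

lemma second_difference_bounds:
  fixes \<phi> \<phi>' \<phi>'' :: "real \<Rightarrow> real"
  assumes 1: "\<And>x. n \<le> x \<Longrightarrow> x \<le> n + 2 \<Longrightarrow> (\<phi> has_real_derivative \<phi>' x) (at x)"
    and 2: "\<And>x. n \<le> x \<Longrightarrow> x \<le> n + 2 \<Longrightarrow> (\<phi>' has_real_derivative \<phi>'' x) (at x)"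
    and bd: "\<And>x. n \<le> x \<Longrightarrow> x \<le> n + 2 \<Longrightarrow> l \<le> \<phi>'' x \<and> \<phi>'' x \<le> u"
  shows "l \<le> (\<phi> (n + 2) - \<phi> (n + 1)) - (\<phi> (n + 1) - \<phi> n) \<and>
         (\<phi> (n + 2) - \<phi> (n + 1)) - (\<phi> (n + 1) - \<phi> n) \<le> u"
proof -
  have "((\<lambda>x. \<phi> (x + 1) - \<phi> x) has_real_derivative (\<phi>' (x + 1) - \<phi>' x)) (at x)" if "n \<le> x" "x \<le> n + 1" for x
    by (rule DERIV_diff[OF iffD1[OF DERIV_shift]]) (use 1 that in auto)
  then have "\<exists>y. n < y \<and> y < n + 1 \<and> (\<phi> (n + 1 + 1) - \<phi> (n + 1)) - (\<phi> (n + 1) - \<phi> n) = ((n + 1) - n) * (\<phi>' (y + 1) - \<phi>' y)"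
    by (intro MVT2) auto
  then obtain y where y: "n < y" "y < n + 1" 
    "(\<phi> (n + 2) - \<phi> (n + 1)) - (\<phi> (n + 1) - \<phi> n) = \<phi>' (y + 1) - \<phi>' y" by (auto simp: add.assoc)
  have "\<exists>x. y < x \<and> x < y + 1 \<and> \<phi>' (y + 1) - \<phi>' y = ((y + 1) - y) * \<phi>'' x"
    by (rule MVT2) (use y 2 in auto)
  then obtain x where "y < x" "x < y + 1" "\<phi>' (y + 1) - \<phi>' y = \<phi>'' x" by auto
  then show ?thesis using y bd[of x] by auto
qed

lemma ln_Suc_diff_bounds:
  assumes "n > 0"
  shows "1 / (real n + 1) \<le> ln (real n + 1) - ln (real n)" "ln (real n + 1) - ln (real n) \<le> 1 / real n"
proof -
  have "ln (real n / (real n + 1)) \<le> real n / (real n + 1) - 1" using assms by (intro ln_le_minus_one) auto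
  then show "1 / (real n + 1) \<le> ln (real n + 1) - ln (real n)" using assms by (simp add: ln_div field_simps)
  have "ln ((real n + 1) / real n) \<le> (real n + 1) / real n - 1" using assms by (intro ln_le_minus_one) auto
  then show "ln (real n + 1) - ln (real n) \<le> 1 / real n" using assms by (simp add: ln_div field_simps)
qed

text \<open>For \<tau> \<le> M the phase moves by at most half a turn per term, so the differences
  stay in one integer interval and Kusmin-Landau alone suffices.\<close>

lemma kernel_bound_small:
  fixes M \<tau> :: real
  assumes M: "1 \<le> M" and t: "1 \<le> \<tau>" "\<tau> \<le> M" and a: "M \<le> real a" and b: "real b \<le> 2 * M" and ab: "a \<le> b"
  shows "norm (\<Sum>n=a..b. cis (- (\<tau> * ln (real n)))) \<le> 40 * (M / \<tau>)"
proof -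
  define f where "f n = - (\<tau> / (2*pi)) * ln (real n)" for n
  \<comment> \<open>For n + 1 \<le> 2M a difference has modulus at least \<tau> / (4 pi M), and 4 pi
    < 20.\<close>
  define \<Delta> where "\<Delta> = \<tau> / (20 * M)"
  have D: "0 < \<Delta>" "\<Delta> \<le> 1/20" using M t by (auto simp: \<Delta>_def field_simps)
  have step: "f (Suc n) - f n = - (\<tau> / (2*pi)) * (ln (real n + 1) - ln (real n))" for n
    by (simp add: f_def algebra_simps)
  have "norm (\<Sum>n=a..b. cis (2 * pi * f n)) \<le> 2 / \<Delta>"
  \<comment> \<open>The phase decreases, so its differences lie between -1 and 0.\<close>
  proof (rule kusmin_landau[where k = "-1" and f = f, unfolded of_int_minus of_int_1])
    fix n assume n: "a \<le> n" "n < b"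
    have n': "M \<le> real n" "real n + 1 \<le> 2 * M" "n > 0" using n a b M by auto
    have "1 / (2 * M) \<le> ln (real n + 1) - ln (real n)"
      using ln_Suc_diff_bounds(1)[OF n'(3)] frac_le[of 1 1 "real n + 1" "2 * M"] n' M by linarith
    then have "(\<tau> / (2*pi)) * (1 / (2 * M)) \<le> (\<tau> / (2*pi)) * (ln (real n + 1) - ln (real n))"
      using t by (intro mult_left_mono) auto
    moreover have "\<Delta> \<le> (\<tau> / (2*pi)) * (1 / (2 * M))"
      using t M pi_less_4 pi_gt_zero by (simp add: \<Delta>_def field_simps)
    moreover have "ln (real n + 1) - ln (real n) \<le> 1 / M"
      using ln_Suc_diff_bounds(2)[OF n'(3)] frac_le[of 1 1 M "real n"] n' M by linarith
    then have "(\<tau> / (2*pi)) * (ln (real n + 1) - ln (real n)) \<le> (\<tau> / (2*pi)) * (1 / M)"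
      using t by (intro mult_left_mono) auto
    moreover have "(\<tau> / (2*pi)) * (1 / M) \<le> 1 / 2"
    proof -
      have "\<tau> / (2*pi) * (1 / M) = (\<tau> / M) * (1 / (2*pi))" by simp
      also have "\<dots> \<le> 1 * (1 / 2)"
        using t M pi_gt3 by (intro mult_mono) (auto simp: field_simps)
      finally show ?thesis by simp
    qed
    ultimately show "- 1 + \<Delta> \<le> f (Suc n) - f n \<and> f (Suc n) - f n \<le> real_of_int (- 1 + 1) - \<Delta>"
      unfolding step of_int_add of_int_minus of_int_1 using D by linarith
  next
    fix n assume n: "a \<le> n" "Suc n < b"
    have n': "n > 0" using n a M by auto
    have "ln (real n * (real n + 2)) \<le> ln ((real n + 1) * (real n + 1))"
      using n' by (intro ln_mono) (auto simp: algebra_simps intro!: add_pos_pos)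
    then have "ln (real n + 2) - ln (real n + 1) \<le> ln (real n + 1) - ln (real n)"
      using n' by (simp add: ln_mult)
    then have "(\<tau> / (2*pi)) * (ln (real n + 2) - ln (real n + 1)) \<le> (\<tau> / (2*pi)) * (ln (real n + 1) - ln (real n))"
      using t by (intro mult_left_mono) auto
    then show "f (Suc n) - f n \<le> f (Suc (Suc n)) - f (Suc n)"
      unfolding step by (simp add: add.commute)
  qed (use D ab in auto)
  moreover have "2 * pi * f n = - (\<tau> * ln (real n))" for n by (simp add: f_def)
  moreover have "2 / \<Delta> = 40 * (M / \<tau>)" using M t by (simp add: \<Delta>_def)
  ultimately show ?thesis by simp
qed

lemma sqrt_inverse_2pi: "1 / 3 \<le> sqrt (1 / (2 * pi))" "sqrt (1 / (2 * pi)) \<le> 1"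
proof -
  have "1 / 9 \<le> 1 / (2 * pi)" using pi_less_4 pi_gt_zero by (simp add: field_simps)
  then have "sqrt (1 / 9) \<le> sqrt (1 / (2 * pi))" by (rule real_sqrt_le_mono)
  moreover have "sqrt (1 / 9) = 1 / (3::real)" by (rule real_sqrt_unique) (auto simp: power2_eq_square)
  ultimately show "1 / 3 \<le> sqrt (1 / (2 * pi))" by simp
  show "sqrt (1 / (2 * pi)) \<le> 1" using pi_gt3 by simp
qed

text \<open>Here q is the square root of M and s the sixth root of \<tau>, so that all bounds are
  monomials. The hypotheses say M \<le> \<tau> \<le> \<open>M powr (3/2)\<close>. The second
  derivative test gives \<open>s ^ 3\<close>, the square root of \<tau>, and
  \<open>s^2 \<le> q\<close> puts it below \<open>q * s\<close>.\<close>

lemma kernel_bound_second: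
  fixes q s :: real
  assumes q: "1 \<le> q" and s: "1 \<le> s" and qs: "q^2 \<le> s^6" "s^2 \<le> q"
    and a: "q^2 \<le> real a" and b: "real b \<le> 2 * q^2" and ab: "a \<le> b"
  shows "norm (\<Sum>n=a..b. cis (- (s^6 * ln (real n)))) \<le> 113 * (q * s)"
proof -
  define c where "c = s^6 / (2*pi)"
  define f where "f x = - c * ln x" for x :: real
  \<comment> \<open>On the dyadic interval the second derivative \<open>c / x^2\<close> lies between
    \<open>lam\<close> and \<open>4 * lam\<close>.\<close>
  define lam where "lam = c / (4 * q^4)"
  have c0: "c > 0" using s by (simp add: c_def)
  have sqc: "sqrt c = s^3 * sqrt (1 / (2*pi))"
  proof -
    have "sqrt (s^6) = s^3" using s by (intro real_sqrt_unique) (auto simp flip: power_mult)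
    moreover have "c = s^6 * (1/(2*pi))" by (simp add: c_def)
    ultimately show ?thesis by (simp only: real_sqrt_mult)
  qed
  have sqlam: "sqrt lam = sqrt c / (2 * q^2)"
  proof -
    have "sqrt (4 * q^4) = 2 * q^2" using q by (intro real_sqrt_unique) (auto simp: power2_eq_square power4_eq_xxxx)
    then show ?thesis by (simp add: lam_def real_sqrt_divide)
  qed
  have c1: "s^3 / 3 \<le> sqrt c" "sqrt c \<le> s^3"
  proof -
    have "s^3 * (1/3) \<le> s^3 * sqrt (1 / (2*pi))" "s^3 * sqrt (1 / (2*pi)) \<le> s^3 * 1"
      using sqrt_inverse_2pi s by (intro mult_left_mono; simp)+
    then show "s^3 / 3 \<le> sqrt c" "sqrt c \<le> s^3" unfolding sqc by linarith+
  qed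
  have lam: "0 < lam" "lam \<le> 1"
  proof -
    show "0 < lam" using c0 q by (simp add: lam_def)
    have "s^3 \<le> q^2"
    proof -
      have "s^3 \<le> (s^2)^2" using s by (simp add: power_increasing)
      also have "\<dots> \<le> q^2" using qs s by (intro power_mono) auto
      finally show ?thesis .
    qed
    then have "sqrt lam \<le> 1" using c1 q by (simp add: sqlam field_simps)
    then show "lam \<le> 1" by simp
  qed
  have "norm (\<Sum>n=a..b. cis (2 * pi * f (real n))) \<le> 8 * 4 * (real b - real a) * sqrt lam + 16 / sqrt lam + 1"
  proof (rule second_derivative_test[OF lam _ ab])
    fix n assume n: "a \<le> n" "Suc n < b"
    have n': "q^2 \<le> real n" "real n + 2 \<le> 2 * q^2" using n a b by auto
    have "lam \<le> (f (real n + 2) - f (real n + 1)) - (f (real n + 1) - f (real n)) \<and>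
      (f (real n + 2) - f (real n + 1)) - (f (real n + 1) - f (real n)) \<le> 4 * lam"
    proof (rule second_difference_bounds[where \<phi>' = "\<lambda>x. - c / x" and \<phi>'' = "\<lambda>x. c / x^2"])
      fix x assume x: "real n \<le> x" "x \<le> real n + 2"
      have "0 < q^2" using q by simp
      then have x': "q^2 \<le> x" "x \<le> 2 * q^2" "0 < x" using x n' by linarith+
      show "(f has_real_derivative - c / x) (at x)" unfolding f_def using x' by (auto intro!: derivative_eq_intros)
      show "((\<lambda>x. - c / x) has_real_derivative c / x^2) (at x)" using x' by (auto intro!: derivative_eq_intros simp: power2_eq_square)
      have "x^2 \<le> (2*q^2)^2" by (rule power_mono) (use x' in auto)
      moreover have "(q^2)^2 \<le> x^2" by (rule power_mono) (use x' in auto)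
      moreover have "(2*q^2)^2 = 4 * q^4" "(q^2)^2 = q^4" by (simp_all add: power_mult_distrib)
      ultimately have x2: "x^2 \<le> 4 * q^4" "q^4 \<le> x^2" by (simp_all only:)
      have "c / (4*q^4) \<le> c / x^2" "c / x^2 \<le> c / q^4"
        using x2 c0 x' q by (auto intro!: divide_left_mono)
      then show "lam \<le> c / x^2 \<and> c / x^2 \<le> 4 * lam" by (simp add: lam_def)
    qed
    then show "lam \<le> (f (real (Suc (Suc n))) - f (real (Suc n))) - (f (real (Suc n)) - f (real n)) \<and>
      (f (real (Suc (Suc n))) - f (real (Suc n))) - (f (real (Suc n)) - f (real n)) \<le> 4 * lam"
      by (simp add: add.commute)
  qed simp
  \<comment> \<open>The coefficients 16, 96 and 1 add up to 113, the constant of the general kernel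
    bound.\<close>
  also have "\<dots> \<le> 16 * s^3 + 96 * s^3 + s^3"
  proof (intro add_mono)
    have "(real b - real a) * sqrt lam \<le> q^2 * (s^3 / (2*q^2))"
      unfolding sqlam using a b ab c1 c0 q by (intro mult_mono divide_right_mono) auto
    also have "\<dots> = s^3 / 2" using q by simp
    finally have le: "(real b - real a) * sqrt lam \<le> s^3 / 2" .
    have "8 * 4 * (real b - real a) * sqrt lam = 32 * ((real b - real a) * sqrt lam)" by (simp add: algebra_simps)
    then show "8 * 4 * (real b - real a) * sqrt lam \<le> 16 * s^3" using le by linarith
    have "s^3 / 3 / (2*q^2) \<le> sqrt lam" unfolding sqlam using c1 by (intro divide_right_mono) auto
    then have "16 / sqrt lam \<le> 16 / (s^3 / 3 / (2*q^2))" using s q by (intro divide_left_mono) (auto intro!: mult_pos_pos simp: lam)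
    also have "\<dots> = 96 * (q^2 / s^3)" by simp
    also have "q^2 / s^3 \<le> s^3" using qs s by (simp add: field_simps flip: power_add)
    finally show "16 / sqrt lam \<le> 96 * s^3" by simp
    show "1 \<le> s^3" using s by simp
  qed
  also have "\<dots> = 113 * (s^2 * s)" by (simp add: eval_nat_numeral)
  also have "\<dots> \<le> 113 * (q * s)" using qs(2) s by (intro mult_left_mono mult_right_mono) auto
  finally show ?thesis by (simp add: f_def c_def)
qed

text \<open>The range is now \<open>M powr (3/2)\<close> \<le> \<tau> \<le> \<open>M powr 3\<close>.
  One Weyl differencing precedes the second derivative test, which amounts to van der Corput's third
  derivative test.\<close>

lemma kernel_bound_third:
  fixes q s :: real
  assumes q: "1 \<le> q" and s: "1 \<le> s" and qs: "q \<le> s^2" "s \<le> q"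
    and a: "q^2 \<le> real a" and b: "real b \<le> 2 * q^2" and ab: "a \<le> b"
  shows "norm (\<Sum>n=a..b. cis (- (s^6 * ln (real n)))) \<le> 70 * (q * s)"
proof -
  define c where "c = s^6 / (2*pi)"
  have c0: "c > 0" using s by (simp add: c_def)
  have sqc: "sqrt c = s^3 * sqrt (1 / (2*pi))"
  proof -
    have "sqrt (s^6) = s^3" using s by (intro real_sqrt_unique) (auto simp flip: power_mult)
    moreover have "c = s^6 * (1/(2*pi))" by (simp add: c_def)
    ultimately show ?thesis by (simp only: real_sqrt_mult)
  qed
  have c1: "s^3 / 3 \<le> sqrt c" "sqrt c \<le> s^3"
  proof -
    have "s^3 * (1/3) \<le> s^3 * sqrt (1 / (2*pi))" "s^3 * sqrt (1 / (2*pi)) \<le> s^3 * 1"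
      using sqrt_inverse_2pi s by (intro mult_left_mono; simp)+
    then show "s^3 / 3 \<le> sqrt c" "sqrt c \<le> s^3" unfolding sqc by linarith+
  qed
  have c2: "c \<le> s^6" using s pi_gt3 by (simp add: c_def field_simps)
  \<comment> \<open>Differencing bounds the squared sum by about \<open>q^4 / H + q^2 * s^2\<close>;
    this H makes the two terms equal.\<close>
  define H where "H = nat \<lceil>q^2 / s^2\<rceil>"
  have s2q2: "s^2 \<le> q^2" using qs s by (intro power_mono) auto
  have q4: "q^2 \<le> s^4" 
  proof -
    have "q^2 \<le> (s^2)^2" using qs q by (intro power_mono) auto
    then show ?thesis by simp
  qed
  have r1: "1 \<le> q^2 / s^2" using s2q2 s by simp
  have H: "q^2 / s^2 \<le> real H" "real H \<le> 2 * (q^2 / s^2)" "H > 0" 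
    using r1 by (simp_all add: H_def) linarith+
  have Hq: "real H \<le> 2 * q^2"
  proof -
    have "q^2 / s^2 \<le> q^2" using s q by (simp add: field_simps)
    then show ?thesis using H by linarith
  qed
  have sqH: "sqrt (real H) \<le> 2 * (q / s)"
  proof -
    have "sqrt (real H) \<le> sqrt ((2 * (q / s))^2)"
      using H(2) s q by (intro real_sqrt_le_mono) (auto simp: power_mult_distrib power_divide intro: order_trans)
    then show ?thesis using s q by simp
  qed
  define z where "z n = cis (- (s^6 * ln (real n)))" for n
  define S where "S = {a..b}"
  define T where "T h = norm (\<Sum>n | n \<in> S \<and> n + h \<in> S. z (n + h) * cnj (z n))" for h
  have Th: "T h \<le> 129 * s^2 + 144 * q^3 / s^3 * (1 / sqrt (real h))" if h: "1 \<le> h" "h < H" for h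
  proof (cases "a + h \<le> b")
    case False
    then have e: "{n. n \<in> S \<and> n + h \<in> S} = {}" by (auto simp: S_def)
    have "T h = 0" unfolding T_def e by simp
    then show ?thesis using s q by simp
  next
    case True
    \<comment> \<open>The differenced phase up to sign. Its second derivative is
      \<open>c * (1 / x^2 - 1 / (x + h)^2)\<close>, of size \<open>c * h / x^3\<close>, so on the
      dyadic interval it varies by a bounded factor, here 16.\<close>
    define f where "f x = c * (ln (x + real h) - ln x)" for x :: real
    define lam where "lam = c * real h / (8 * q^6)"
    have h0: "real h \<ge> 1" "real h \<le> real H" using h by auto
    have lam0: "0 < lam" using c0 q h0 by (simp add: lam_def)
    have "c * real h \<le> s^6 * (2 * (q^2 / s^2))"
      using c2 h0 H s by (intro mult_mono) auto
    also have "s^6 * (2 * (q^2 / s^2)) = 2 * s^4 * q^2" using s by (simp add: field_simps flip: power_add)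
    also have "\<dots> \<le> 2 * q^4 * q^2" using qs s by (intro mult_mono power_mono) auto
    also have "\<dots> \<le> 8 * q^6" using q by (simp flip: power_add)
    finally have lam1: "lam \<le> 1" using q by (simp add: lam_def)
    define r where "r = sqrt (real h)"
    have r: "1 \<le> r" "r \<le> 2 * (q / s)" using h0 order_trans[OF real_sqrt_le_mono[OF h0(2)] sqH] by (auto simp: r_def)
    have sqlam: "sqrt lam = sqrt c * r / (sqrt 8 * q^3)"
    proof -
      have "sqrt (q^6) = q^3" using q by (intro real_sqrt_unique) (auto simp flip: power_mult)
      then show ?thesis by (simp add: lam_def real_sqrt_divide real_sqrt_mult r_def)
    qed
    have s8: "2 \<le> sqrt 8" "sqrt 8 \<le> 3" by (auto intro: real_le_rsqrt real_le_lsqrt)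
    have l1: "sqrt lam \<le> s^3 * r / (2 * q^3)"
      unfolding sqlam using c1 c0 r q s8 s by (intro frac_le mult_mono) auto
    have l2: "s^3 * r / (9 * q^3) \<le> sqrt lam"
    proof -
      have "s^3 * r / (9 * q^3) = (s^3 / 3) * r / (3 * q^3)" by simp
      also have "\<dots> \<le> sqrt lam" 
        unfolding sqlam using c1 c0 r q s8 s by (intro frac_le mult_mono) auto
      finally show ?thesis .
    qed
    have "norm (\<Sum>n=a..b-h. cis (2 * pi * f (real n))) \<le> 8 * 16 * (real (b-h) - real a) * sqrt lam + 16 / sqrt lam + 1"
    proof (rule second_derivative_test[OF lam0 lam1])
      fix n assume n: "a \<le> n" "Suc n < b - h"
      have n': "q^2 \<le> real n" "real n + 2 + real h \<le> 2 * q^2" using n a b by auto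
      have "lam \<le> (f (real n + 2) - f (real n + 1)) - (f (real n + 1) - f (real n)) \<and>
        (f (real n + 2) - f (real n + 1)) - (f (real n + 1) - f (real n)) \<le> 16 * lam"
      proof (rule second_difference_bounds[where \<phi>' = "\<lambda>x. c * (1 / (x + real h) - 1 / x)" 
            and \<phi>'' = "\<lambda>x. c * (1 / x^2 - 1 / (x + real h)^2)"])
        fix x assume x: "real n \<le> x" "x \<le> real n + 2"
        have "1 \<le> q^2" using q by simp
        then have x': "q^2 \<le> x" "x + real h \<le> 2 * q^2" "0 < x" "1 \<le> x" using x n' by linarith+
        show "(f has_real_derivative c * (1 / (x + real h) - 1 / x)) (at x)" 
          unfolding f_def using x' by (auto intro!: derivative_eq_intros)
        show "((\<lambda>x. c * (1 / (x + real h) - 1 / x)) has_real_derivative c * (1 / x^2 - 1 / (x + real h)^2)) (at x)" 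
        proof -
          have inv: "((\<lambda>x. 1 / x) has_real_derivative - (1 / y^2)) (at y)" if "y \<noteq> 0" for y :: real
            using that by (auto intro!: derivative_eq_intros simp: power2_eq_square)
          have "((\<lambda>x. c * (1 / (x + real h) - 1 / x)) has_real_derivative c * (- (1 / (x + real h)^2) - - (1 / x^2))) (at x)"
            by (intro DERIV_cmult DERIV_diff iffD1[OF DERIV_shift] inv) (use x' h0 in auto)
          moreover have "- u - - v = v - u" for u v :: real by simp
          ultimately show ?thesis by (simp only:)
        qed
        define y where "y = x + real h"
        have y: "x \<le> y" "y \<le> 2 * q^2" "0 < y" using x' by (auto simp: y_def)
        have eq: "1 / x^2 - 1 / y^2 = real h * (x + y) / (x^2 * y^2)"
        proof -
          have "1 / x^2 - 1 / y^2 = (y - x) * (x + y) / (x^2 * y^2)"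
            using x'(3) y(3) by (simp add: field_simps power2_eq_square)
          then show ?thesis by (simp add: y_def)
        qed
        have "real h * (2 * q^2) / ((2*q^2)^2 * (2*q^2)^2) \<le> real h * (x + y) / (x^2 * y^2)"
          using x' y q by (intro frac_le mult_mono power_mono mult_left_mono mult_pos_pos) auto
        moreover have "real h * (2 * q^2) / ((2*q^2)^2 * (2*q^2)^2) = real h / (8 * q^6)"
          using q by (simp add: power_mult_distrib field_simps flip: power_add)
        ultimately have lo: "real h / (8 * q^6) \<le> 1 / x^2 - 1 / y^2" using eq by simp
        have "real h * (x + y) / (x^2 * y^2) \<le> real h * (2 * y) / ((q^2)^2 * y^2)"
          using x' y q by (intro frac_le mult_mono power_mono mult_left_mono mult_pos_pos mult_right_mono) auto
        also have "\<dots> = 2 * real h / (q^4 * y)" 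
        proof -
          have e: "(q^2)^2 = q^4" by simp
          show ?thesis unfolding e using y q by (simp add: field_simps power2_eq_square)
        qed
        also have "\<dots> \<le> 2 * real h / (q^4 * q^2)" 
          using x' y q by (intro divide_left_mono mult_left_mono mult_pos_pos) auto
        also have "\<dots> = 16 * (real h / (8 * q^6))" by (simp flip: power_add)
        finally have hi: "1 / x^2 - 1 / y^2 \<le> 16 * (real h / (8 * q^6))" using eq by simp
        have "c * (real h / (8 * q^6)) \<le> c * (1 / x^2 - 1 / y^2)" "c * (1 / x^2 - 1 / y^2) \<le> c * (16 * (real h / (8 * q^6)))"
          using lo hi c0 by (intro mult_left_mono; simp)+
        moreover have "c * (real h / (8 * q^6)) = lam" "c * (16 * (real h / (8 * q^6))) = 16 * lam" by (simp_all add: lam_def)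
        ultimately show "lam \<le> c * (1 / x^2 - 1 / (x + real h)^2) \<and> c * (1 / x^2 - 1 / (x + real h)^2) \<le> 16 * lam" 
          by (simp only: y_def)
      qed
      then show "lam \<le> (f (real (Suc (Suc n))) - f (real (Suc n))) - (f (real (Suc n)) - f (real n)) \<and>
        (f (real (Suc (Suc n))) - f (real (Suc n))) - (f (real (Suc n)) - f (real n)) \<le> 16 * lam"
        by (simp add: add.commute)
    qed (use True in auto)
    also have "\<dots> \<le> 128 * s^2 + 144 * q^3 / s^3 * (1 / r) + s^2"
    proof (intro add_mono)
      have "(real (b-h) - real a) * sqrt lam \<le> q^2 * (s^3 * r / (2 * q^3))"
        using a b True l1 lam0 by (intro mult_mono) auto
      also have "\<dots> \<le> q^2 * (s^3 * (2 * (q / s)) / (2 * q^3))"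
        using r s q by (intro mult_left_mono divide_right_mono) auto
      also have "\<dots> = s^2" using s q by (simp add: field_simps eval_nat_numeral)
      finally have le: "(real (b-h) - real a) * sqrt lam \<le> s^2" .
      have "8 * 16 * (real (b-h) - real a) * sqrt lam = 128 * ((real (b-h) - real a) * sqrt lam)" by (simp add: algebra_simps)
      then show "8 * 16 * (real (b-h) - real a) * sqrt lam \<le> 128 * s^2" using le by linarith
      have "16 / sqrt lam \<le> 16 / (s^3 * r / (9 * q^3))" 
        using l2 s q r lam0 by (intro divide_left_mono mult_pos_pos) auto
      also have "\<dots> = 144 * q^3 / s^3 * (1 / r)" by simp
      finally show "16 / sqrt lam \<le> 144 * q^3 / s^3 * (1 / r)" .
      show "1 \<le> s^2" using s by simp
    qed
    finally have 1: "norm (\<Sum>n=a..b-h. cis (2 * pi * f (real n))) \<le> 129 * s^2 + 144 * q^3 / s^3 * (1 / r)" by simp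
    have "{n. n \<in> S \<and> n + h \<in> S} = {a..b-h}" using True by (auto simp: S_def)
    moreover have "z (n + h) * cnj (z n) = cnj (cis (2 * pi * f (real n)))" for n
    proof -
      have "2 * pi * c = s^6" by (simp add: c_def)
      moreover have "2 * pi * f (real n) = (2 * pi * c) * (ln (real (n + h)) - ln (real n))" by (simp add: f_def)
      ultimately have "2 * pi * f (real n) = s^6 * ln (real (n + h)) - s^6 * ln (real n)" by (simp only: right_diff_distrib)
      then show ?thesis by (simp add: z_def cis_cnj cis_mult)
    qed
    ultimately have "T h = norm (cnj (\<Sum>n=a..b-h. cis (2 * pi * f (real n))))" by (simp add: T_def)
    then show ?thesis using 1 by (simp only: complex_mod_cnj r_def)
  qed
  have sumT: "(\<Sum>h=1..<H. T h) \<le> 705 * real H * s^2"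
  proof -
    have "(\<Sum>h=1..<H. T h) \<le> (\<Sum>h=1..<H. 129 * s^2 + 144 * q^3 / s^3 * (1 / sqrt (real h)))"
      by (intro sum_mono Th) auto
    also have "\<dots> = real (H - 1) * (129 * s^2) + 144 * q^3 / s^3 * (\<Sum>h=1..<H. 1 / sqrt (real h))"
      by (simp only: sum.distrib sum_distrib_left[symmetric]) simp
    also have "\<dots> \<le> real H * (129 * s^2) + 576 * (real H * s^2)"
    proof (rule add_mono)
      have "(\<Sum>h=1..<H. 1 / sqrt (real h)) \<le> (\<Sum>h=1..H. 1 / sqrt (real h))"
        by (intro sum_mono2) auto
      then have "(\<Sum>h=1..<H. 1 / sqrt (real h)) \<le> 4 * (q / s)" using sum_inverse_sqrt_le[of H] sqH by linarith
      then have "144 * q^3 / s^3 * (\<Sum>h=1..<H. 1 / sqrt (real h)) \<le> 144 * q^3 / s^3 * (4 * (q / s))"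
        using s q by (intro mult_left_mono) auto
      also have "\<dots> = 576 * ((q^2 / s^2) * (q^2 / s^2))"
        using s by (simp add: eval_nat_numeral)
      also have "\<dots> \<le> 576 * (real H * s^2)"
      proof -
        have "q^2 / s^2 \<le> s^2" using s q4 by (simp add: field_simps flip: power_add)
        then have "(q^2 / s^2) * (q^2 / s^2) \<le> real H * s^2" using H(1) by (intro mult_mono) auto
        then show ?thesis by linarith
      qed
      finally show "144 * q^3 / s^3 * (\<Sum>h=1..<H. 1 / sqrt (real h)) \<le> 576 * (real H * s^2)" .
    qed (auto intro!: mult_right_mono)
    finally show ?thesis using s q by (simp add: algebra_simps)
  qed
  have "real H * (norm (\<Sum>n\<in>S. z n))\<^sup>2 \<le> real (b - a + H) * (real (card S) + 2 * (\<Sum>h=1..<H. T h))"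
    unfolding T_def by (rule weyl_vdc) (use ab H in \<open>auto simp: S_def z_def\<close>)
  also have "\<dots> \<le> (3 * q^2) * (2 * q^2 + 2 * (705 * real H * s^2))"
  proof -
    have a1: "real (b - a + H) \<le> 3 * q^2" using a b ab Hq by (simp add: of_nat_diff)
    have "1 \<le> q^2" using q by simp
    then have a2: "real (card S) \<le> 2 * q^2" using a b ab by (simp add: S_def of_nat_diff)
    have "0 \<le> (\<Sum>h=1..<H. T h)" by (intro sum_nonneg) (simp add: T_def)
    then show ?thesis using sumT by (intro mult_mono add_mono a1 a2) auto
  qed
  also have "\<dots> \<le> (3 * q^2) * (2 * (real H * s^2) + 2 * (705 * real H * s^2))"
    using H(1) s q by (intro mult_left_mono add_mono) (auto simp: field_simps)
  also have "\<dots> = real H * (4236 * (q * s)^2)" by (simp only: power_mult_distrib) algebra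
  finally have H_le: "real H * (norm (\<Sum>n\<in>S. z n))\<^sup>2 \<le> real H * (4236 * (q * s)^2)" .
  have "(norm (\<Sum>n\<in>S. z n))\<^sup>2 \<le> 4236 * (q * s)^2"
    by (rule mult_left_le_imp_le[OF H_le]) (use H(3) in simp)
  moreover have "4236 * x^2 \<le> (70 * x)^2" for x :: real
  proof -
    have "(70 * x)^2 = 4236 * x^2 + 664 * x^2" by (simp add: power2_eq_square)
    then show ?thesis using zero_le_power2[of x] by linarith
  qed
  ultimately have "(norm (\<Sum>n\<in>S. z n))\<^sup>2 \<le> (70 * (q * s))^2" by (rule order_trans)
  then have "norm (\<Sum>n\<in>S. z n) \<le> 70 * (q * s)"
    by (rule power2_le_imp_le) (use s q in simp)
  then show ?thesis unfolding S_def z_def .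
qed

text \<open>Four ranges: Kusmin-Landau for \<tau> \<le> M, the second derivative test up to
  \<open>M powr (3/2)\<close>, one differencing up to \<open>M powr 3\<close>, and beyond that the
  trivial bound, since then M is at most \<open>M powr (1/2) * \<tau> powr (1/6)\<close>.\<close>

lemma kernel_bound:
  fixes M \<tau> :: real
  assumes M: "1 \<le> M" and t: "1 \<le> \<tau>" and a: "M \<le> real a" and b: "real b \<le> 2 * M"
  shows "norm (\<Sum>n=a..b. cis (- (\<tau> * ln (real n)))) \<le> 113 * (M / \<tau> + M powr (1/2) * \<tau> powr (1/6))"
proof (cases "a \<le> b")
  case ab: True
  define q s where "q = M powr (1/2)" and "s = \<tau> powr (1/6)"
  have qM: "q^2 = M" using M by (simp add: q_def powr_power)
  have st: "s^6 = \<tau>" using t by (simp add: s_def powr_power)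
  have q1: "1 \<le> q" and s1: "1 \<le> s" using M t by (auto simp: q_def s_def ge_one_powr_ge_zero)
  have qs0: "0 \<le> q * s" using q1 s1 by simp
  have Mt0: "0 \<le> M / \<tau>" using M t by simp
  have aux: "u \<le> k * x \<Longrightarrow> k \<le> 113 \<Longrightarrow> 0 \<le> k \<Longrightarrow> 0 \<le> x \<Longrightarrow> 0 \<le> y \<Longrightarrow> u \<le> 113 * (x + y)" 
    "u \<le> k * y \<Longrightarrow> k \<le> 113 \<Longrightarrow> 0 \<le> k \<Longrightarrow> 0 \<le> x \<Longrightarrow> 0 \<le> y \<Longrightarrow> u \<le> 113 * (x + y)" for u k x y :: real
    using mult_right_mono[of k 113 x] mult_right_mono[of k 113 y] by argo+
  consider "\<tau> \<le> M" | "M \<le> \<tau>" "s^2 \<le> q" | "q \<le> s^2" "s \<le> q" | "q \<le> s" by linarith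
  then show ?thesis
  proof cases
    case 1
    show ?thesis unfolding q_def[symmetric] s_def[symmetric]
      by (rule aux(1)[OF kernel_bound_small[OF M t 1 a b ab]]) (use qs0 Mt0 in auto)
  next
    case 2
    show ?thesis unfolding q_def[symmetric] s_def[symmetric]
      by (rule aux(2)[OF kernel_bound_second[OF q1 s1 _ 2(2), of a b, unfolded st qM, OF 2(1) a b ab]]) (use qs0 Mt0 in auto)
  next
    case 3
    show ?thesis unfolding q_def[symmetric] s_def[symmetric]
      by (rule aux(2)[OF kernel_bound_third[OF q1 s1 3, of a b, unfolded st qM, OF a b ab]]) (use qs0 Mt0 in auto)
  next
    case 4
    have "norm (\<Sum>n=a..b. cis (- (\<tau> * ln (real n)))) \<le> real (card {a..b})"
      by (rule order_trans[OF norm_sum]) simp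
    also have "\<dots> \<le> 2 * M" using a b ab M by (simp add: of_nat_diff)
    also have "\<dots> \<le> 2 * (q * s)" using 4 q1 by (simp add: qM[symmetric] power2_eq_square)
    finally show ?thesis unfolding q_def[symmetric] s_def[symmetric]
      by (rule aux(2)) (use qs0 Mt0 in auto)
  qed
qed (use M t in auto)

section \<open>Dirichlet series and convolutions\<close>

definition dconv :: "(nat \<Rightarrow> 'a::comm_semiring_1) \<Rightarrow> (nat \<Rightarrow> 'a) \<Rightarrow> nat \<Rightarrow> 'a" where
  "dconv f g n = (\<Sum>d | d dvd n. f d * g (n div d))"

primrec dpow :: "(nat \<Rightarrow> 'a::comm_semiring_1) \<Rightarrow> nat \<Rightarrow> nat \<Rightarrow> 'a" where
  "dpow f 0 = (\<lambda>n. if n = 1 then 1 else 0)"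
| "dpow f (Suc k) = dconv f (dpow f k)"

text \<open>The exponential series for Dirichlet convolution. If f vanishes at 1, its k-th power
  vanishes below \<open>2 ^ k\<close>, so stopping at k = n loses nothing and each value is a finite
  sum.\<close>

definition dexp :: "(nat \<Rightarrow> complex) \<Rightarrow> nat \<Rightarrow> complex" where
  "dexp f n = (\<Sum>k\<le>n. dpow f k n / fact k)"

definition dabs :: "(nat \<Rightarrow> complex) \<Rightarrow> real \<Rightarrow> bool" where
  "dabs f \<sigma> \<longleftrightarrow> (\<lambda>n. norm (f n) * real n powr (-\<sigma>)) summable_on {1..}"

text \<open>A weighted l1 norm, submultiplicative under convolution; it bounds the series on the
  whole half-plane Re s \<ge> \<sigma>.\<close>

definition dnorm :: "(nat \<Rightarrow> complex) \<Rightarrow> real \<Rightarrow> real" where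
  "dnorm f \<sigma> = infsum (\<lambda>n. norm (f n) * real n powr (-\<sigma>)) {1..}"

definition dirsum :: "(nat \<Rightarrow> complex) \<Rightarrow> complex \<Rightarrow> complex" where
  "dirsum f s = infsum (dirichlet_term f s) {1..}"

text \<open>Everything divides 0, so the sum runs over an infinite set and takes the default
  value.\<close>

lemma dconv_0 [simp]: "dconv f g 0 = 0"
  by (simp add: dconv_def)

lemma dconv_1 [simp]: "dconv f g (Suc 0) = f (Suc 0) * g (Suc 0)"
  by (simp add: dconv_def)

lemma finite_divisors: "n \<ge> 1 \<Longrightarrow> finite {d. d dvd (n::nat)}"
  by simp

lemma div_ge_1: "d dvd n \<Longrightarrow> n \<ge> 1 \<Longrightarrow> n div d \<ge> (1::nat)"
  by (cases "d = 0") (auto elim!: dvdE)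

text \<open>Both sides sum over the pairs (d, e) with \<open>d * e\<close> dividing n, a set
  symmetric in d and e.\<close>

lemma dconv_left_commute:
  "dconv f (dconv g h) n = dconv g (dconv f h) n"
proof (cases "n = 0")
  case False
  define S where "S = (SIGMA d:{d. d dvd n}. {e. e dvd n div d})"
  have swap: "(\<lambda>(d, e). (e, d)) ` S = S"
  proof -
    have "(e, d) \<in> S" if "(d, e) \<in> S" for d e
    proof -
      have "d dvd n" "e dvd n div d" using that by (auto simp: S_def)
      then have "d * e dvd n" using False by (metis dvd_div_iff_mult dvd_0_left mult.commute)
      then have "e dvd n" "d dvd n div e" using False \<open>e dvd n div d\<close>
        by (auto dest: dvd_mult_right simp: dvd_div_iff_mult)
      then show ?thesis by (simp add: S_def)
    qed
    then show ?thesis by force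
  qed
  have div_eq: "n div d div e = n div e div d" for d e by (metis div_mult2_eq mult.commute)
  have fin: "finite {e. e dvd n div d}" if "d dvd n" for d
    using that False by (intro finite_divisors div_ge_1) auto
  have "dconv f (dconv g h) n = (\<Sum>(d,e)\<in>S. f d * (g e * h (n div d div e)))"
    unfolding dconv_def S_def sum_distrib_left using False by (subst sum.Sigma) (auto simp: fin)
  also have "\<dots> = (\<Sum>(e,d)\<in>(\<lambda>(d, e). (e, d)) ` S. f d * (g e * h (n div d div e)))"
    by (subst sum.reindex) (auto simp: inj_on_def case_prod_unfold)
  also have "\<dots> = (\<Sum>(e,d)\<in>S. g e * (f d * h (n div e div d)))"
    unfolding swap by (intro sum.cong) (auto simp: div_eq algebra_simps)
  also have "\<dots> = dconv g (dconv f h) n"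
    unfolding dconv_def S_def sum_distrib_left using False by (subst sum.Sigma) (auto simp: fin)
  finally show ?thesis .
qed simp

text \<open>A nonzero term needs a factorisation of n into k factors, each at least 2.\<close>

lemma dpow_eq_0:
  assumes "f 1 = 0" "n < 2 ^ k"
  shows "dpow f k n = 0"
  using assms(2)
proof (induction k arbitrary: n)
  case (Suc k)
  have "f d * dpow f k (n div d) = 0" if "d dvd n" "n > 0" for d
  proof (cases "d = 1")
    case False
    then have "d \<ge> 2" using that by (metis One_nat_def Suc_leI dvd_pos_nat le_neq_implies_less numeral_2_eq_2)
    then have "n div d \<le> n div 2" by (intro div_le_mono2) auto
    also have "n div 2 < 2 ^ k" using Suc.prems by auto
    finally show ?thesis using Suc.IH by simp
  qed (use assms in simp)
  then show ?case by (cases "n = 0") (auto simp: dconv_def)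
qed auto

lemma dexp_eq:
  assumes "f 1 = 0" "n \<le> N"
  shows "dexp f n = (\<Sum>k\<le>N. dpow f k n / fact k)"
  unfolding dexp_def
proof (rule sum.mono_neutral_left)
  show "\<forall>i\<in>{..N} - {..n}. dpow f i n / fact i = 0"
  proof
    fix i assume "i \<in> {..N} - {..n}"
    then have "n < 2 ^ i" by (intro less_trans[OF _ less_exp]) auto
    then show "dpow f i n / fact i = 0" using dpow_eq_0[of f n i] assms by simp
  qed
qed (use assms in auto)

lemma dexp_1: "f 1 = 0 \<Longrightarrow> dexp f 1 = 1"
  by (simp add: dexp_def)

text \<open>Multiplication by \<open>ln n\<close> is a derivation for Dirichlet convolution; this is
  its power rule. At k = 0 the truncated exponent \<open>k - 1\<close> does no harm, being
  multiplied by 0.\<close>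

lemma dpow_ln:
  fixes f :: "nat \<Rightarrow> complex"
  assumes "n \<ge> 1"
  shows "dpow f k n * ln (real n) = of_nat k * dconv (\<lambda>d. f d * ln (real d)) (dpow f (k - 1)) n"
  using assms
proof (induction k arbitrary: n)
  case (Suc k)
  define l where "l d = f d * ln (real d)" for d
  have ln_div: "ln (real n) = ln (real d) + ln (real (n div d))" if "d dvd n" for d
    using that Suc.prems by (auto elim!: dvdE simp: ln_mult)
  have "dpow f (Suc k) n * ln (real n) = (\<Sum>d | d dvd n. f d * dpow f k (n div d) * ln (real n))"
    by (simp add: dconv_def sum_distrib_right)
  also have "\<dots> = (\<Sum>d | d dvd n. l d * dpow f k (n div d) + f d * (dpow f k (n div d) * ln (real (n div d))))"
    by (intro sum.cong refl) (simp add: ln_div l_def algebra_simps)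
  also have "\<dots> = dconv l (dpow f k) n + (\<Sum>d | d dvd n. f d * (dpow f k (n div d) * ln (real (n div d))))"
    by (simp add: sum.distrib dconv_def)
  also have "(\<Sum>d | d dvd n. f d * (dpow f k (n div d) * ln (real (n div d)))) = 
             (\<Sum>d | d dvd n. f d * (of_nat k * dconv l (dpow f (k - 1)) (n div d)))"
  proof (intro sum.cong refl, goal_cases)
    case (1 d)
    then have "n div d \<ge> 1" using Suc.prems by (auto intro: div_ge_1)
    then show ?case using Suc.IH[of "n div d"] by (simp add: l_def[abs_def])
  qed
  also have "\<dots> = of_nat k * dconv f (dconv l (dpow f (k - 1))) n"
    by (simp add: dconv_def sum_distrib_left mult_ac)
  also have "\<dots> = of_nat k * dconv l (dconv f (dpow f (k - 1))) n"
    by (simp add: dconv_left_commute)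
  also have "\<dots> = of_nat k * dconv l (dpow f k) n"
    by (cases k) auto
  finally show ?case by (simp add: l_def[abs_def] algebra_simps)
qed auto

text \<open>The logarithmic derivative of \<open>exp L\<close> is \<open>L'\<close>, read off on coefficients.\<close>

lemma dexp_ln:
  assumes "f 1 = 0" "n \<ge> 1"
  shows "dexp f n * ln (real n) = (\<Sum>d | d dvd n. f d * ln (real d) * dexp f (n div d))"
proof -
  define l where "l d = f d * ln (real d)" for d
  have "dexp f n * ln (real n) = (\<Sum>k\<le>n. dpow f k n * ln (real n) / fact k)"
    by (simp add: dexp_def sum_distrib_right)
  also have "\<dots> = (\<Sum>k\<le>n. of_nat k * dconv l (dpow f (k - 1)) n / fact k)"
    using dpow_ln[OF assms(2), of f] by (simp add: l_def[abs_def])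
  also have "\<dots> = (\<Sum>k<n. of_nat (Suc k) * dconv l (dpow f k) n / fact (Suc k))"
    by (simp add: sum.atMost_shift del: of_nat_Suc fact_Suc)
  also have "\<dots> = (\<Sum>k<n. dconv l (dpow f k) n / fact k)"
    by (intro sum.cong refl) (simp only: fact_Suc of_nat_mult, simp del: of_nat_Suc)
  also have "\<dots> = (\<Sum>d | d dvd n. \<Sum>k<n. l d * dpow f k (n div d) / fact k)"
    by (simp add: dconv_def sum_divide_distrib sum.swap[of _ "{..<n}"])
  also have "\<dots> = (\<Sum>d | d dvd n. l d * dexp f (n div d))"
  proof (intro sum.cong refl, goal_cases)
    case (1 d)
    show ?case
    \<comment> \<open>For d \<ge> 2 the quotient is at most n - 1, so the powers k < n already give
      all of \<open>dexp f (n div d)\<close>; for d = 1 the factor \<open>ln d\<close>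
      vanishes.\<close>
    proof (cases "d = 1")
      case False
      have "d \<noteq> 0" using 1 assms by (cases "d = 0") auto
      then have "d \<ge> 2" using False by simp
      then have "n div d \<le> n div 2" by (intro div_le_mono2) auto
      then have "n div d \<le> n - 1" using assms by linarith
      then have "dexp f (n div d) = (\<Sum>k\<le>n-1. dpow f k (n div d) / fact k)" by (intro dexp_eq assms)
      also have "{..n-1} = {..<n}" using assms by auto
      finally show ?thesis by (simp add: sum_distrib_left)
    qed (simp add: l_def)
  qed
  finally show ?thesis by (simp add: l_def)
qed

section \<open>Absolutely convergent Dirichlet series\<close>

text \<open>The double series over (d, e) converges absolutely and may be regrouped along the
  products n = d e.\<close>

lemma has_sum_dconv:
  fixes u v :: "nat \<Rightarrow> 'a::{real_normed_field,banach}"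
  assumes u: "(\<lambda>n. norm (u n)) summable_on {1..}" and v: "(\<lambda>n. norm (v n)) summable_on {1..}"
  shows "(dconv u v has_sum (infsum u {1..} * infsum v {1..})) {1..}"
proof -
  define P where "P = (\<lambda>(d, e). u d * v e)"
  have "(\<lambda>x. norm (P x)) summable_on ({1..} \<times> {1..})"
  proof (rule summable_on_SigmaI)
    fix d
    show "((\<lambda>e. norm (P (d, e))) has_sum (norm (u d) * infsum (\<lambda>n. norm (v n)) {1..})) {1..}"
      unfolding P_def prod.case norm_mult by (intro has_sum_cmult_right has_sum_infsum v)
  next
    show "(\<lambda>d. norm (u d) * infsum (\<lambda>n. norm (v n)) {1..}) summable_on {1..}"
      by (intro summable_on_cmult_left u)
  qed simp
  then have "P summable_on ({1..} \<times> {1..})" by (rule abs_summable_summable)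
  then obtain S where S: "(P has_sum S) ({1..} \<times> {1..})" by (auto simp: summable_on_def)
  have su: "(u has_sum infsum u {1..}) {1..}" and sv: "(v has_sum infsum v {1..}) {1..}"
    using has_sum_infsum abs_summable_summable[OF u] abs_summable_summable[OF v] by blast+
  have "((\<lambda>d. u d * infsum v {1..}) has_sum S) {1..}"
  proof (rule has_sum_SigmaD[OF S])
    show "((\<lambda>e. P (d, e)) has_sum (u d * infsum v {1..})) {1..}" for d
      unfolding P_def prod.case by (rule has_sum_cmult_right[OF sv])
  qed
  moreover have "((\<lambda>d. u d * infsum v {1..}) has_sum (infsum u {1..} * infsum v {1..})) {1..}"
    by (rule has_sum_cmult_left[OF su])
  ultimately have S_eq: "S = infsum u {1..} * infsum v {1..}" by (rule has_sum_unique)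
  define Q where "Q = (\<lambda>(n, d). u d * v (n div d))"
  define g where "g = (\<lambda>(d, e). (d * e, d) :: nat \<times> nat)"
  \<comment> \<open>Recording (d, e) as (d e, d) makes the inner summation run over the divisors of
    n.\<close>
  have bij: "bij_betw g ({1..} \<times> {1..}) (SIGMA n:{1..}. {d. d dvd n})"
  proof (rule bij_betw_imageI)
    show "inj_on g ({1..} \<times> {1..})" by (auto simp: inj_on_def g_def)
    have "(n, d) \<in> g ` ({1..} \<times> {1..})" if "n \<ge> 1" "d dvd n" for n d :: nat
    proof (rule image_eqI[where x = "(d, n div d)"])
      have "d \<ge> 1" using that by (cases d) auto
      then show "(d, n div d) \<in> {1..} \<times> {1..}" using div_ge_1[OF that(2,1)] by simp
      show "(n, d) = g (d, n div d)" using that by (simp add: g_def)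
    qed
    moreover have "g ` ({1..} \<times> {1..}) \<subseteq> (SIGMA n:{1..}. {d. d dvd n})" by (auto simp: g_def)
    ultimately show "g ` ({1..} \<times> {1..}) = (SIGMA n:{1..}. {d. d dvd n})" by auto
  qed
  have "Q (g x) = P x" if "x \<in> {1..} \<times> {1..}" for x
    using that by (auto simp: Q_def g_def P_def)
  then have "((\<lambda>x. Q (g x)) has_sum S) ({1..} \<times> {1..})"
    using S has_sum_cong[of "{1..} \<times> {1..}" "\<lambda>x. Q (g x)" P S] by blast
  then have "(Q has_sum S) (SIGMA n:{1..}. {d. d dvd n})"
    by (simp only: has_sum_reindex_bij_betw[OF bij])
  then have "((\<lambda>(n, d). u d * v (n div d)) has_sum S) (SIGMA n:{1..}. {d. d dvd n})"
    by (simp only: Q_def)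
  then have "((\<lambda>n. \<Sum>d | d dvd n. u d * v (n div d)) has_sum S) {1..}"
    by (rule has_sum_SigmaD) (auto intro!: has_sum_finite)
  then show ?thesis unfolding S_eq dconv_def[abs_def] .
qed

lemma norm_of_nat_powr: "norm (of_nat n powr (-s) :: complex) = real n powr (- Re s)"
  using norm_powr_real_powr[of "of_nat n" "-s"] by simp

lemma norm_dirichlet_term: "norm (dirichlet_term f s n) = norm (f n) * real n powr (- Re s)"
  by (simp add: dirichlet_term_def norm_mult norm_of_nat_powr)

lemma of_nat_powr_mult:
  assumes "m \<ge> 1" "n \<ge> 1"
  shows "(of_nat (m * n) :: complex) powr s = of_nat m powr s * of_nat n powr s"
proof -
  have "Ln (of_nat (m * n)) = Ln (of_nat m) + Ln (of_nat n)"
    using assms Ln_of_nat[of "m * n"] Ln_of_nat[of m] Ln_of_nat[of n] 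
    by (simp del: of_nat_mult add: ln_mult) (simp add: ln_mult)
  then show ?thesis using assms by (simp only: powr_def) (simp add: exp_add distrib_left)
qed

lemma of_nat_powr_div:
  assumes "d dvd n" "n \<ge> (1::nat)"
  shows "(of_nat n :: complex) powr s = of_nat d powr s * of_nat (n div d) powr s"
proof -
  obtain e where e: "n = d * e" using assms by blast
  then have "d \<ge> 1" "e \<ge> 1" using assms by (auto simp: Suc_le_eq intro!: Nat.gr0I)
  then show ?thesis using e of_nat_powr_mult[of d e s] by simp
qed

lemma dirichlet_term_dconv:
  assumes "n \<ge> 1"
  shows "dirichlet_term (dconv f g) s n = dconv (dirichlet_term f s) (dirichlet_term g s) n"
  unfolding dirichlet_term_def dconv_def sum_distrib_right
proof (intro sum.cong refl, goal_cases)
  case (1 d)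
  then have "d dvd n" by simp
  from of_nat_powr_div[OF this assms, of "-s"] show ?case by (simp add: mult_ac)
qed

lemma dabs_iff: "dabs f \<sigma> \<longleftrightarrow> dirichlet_term f (of_real \<sigma>) summable_on {1..}"
  unfolding dabs_def summable_on_iff_abs_summable_on_complex by (simp add: norm_dirichlet_term)

lemma norm_term_le:
  assumes "\<sigma> \<le> Re s" "n \<in> {1..}"
  shows "norm (dirichlet_term f s n) \<le> norm (f n) * real n powr (-\<sigma>)"
proof -
  have "real n powr (- Re s) \<le> real n powr (-\<sigma>)" using assms by (intro powr_mono) auto
  then show ?thesis unfolding norm_dirichlet_term by (rule mult_left_mono) simp
qed

lemma dabs_norm_summable:
  assumes "dabs f \<sigma>" "\<sigma> \<le> Re s"
  shows "(\<lambda>n. norm (dirichlet_term f s n)) summable_on {1..}"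
  by (rule summable_on_comparison_test[OF assms(1)[unfolded dabs_def]]) (use norm_term_le[OF assms(2)] in auto)

lemma dabs_mono: 
  assumes "dabs f \<sigma>" "\<sigma> \<le> \<sigma>'" shows "dabs f \<sigma>'"
  using dabs_norm_summable[OF assms(1), of "of_real \<sigma>'"] assms(2) unfolding dabs_def norm_dirichlet_term by simp

lemma dirsum_has_sum:
  assumes "dabs f \<sigma>" "\<sigma> \<le> Re s"
  shows "(dirichlet_term f s has_sum dirsum f s) {1..}"
  unfolding dirsum_def by (rule has_sum_infsum[OF abs_summable_summable[OF dabs_norm_summable[OF assms]]])

lemma norm_dirsum_le:
  assumes "dabs f \<sigma>" "\<sigma> \<le> Re s"
  shows "norm (dirsum f s) \<le> dnorm f \<sigma>"
proof -
  have "norm (dirsum f s) \<le> infsum (\<lambda>n. norm (dirichlet_term f s n)) {1..}"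
    unfolding dirsum_def by (rule norm_infsum_bound[OF dabs_norm_summable[OF assms]])
  also have "\<dots> \<le> dnorm f \<sigma>"
    unfolding dnorm_def by (rule infsum_mono[OF dabs_norm_summable[OF assms] assms(1)[unfolded dabs_def]]) (rule norm_term_le[OF assms(2)])
  finally show ?thesis .
qed

lemma dirsum_dconv:
  assumes f: "dabs f \<sigma>" and g: "dabs g \<sigma>" and s: "\<sigma> \<le> Re s"
  shows "dirsum (dconv f g) s = dirsum f s * dirsum g s"
proof -
  have "(dconv (dirichlet_term f s) (dirichlet_term g s) has_sum (dirsum f s * dirsum g s)) {1..}"
    unfolding dirsum_def by (rule has_sum_dconv[OF dabs_norm_summable[OF f s] dabs_norm_summable[OF g s]])
  then have "(dirichlet_term (dconv f g) s has_sum (dirsum f s * dirsum g s)) {1..}"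
    by (subst has_sum_cong[of "{1..}"]) (auto simp: dirichlet_term_dconv)
  then show ?thesis unfolding dirsum_def by (rule infsumI)
qed

lemma dabs_dconv:
  assumes f: "dabs f \<sigma>" and g: "dabs g \<sigma>"
  shows "dabs (dconv f g) \<sigma>" "dnorm (dconv f g) \<sigma> \<le> dnorm f \<sigma> * dnorm g \<sigma>"
proof -
  let ?n = "\<lambda>f n. norm (f n :: complex) * real n powr (-\<sigma>)"
  have hs: "(dconv (?n f) (?n g) has_sum (dnorm f \<sigma> * dnorm g \<sigma>)) {1..}"
    unfolding dnorm_def by (rule has_sum_dconv) (use f g in \<open>auto simp: dabs_def abs_mult\<close>)
  have le: "?n (dconv f g) n \<le> dconv (?n f) (?n g) n" if "n \<in> {1..}" for n
  proof -
    have "?n (dconv f g) n = norm (dconv (dirichlet_term f (of_real \<sigma>)) (dirichlet_term g (of_real \<sigma>)) n)"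
      using that by (simp add: dirichlet_term_dconv[symmetric] norm_dirichlet_term)
    also have "\<dots> \<le> (\<Sum>d | d dvd n. norm (dirichlet_term f (of_real \<sigma>) d * dirichlet_term g (of_real \<sigma>) (n div d)))"
      unfolding dconv_def by (rule norm_sum)
    also have "\<dots> = dconv (?n f) (?n g) n"
      by (simp add: dconv_def norm_mult norm_dirichlet_term)
    finally show ?thesis .
  qed
  have sm: "?n (dconv f g) summable_on {1..}"
    by (rule summable_on_comparison_test[OF has_sum_imp_summable[OF hs] le]) auto
  then show "dabs (dconv f g) \<sigma>" by (simp add: dabs_def)
  have "dnorm (dconv f g) \<sigma> \<le> infsum (dconv (?n f) (?n g)) {1..}"
    unfolding dnorm_def by (rule infsum_mono[OF sm has_sum_imp_summable[OF hs] le])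
  then show "dnorm (dconv f g) \<sigma> \<le> dnorm f \<sigma> * dnorm g \<sigma>" using infsumI[OF hs] by simp
qed

lemma dpow_0_has_sum: "(dirichlet_term (dpow f 0) s has_sum 1) {1..}"
  "((\<lambda>n. norm (dpow f 0 n :: complex) * real n powr (-\<sigma>)) has_sum 1) {1..}"
  by (rule has_sum_finite_neutralI[of "{1}"]; auto simp: dirichlet_term_def)+

lemma dpow_props:
  assumes "dabs f \<sigma>"
  shows "dabs (dpow f k) \<sigma> \<and> dnorm (dpow f k) \<sigma> \<le> dnorm f \<sigma> ^ k \<and> (\<forall>s. \<sigma> \<le> Re s \<longrightarrow> dirsum (dpow f k) s = dirsum f s ^ k)"
proof (induction k)
  case 0
  have "dabs (dpow f 0) \<sigma>" unfolding dabs_def by (rule has_sum_imp_summable[OF dpow_0_has_sum(2)])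
  moreover have "dnorm (dpow f 0) \<sigma> = 1" unfolding dnorm_def by (rule infsumI[OF dpow_0_has_sum(2)])
  moreover have "dirsum (dpow f 0) s = 1" for s unfolding dirsum_def by (rule infsumI[OF dpow_0_has_sum(1)])
  ultimately show ?case by (simp del: dpow.simps)
next
  case (Suc k)
  have nn: "dnorm f \<sigma> \<ge> 0" unfolding dnorm_def by (intro infsum_nonneg) auto
  have "dnorm (dpow f (Suc k)) \<sigma> \<le> dnorm f \<sigma> * dnorm (dpow f k) \<sigma>"
    using dabs_dconv(2)[OF assms, of "dpow f k"] Suc by simp
  also have "\<dots> \<le> dnorm f \<sigma> * dnorm f \<sigma> ^ k" using Suc nn by (intro mult_left_mono) auto
  finally show ?case using dabs_dconv(1)[OF assms, of "dpow f k"] dirsum_dconv[OF assms, of "dpow f k"] Suc by simp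
qed

text \<open>The sums over k and n may be interchanged because the k-th layer has norm at most
  \<open>dnorm f \<sigma> ^ k / fact k\<close>.\<close>

lemma dexp_props:
  assumes "dabs f \<sigma>" "f 1 = 0"
  shows "dabs (dexp f) \<sigma>" "\<And>s. \<sigma> \<le> Re s \<Longrightarrow> dirsum (dexp f) s = exp (dirsum f s)"
proof -
  have main: "(dirichlet_term (dexp f) s has_sum exp (dirsum f s)) {1..}" if s: "\<sigma> \<le> Re s" for s
  proof -
    define T where "T = (\<lambda>(k, n). dirichlet_term (dpow f k) s n / fact k)"
    have exp_sum: "((\<lambda>k. x ^ k / fact k) has_sum exp x) UNIV" for x :: "'b :: {real_normed_field, banach}"
    proof (rule norm_summable_imp_has_sum)
      show "summable (\<lambda>k. norm (x ^ k / fact k))"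
      proof -
        have "norm (x ^ k / fact k) = norm (x ^ k /\<^sub>R fact k)" for k
          by (simp add: divide_inverse norm_mult norm_inverse mult.commute)
        then show ?thesis using summable_norm_exp[of x] by simp
      qed
      show "(\<lambda>k. x ^ k / fact k) sums exp x"
        using exp_converges[of x] by (simp add: divide_inverse scaleR_conv_of_real mult.commute)
    qed
    have "(\<lambda>x. norm (T x)) summable_on (UNIV \<times> {1..})"
    proof (rule summable_on_SigmaI)
      fix k :: nat
      have "((\<lambda>n. norm (dirichlet_term (dpow f k) s n)) has_sum infsum (\<lambda>n. norm (dirichlet_term (dpow f k) s n)) {1..}) {1..}"
        using dpow_props[OF assms(1), of k] s dabs_norm_summable[of "dpow f k" \<sigma> s] by (simp add: has_sum_infsum)
      from has_sum_cmult_right[OF this, of "1 / fact k"]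
      show "((\<lambda>n. norm (T (k, n))) has_sum (1 / fact k * infsum (\<lambda>n. norm (dirichlet_term (dpow f k) s n)) {1..})) {1..}"
        by (simp add: T_def norm_divide)
    next
      show "(\<lambda>k. 1 / fact k * infsum (\<lambda>n. norm (dirichlet_term (dpow f k) s n)) {1..}) summable_on UNIV"
      proof (rule summable_on_comparison_test[OF has_sum_imp_summable[OF exp_sum[of "dnorm f \<sigma>"]]])
        fix k :: nat
        have "infsum (\<lambda>n. norm (dirichlet_term (dpow f k) s n)) {1..} \<le> dnorm (dpow f k) \<sigma>"
          unfolding dnorm_def using dpow_props[OF assms(1), of k] s
          by (intro infsum_mono dabs_norm_summable[of "dpow f k" \<sigma> s] norm_term_le) (auto simp: dabs_def)
        also have "\<dots> \<le> dnorm f \<sigma> ^ k" using dpow_props[OF assms(1), of k] by simp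
        finally show "1 / fact k * infsum (\<lambda>n. norm (dirichlet_term (dpow f k) s n)) {1..} \<le> dnorm f \<sigma> ^ k / fact k"
          by (simp add: divide_right_mono)
        show "0 \<le> 1 / fact k * infsum (\<lambda>n. norm (dirichlet_term (dpow f k) s n)) {1..}"
          by (intro mult_nonneg_nonneg infsum_nonneg) auto
      qed
    qed simp
    then have "T summable_on (UNIV \<times> {1..})" by (rule abs_summable_summable)
    then obtain S where S: "(T has_sum S) (UNIV \<times> {1..})" by (auto simp: summable_on_def)
    have "((\<lambda>k. dirsum (dpow f k) s / fact k) has_sum S) UNIV"
    proof (rule has_sum_SigmaD[OF S])
      fix k :: nat
      show "((\<lambda>n. T (k, n)) has_sum (dirsum (dpow f k) s / fact k)) {1..}"
        using has_sum_cmult_left[OF dirsum_has_sum[of "dpow f k" \<sigma> s], of "1 / fact k"] dpow_props[OF assms(1), of k] s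
        by (simp add: T_def)
    qed
    moreover have "dirsum (dpow f k) s = dirsum f s ^ k" for k using dpow_props[OF assms(1), of k] s by simp
    ultimately have "S = exp (dirsum f s)" using has_sum_unique[OF exp_sum[of "dirsum f s"]] by simp
    moreover have "((\<lambda>(n, k). T (k, n)) has_sum S) ({1..} \<times> UNIV)"
      using S by (simp add: has_sum_swap[of T])
    then have "(dirichlet_term (dexp f) s has_sum S) {1..}"
    proof (rule has_sum_SigmaD)
      fix n :: nat assume n: "n \<in> {1..}"
      show "((\<lambda>k. case (n, k) of (n, k) \<Rightarrow> T (k, n)) has_sum dirichlet_term (dexp f) s n) UNIV"
      proof (rule has_sum_finite_neutralI[of "{..n}"])
        fix k assume "k \<in> UNIV - {..n}"
        then have "n < 2 ^ k" by (intro less_trans[OF _ less_exp]) auto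
        then show "(case (n, k) of (n, k) \<Rightarrow> T (k, n)) = 0"
          using dpow_eq_0[of f n k] assms(2) by (simp add: T_def dirichlet_term_def)
      qed (auto simp: T_def dirichlet_term_def dexp_def sum_distrib_right)
    qed
    ultimately show ?thesis by simp
  qed
  show "dabs (dexp f) \<sigma>" unfolding dabs_iff using main[of "of_real \<sigma>"] by (auto simp: summable_on_def)
  show "dirsum (dexp f) s = exp (dirsum f s)" if "\<sigma> \<le> Re s" for s
    using infsumI[OF main[OF that]] by (simp add: dirsum_def)
qed

text \<open>Once the earlier coefficients vanish, the n-th term is minus the tail. Relative to
  \<open>n powr (-x)\<close> the tail decays like a power of n / (n + 1) with exponent x, so the
  coefficient is 0 in the limit.\<close>

lemma dirsum_unique:
  assumes f: "dabs f \<sigma>" and zero: "\<And>x. x \<ge> \<sigma> \<Longrightarrow> dirsum f (of_real x) = 0" and n: "n \<ge> 1"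
  shows "f n = 0"
  using n
proof (induction n rule: less_induct)
  case (less n)
  define K where "K = dnorm f \<sigma> * real n powr \<sigma>"
  define r where "r = real n / (real n + 1)"
  have r: "0 < r" "r < 1" using less.prems by (auto simp: r_def)
  have bound: "norm (f n) \<le> K * r powr y" if y: "y \<ge> 0" for y :: real
  proof -
    define x where "x = \<sigma> + y"
    have sub: "{1..} = insert n ({1..<n} \<union> {n<..})" using less.prems by auto
    have hs: "(dirichlet_term f (of_real x) has_sum 0) {1..}"
      using dirsum_has_sum[OF f, of "of_real x"] zero[of x] y by (simp add: x_def)
    then have "(dirichlet_term f (of_real x) has_sum 0) ({n} \<union> {n<..})"
      by (rule has_sum_cong_neutral[THEN iffD1, rotated -1])
         (use less in \<open>auto simp: dirichlet_term_def not_less_iff_gr_or_eq\<close>)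
    moreover have "(dirichlet_term f (of_real x) has_sum dirichlet_term f (of_real x) n) {n}" 
      using has_sum_finite[of "{n}" "dirichlet_term f (of_real x)"] by simp
    ultimately have "(dirichlet_term f (of_real x) has_sum (0 - dirichlet_term f (of_real x) n)) (({n} \<union> {n<..}) - {n})"
      by (intro has_sum_Diff) auto
    moreover have "({n} \<union> {n<..}) - {n} = {n<..}" by auto
    ultimately have tail: "(dirichlet_term f (of_real x) has_sum (- dirichlet_term f (of_real x) n)) {n<..}" by simp
    have dab: "(\<lambda>m. norm (f m) * real m powr (-\<sigma>)) summable_on {1..}" using f by (simp add: dabs_def)
    have dab': "(\<lambda>m. norm (f m) * real m powr (-\<sigma>)) summable_on {n<..}"
      by (rule summable_on_subset_banach[OF dab]) auto
    have termle: "norm (dirichlet_term f (of_real x) m) \<le> (real n + 1) powr (-y) * (norm (f m) * real m powr (-\<sigma>))" if "m \<in> {n<..}" for m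
    proof -
      have "real m powr (-y) \<le> (real n + 1) powr (-y)" using that y by (intro powr_mono2') auto
      then have "norm (f m) * real m powr (-\<sigma>) * real m powr (-y) \<le> norm (f m) * real m powr (-\<sigma>) * (real n + 1) powr (-y)"
        by (intro mult_left_mono) auto
      then show ?thesis by (simp add: norm_dirichlet_term x_def powr_add[symmetric] mult_ac)
    qed
    have "norm (f n) * real n powr (-x) = norm (infsum (dirichlet_term f (of_real x)) {n<..})"
      using infsumI[OF tail] by (simp add: norm_dirichlet_term)
    also have "\<dots> \<le> infsum (\<lambda>m. norm (dirichlet_term f (of_real x) m)) {n<..}"
      using has_sum_imp_summable[OF tail] by (intro norm_infsum_bound) (simp add: summable_on_iff_abs_summable_on_complex)
    also have "\<dots> \<le> infsum (\<lambda>m. (real n + 1) powr (-y) * (norm (f m) * real m powr (-\<sigma>))) {n<..}"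
      using has_sum_imp_summable[OF tail] termle 
      by (intro infsum_mono summable_on_cmult_right dab') (auto simp: summable_on_iff_abs_summable_on_complex)
    also have "\<dots> = (real n + 1) powr (-y) * infsum (\<lambda>m. norm (f m) * real m powr (-\<sigma>)) {n<..}"
      by (rule infsum_cmult_right) (rule dab')
    also have "\<dots> \<le> (real n + 1) powr (-y) * dnorm f \<sigma>"
      unfolding dnorm_def by (intro mult_left_mono infsum_mono_neutral dab dab') auto
    finally have "norm (f n) * real n powr (-x) * real n powr x \<le> (real n + 1) powr (-y) * dnorm f \<sigma> * real n powr x"
      by (intro mult_right_mono) auto
    moreover have "real n powr (-x) * real n powr x = 1" using less.prems by (simp add: powr_minus)
    moreover have "(real n + 1) powr (-y) * dnorm f \<sigma> * real n powr x = K * r powr y"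
    proof -
      have "r powr y = real n powr y / (real n + 1) powr y" by (simp add: r_def powr_divide)
      moreover have "real n powr x = real n powr \<sigma> * real n powr y" by (simp add: x_def powr_add)
      moreover have "(real n + 1) powr (-y) = 1 / (real n + 1) powr y" by (simp add: powr_minus_divide)
      ultimately show ?thesis by (simp add: K_def)
    qed
    ultimately show ?thesis by (simp add: mult.assoc)
  qed
  have "((\<lambda>y. K * r powr y) \<longlongrightarrow> K * 0) at_top"
    using r by (intro tendsto_mult tendsto_const) real_asymp
  then have "norm (f n) \<le> K * 0"
    by (rule tendsto_lowerbound) (auto intro!: eventually_mono[OF eventually_ge_at_top[of 0]] bound)
  then show ?case by simp
qed

lemma dirsum_eq_imp_eq:
  assumes f: "dabs f \<sigma>" and g: "dabs g \<sigma>" and eq: "\<And>x. x \<ge> \<sigma> \<Longrightarrow> dirsum f (of_real x) = dirsum g (of_real x)" and n: "n \<ge> 1"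
  shows "f n = g n"
proof -
  have hs: "(dirichlet_term (\<lambda>n. f n - g n) s has_sum (dirsum f s - dirsum g s)) {1..}" if "\<sigma> \<le> Re s" for s
    using has_sum_add[OF dirsum_has_sum[OF f that] has_sum_cmult_right[OF dirsum_has_sum[OF g that], of "-1"]]
    by (simp add: dirichlet_term_def[abs_def] left_diff_distrib)
  have "f n - g n = 0"
  proof (rule dirsum_unique[where \<sigma> = \<sigma>])
    show "dabs (\<lambda>n. f n - g n) \<sigma>" unfolding dabs_iff using hs[of "of_real \<sigma>"] by (auto simp: summable_on_def)
    show "dirsum (\<lambda>n. f n - g n) (of_real x) = 0" if "x \<ge> \<sigma>" for x
      unfolding dirsum_def using infsumI[OF hs[of "of_real x"]] eq[OF that] that by simp
  qed fact
  then show ?thesis by simp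
qed

section \<open>Coefficients of the Selberg class\<close>

text \<open>The Ramanujan condition with a constant valid from n = 1 on instead of eventually, and
  for values in any normed space, so that real majorants are covered too.\<close>

definition ram :: "(nat \<Rightarrow> 'a::real_normed_vector) \<Rightarrow> bool" where
  "ram f \<longleftrightarrow> (\<forall>\<epsilon>>0. \<exists>C. \<forall>n\<ge>1. norm (f n) \<le> C * real n powr \<epsilon>)"

lemma ramE:
  assumes "ram f" "\<epsilon> > 0"
  obtains C where "C > 0" "\<And>n. n \<ge> 1 \<Longrightarrow> norm (f n) \<le> C * real n powr \<epsilon>"
proof -
  obtain C where C: "\<And>n. n \<ge> 1 \<Longrightarrow> norm (f n) \<le> C * real n powr \<epsilon>"
    using assms unfolding ram_def by blast
  show ?thesis
  proof (rule that[of "\<bar>C\<bar> + 1"])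
    fix n :: nat assume "n \<ge> 1"
    have "C * real n powr \<epsilon> \<le> (\<bar>C\<bar> + 1) * real n powr \<epsilon>" by (intro mult_right_mono) auto
    then show "norm (f n) \<le> (\<bar>C\<bar> + 1) * real n powr \<epsilon>" using C[OF \<open>n \<ge> 1\<close>] by linarith
  qed auto
qed

lemma ram_dominated:
  assumes "ram g" "\<And>n. n \<ge> 1 \<Longrightarrow> norm (f n) \<le> norm (g n)"
  shows "ram f"
  unfolding ram_def using assms unfolding ram_def by (meson order_trans)

lemma mangoldt_sum_real: "n \<ge> 1 \<Longrightarrow> (\<Sum>d | d dvd n. mangoldt d :: real) = ln (real n)"
  using mangoldt_sum[of n, where ?'a = real] by simp

text \<open>Induction for f n \<le> \<open>C * n powr \<epsilon>\<close>. The von Mangoldt values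
  over the divisors of n add up to \<open>ln n\<close>. The q with
  \<open>\<kappa> q * q powr (-\<epsilon>)\<close> at most 1/2 therefore use up at most half of
  \<open>ln n\<close>; the finitely many others contribute a constant, which fits into the other
  half for large n.\<close>

lemma ram_of_recursion:
  fixes f \<kappa> :: "nat \<Rightarrow> real"
  assumes \<kappa>: "ram \<kappa>" "\<And>q. \<kappa> q \<ge> 0" and f0: "\<And>n. f n \<ge> 0"
    and rec: "\<And>n. n \<ge> 1 \<Longrightarrow> f n * ln (real n) \<le> (\<Sum>q | q dvd n. \<kappa> q * mangoldt q * f (n div q))"
  shows "ram f"
  unfolding ram_def
proof (intro allI impI)
  fix \<epsilon> :: real assume \<epsilon>: "\<epsilon> > 0"
  obtain C0 where C0: "C0 > 0" "\<And>q. q \<ge> 1 \<Longrightarrow> \<kappa> q \<le> C0 * real q powr (\<epsilon>/2)"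
    using ramE[OF \<kappa>(1), of "\<epsilon>/2"] \<epsilon> \<kappa>(2) by (metis abs_of_nonneg half_gt_zero real_norm_def)
  have "((\<lambda>x::real. C0 * x powr (-(\<epsilon>/2))) \<longlongrightarrow> 0) at_top" using \<epsilon> by real_asymp
  then have "eventually (\<lambda>x::real. C0 * x powr (-(\<epsilon>/2)) < 1/2) at_top"
    by (rule order_tendstoD) simp
  then obtain Q0 :: real where Q0: "\<And>x. x \<ge> Q0 \<Longrightarrow> C0 * x powr (-(\<epsilon>/2)) < 1/2"
    by (auto simp: eventually_at_top_linorder)
  define Q where "Q = nat \<lceil>max Q0 1\<rceil>"
  define K where "K = (\<Sum>q<Q. \<kappa> q * mangoldt q)"
  \<comment> \<open>From here on \<open>ln n\<close> is at least \<open>2 * K\<close>, and the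
    summand 2 makes it positive.\<close>
  define n0 where "n0 = nat \<lceil>exp (2 * K)\<rceil> + 2"
  define C where "C = (\<Sum>n<n0. f n) + 1"
  have C1: "C \<ge> 1" using f0 by (simp add: C_def sum_nonneg)
  have large: "\<kappa> q * real q powr (-\<epsilon>) \<le> 1/2" if "q \<ge> Q" "q \<ge> 1" for q
  proof -
    have "real q \<ge> Q0" using that by (simp add: Q_def)
    have "\<kappa> q * real q powr (-\<epsilon>) \<le> C0 * real q powr (\<epsilon>/2) * real q powr (-\<epsilon>)"
      using C0(2)[OF that(2)] by (intro mult_right_mono) auto
    also have "\<dots> = C0 * real q powr (-(\<epsilon>/2))" by (simp add: powr_add[symmetric])
    also have "\<dots> \<le> 1/2" using Q0[OF \<open>real q \<ge> Q0\<close>] by simp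
    finally show ?thesis .
  qed
  have "f n \<le> C * real n powr \<epsilon>" if "n \<ge> 1" for n
    using that
  proof (induction n rule: less_induct)
    case (less n)
    have n1: "real n powr \<epsilon> \<ge> 1" using less.prems \<epsilon> by (simp add: ge_one_powr_ge_zero)
    show ?case
    proof (cases "n < n0")
      case True
      have "f n \<le> (\<Sum>n<n0. f n)" using True f0 by (intro member_le_sum) auto
      also have "\<dots> \<le> C * 1" by (simp add: C_def)
      also have "\<dots> \<le> C * real n powr \<epsilon>" using n1 C1 by (intro mult_left_mono) auto
      finally show ?thesis .
    next
      case False
      then have n2: "real n \<ge> exp (2 * K)" "n \<ge> 2" unfolding n0_def by (simp_all, linarith)
      have lnK: "ln (real n) \<ge> 2 * K"
        using ln_mono[OF n2(1)] by simp
      have lnpos: "ln (real n) > 0" using n2(2) by simp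
      have fin: "finite {q. q dvd n}" using n2 by simp
      have "f n * ln (real n) \<le> (\<Sum>q | q dvd n. \<kappa> q * mangoldt q * f (n div q))" by (rule rec[OF less.prems])
      also have "\<dots> \<le> (\<Sum>q | q dvd n. C * real n powr \<epsilon> * (\<kappa> q * real q powr (-\<epsilon>) * mangoldt q))"
      proof (rule sum_mono)
        fix q assume "q \<in> {q. q dvd n}"
        then have q: "q dvd n" by simp
        show "\<kappa> q * mangoldt q * f (n div q) \<le> C * real n powr \<epsilon> * (\<kappa> q * real q powr (-\<epsilon>) * mangoldt q)"
        proof (cases "q = 1")
          case False
          have q1: "q \<ge> 1" using q n2 by (cases q) auto
          have lt: "n div q < n" using q1 False n2 by simp
          have "f (n div q) \<le> C * real (n div q) powr \<epsilon>"
            using less.IH[OF lt] div_ge_1[OF q less.prems] by simp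
          also have "real (n div q) = real n / real q" using q by (simp add: real_of_nat_div)
          also have "(real n / real q) powr \<epsilon> = real n powr \<epsilon> * real q powr (-\<epsilon>)"
            by (simp add: powr_divide powr_minus_divide)
          finally have "\<kappa> q * mangoldt q * f (n div q) \<le> \<kappa> q * mangoldt q * (C * (real n powr \<epsilon> * real q powr (-\<epsilon>)))"
            using \<kappa>(2) mangoldt_nonneg by (intro mult_left_mono mult_nonneg_nonneg) auto
          then show ?thesis by (simp add: mult_ac)
        qed simp
      qed
      also have "\<dots> = C * real n powr \<epsilon> * (\<Sum>q | q dvd n. \<kappa> q * real q powr (-\<epsilon>) * mangoldt q)"
        by (simp add: sum_distrib_left)
      also have "\<dots> \<le> C * real n powr \<epsilon> * ln (real n)"
      proof (rule mult_left_mono)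
        have "(\<Sum>q | q dvd n. \<kappa> q * real q powr (-\<epsilon>) * mangoldt q) \<le>
              (\<Sum>q | q dvd n. 1/2 * mangoldt q + (if q < Q then \<kappa> q * mangoldt q else 0))"
        proof (rule sum_mono)
          fix q assume "q \<in> {q. q dvd n}"
          then have q1: "q \<ge> 1" using n2 by (cases q) auto
          show "\<kappa> q * real q powr (-\<epsilon>) * mangoldt q \<le> 1/2 * mangoldt q + (if q < Q then \<kappa> q * mangoldt q else 0)"
          proof (cases "q < Q")
            case True
            have "real q powr (-\<epsilon>) \<le> 1 powr (-\<epsilon>)" using q1 \<epsilon> by (intro powr_mono2') auto
            then have "\<kappa> q * real q powr (-\<epsilon>) * mangoldt q \<le> \<kappa> q * 1 * mangoldt q"
              using \<kappa>(2)[of q] mangoldt_nonneg[of q] by (intro mult_right_mono mult_left_mono) auto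
            then show ?thesis using True mangoldt_nonneg[of q] by simp
          next
            case False
            then have "\<kappa> q * real q powr (-\<epsilon>) * mangoldt q \<le> 1/2 * mangoldt q"
              using large[of q] q1 mangoldt_nonneg[of q] by (intro mult_right_mono) auto
            then show ?thesis using False by simp
          qed
        qed
        also have "\<dots> = 1/2 * ln (real n) + (\<Sum>q | q dvd n \<and> q < Q. \<kappa> q * mangoldt q)"
          using fin less.prems
          by (simp add: sum.distrib sum_divide_distrib[symmetric] mangoldt_sum_real sum.If_cases Int_def)
        also have "\<dots> \<le> 1/2 * ln (real n) + K"
          unfolding K_def using \<kappa>(2) mangoldt_nonneg by (intro add_left_mono sum_mono2) auto
        also have "\<dots> \<le> ln (real n)" using lnK by simp
        finally show "(\<Sum>q | q dvd n. \<kappa> q * real q powr (-\<epsilon>) * mangoldt q) \<le> ln (real n)" .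
      qed (use C1 in simp)
      finally show ?thesis using lnpos by simp
    qed
  qed
  then show "\<exists>C. \<forall>n\<ge>1. norm (f n) \<le> C * real n powr \<epsilon>" using f0 by (intro exI[of _ C]) auto
qed

lemma card_divisors_multiples:
  assumes "q dvd n" "n \<ge> (1::nat)"
  shows "card {e. e dvd n \<and> q dvd e} = card {d. d dvd n div q}"
proof -
  have q0: "q \<noteq> 0" using assms by (cases "q = 0") auto
  have "(\<lambda>e. q * e) ` {d. d dvd n div q} = {e. e dvd n \<and> q dvd e}"
  proof safe
    fix d assume "d dvd n div q"
    then show "q * d dvd n" using assms q0 by (metis dvd_div_iff_mult mult.commute)
  next
    fix e assume e: "e dvd n" "q dvd e"
    then obtain d where d: "e = q * d" by blast
    then have "d dvd n div q" using e assms q0 by (metis dvd_div_iff_mult mult.commute)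
    then show "e \<in> (\<lambda>e. q * e) ` {d. d dvd n div q}" using d by blast
  qed simp
  moreover have "inj_on (\<lambda>e. q * e) {d. d dvd n div q}" using q0 by (auto simp: inj_on_def)
  ultimately show ?thesis by (metis card_image)
qed

text \<open>Pairing e with n / e, the number of divisors times \<open>ln n\<close> is twice the sum
  of \<open>ln e\<close> over the divisors e; writing \<open>ln e\<close> as a sum of von Mangoldt
  values gives the recursion with \<kappa> = 2.\<close>

lemma ram_divisor_count: "ram (\<lambda>n. real (card {d. d dvd n}))"
proof (rule ram_of_recursion[where \<kappa> = "\<lambda>_. 2"])
  show "ram (\<lambda>_. 2 :: real)"
    unfolding ram_def by (auto intro!: exI[of _ 2] ge_one_powr_ge_zero)
  fix n :: nat assume n: "n \<ge> 1"
  have fin: "finite {d. d dvd n}" using n by simp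
  have sub: "finite {q. q dvd e}" if "e dvd n" for e using that n by (intro finite_divisors) (cases e; auto)
  have "real (card {d. d dvd n}) * ln (real n) = (\<Sum>e | e dvd n. ln (real n))" by simp
  also have "\<dots> = (\<Sum>e | e dvd n. ln (real e) + ln (real (n div e)))"
    using n by (intro sum.cong refl) (auto elim!: dvdE simp: ln_mult)
  also have "\<dots> = (\<Sum>e | e dvd n. ln (real e)) + (\<Sum>e | e dvd n. ln (real (n div e)))"
    by (simp add: sum.distrib)
  also have "(\<Sum>e | e dvd n. ln (real (n div e))) = (\<Sum>e | e dvd n. ln (real e))"
    by (rule sum.reindex_bij_witness[of _ "\<lambda>e. n div e" "\<lambda>e. n div e"]) (use n in \<open>auto elim!: dvdE\<close>)
  also have "(\<Sum>e | e dvd n. ln (real e)) = (\<Sum>e | e dvd n. \<Sum>q | q dvd e. mangoldt q)"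
    using n by (intro sum.cong refl) (subst mangoldt_sum_real, auto intro: Suc_leI dvd_pos_nat)
  also have "\<dots> = (\<Sum>e | e dvd n. \<Sum>q | q dvd n \<and> q dvd e. mangoldt q)"
    by (intro sum.cong refl) (auto intro: dvd_trans)
  also have "\<dots> = (\<Sum>q | q dvd n. \<Sum>e | e dvd n \<and> q dvd e. mangoldt q)"
    using sum.swap_restrict[OF fin fin, of "\<lambda>e q. mangoldt q :: real" "\<lambda>e q. q dvd e"] by simp
  also have "\<dots> = (\<Sum>q | q dvd n. mangoldt q * real (card {d. d dvd n div q}))"
    by (intro sum.cong refl) (use card_divisors_multiples[OF _ n] in auto)
  finally show "real (card {d. d dvd n}) * ln (real n) \<le> (\<Sum>q | q dvd n. 2 * mangoldt q * real (card {d. d dvd n div q}))"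
    by (simp add: sum_distrib_left mult.assoc flip: mult_2)
qed auto

text \<open>The product of the two bounds depends only on n, and the number of divisors is itself at
  most a small power of n.\<close>

lemma ram_dconv:
  fixes f g :: "nat \<Rightarrow> 'a::{real_normed_field}"
  assumes "ram f" "ram g"
  shows "ram (dconv f g)"
  unfolding ram_def
proof (intro allI impI)
  fix \<epsilon> :: real assume \<epsilon>: "\<epsilon> > 0"
  then have e2: "\<epsilon>/2 > 0" by simp
  obtain A where A: "A > 0" "\<And>n. n \<ge> 1 \<Longrightarrow> norm (f n) \<le> A * real n powr (\<epsilon>/2)" using ramE[OF assms(1) e2] by metis
  obtain B where B: "B > 0" "\<And>n. n \<ge> 1 \<Longrightarrow> norm (g n) \<le> B * real n powr (\<epsilon>/2)" using ramE[OF assms(2) e2] by metis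
  obtain D where D: "D > 0" "\<And>n. n \<ge> 1 \<Longrightarrow> norm (real (card {d. d dvd n})) \<le> D * real n powr (\<epsilon>/2)"
    using ramE[OF ram_divisor_count e2] by metis
  have "norm (dconv f g n) \<le> (A * B * D) * real n powr \<epsilon>" if n: "n \<ge> 1" for n
  proof -
    have "norm (dconv f g n) \<le> (\<Sum>d | d dvd n. A * B * real n powr (\<epsilon>/2))"
      unfolding dconv_def
    proof (rule sum_norm_le)
      fix d assume "d \<in> {d. d dvd n}"
      then have d: "d dvd n" by simp
      have d1: "d \<ge> 1" using d n by (cases d) auto
      have "norm (f d * g (n div d)) \<le> (A * real d powr (\<epsilon>/2)) * (B * real (n div d) powr (\<epsilon>/2))"
        unfolding norm_mult using A(1) by (intro mult_mono A(2) B(2) d1 div_ge_1[OF d n]) auto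
      also have "\<dots> = A * B * (real d * real (n div d)) powr (\<epsilon>/2)" by (simp add: powr_mult)
      also have "real d * real (n div d) = real n" using d by (metis dvd_mult_div_cancel of_nat_mult)
      finally show "norm (f d * g (n div d)) \<le> A * B * real n powr (\<epsilon>/2)" .
    qed
    also have "\<dots> = real (card {d. d dvd n}) * (A * B * real n powr (\<epsilon>/2))" by simp
    also have "\<dots> \<le> (D * real n powr (\<epsilon>/2)) * (A * B * real n powr (\<epsilon>/2))"
      using D(2)[OF n] A(1) B(1) by (intro mult_right_mono) auto
    also have "\<dots> = (A * B * D) * (real n powr (\<epsilon>/2) * real n powr (\<epsilon>/2))" by (simp add: mult_ac)
    also have "real n powr (\<epsilon>/2) * real n powr (\<epsilon>/2) = real n powr \<epsilon>" by (simp add: powr_add[symmetric])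
    finally show ?thesis .
  qed
  then show "\<exists>C. \<forall>n\<ge>1. norm (dconv f g n) \<le> C * real n powr \<epsilon>" by blast
qed

lemma ram_dpow:
  fixes f :: "nat \<Rightarrow> 'a::{real_normed_field}"
  assumes "ram f"
  shows "ram (dpow f k)"
proof (induction k)
  case 0
  show ?case unfolding ram_def by (auto intro!: exI[of _ 1] ge_one_powr_ge_zero)
qed (use ram_dconv[OF assms] in auto)

lemma ram_dabs:
  assumes "ram f" "\<sigma> > 1"
  shows "dabs f \<sigma>"
proof -
  define \<delta> where "\<delta> = (\<sigma> - 1) / 2"
  have \<delta>: "\<delta> > 0" "\<sigma> = 1 + 2 * \<delta>" using assms by (auto simp: \<delta>_def field_simps)
  obtain C where C: "C > 0" "\<And>n. n \<ge> 1 \<Longrightarrow> norm (f n) \<le> C * real n powr \<delta>" using ramE[OF assms(1) \<delta>(1)] by metis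
  have "summable (\<lambda>n. real n powr (-(1 + \<delta>)))" using \<delta> by (subst summable_real_powr_iff) auto
  then have "(\<lambda>n. real n powr (-(1 + \<delta>))) summable_on UNIV"
    by (intro norm_summable_imp_summable_on) simp
  then have s: "(\<lambda>n. C * real n powr (-(1 + \<delta>))) summable_on {1..}"
    by (intro summable_on_cmult_right) (rule summable_on_subset_banach, auto)
  show ?thesis unfolding dabs_def
  proof (rule summable_on_comparison_test[OF s])
    fix n :: nat assume "n \<in> {1..}"
    then have "norm (f n) * real n powr (-\<sigma>) \<le> (C * real n powr \<delta>) * real n powr (-\<sigma>)"
      using C by (intro mult_right_mono) auto
    also have "\<dots> = C * real n powr (-(1 + \<delta>))" by (simp add: \<delta>(2) powr_add[symmetric] algebra_simps)
    finally show "norm (f n) * real n powr (-\<sigma>) \<le> C * real n powr (-(1 + \<delta>))" .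
  qed auto
qed

lemma ram_of_ramanujan_condition:
  assumes "ramanujan_condition a"
  shows "ram a"
  unfolding ram_def
proof (intro allI impI)
  fix \<epsilon> :: real assume \<epsilon>: "\<epsilon> > 0"
  then have "(\<lambda>n. norm (a n)) \<in> O(\<lambda>n. real n powr \<epsilon>)" using assms by (auto simp: ramanujan_condition_def)
  then obtain c where c: "c > 0" "eventually (\<lambda>n. norm (norm (a n)) \<le> c * norm (real n powr \<epsilon>)) at_top"
    by (rule landau_o.bigE)
  then obtain N where N: "\<And>n. n \<ge> N \<Longrightarrow> norm (a n) \<le> c * real n powr \<epsilon>"
    by (auto simp: eventually_at_top_linorder)
  have "norm (a n) \<le> (c + (\<Sum>k<N. norm (a k))) * real n powr \<epsilon>" if n: "n \<ge> 1" for n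
  proof (cases "n \<ge> N")
    case True
    have "c * real n powr \<epsilon> \<le> (c + (\<Sum>k<N. norm (a k))) * real n powr \<epsilon>"
      by (intro mult_right_mono) (auto simp: sum_nonneg)
    then show ?thesis using N[OF True] by linarith
  next
    case False
    have "norm (a n) \<le> (\<Sum>k<N. norm (a k))" using False by (intro member_le_sum) auto
    also have "\<dots> \<le> (c + (\<Sum>k<N. norm (a k))) * 1" using c by simp
    also have "\<dots> \<le> (c + (\<Sum>k<N. norm (a k))) * real n powr \<epsilon>"
      using c n \<epsilon> by (intro mult_left_mono ge_one_powr_ge_zero) (auto simp: sum_nonneg add_nonneg_nonneg)
    finally show ?thesis .
  qed
  then show "\<exists>C. \<forall>n\<ge>1. norm (a n) \<le> C * real n powr \<epsilon>" by blast
qed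

section \<open>Coefficients of the Euler product\<close>

lemma norm_exp_ge: "norm (exp z) \<ge> exp (- norm (z::complex))"
  using abs_Re_le_cmod[of z] by (simp add: norm_exp_eq_Re)

lemma bij_betw_primepow:
  "bij_betw (\<lambda>(p, m). p ^ m :: nat) ({p. prime p} \<times> {1..}) {n. primepow n}"
proof (rule bij_betw_imageI)
  show "inj_on (\<lambda>(p, m). p ^ m :: nat) ({p. prime p} \<times> {1..})"
    by (auto simp: inj_on_def prime_power_inj'')
  show "(\<lambda>(p, m). p ^ m) ` ({p. prime p} \<times> {1..}) = {n::nat. primepow n}"
  proof (intro set_eqI iffI)
    fix n :: nat assume "n \<in> {n. primepow n}"
    then obtain p k where "prime p" "k > 0" "n = p ^ k" by (auto simp: primepow_def)
    then show "n \<in> (\<lambda>(p, m). p ^ m) ` ({p. prime p} \<times> {1..})" by (intro image_eqI[of _ _ "(p, k)"]) auto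
  qed auto
qed

lemma sum_divisors_prime_power:
  assumes "prime (p::nat)"
  shows "(\<Sum>d | d dvd p ^ m. f d) = (\<Sum>j\<le>m. f (p ^ j))"
proof -
  have "{d. d dvd p ^ m} = (\<lambda>j. p ^ j) ` {..m}"
    using assms by (auto simp: divides_primepow_nat)
  moreover have "inj_on (\<lambda>j. p ^ j) {..m}" using prime_gt_1_nat[OF assms] by (auto simp: inj_on_def)
  ultimately show ?thesis by (simp add: sum.reindex)
qed

text \<open>The recursion is solved for \<open>b (p ^ m)\<close> by induction on m. The constant
  depends on m, so this replaces the exponent \<theta> by an arbitrarily small one only for
  boundedly many m.\<close>

lemma log_coeff_prime_power_bound:
  fixes a b :: "nat \<Rightarrow> complex"
  assumes a: "ram a" and a1: "a 1 = 1"
    and rec: "\<And>p m. prime p \<Longrightarrow> m \<ge> 1 \<Longrightarrow> 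
        a (p ^ m) * of_nat m = (\<Sum>j=1..m. b (p ^ j) * of_nat j * a (p ^ (m - j)))"
    and "m \<ge> 1" "\<epsilon> > 0"
  shows "\<exists>C>0. \<forall>p. prime p \<longrightarrow> norm (b (p ^ m)) \<le> C * real p powr \<epsilon>"
  using assms(4,5)
proof (induction m arbitrary: \<epsilon> rule: less_induct)
  case (less m)
  have "\<exists>C>0. \<forall>p. prime p \<longrightarrow> norm (b (p ^ j)) \<le> C * real p powr (\<epsilon>/2)" if "j \<in> {1..<m}" for j
    using less.IH[of j "\<epsilon>/2"] that less.prems by auto
  then obtain C where C: "\<And>j. j \<in> {1..<m} \<Longrightarrow> C j > 0" 
     "\<And>j p. j \<in> {1..<m} \<Longrightarrow> prime p \<Longrightarrow> norm (b (p ^ j)) \<le> C j * real p powr (\<epsilon>/2)" by metis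
  have "\<epsilon> / (2 * real m) > 0" using less.prems by simp
  from ramE[OF a this] obtain A where A: "A > 0" "\<And>n. n \<ge> 1 \<Longrightarrow> norm (a n) \<le> A * real n powr (\<epsilon> / (2 * real m))"
    by metis
  have apow: "norm (a (p ^ i)) \<le> A * real p powr (\<epsilon>/2)" if "prime p" "i \<le> m" for p i
  proof -
    have p1: "real p \<ge> 1" using prime_gt_0_nat[OF that(1)] by simp
    have "real (p ^ i) powr (\<epsilon> / (2 * real m)) = real p powr (real i * (\<epsilon> / (2 * real m)))"
      using p1 by (simp add: powr_powr powr_realpow[symmetric])
    also have "\<dots> \<le> real p powr (real m * (\<epsilon> / (2 * real m)))"
      using p1 that less.prems by (intro powr_mono mult_right_mono) auto
    also have "real m * (\<epsilon> / (2 * real m)) = \<epsilon>/2" using less.prems by simp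
    finally have "A * real (p ^ i) powr (\<epsilon> / (2 * real m)) \<le> A * real p powr (\<epsilon>/2)" using A(1) by simp
    moreover have "p ^ i \<ge> 1" using prime_gt_0_nat[OF that(1)] by (simp add: Suc_le_eq)
    ultimately show ?thesis using A(2)[of "p ^ i"] by linarith
  qed
  show ?case
  proof (intro exI conjI allI impI)
    have "(\<Sum>j=1..<m. C j * A) \<ge> 0" using C(1) A(1) by (intro sum_nonneg mult_nonneg_nonneg) (auto intro: less_imp_le)
    then show "A + (\<Sum>j=1..<m. C j * A) > 0" using A(1) by linarith
    fix p :: nat assume p: "prime p"
    have p1: "real p \<ge> 1" using prime_gt_0_nat[OF p] by simp
    have pe: "real p powr (\<epsilon>/2) \<le> real p powr \<epsilon>" using p1 less.prems by (intro powr_mono) auto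
    have "{1..m} = insert m {1..<m}" using less.prems by auto
    then have "a (p ^ m) * of_nat m = b (p ^ m) * of_nat m + (\<Sum>j=1..<m. b (p ^ j) * of_nat j * a (p ^ (m - j)))"
      using rec[OF p less.prems(1)] a1 by simp
    then have "b (p ^ m) * of_nat m = a (p ^ m) * of_nat m - (\<Sum>j=1..<m. b (p ^ j) * of_nat j * a (p ^ (m - j)))"
      by simp
    then have "norm (b (p ^ m) * of_nat m) \<le> norm (a (p ^ m) * of_nat m) + norm (\<Sum>j=1..<m. b (p ^ j) * of_nat j * a (p ^ (m - j)))"
      by (metis norm_triangle_ineq4)
    also have "norm (\<Sum>j=1..<m. b (p ^ j) * of_nat j * a (p ^ (m - j))) \<le> (\<Sum>j=1..<m. (C j * A * real p powr \<epsilon>) * real m)"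
    proof (rule sum_norm_le)
      fix j assume j: "j \<in> {1..<m}"
      have "norm (b (p ^ j) * of_nat j * a (p ^ (m - j))) = norm (b (p ^ j)) * norm (a (p ^ (m - j))) * real j"
        by (simp add: norm_mult)
      also have "\<dots> \<le> (C j * real p powr (\<epsilon>/2)) * (A * real p powr (\<epsilon>/2)) * real m"
        using C(1)[OF j] A(1) j by (intro mult_mono C(2)[OF j p] apow[OF p]) auto
      also have "\<dots> = (C j * A * (real p powr (\<epsilon>/2) * real p powr (\<epsilon>/2))) * real m" by (simp add: mult_ac)
      also have "real p powr (\<epsilon>/2) * real p powr (\<epsilon>/2) = real p powr \<epsilon>" by (simp add: powr_add[symmetric])
      finally show "norm (b (p ^ j) * of_nat j * a (p ^ (m - j))) \<le> (C j * A * real p powr \<epsilon>) * real m" .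
    qed
    also have "norm (a (p ^ m) * of_nat m) \<le> (A * real p powr \<epsilon>) * real m"
    proof -
      have "A * real p powr (\<epsilon>/2) \<le> A * real p powr \<epsilon>" using pe A(1) by simp
      then have "norm (a (p ^ m)) \<le> A * real p powr \<epsilon>" using apow[OF p order_refl] by linarith
      then show ?thesis by (simp add: norm_mult mult_right_mono)
    qed
    finally have "norm (b (p ^ m)) * real m \<le> ((A + (\<Sum>j=1..<m. C j * A)) * real p powr \<epsilon>) * real m"
      by (simp add: norm_mult distrib_right sum_distrib_right)
    then show "norm (b (p ^ m)) \<le> (A + (\<Sum>j=1..<m. C j * A)) * real p powr \<epsilon>"
      using less.prems by simp
  qed
qed

text \<open>The logarithm is split into primes and higher prime powers; \<open>g\<close> is the
  exponential of minus the first part and \<open>h\<close> that of the second, so the convolution of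
  \<open>a\<close> and \<open>g\<close> is \<open>h\<close>. At primes b = a, hence \<open>g\<close>
  inherits the Ramanujan bound. The second part converges absolutely at 4/5, and the exponential of
  a bounded sum stays away from zero.\<close>

lemma selberg_class_coefficients:
  assumes F: "F \<in> selberg_class"
  obtains a g h :: "nat \<Rightarrow> complex" and c0 c1 :: real where
    "ram a" "ram g" "\<And>s. Re s > 1 \<Longrightarrow> F s = dirsum a s"
    "\<And>n. n \<ge> 1 \<Longrightarrow> dconv a g n = h n" "dabs h (4/5)" 
    "c0 > 0" "\<And>s. Re s \<ge> 4/5 \<Longrightarrow> c0 \<le> norm (dirsum h s)"
    "c1 > 0" "\<And>s. Re s \<ge> 2 \<Longrightarrow> c1 \<le> norm (F s)"
proof -
  obtain a where a: "has_dirichlet_series F a" "ramanujan_condition a"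
    using F by (auto simp: selberg_class_def)
  have ram_a: "ram a" by (rule ram_of_ramanujan_condition[OF a(2)])
  have Fa: "F s = dirsum a s" if "Re s > 1" for s
    using a(1) that unfolding has_dirichlet_series_def dirsum_def by (metis infsumI)
  obtain b :: "nat \<Rightarrow> complex" and \<theta> C :: real where th: "\<theta> < 1/2" 
    and bC: "\<And>p m. prime p \<Longrightarrow> m \<ge> 1 \<Longrightarrow> norm (b (p ^ m)) \<le> C * real (p ^ m) powr \<theta>"
    and bF: "\<And>s. Re s > 1 \<Longrightarrow> \<exists>L. ((\<lambda>(p, m). dirichlet_term b s (p ^ m)) has_sum L) ({p. prime p} \<times> {1..}) \<and> exp L = F s"
    using F unfolding selberg_class_def selberg_log_series_def by blast
  define \<beta> where "\<beta> n = (if primepow n then b n else 0)" for n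
  define \<beta>1 where "\<beta>1 n = (if prime n then b n else 0)" for n
  define \<beta>2 where "\<beta>2 n = \<beta> n + (- \<beta>1 n)" for n
  have \<beta>2: "\<beta>2 n = (if primepow n \<and> \<not> prime n then b n else 0)" for n
    by (auto simp: \<beta>2_def \<beta>_def \<beta>1_def)
  have one: "\<beta> 1 = 0" "(\<lambda>n. - \<beta>1 n) 1 = 0" "\<beta>2 1 = 0" by (auto simp: \<beta>_def \<beta>1_def \<beta>2)
  have \<beta>_sum: "\<exists>L. (dirichlet_term \<beta> s has_sum L) {1..} \<and> exp L = F s" if s: "Re s > 1" for s
  proof -
    obtain L where L: "((\<lambda>(p, m). dirichlet_term b s (p ^ m)) has_sum L) ({p. prime p} \<times> {1..})" "exp L = F s"
      using bF[OF s] by blast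
    have "((\<lambda>x. dirichlet_term b s ((\<lambda>(p, m). p ^ m) x)) has_sum L) ({p. prime p} \<times> {1..})"
      using L(1) by (simp add: case_prod_unfold)
    then have "(dirichlet_term b s has_sum L) {n. primepow n}"
      by (simp only: has_sum_reindex_bij_betw[OF bij_betw_primepow])
    then have "(dirichlet_term \<beta> s has_sum L) {1..}"
      by (rule has_sum_cong_neutral[THEN iffD1, rotated -1])
         (auto simp: dirichlet_term_def \<beta>_def Suc_le_eq primepow_gt_0_nat)
    then show ?thesis using L(2) by blast
  qed
  have dabs_\<beta>: "dabs \<beta> \<sigma>" if "\<sigma> > 1" for \<sigma>
    unfolding dabs_iff summable_on_def using \<beta>_sum[of "of_real \<sigma>"] that by auto
  have F\<beta>: "F s = exp (dirsum \<beta> s)" if "Re s > 1" for s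
    using \<beta>_sum[OF that] unfolding dirsum_def by (metis infsumI)
  have a_eq: "a n = dexp \<beta> n" if "n \<ge> 1" for n
  proof (rule dirsum_eq_imp_eq[where \<sigma> = 2, OF _ _ _ that])
    show "dabs a 2" by (rule ram_dabs[OF ram_a]) simp
    show "dabs (dexp \<beta>) 2" by (rule dexp_props(1)[OF dabs_\<beta> one(1)]) simp
    show "dirsum a (of_real x) = dirsum (dexp \<beta>) (of_real x)" if "x \<ge> 2" for x
      using that Fa[of "of_real x"] F\<beta>[of "of_real x"] dexp_props(2)[OF dabs_\<beta>[of 2] one(1), of "of_real x"] by simp
  qed
  have a1: "a 1 = 1" using a_eq[of 1] dexp_1[of \<beta>, OF one(1)] by simp
  \<comment> \<open>This compares the coefficients at \<open>p ^ m\<close> in the logarithmic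
    derivative and cancels \<open>ln p\<close>.\<close>
  have rec: "a (p ^ m) * of_nat m = (\<Sum>j=1..m. b (p ^ j) * of_nat j * a (p ^ (m - j)))"
    if p: "prime p" and m: "m \<ge> 1" for p m :: nat
  proof -
    have p0: "p > 1" using prime_gt_1_nat[OF p] .
    have ge: "p ^ j \<ge> 1" for j using p0 by (simp add: Suc_le_eq)
    have lnp: "ln (real (p ^ j)) = real j * ln (real p)" for j using p0 by (simp add: ln_realpow)
    have "a (p ^ m) * ln (real (p ^ m)) = (\<Sum>d | d dvd p ^ m. \<beta> d * ln (real d) * dexp \<beta> (p ^ m div d))"
      using dexp_ln[of \<beta>, OF one(1) ge] a_eq[OF ge] by simp
    also have "\<dots> = (\<Sum>j\<le>m. \<beta> (p ^ j) * ln (real (p ^ j)) * dexp \<beta> (p ^ m div p ^ j))"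
      by (rule sum_divisors_prime_power[OF p])
    also have "\<dots> = (\<Sum>j\<in>{1..m}. \<beta> (p ^ j) * ln (real (p ^ j)) * dexp \<beta> (p ^ m div p ^ j))"
      by (rule sum.mono_neutral_right) (auto simp: Suc_le_eq)
    also have "\<dots> = (\<Sum>j\<in>{1..m}. (b (p ^ j) * of_nat j * a (p ^ (m - j))) * ln (real p))"
    proof (rule sum.cong[OF refl])
      fix j assume j: "j \<in> {1..m}"
      have "p ^ m div p ^ j = p ^ (m - j)" using j p0 by (simp add: power_diff)
      moreover have "\<beta> (p ^ j) = b (p ^ j)" using j p by (simp add: \<beta>_def)
      ultimately show "\<beta> (p ^ j) * ln (real (p ^ j)) * dexp \<beta> (p ^ m div p ^ j) = (b (p ^ j) * of_nat j * a (p ^ (m - j))) * ln (real p)"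
        using a_eq[OF ge, of "m - j"] by (simp add: lnp[unfolded of_nat_power])
    qed
    finally have "(a (p ^ m) * of_nat m) * ln (real p) = (\<Sum>j=1..m. b (p ^ j) * of_nat j * a (p ^ (m - j))) * ln (real p)"
      by (simp only: lnp sum_distrib_right) (simp add: mult.assoc)
    moreover have "complex_of_real (ln (real p)) \<noteq> 0" using p0 by simp
    ultimately show ?thesis by simp
  qed
  have b_prime: "b p = a p" if "prime p" for p using rec[OF that, of 1] a1 by simp
  have ram_\<beta>1: "ram (\<lambda>n. norm (\<beta>1 n))"
    by (rule ram_dominated[OF ram_a]) (auto simp: \<beta>1_def b_prime)
  define g where "g = dexp (\<lambda>n. - \<beta>1 n)"
  define h where "h = dexp \<beta>2"
  have ram_g: "ram g"
  proof -
    have "ram (\<lambda>n. norm (g n))"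
    proof (rule ram_of_recursion[OF ram_\<beta>1])
      fix n :: nat assume n: "n \<ge> 1"
      have "norm (g n) * ln (real n) = norm (g n * ln (real n))" using n by (simp add: norm_mult)
      also have "\<dots> = norm (\<Sum>d | d dvd n. (- \<beta>1 d) * ln (real d) * g (n div d))"
        unfolding g_def using dexp_ln[of "\<lambda>n. - \<beta>1 n", OF one(2) n] by simp
      also have "\<dots> \<le> (\<Sum>d | d dvd n. norm (\<beta>1 d) * mangoldt d * norm (g (n div d)))"
      proof (rule sum_norm_le)
        fix d assume "d \<in> {d. d dvd n}"
        show "norm ((- \<beta>1 d) * ln (real d) * g (n div d)) \<le> norm (\<beta>1 d) * mangoldt d * norm (g (n div d))"
        proof (cases "prime d")
          case True
          then show ?thesis using prime_gt_1_nat[OF True] by (simp add: norm_mult)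
        qed (simp add: \<beta>1_def)
      qed
      finally show "norm (g n) * ln (real n) \<le> (\<Sum>q | q dvd n. norm (\<beta>1 q) * mangoldt q * norm (g (n div q)))" .
    qed auto
    then show ?thesis by (rule ram_dominated) simp
  qed
  have "\<forall>m\<in>{1..<10}. \<exists>C. C > 0 \<and> (\<forall>p. prime p \<longrightarrow> norm (b (p ^ m)) \<le> C * real p powr (1/10))"
  proof
    fix m :: nat assume "m \<in> {1..<10}"
    then have m: "m \<ge> 1" by simp
    show "\<exists>C. C > 0 \<and> (\<forall>p. prime p \<longrightarrow> norm (b (p ^ m)) \<le> C * real p powr (1/10))"
      by (rule log_coeff_prime_power_bound[OF ram_a a1 rec m]) auto
  qed
  from bchoice[OF this] obtain D where D': 
    "\<forall>m\<in>{1..<10}. D m > 0 \<and> (\<forall>p. prime p \<longrightarrow> norm (b (p ^ m)) \<le> D m * real p powr (1/10))" ..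
  have D: "D m > 0" "prime p \<Longrightarrow> norm (b (p ^ m)) \<le> D m * real p powr (1/10)" if "m \<in> {1..<10}" for m p
    using D' that by auto
  define K where "K = \<bar>C\<bar> + 4 * (\<Sum>m\<in>{1..<10}. D m)"
  have D0: "(\<Sum>m\<in>{1..<10}. D m) \<ge> 0" using D(1) by (intro sum_nonneg) (auto intro: less_imp_le)
  \<comment> \<open>For m < 10 the bound \<open>p powr (1/10)\<close> leaves the exponent 1/10 - 8/5
    = -3/2, summable over p. From m = 10 on, \<theta> < 1/2 leaves
    \<open>p powr (-3 * m / 10)\<close>: half of this exponent yields at most
    \<open>p powr (-3/2)\<close>, the other half is summable over m.\<close>
  have b_bound: "norm (b (p ^ m)) * real (p ^ m) powr (-(4/5)) \<le> K * (real p powr (-3/2) * 2 powr (- (3/20) * real m))"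
    if p: "prime p" and m: "m \<ge> 2" for p m :: nat
  proof -
    have p2: "real p \<ge> 2" using prime_ge_2_nat[OF p] by simp
    have pw: "real (p ^ m) powr x = real p powr (real m * x)" for x
      using p2 by (simp add: powr_powr powr_realpow[symmetric])
    show ?thesis
    proof (cases "m < 10")
      case True
      \<comment> \<open>For the finitely many m below 10 the decay in m is supplied artificially, at
        the price of the factor 4.\<close>
      have two: "1 \<le> 4 * (2::real) powr (- (3/20) * real m)"
      proof -
        have "(2::real) powr (-2) \<le> 2 powr (- (3/20) * real m)" using True by (intro powr_mono) auto
        moreover have "(2::real) powr (-2) = 1/4" by (simp add: powr_minus_divide)
        ultimately show ?thesis by simp
      qed
      have "norm (b (p ^ m)) * real (p ^ m) powr (-(4/5)) \<le> (D m * real p powr (1/10)) * real p powr (-8/5)"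
      proof (rule mult_mono)
        show "real (p ^ m) powr (-(4/5)) \<le> real p powr (-8/5)"
          unfolding pw using p2 m by (intro powr_mono) auto
      qed (use D(2)[of m p] D(1)[of m] True m p in auto)
      also have "\<dots> = D m * real p powr (-3/2) * 1" by (simp add: powr_add[symmetric])
      also have "\<dots> \<le> D m * real p powr (-3/2) * (4 * 2 powr (- (3/20) * real m))"
        using two D(1)[of m] True m by (intro mult_left_mono) auto
      also have "\<dots> = (4 * D m) * (real p powr (-3/2) * 2 powr (- (3/20) * real m))" by simp
      also have "\<dots> \<le> K * (real p powr (-3/2) * 2 powr (- (3/20) * real m))"
      proof (rule mult_right_mono)
        have "D m \<le> (\<Sum>m\<in>{1..<10}. D m)" using True m D(1) by (intro member_le_sum) (auto intro: less_imp_le)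
        then show "4 * D m \<le> K" by (simp add: K_def)
      qed simp
      finally show ?thesis .
    next
      case False
      have "norm (b (p ^ m)) * real (p ^ m) powr (-(4/5)) \<le> (\<bar>C\<bar> * real (p ^ m) powr (1/2)) * real (p ^ m) powr (-(4/5))"
      proof (rule mult_right_mono)
        have "norm (b (p ^ m)) \<le> C * real (p ^ m) powr \<theta>" using bC[OF p, of m] m by simp
        also have "\<dots> \<le> \<bar>C\<bar> * real (p ^ m) powr (1/2)"
          using th p2 by (intro mult_mono powr_mono) (auto simp: one_le_power)
        finally show "norm (b (p ^ m)) \<le> \<bar>C\<bar> * real (p ^ m) powr (1/2)" .
      qed simp
      also have "\<dots> = \<bar>C\<bar> * (real p powr (- (3/20) * real m) * real p powr (- (3/20) * real m))"
        unfolding pw by (simp add: powr_add[symmetric])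
      also have "\<dots> \<le> \<bar>C\<bar> * (real p powr (-3/2) * 2 powr (- (3/20) * real m))"
        using p2 False by (intro mult_left_mono mult_mono powr_mono powr_mono2') auto
      also have "\<dots> \<le> K * (real p powr (-3/2) * 2 powr (- (3/20) * real m))"
        using D0 by (intro mult_right_mono) (auto simp: K_def)
      finally show ?thesis .
    qed
  qed
  have K0: "K \<ge> 0" using D0 by (simp add: K_def)
  have dabs_\<beta>2: "dabs \<beta>2 (4/5)"
  proof -
    define w where "w n = norm (\<beta>2 n) * real n powr (-(4/5))" for n
    have "summable (\<lambda>p. real p powr (-3/2))" by (subst summable_real_powr_iff) auto
    then have su: "(\<lambda>p. real p powr (-3/2)) summable_on UNIV" by (intro norm_summable_imp_summable_on) simp
    have "summable (\<lambda>m. (2 powr (-(3/20)) :: real) ^ m)"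
    proof (rule summable_geometric)
      have "(2::real) powr (-(3/20)) < 2 powr 0" by (intro powr_less_mono) auto
      then show "norm ((2::real) powr (-(3/20))) < 1" by simp
    qed
    moreover have "(2 powr (-(3/20)) :: real) ^ m = 2 powr (-(3/20) * real m)" for m
      by (simp add: powr_realpow[symmetric] powr_powr)
    ultimately have "summable (\<lambda>m. (2::real) powr (-(3/20) * real m))" by (simp only:)
    then have sv: "(\<lambda>m. (2::real) powr (-(3/20) * real m)) summable_on UNIV" by (intro norm_summable_imp_summable_on) simp
    have su': "(\<lambda>p. real p powr (-3/2)) summable_on {p. prime p}" by (rule summable_on_subset_banach[OF su]) auto
    have sv': "(\<lambda>m. (2::real) powr (-(3/20) * real m)) summable_on {1..}" by (rule summable_on_subset_banach[OF sv]) auto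
    define Z where "Z = infsum (\<lambda>m. (2::real) powr (-(3/20) * real m)) {1..}"
    define W where "W = (\<lambda>(p::nat, m::nat). K * (real p powr (-3/2) * 2 powr (- (3/20) * real m)))"
    have sW: "W summable_on ({p. prime p} \<times> {1..})"
    proof (rule summable_on_SigmaI)
      fix p :: nat
      show "((\<lambda>m. W (p, m)) has_sum (K * (real p powr (-3/2) * Z))) {1..}"
        unfolding W_def prod.case Z_def by (intro has_sum_cmult_right has_sum_infsum sv')
    next
      show "(\<lambda>p. K * (real p powr (-3/2) * Z)) summable_on {p. prime p}"
        by (intro summable_on_cmult_right summable_on_cmult_left su')
    qed (use K0 in \<open>auto simp: W_def\<close>)
    have "(\<lambda>x. w ((\<lambda>(p, m). p ^ m) x)) summable_on ({p. prime p} \<times> {1..})"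
    proof (rule summable_on_comparison_test[OF sW])
      fix x :: "nat \<times> nat" assume x: "x \<in> {p. prime p} \<times> {1..}"
      obtain p m where pm: "x = (p, m)" by (cases x)
      have p: "prime p" and m: "m \<ge> 1" using x pm by auto
      show "w ((\<lambda>(p, m). p ^ m) x) \<le> W x"
      proof (cases "m = 1")
        case True
        then show ?thesis using p K0 by (simp add: pm w_def W_def \<beta>2)
      next
        case False
        have "norm (\<beta>2 (p ^ m)) \<le> norm (b (p ^ m))" by (simp add: \<beta>2)
        then have "w (p ^ m) \<le> norm (b (p ^ m)) * real (p ^ m) powr (-(4/5))" unfolding w_def by (rule mult_right_mono) simp
        then show ?thesis using b_bound[OF p, of m] False m by (simp add: pm W_def)
      qed
    qed (simp add: w_def case_prod_unfold)
    then obtain S where "((\<lambda>x. w ((\<lambda>(p, m). p ^ m) x)) has_sum S) ({p. prime p} \<times> {1..})" by (auto simp: summable_on_def)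
    then have "(w has_sum S) {n. primepow n}"
      by (simp only: has_sum_reindex_bij_betw[OF bij_betw_primepow])
    then have "(w has_sum S) {1..}"
      by (rule has_sum_cong_neutral[THEN iffD1, rotated -1])
         (auto simp: w_def \<beta>2 Suc_le_eq primepow_gt_0_nat)
    then show ?thesis unfolding dabs_def w_def[symmetric] summable_on_def by blast
  qed
  have dabs_m\<beta>1: "dabs (\<lambda>n. - \<beta>1 n) 2"
  proof (rule ram_dabs)
    show "ram (\<lambda>n. - \<beta>1 n)" by (rule ram_dominated[OF ram_\<beta>1]) simp
  qed simp
  have dabs_a: "dabs a 2" by (rule ram_dabs[OF ram_a]) simp
  have dabs_g: "dabs g 2" unfolding g_def by (rule dexp_props(1)[OF dabs_m\<beta>1 one(2)])
  have dabs_h: "dabs h (4/5)" unfolding h_def by (rule dexp_props(1)[OF dabs_\<beta>2 one(3)])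
  \<comment> \<open>Both series have the same sum at all real points from 2 on, so the coefficients
    agree by uniqueness.\<close>
  have ag: "dconv a g n = h n" if "n \<ge> 1" for n
  proof (rule dirsum_eq_imp_eq[where \<sigma> = 2, OF _ _ _ that])
    show "dabs (dconv a g) 2" by (rule dabs_dconv(1)[OF dabs_a dabs_g])
    show "dabs h 2" by (rule dabs_mono[OF dabs_h]) simp
    fix x :: real assume x: "x \<ge> 2"
    have "(dirichlet_term \<beta>2 (of_real x) has_sum (dirsum \<beta> (of_real x) + dirsum (\<lambda>n. - \<beta>1 n) (of_real x))) {1..}"
      using has_sum_add[OF dirsum_has_sum[OF dabs_\<beta>[of 2]] dirsum_has_sum[OF dabs_m\<beta>1], of "of_real x" "of_real x"] x
      by (simp add: dirichlet_term_def[abs_def] \<beta>2_def distrib_right left_diff_distrib)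
    then have e: "dirsum \<beta>2 (of_real x) = dirsum \<beta> (of_real x) + dirsum (\<lambda>n. - \<beta>1 n) (of_real x)"
      unfolding dirsum_def[of \<beta>2] by (rule infsumI)
    have "dirsum (dconv a g) (of_real x) = dirsum a (of_real x) * dirsum g (of_real x)"
      by (rule dirsum_dconv[OF dabs_a dabs_g]) (use x in simp)
    also have "dirsum a (of_real x) = exp (dirsum \<beta> (of_real x))"
      using Fa[of "of_real x"] F\<beta>[of "of_real x"] x by simp
    also have "dirsum g (of_real x) = exp (dirsum (\<lambda>n. - \<beta>1 n) (of_real x))"
      unfolding g_def by (rule dexp_props(2)[OF dabs_m\<beta>1 one(2)]) (use x in simp)
    also have "exp (dirsum \<beta> (of_real x)) * exp (dirsum (\<lambda>n. - \<beta>1 n) (of_real x)) = exp (dirsum \<beta>2 (of_real x))"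
      by (simp add: e exp_add)
    also have "\<dots> = dirsum h (of_real x)"
      unfolding h_def by (rule dexp_props(2)[OF dabs_\<beta>2 one(3), symmetric]) (use x in simp)
    finally show "dirsum (dconv a g) (of_real x) = dirsum h (of_real x)" .
  qed
  show ?thesis
  proof (rule that[OF ram_a ram_g Fa ag dabs_h])
    show "exp (- dnorm \<beta>2 (4/5)) > 0" "exp (- dnorm \<beta> 2) > 0" by auto
    show "exp (- dnorm \<beta>2 (4/5)) \<le> norm (dirsum h s)" if "Re s \<ge> 4/5" for s
    proof -
      have "exp (- dnorm \<beta>2 (4/5)) \<le> exp (- norm (dirsum \<beta>2 s))" using norm_dirsum_le[OF dabs_\<beta>2 that] by simp
      also have "\<dots> \<le> norm (dirsum h s)" using norm_exp_ge dexp_props(2)[OF dabs_\<beta>2 one(3) that] by (simp add: h_def)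
      finally show ?thesis .
    qed
    show "exp (- dnorm \<beta> 2) \<le> norm (F s)" if "Re s \<ge> 2" for s
    proof -
      have "exp (- dnorm \<beta> 2) \<le> exp (- norm (dirsum \<beta> s))" using norm_dirsum_le[OF dabs_\<beta>[of 2] that] by simp
      also have "\<dots> \<le> norm (F s)" using norm_exp_ge F\<beta>[of s] that by simp
      finally show ?thesis .
    qed
  qed auto
qed

section \<open>The functional equation\<close>

text \<open>For v \<ge> |y| the logarithm of |v + iy| is concave in v, so its mean slope on
  [u, u + c] is at least the one on [u + c, u + c + 1].\<close>

lemma log_modulus_concave:
  fixes u c y :: real
  assumes u: "\<bar>y\<bar> \<le> u" "0 < u" and c: "0 \<le> c"
  shows "norm (Complex u y) / norm (Complex (u + c) y) \<le> (norm (Complex (u + c) y) / norm (Complex (u + c + 1) y)) powr c"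
proof (cases "c = 0")
  case False
  define \<phi> where "\<phi> v = ln (v^2 + y^2) / 2" for v
  define \<phi>' where "\<phi>' v = v / (v^2 + y^2)" for v
  have pos: "v^2 + y^2 > 0" if "v \<ge> u" for v using that u by (intro add_pos_nonneg) auto
  have der: "(\<phi> has_real_derivative \<phi>' v) (at v)" if "v \<ge> u" for v
  proof -
    have "((\<lambda>v. ln (v^2 + y^2)) has_real_derivative (2 * v) / (v^2 + y^2)) (at v)"
      using pos[OF that] by (auto intro!: derivative_eq_intros)
    moreover have "2 * v / w / 2 = v / w" for w :: real by simp
    ultimately show ?thesis using DERIV_cdivide[of "\<lambda>v. ln (v^2 + y^2)" "2 * v / (v^2 + y^2)" v UNIV 2]
      unfolding \<phi>_def[abs_def] \<phi>'_def by (simp only:)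
  qed
  have anti: "\<phi>' w \<le> \<phi>' v" if "u \<le> v" "v \<le> w" for v w
  proof -
    have "y^2 \<le> v * w"
    proof -
      have "\<bar>y\<bar> * \<bar>y\<bar> \<le> v * w" using that u by (intro mult_mono) auto
      then show ?thesis by (simp add: power2_eq_square)
    qed
    then have "0 \<le> (w - v) * (v * w - y^2)" using that by simp
    then have "w * (v^2 + y^2) \<le> v * (w^2 + y^2)" by (simp add: power2_eq_square algebra_simps)
    then show ?thesis using pos[of v] pos[of w] that by (simp add: \<phi>'_def field_simps)
  qed
  have "\<exists>\<xi>. u < \<xi> \<and> \<xi> < u + c \<and> \<phi> (u + c) - \<phi> u = (u + c - u) * \<phi>' \<xi>"
    by (rule MVT2) (use False c der in auto)
  then obtain \<xi> where \<xi>: "u < \<xi>" "\<xi> < u + c" "\<phi> (u + c) - \<phi> u = c * \<phi>' \<xi>" by auto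
  have "\<exists>\<zeta>. u + c < \<zeta> \<and> \<zeta> < u + c + 1 \<and> \<phi> (u + c + 1) - \<phi> (u + c) = (u + c + 1 - (u + c)) * \<phi>' \<zeta>"
    by (rule MVT2) (use c der in auto)
  then obtain \<zeta> where \<zeta>: "u + c < \<zeta>" "\<phi> (u + c + 1) - \<phi> (u + c) = \<phi>' \<zeta>" by auto
  have "c * \<phi>' \<zeta> \<le> c * \<phi>' \<xi>" using anti[of \<xi> \<zeta>] \<xi> \<zeta> c by (intro mult_left_mono) auto
  then have le: "\<phi> u - \<phi> (u + c) \<le> c * (\<phi> (u + c) - \<phi> (u + c + 1))" 
  proof -
    have "\<phi> (u + c) - \<phi> (u + c + 1) = - \<phi>' \<zeta>" using \<zeta>(2) by simp
    then show ?thesis using \<open>c * \<phi>' \<zeta> \<le> c * \<phi>' \<xi>\<close> \<xi>(3) by simp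
  qed
  have nrm: "norm (Complex v y) = exp (\<phi> v)" if "v \<ge> u" for v
  proof -
    have "ln (sqrt (v^2 + y^2)) = \<phi> v" using pos[OF that] by (simp add: \<phi>_def ln_sqrt)
    then have "exp (\<phi> v) = exp (ln (sqrt (v^2 + y^2)))" by simp
    also have "\<dots> = sqrt (v^2 + y^2)" using pos[OF that] by (intro exp_ln) simp
    finally show ?thesis by (simp add: complex_norm)
  qed
  have "norm (Complex u y) / norm (Complex (u + c) y) = exp (\<phi> u - \<phi> (u + c))"
    using c nrm[of u] nrm[of "u + c"] by (simp add: exp_diff)
  also have "\<dots> \<le> exp (c * (\<phi> (u + c) - \<phi> (u + c + 1)))" using le by simp
  also have "\<dots> = (norm (Complex (u + c) y) / norm (Complex (u + c + 1) y)) powr c"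
    using c nrm[of "u + c"] nrm[of "u + c + 1"] by (simp add: exp_diff[symmetric] powr_def)
  finally show ?thesis .
qed (use assms in \<open>auto simp: complex_eq_iff\<close>)

text \<open>A substitute for Stirling's formula, uniform in the imaginary part. In the Gauss product
  the quotient consists of factors |z + k| / |z + c + k|. Those with k < K are at most 1, the others
  telescope by concavity, and the factor \<open>n powr c\<close> of the product is cancelled by what
  remains.\<close>

lemma Gamma_shift_bound:
  fixes z :: complex and c :: real
  assumes z: "Re z \<ge> 0" "Im z \<noteq> 0" and c: "0 \<le> c" and K: "\<bar>Im z\<bar> \<le> real K" 
  shows "norm (Gamma (z + of_real c)) \<le> norm (z + of_nat K + of_real c) powr c * norm (Gamma z)"
proof -
  define x y where "x = Re z" and "y = Im z"
  have K0: "real K > 0" using z K by linarith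
  define m where "m u = norm (Complex (x + u) y)" for u :: real
  have mpos: "m u > 0" for u using z(2) by (auto simp: m_def y_def complex_eq_iff)
  have mz: "norm (z + of_nat k) = m (real k)" "norm (z + of_real c + of_nat k) = m (real k + c)" for k
    by (auto simp: m_def x_def y_def intro!: arg_cong[where f = norm] complex_eqI)
  have mono: "m u \<le> m v" if "0 \<le> u" "u \<le> v" for u v
    using that z(1) by (simp add: m_def cmod_def x_def power_mono)
  have stp: "m (real k) / m (real k + c) \<le> (m (real k + c) / m (real k + 1 + c)) powr c" if "k \<ge> K" for k
  proof -
    have "\<bar>y\<bar> \<le> x + real k" "0 < x + real k" using K K0 z(1) that by (auto simp: x_def y_def)
    from log_modulus_concave[OF this c] show ?thesis by (simp add: m_def algebra_simps)
  qed
  have le1: "m (real k) / m (real k + c) \<le> 1" for k using mono[of "real k" "real k + c"] c mpos[of "real k + c"] by simp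
  \<comment> \<open>Up to K only the last factor is estimated nontrivially; every further index
    multiplies in one quotient of the telescope.\<close>
  have prod_bound: "(\<Prod>k\<le>n. m (real k) / m (real k + c)) \<le> (m (real K + c) / m (real n + 1 + c)) powr c" if "n \<ge> K" for n
    using that
  proof (induction n rule: dec_induct)
    case base
    have "{..K} = insert K {..<K}" by auto
    then have "(\<Prod>k\<le>K. m (real k) / m (real k + c)) = (m (real K) / m (real K + c)) * (\<Prod>k<K. m (real k) / m (real k + c))" by simp
    also have "\<dots> \<le> (m (real K) / m (real K + c)) * 1"
      using le1 mpos by (intro mult_left_mono prod_le_1) (auto intro: less_imp_le)
    also have "\<dots> \<le> (m (real K + c) / m (real K + 1 + c)) powr c" using stp[of K] by simp
    finally show ?case .
  next
    case (step n)
    have "(\<Prod>k\<le>Suc n. m (real k) / m (real k + c)) = (\<Prod>k\<le>n. m (real k) / m (real k + c)) * (m (real (Suc n)) / m (real (Suc n) + c))" by simp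
    also have "\<dots> \<le> (m (real K + c) / m (real n + 1 + c)) powr c * (m (real (Suc n) + c) / m (real (Suc n) + 1 + c)) powr c"
    proof (rule mult_mono)
      show "m (real (Suc n)) / m (real (Suc n) + c) \<le> (m (real (Suc n) + c) / m (real (Suc n) + 1 + c)) powr c"
        using stp[of "Suc n"] step.hyps by simp
    qed (use step.IH mpos in \<open>auto intro: less_imp_le\<close>)
    also have "\<dots> = ((m (real K + c) / m (real n + 1 + c)) * (m (real n + 1 + c) / m (real (Suc n) + 1 + c))) powr c"
    proof -
      have "real (Suc n) + c = real n + 1 + c" by simp
      then show ?thesis using mpos by (simp only: powr_mult[symmetric])
    qed
    also have "\<dots> = (m (real K + c) / m (real (Suc n) + 1 + c)) powr c"
      using mpos[of "real n + 1 + c"] by simp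
    finally show ?case .
  qed
  have ev: "norm (Gamma_series (z + of_real c) n) \<le> m (real K + c) powr c * norm (Gamma_series z n)" if n: "n \<ge> max K 1" for n
  proof -
    have poch: "norm (pochhammer w (n + 1)) = (\<Prod>k\<le>n. norm (w + of_nat k))" for w :: complex
      by (simp add: pochhammer_prod prod_norm[symmetric] atLeast0LessThan lessThan_Suc_atMost)
    have npos: "real n > 0" using n by simp
    have en: "norm (exp (w * of_real (ln (of_nat n)))) = real n powr Re w" for w :: complex
      using npos by (simp add: norm_exp_eq_Re powr_def)
    have gs: "norm (Gamma_series w n) = fact n * real n powr Re w / (\<Prod>k\<le>n. norm (w + of_nat k))" for w
      unfolding Gamma_series_def norm_divide norm_mult poch en by simp
    define P where "P = (\<Prod>k\<le>n. m (real k))"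
    define P' where "P' = (\<Prod>k\<le>n. m (real k + c))"
    have PP: "P > 0" "P' > 0" unfolding P_def P'_def using mpos by (auto intro: prod_pos)
    have "P / P' = (\<Prod>k\<le>n. m (real k) / m (real k + c))" by (simp add: P_def P'_def prod_dividef)
    also have "\<dots> \<le> (m (real K + c) / m (real n + 1 + c)) powr c" using prod_bound n by simp
    finally have "P / P' \<le> (m (real K + c) / m (real n + 1 + c)) powr c" .
    also have "\<dots> = m (real K + c) powr c / m (real n + 1 + c) powr c" using mpos by (simp add: powr_divide less_imp_le)
    also have "\<dots> \<le> m (real K + c) powr c / real n powr c"
    proof (intro divide_left_mono powr_mono2)
      have "real n \<le> \<bar>x + (real n + 1 + c)\<bar>" using z(1) c by (simp add: x_def)
      also have "\<dots> \<le> m (real n + 1 + c)" unfolding m_def using abs_Re_le_cmod[of "Complex (x + (real n + 1 + c)) y"] by simp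
      finally show "real n \<le> m (real n + 1 + c)" .
      show "0 < m (real n + 1 + c) powr c * real n powr c"
        using mpos[of "real n + 1 + c"] npos by (intro mult_pos_pos) auto
    qed (use npos mpos c in auto)
    finally have "P / P' * real n powr c \<le> m (real K + c) powr c" using npos by (simp add: pos_le_divide_eq)
    then have "(fact n * real n powr x / P) * (P / P' * real n powr c) \<le> (fact n * real n powr x / P) * m (real K + c) powr c"
      using PP by (intro mult_left_mono) auto
    moreover have "norm (Gamma_series (z + of_real c) n) = (fact n * real n powr x / P) * (P / P' * real n powr c)"
      unfolding gs using PP by (simp add: mz P'_def[symmetric] powr_add x_def)
    moreover have "norm (Gamma_series z n) = fact n * real n powr x / P"
      unfolding gs by (simp add: mz P_def x_def)
    ultimately show ?thesis by (simp add: mult.commute)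
  qed
  have "norm (Gamma (z + of_real c)) \<le> m (real K + c) powr c * norm (Gamma z)"
  proof (rule tendsto_le[OF sequentially_bot])
    show "(\<lambda>n. m (real K + c) powr c * norm (Gamma_series z n)) \<longlonglongrightarrow> m (real K + c) powr c * norm (Gamma z)"
      by (intro tendsto_intros)
    show "(\<lambda>n. norm (Gamma_series (z + of_real c) n)) \<longlonglongrightarrow> norm (Gamma (z + of_real c))"
      by (intro tendsto_intros)
    show "eventually (\<lambda>n. norm (Gamma_series (z + of_real c) n) \<le> m (real K + c) powr c * norm (Gamma_series z n)) sequentially"
      using eventually_ge_at_top[of "max K 1"] by eventually_elim (rule ev)
  qed
  moreover have "m (real K + c) = norm (z + of_nat K + of_real c)"
    using mz(2)[of K] by (simp add: add_ac)
  ultimately show ?thesis by simp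
qed

text \<open>Negative real parts are reached by shifting the argument m times. The two Pochhammer
  factors are comparable because each of their factors has modulus at least |Im z| \<ge> 1.\<close>

lemma Gamma_ratio_bound:
  assumes "X \<ge> 0" "c0 \<ge> (0::real)"
  obtains C where "C > 0" "\<And>z c. \<bar>Re z\<bar> \<le> X \<Longrightarrow> 0 \<le> c \<Longrightarrow> c \<le> c0 \<Longrightarrow> \<bar>Im z\<bar> \<ge> 1 \<Longrightarrow>
       norm (Gamma (z + of_real c)) \<le> C * \<bar>Im z\<bar> powr c * norm (Gamma z)"
proof -
  define m where "m = nat \<lceil>X\<rceil>"
  define B where "B = X + real m + c0 + 4"
  have B1: "B \<ge> 1" using assms by (simp add: B_def)
  define C where "C = B powr c0 * (1 + c0) ^ m"
  have "C > 0" using B1 assms by (simp add: C_def)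
  moreover have "norm (Gamma (z + of_real c)) \<le> C * \<bar>Im z\<bar> powr c * norm (Gamma z)"
    if z: "\<bar>Re z\<bar> \<le> X" "\<bar>Im z\<bar> \<ge> 1" and c: "0 \<le> c" "c \<le> c0" for z c
  proof -
    have notint: "w \<notin> \<int>\<^sub>\<le>\<^sub>0" if "Im w \<noteq> 0" for w :: complex using that by (auto simp: nonpos_Ints_def)
    have Im0: "Im z \<noteq> 0" using z by auto
    have zm: "Gamma (w + of_nat m) = pochhammer w m * Gamma w" if "Im w \<noteq> 0" for w :: complex
      using pochhammer_Gamma[OF notint[OF that], of m] notint[OF that] by (simp add: Gamma_eq_zero_iff)
    \<comment> \<open>K lies between |Im z| and 2 |Im z|, so the base of the resulting power is at
      most a constant times |Im z|.\<close>
    define K where "K = nat \<lceil>\<bar>Im z\<bar>\<rceil>"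
    have K: "\<bar>Im z\<bar> \<le> real K" "real K \<le> 2 * \<bar>Im z\<bar>" using z(2) unfolding K_def by linarith+
    have Rem: "Re (z + of_nat m) \<ge> 0" using z(1) unfolding m_def by simp linarith
    have big: "norm (z + of_nat m + of_nat K + of_real c) \<le> B * \<bar>Im z\<bar>"
    proof -
      have "norm (z + of_nat m + of_nat K + of_real c) \<le> norm z + real m + real K + c"
        by (intro norm_triangle_mono) (use c in auto)
      also have "norm z \<le> \<bar>Re z\<bar> + \<bar>Im z\<bar>" by (rule cmod_le)
      finally have "norm (z + of_nat m + of_nat K + of_real c) \<le> (X + real m + c0) * 1 + 3 * \<bar>Im z\<bar>" using z c K by simp
      also have "(X + real m + c0) * 1 \<le> (X + real m + c0) * \<bar>Im z\<bar>" using assms z by (intro mult_left_mono) auto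
      finally show ?thesis using z(2) by (simp add: B_def algebra_simps)
    qed
    have poch: "norm (pochhammer z m) \<le> (1 + c0) ^ m * norm (pochhammer (z + of_real c) m)"
    proof -
      have "norm (pochhammer z m) = (\<Prod>k<m. norm (z + of_nat k))"
        by (simp add: pochhammer_prod prod_norm[symmetric] atLeast0LessThan)
      also have "\<dots> \<le> (\<Prod>k<m. (1 + c0) * norm (z + of_real c + of_nat k))"
      proof (rule prod_mono, intro conjI)
        fix k
        have ge1: "1 \<le> norm (z + of_real c + of_nat k)"
          using abs_Im_le_cmod[of "z + of_real c + of_nat k"] z(2) by simp
        have "norm (z + of_nat k) \<le> norm (z + of_real c + of_nat k) + norm (of_real c :: complex)"
          using norm_triangle_ineq4[of "z + of_real c + of_nat k" "of_real c"] by (simp add: algebra_simps)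
        also have "norm (of_real c :: complex) \<le> c0 * 1" using c by simp
        also have "c0 * 1 \<le> c0 * norm (z + of_real c + of_nat k)" using ge1 assms by (intro mult_left_mono) auto
        finally show "norm (z + of_nat k) \<le> (1 + c0) * norm (z + of_real c + of_nat k)" by (simp add: algebra_simps)
      qed simp
      also have "\<dots> = (1 + c0) ^ m * norm (pochhammer (z + of_real c) m)"
        by (simp add: pochhammer_prod prod_norm[symmetric] atLeast0LessThan prod.distrib)
      finally show ?thesis .
    qed
    define G where "G = norm (Gamma (z + of_real c))"
    define p where "p = norm (pochhammer (z + of_real c) m)"
    have p0: "p > 0"
    proof -
      have "Gamma (z + of_real c + of_nat m) \<noteq> 0" using Im0 notint[of "z + of_real c + of_nat m"] by (simp add: Gamma_eq_zero_iff)
      then show ?thesis using zm[of "z + of_real c"] Im0 by (auto simp: p_def)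
    qed
    have "p * G = norm (Gamma (z + of_nat m + of_real c))"
      using zm[of "z + of_real c"] Im0 by (simp add: p_def G_def norm_mult add_ac)
    also have "\<dots> \<le> norm (z + of_nat m + of_nat K + of_real c) powr c * norm (Gamma (z + of_nat m))"
      by (rule Gamma_shift_bound[OF Rem _ c(1)]) (use Im0 K in auto)
    also have "\<dots> \<le> (B * \<bar>Im z\<bar>) powr c * norm (Gamma (z + of_nat m))"
      using big c by (intro mult_right_mono powr_mono2) auto
    also have "norm (Gamma (z + of_nat m)) = norm (pochhammer z m) * norm (Gamma z)"
      using zm[OF Im0] by (simp add: norm_mult)
    also have "(B * \<bar>Im z\<bar>) powr c * (norm (pochhammer z m) * norm (Gamma z)) \<le> (B powr c0 * \<bar>Im z\<bar> powr c) * ((1 + c0) ^ m * p * norm (Gamma z))"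
    proof (intro mult_mono)
      have "(B * \<bar>Im z\<bar>) powr c = B powr c * \<bar>Im z\<bar> powr c" using B1 by (simp add: powr_mult)
      also have "\<dots> \<le> B powr c0 * \<bar>Im z\<bar> powr c" using B1 c by (intro mult_right_mono powr_mono) auto
      finally show "(B * \<bar>Im z\<bar>) powr c \<le> B powr c0 * \<bar>Im z\<bar> powr c" .
    qed (use poch assms in \<open>auto simp: p_def\<close>)
    also have "\<dots> = p * (C * \<bar>Im z\<bar> powr c * norm (Gamma z))" by (simp add: C_def mult_ac)
    finally show ?thesis using p0 by (simp add: G_def)
  qed
  ultimately show ?thesis using that by blast
qed

text \<open>The factor in the functional equation solved for F. Since \<open>rGamma\<close> is
  entire, only the poles of the numerators have to be avoided.\<close>

definition gamma_ratio :: "complex \<Rightarrow> real \<Rightarrow> nat \<Rightarrow> (nat \<Rightarrow> real) \<Rightarrow> (nat \<Rightarrow> complex) \<Rightarrow> complex \<Rightarrow> complex" where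
  "gamma_ratio \<omega> Q r lam mu s = \<omega> * of_real Q powr (1 - 2 * s) *
     (\<Prod>j=1..r. Gamma (of_real (lam j) * (1 - s) + cnj (mu j)) * rGamma (of_real (lam j) * s + mu j))"

text \<open>Above height t1 all gamma arguments have imaginary part at least 1 in modulus, which
  excludes poles and admits the bound for shifted gamma values. On the critical line
  \<open>1 - cnj s\<close> is s, so each numerator is the conjugate of its denominator.\<close>

lemma selberg_functional_equation_ratio:
  assumes fe: "selberg_functional_equation F \<omega> Q r lam mu"
  shows "\<exists>t1\<ge>1. 
    (\<forall>s. \<bar>Im s\<bar> \<ge> t1 \<longrightarrow> F s = gamma_ratio \<omega> Q r lam mu s * cnj (F (1 - cnj s))) \<and>
    (\<forall>S. S \<subseteq> {s. \<bar>Im s\<bar> \<ge> t1} \<longrightarrow> gamma_ratio \<omega> Q r lam mu holomorphic_on S) \<and>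
    (\<forall>s. \<bar>Im s\<bar> \<ge> t1 \<longrightarrow> Re s = 1/2 \<longrightarrow> norm (gamma_ratio \<omega> Q r lam mu s) = 1) \<and>
    (\<forall>A\<ge>0. \<exists>C>0. \<forall>s. \<bar>Im s\<bar> \<ge> t1 \<longrightarrow> -A \<le> Re s \<longrightarrow> Re s \<le> 1/2 \<longrightarrow> 
        norm (gamma_ratio \<omega> Q r lam mu s) \<le> C * \<bar>Im s\<bar> powr ((\<Sum>j=1..r. lam j) * (1 - 2 * Re s)))"
proof -
  have om: "norm \<omega> = 1" and Q: "Q > 0" and lam: "\<And>j. j \<in> {1..r} \<Longrightarrow> lam j > 0"
    using fe by (auto simp: selberg_functional_equation_def)
  \<comment> \<open>The sum dominates each of its terms, so \<open>lam j * \<bar>t\<bar>\<close>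
    exceeds the norm of \<open>mu j\<close> by 1 for all j at once.\<close>
  define t1 where "t1 = 1 + (\<Sum>j=1..r. (1 + norm (mu j)) / lam j)"
  define z where "z j s = of_real (lam j) * s + mu j" for j s
  define z' where "z' j s = of_real (lam j) * (1 - s) + cnj (mu j)" for j s
  have t1: "t1 \<ge> 1" using lam by (auto simp: t1_def intro!: sum_nonneg divide_nonneg_pos)
  have lamt: "1 + norm (mu j) \<le> lam j * \<bar>t\<bar>" if "j \<in> {1..r}" "\<bar>t\<bar> \<ge> t1" for j t
  proof -
    have "(1 + norm (mu j)) / lam j \<le> (\<Sum>j=1..r. (1 + norm (mu j)) / lam j)"
      using that lam by (intro member_le_sum) (auto intro!: divide_nonneg_pos)
    then have "(1 + norm (mu j)) / lam j \<le> \<bar>t\<bar>" using that by (simp add: t1_def)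
    then show ?thesis using lam[OF that(1)] by (simp add: field_simps)
  qed
  have Imz: "\<bar>Im (z j s)\<bar> \<ge> 1" if "j \<in> {1..r}" "\<bar>Im s\<bar> \<ge> t1" for j s
  proof -
    have "\<bar>lam j * Im s\<bar> = lam j * \<bar>Im s\<bar>" using lam[OF that(1)] by (simp add: abs_mult)
    then show ?thesis using lamt[OF that] abs_Im_le_cmod[of "mu j"] by (simp add: z_def)
  qed
  have z'_cnj: "z' j s = cnj (z j (1 - cnj s))" for j s by (simp add: z'_def z_def)
  have Imz': "\<bar>Im (z' j s)\<bar> \<ge> 1" if "j \<in> {1..r}" "\<bar>Im s\<bar> \<ge> t1" for j s
    using Imz[OF that(1), of "1 - cnj s"] that by (simp add: z'_cnj)
  have notint: "w \<notin> \<int>\<^sub>\<le>\<^sub>0" if "\<bar>Im w\<bar> \<ge> 1" for w :: complex using that by (auto simp: nonpos_Ints_def)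
  have feq: "F s = gamma_ratio \<omega> Q r lam mu s * cnj (F (1 - cnj s))" if s: "\<bar>Im s\<bar> \<ge> t1" for s
  proof -
    have "Im s \<noteq> 0" using s t1 by linarith
    then have s01: "s \<noteq> 0" "s \<noteq> 1" by auto
    have "completed_function F Q r lam mu s = \<omega> * cnj (completed_function F Q r lam mu (1 - cnj s))"
    proof -
      have "\<forall>j\<in>{1..r}. of_real (lam j) * s + mu j \<notin> \<int>\<^sub>\<le>\<^sub>0 \<and> of_real (lam j) * (1 - cnj s) + mu j \<notin> \<int>\<^sub>\<le>\<^sub>0"
      proof (intro ballI conjI notint)
        fix j assume j: "j \<in> {1..r}"
        show "1 \<le> \<bar>Im (of_real (lam j) * s + mu j)\<bar>" using Imz[OF j s] by (simp add: z_def)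
        show "1 \<le> \<bar>Im (of_real (lam j) * (1 - cnj s) + mu j)\<bar>" using Imz[OF j, of "1 - cnj s"] s by (simp add: z_def)
      qed
      then show ?thesis using fe s01 unfolding selberg_functional_equation_def by blast
    qed
    then have eq: "of_real Q powr s * (\<Prod>j=1..r. Gamma (z j s)) * F s =
       \<omega> * (cnj (of_real Q powr (1 - cnj s)) * (\<Prod>j=1..r. Gamma (z' j s)) * cnj (F (1 - cnj s)))"
      by (simp add: completed_function_def z_def z'_def cnj_Gamma)
    have Qc: "cnj (of_real Q powr (1 - cnj s)) = of_real Q powr (1 - s)"
      using Q by (simp add: powr_def exp_cnj Ln_of_real)
    have Qp: "of_real Q powr (1 - 2 * s) * of_real Q powr s = (of_real Q powr (1 - s) :: complex)"
      using Q by (simp add: powr_add[symmetric] algebra_simps)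
    have Q0: "(of_real Q powr s :: complex) \<noteq> 0" using Q by simp
    have G: "(\<Prod>j=1..r. Gamma (z j s)) * (\<Prod>j=1..r. rGamma (z j s)) = 1"
    proof -
      have "Gamma (z j s) * rGamma (z j s) = 1" if "j \<in> {1..r}" for j
        using notint[OF Imz[OF that s]] by (simp add: rGamma_inverse_Gamma Gamma_eq_zero_iff)
      then show ?thesis by (simp add: prod.distrib[symmetric])
    qed
    have "of_real Q powr s * F s = of_real Q powr s * F s * ((\<Prod>j=1..r. Gamma (z j s)) * (\<Prod>j=1..r. rGamma (z j s)))"
      by (simp only: G mult_1_right)
    also have "\<dots> = (of_real Q powr s * (\<Prod>j=1..r. Gamma (z j s)) * F s) * (\<Prod>j=1..r. rGamma (z j s))" by (simp add: mult_ac)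
    also have "\<dots> = of_real Q powr s * (gamma_ratio \<omega> Q r lam mu s * cnj (F (1 - cnj s)))"
      unfolding eq Qc Qp[symmetric] by (simp add: gamma_ratio_def z_def z'_def prod.distrib mult_ac)
    finally show ?thesis using Q0 by simp
  qed
  have holo: "gamma_ratio \<omega> Q r lam mu holomorphic_on S" if S: "S \<subseteq> {s. \<bar>Im s\<bar> \<ge> t1}" for S
    unfolding gamma_ratio_def
  proof (intro holomorphic_intros)
    fix j x assume "j \<in> {1..r}" "x \<in> S"
    then have "\<bar>Im (z' j x)\<bar> \<ge> 1" using Imz'[of j x] S by auto
    then show "of_real (lam j) * (1 - x) + cnj (mu j) \<notin> \<int>\<^sub>\<le>\<^sub>0" using notint by (simp add: z'_def)
  qed
  have half: "norm (gamma_ratio \<omega> Q r lam mu s) = 1" if s: "\<bar>Im s\<bar> \<ge> t1" "Re s = 1/2" for s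
  proof -
    have "1 - cnj s = s" using s(2) by (simp add: complex_eq_iff)
    then have "norm (Gamma (z' j s) * rGamma (z j s)) = 1" if "j \<in> {1..r}" for j
      using notint[OF Imz[OF that s(1)]] by (simp add: z'_cnj cnj_Gamma[symmetric] norm_mult rGamma_inverse_Gamma norm_inverse Gamma_eq_zero_iff)
    moreover have "1 - 2 * Re s = 0" using s(2) by simp
    then have "norm (of_real Q powr (1 - 2 * s) :: complex) = 1" using Q by (simp add: norm_powr_real_powr)
    ultimately show ?thesis unfolding gamma_ratio_def z_def z'_def by (simp add: norm_mult om prod_norm[symmetric])
  qed
  have bound: "\<exists>C>0. \<forall>s. \<bar>Im s\<bar> \<ge> t1 \<longrightarrow> -A \<le> Re s \<longrightarrow> Re s \<le> 1/2 \<longrightarrow> 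
        norm (gamma_ratio \<omega> Q r lam mu s) \<le> C * \<bar>Im s\<bar> powr ((\<Sum>j=1..r. lam j) * (1 - 2 * Re s))" if A: "A \<ge> 0" for A
  proof -
    have fac: "\<exists>C>0. \<forall>s. \<bar>Im s\<bar> \<ge> t1 \<longrightarrow> -A \<le> Re s \<longrightarrow> Re s \<le> 1/2 \<longrightarrow> 
        norm (Gamma (z' j s) * rGamma (z j s)) \<le> C * \<bar>Im s\<bar> powr (lam j * (1 - 2 * Re s))" if j: "j \<in> {1..r}" for j
    proof -
      have lj: "lam j > 0" by (rule lam[OF j])
      define X where "X = lam j * (A + 1) + norm (mu j)"
      define c0 where "c0 = lam j * (1 + 2 * A)"
      have "X \<ge> 0" "c0 \<ge> 0" using A lj by (auto simp: X_def c0_def)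
      then obtain C where C: "C > 0" "\<And>z c. \<bar>Re z\<bar> \<le> X \<Longrightarrow> 0 \<le> c \<Longrightarrow> c \<le> c0 \<Longrightarrow> \<bar>Im z\<bar> \<ge> 1 \<Longrightarrow>
           norm (Gamma (z + of_real c)) \<le> C * \<bar>Im z\<bar> powr c * norm (Gamma z)" using Gamma_ratio_bound by metis
      define B where "B = lam j + norm (mu j) + 1"
      have B1: "B \<ge> 1" using lj by (simp add: B_def)
      show ?thesis
      proof (intro exI[of _ "C * B powr c0"] conjI allI impI)
        show "C * B powr c0 > 0" using C B1 by simp
        fix s assume s: "\<bar>Im s\<bar> \<ge> t1" "-A \<le> Re s" "Re s \<le> 1/2"
        define c where "c = lam j * (1 - 2 * Re s)"
        have c: "0 \<le> c" "c \<le> c0" using s lj by (auto simp: c_def c0_def)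
        have "norm (Gamma (z' j s)) = norm (Gamma (z j s + of_real c))"
        proof -
          \<comment> \<open>Reflection changes the argument only by a real shift, which reduces the
            factor to a quotient of gamma values at z + c and z.\<close>
          have "z j (1 - cnj s) = z j s + of_real c" by (simp add: z_def c_def complex_eq_iff algebra_simps)
          then show ?thesis by (simp only: z'_cnj cnj_Gamma[symmetric] complex_mod_cnj)
        qed
        also have "\<dots> \<le> C * \<bar>Im (z j s)\<bar> powr c * norm (Gamma (z j s))"
        proof (rule C(2)[OF _ c Imz[OF j s(1)]])
          have "\<bar>lam j * Re s\<bar> \<le> lam j * (A + 1)" using s A lj by (simp add: abs_mult)
          then show "\<bar>Re (z j s)\<bar> \<le> X" using abs_Re_le_cmod[of "mu j"] by (simp add: z_def X_def)
        qed
        finally have "norm (Gamma (z' j s)) * norm (rGamma (z j s)) \<le> (C * \<bar>Im (z j s)\<bar> powr c * norm (Gamma (z j s))) * norm (rGamma (z j s))"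
          by (rule mult_right_mono) simp
        also have "\<dots> = C * \<bar>Im (z j s)\<bar> powr c"
          using notint[OF Imz[OF j s(1)]] by (simp add: rGamma_inverse_Gamma norm_inverse Gamma_eq_zero_iff)
        also have "\<dots> \<le> C * (B * \<bar>Im s\<bar>) powr c"
        proof (intro mult_left_mono powr_mono2)
          have "\<bar>Im (z j s)\<bar> \<le> \<bar>lam j * Im s\<bar> + norm (mu j) * 1" using abs_Im_le_cmod[of "mu j"] by (simp add: z_def)
          also have "\<dots> \<le> lam j * \<bar>Im s\<bar> + norm (mu j) * \<bar>Im s\<bar>"
            using lj s(1) t1 by (intro add_mono mult_left_mono) (auto simp: abs_mult)
          also have "\<dots> \<le> B * \<bar>Im s\<bar>" by (simp add: B_def algebra_simps)
          finally show "\<bar>Im (z j s)\<bar> \<le> B * \<bar>Im s\<bar>" .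
        qed (use C c in auto)
        also have "\<dots> = C * (B powr c * \<bar>Im s\<bar> powr c)" using B1 by (simp add: powr_mult)
        also have "\<dots> \<le> C * (B powr c0 * \<bar>Im s\<bar> powr c)" using C B1 c by (intro mult_left_mono mult_right_mono powr_mono) auto
        finally show "norm (Gamma (z' j s) * rGamma (z j s)) \<le> C * B powr c0 * \<bar>Im s\<bar> powr (lam j * (1 - 2 * Re s))"
          by (simp add: norm_mult c_def mult_ac)
      qed
    qed
    then have "\<forall>j\<in>{1..r}. \<exists>C. C > 0 \<and> (\<forall>s. \<bar>Im s\<bar> \<ge> t1 \<longrightarrow> -A \<le> Re s \<longrightarrow> Re s \<le> 1/2 \<longrightarrow> 
        norm (Gamma (z' j s) * rGamma (z j s)) \<le> C * \<bar>Im s\<bar> powr (lam j * (1 - 2 * Re s)))" by blast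
    from bchoice[OF this] obtain D where D: "\<forall>j\<in>{1..r}. D j > 0 \<and> (\<forall>s. \<bar>Im s\<bar> \<ge> t1 \<longrightarrow> -A \<le> Re s \<longrightarrow> Re s \<le> 1/2 \<longrightarrow> 
        norm (Gamma (z' j s) * rGamma (z j s)) \<le> D j * \<bar>Im s\<bar> powr (lam j * (1 - 2 * Re s)))" ..
    show ?thesis
    proof (intro exI[of _ "(1 + Q) powr (1 + 2 * A) * (\<Prod>j=1..r. D j)"] conjI allI impI)
      show "(1 + Q) powr (1 + 2 * A) * (\<Prod>j=1..r. D j) > 0" using D Q by (intro mult_pos_pos prod_pos) auto
      fix s assume s: "\<bar>Im s\<bar> \<ge> t1" "-A \<le> Re s" "Re s \<le> 1/2"
      have "norm (of_real Q powr (1 - 2 * s) :: complex) = Q powr (1 - 2 * Re s)" using Q by (simp add: norm_powr_real_powr)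
      also have "\<dots> \<le> (1 + Q) powr (1 - 2 * Re s)" using Q s by (intro powr_mono2) auto
      also have "\<dots> \<le> (1 + Q) powr (1 + 2 * A)" using Q s by (intro powr_mono) auto
      finally have 1: "norm (of_real Q powr (1 - 2 * s) :: complex) \<le> (1 + Q) powr (1 + 2 * A)" .
      have "(\<Prod>j=1..r. norm (Gamma (z' j s) * rGamma (z j s))) \<le> (\<Prod>j=1..r. D j * \<bar>Im s\<bar> powr (lam j * (1 - 2 * Re s)))"
        using D s by (intro prod_mono) auto
      also have "\<dots> = (\<Prod>j=1..r. D j) * \<bar>Im s\<bar> powr ((\<Sum>j=1..r. lam j) * (1 - 2 * Re s))"
        using s t1 by (simp add: prod.distrib powr_sum sum_distrib_right)
      finally have 2: "(\<Prod>j=1..r. norm (Gamma (z' j s) * rGamma (z j s))) \<le> (\<Prod>j=1..r. D j) * \<bar>Im s\<bar> powr ((\<Sum>j=1..r. lam j) * (1 - 2 * Re s))" .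
      have "norm (gamma_ratio \<omega> Q r lam mu s) = norm (of_real Q powr (1 - 2 * s) :: complex) * (\<Prod>j=1..r. norm (Gamma (z' j s) * rGamma (z j s)))"
        by (simp only: gamma_ratio_def z_def z'_def norm_mult om prod_norm[symmetric] mult_1_left)
      also have "\<dots> \<le> (1 + Q) powr (1 + 2 * A) * ((\<Prod>j=1..r. D j) * \<bar>Im s\<bar> powr ((\<Sum>j=1..r. lam j) * (1 - 2 * Re s)))"
        by (intro mult_mono 1 2) (auto intro: prod_nonneg)
      finally show "norm (gamma_ratio \<omega> Q r lam mu s) \<le> (1 + Q) powr (1 + 2 * A) * (\<Prod>j=1..r. D j) * \<bar>Im s\<bar> powr ((\<Sum>j=1..r. lam j) * (1 - 2 * Re s))"
        by (simp add: mult.assoc)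
    qed
  qed
  show ?thesis
    by (rule exI[of _ t1], intro conjI allI impI t1 feq holo half bound)
qed

section \<open>Polynomial growth\<close>

text \<open>The auxiliary factor \<open>exp (- e cos (\<kappa> (s - c)))\<close> decays doubly exponentially in the strip.\<close>

lemma phragmen_lindelof_strip:
  fixes f :: "complex \<Rightarrow> complex" and \<alpha> \<beta> :: real
  assumes ab: "\<alpha> < \<beta>"
    and cont: "continuous_on {s. \<alpha> \<le> Re s \<and> Re s \<le> \<beta>} f"
    and holo: "f holomorphic_on {s. \<alpha> < Re s \<and> Re s < \<beta>}"
    and growth: "\<And>s. \<alpha> \<le> Re s \<Longrightarrow> Re s \<le> \<beta> \<Longrightarrow> norm (f s) \<le> C * exp (norm s powr \<rho>)" and \<rho>: "\<rho> > 0"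
    and bd: "\<And>s. Re s = \<alpha> \<or> Re s = \<beta> \<Longrightarrow> norm (f s) \<le> M" and M: "M > 0"
    and s: "\<alpha> \<le> Re s" "Re s \<le> \<beta>"
  shows "norm (f s) \<le> M"
proof -
  define c where "c = (\<alpha> + \<beta>) / 2"
  \<comment> \<open>With this \<kappa> the angle \<open>\<kappa> * (Re z - c)\<close> stays in
    [-1, 1], where the cosine is at least 1/2 because 1 < pi/3.\<close>
  define \<kappa> where "\<kappa> = 2 / (\<beta> - \<alpha>)"
  have \<kappa>: "\<kappa> > 0" using ab by (simp add: \<kappa>_def)
  define h where "h z = cos (of_real \<kappa> * (z - of_real c))" for z :: complex
  have Re_h: "Re (h z) \<ge> exp (\<kappa> * \<bar>Im z\<bar>) / 4" if "\<alpha> \<le> Re z" "Re z \<le> \<beta>" for z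
  proof -
    define x where "x = \<kappa> * (Re z - c)"
    have "\<bar>Re z - c\<bar> \<le> (\<beta> - \<alpha>) / 2" using that unfolding c_def by (simp add: abs_le_iff field_simps)
    then have "\<bar>x\<bar> \<le> \<kappa> * ((\<beta> - \<alpha>) / 2)" using \<kappa> unfolding x_def abs_mult by (intro mult_mono) auto
    moreover have "\<kappa> * ((\<beta> - \<alpha>) / 2) = 1" using ab unfolding \<kappa>_def by (simp add: divide_eq_eq_1)
    ultimately have x1: "\<bar>x\<bar> \<le> 1" by simp
    have "cos x = cos \<bar>x\<bar>" by (simp add: cos_abs_real)
    also have "\<dots> \<ge> cos (pi/3)" using x1 pi_gt3 by (intro cos_monotone_0_pi_le) auto
    finally have cosx: "cos x \<ge> 1/2" by (simp add: cos_60)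
    have "exp (\<kappa> * \<bar>Im z\<bar>) / 4 \<le> (1/2) * cosh (\<kappa> * \<bar>Im z\<bar>)" by (simp add: cosh_def)
    also have "cosh (\<kappa> * \<bar>Im z\<bar>) = cosh (\<kappa> * Im z)" by (cases "Im z \<ge> 0") auto
    also have "(1/2) * cosh (\<kappa> * Im z) \<le> cos x * cosh (\<kappa> * Im z)"
      using cosx by (intro mult_right_mono) (auto simp: cosh_real_nonneg)
    also have "\<dots> = Re (h z)"
      by (simp add: h_def x_def Re_cos cosh_def scaleR_conv_of_real)
    finally show ?thesis by simp
  qed
  have main: "norm (f s) * exp (- e * Re (h s)) \<le> M" if e: "e > 0" for e
  proof -
    define g where "g z = f z * exp (- of_real e * h z)" for z
    have ng: "norm (g z) = norm (f z) * exp (- e * Re (h z))" for z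
      by (simp add: g_def norm_mult norm_exp_eq_Re)
    define b where "b = \<bar>\<alpha>\<bar> + \<bar>\<beta>\<bar>"
    \<comment> \<open>On high horizontal sides the doubly exponential decay beats the growth of f,
      whatever e > 0 is.\<close>
    have "((\<lambda>y::real. \<bar>C\<bar> * exp ((y + b) powr \<rho> - e * (exp (\<kappa> * y) / 4))) \<longlongrightarrow> 0) at_top"
      using e \<kappa> \<rho> by real_asymp
    then have "eventually (\<lambda>y. \<bar>C\<bar> * exp ((y + b) powr \<rho> - e * (exp (\<kappa> * y) / 4)) < M) at_top"
      using M by (rule order_tendstoD)
    then obtain Y where Y: "\<And>y. y \<ge> Y \<Longrightarrow> \<bar>C\<bar> * exp ((y + b) powr \<rho> - e * (exp (\<kappa> * y) / 4)) < M"
      by (auto simp: eventually_at_top_linorder)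
    define T where "T = max Y 0 + \<bar>Im s\<bar> + 1"
    have T: "T \<ge> Y" "T > \<bar>Im s\<bar>" "T > 0" by (auto simp: T_def)
    define S where "S = cbox (Complex \<alpha> (-T)) (Complex \<beta> T)"
    have Smem: "z \<in> S \<longleftrightarrow> \<alpha> \<le> Re z \<and> Re z \<le> \<beta> \<and> -T \<le> Im z \<and> Im z \<le> T" for z
      by (auto simp: S_def in_cbox_complex_iff)
    have int: "interior S = box (Complex \<alpha> (-T)) (Complex \<beta> T)" by (simp add: S_def interior_cbox)
    have "norm (g s) \<le> M"
    proof (rule maximum_modulus_frontier[of g S])
      show "g holomorphic_on interior S"
        unfolding g_def h_def
        by (intro holomorphic_intros holomorphic_on_subset[OF holo]) (auto simp: int in_box_complex_iff)
      show "continuous_on (closure S) g"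
        unfolding g_def h_def
        by (intro continuous_intros continuous_on_subset[OF cont]) (auto simp: S_def in_cbox_complex_iff)
      show "bounded S" by (simp add: S_def)
      show "s \<in> S" using s T by (auto simp: Smem)
      fix z assume "z \<in> frontier S"
      then have z: "z \<in> S" "z \<notin> box (Complex \<alpha> (-T)) (Complex \<beta> T)"
        by (auto simp: frontier_def int) (simp add: S_def)
      have zs: "\<alpha> \<le> Re z" "Re z \<le> \<beta>" using z(1) by (auto simp: Smem)
      from z consider "Re z = \<alpha> \<or> Re z = \<beta>" | "\<bar>Im z\<bar> = T" by (fastforce simp: Smem in_box_complex_iff)
      then show "norm (g z) \<le> M"
      proof cases
        case 1
        have "0 \<le> exp (\<kappa> * \<bar>Im z\<bar>) / 4" by simp
        then have "0 \<le> Re (h z)" using Re_h[OF zs] by linarith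
        then have "exp (- e * Re (h z)) \<le> 1" using e by simp
        then have "norm (g z) \<le> norm (f z) * 1" unfolding ng by (intro mult_left_mono) auto
        then show ?thesis using bd[OF 1] by simp
      next
        case 2
        have "norm z \<le> \<bar>Re z\<bar> + \<bar>Im z\<bar>" by (rule cmod_le)
        then have nz: "norm z \<le> T + b" using zs 2 unfolding b_def by linarith
        have "norm (g z) \<le> (C * exp (norm z powr \<rho>)) * exp (- e * (exp (\<kappa> * T) / 4))"
          unfolding ng
        proof (rule mult_mono)
          show "exp (- e * Re (h z)) \<le> exp (- e * (exp (\<kappa> * T) / 4))" using Re_h[OF zs] 2 e by simp
          show "norm (f z) \<le> C * exp (norm z powr \<rho>)" by (rule growth[OF zs])
          then show "0 \<le> C * exp (norm z powr \<rho>)" by (rule order_trans[OF norm_ge_zero])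
        qed simp
        also have "\<dots> \<le> (\<bar>C\<bar> * exp ((T + b) powr \<rho>)) * exp (- e * (exp (\<kappa> * T) / 4))"
        proof (rule mult_right_mono)
          have "norm z powr \<rho> \<le> (T + b) powr \<rho>" by (rule powr_mono2) (use nz \<rho> in auto)
          then have "\<bar>C\<bar> * exp (norm z powr \<rho>) \<le> \<bar>C\<bar> * exp ((T + b) powr \<rho>)" by (intro mult_left_mono) auto
          moreover have "C * exp (norm z powr \<rho>) \<le> \<bar>C\<bar> * exp (norm z powr \<rho>)" by (intro mult_right_mono) auto
          ultimately show "C * exp (norm z powr \<rho>) \<le> \<bar>C\<bar> * exp ((T + b) powr \<rho>)" by linarith
        qed simp
        also have "\<dots> = \<bar>C\<bar> * exp ((T + b) powr \<rho> - e * (exp (\<kappa> * T) / 4))" by (simp only: mult.assoc exp_add[symmetric]) simp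
        also have "\<dots> \<le> M" using Y[OF T(1)] by simp
        finally show ?thesis .
      qed
    qed
    then show ?thesis by (simp add: ng)
  qed
  \<comment> \<open>The bound M is the same for every e, so e may tend to 0.\<close>
  have "((\<lambda>e. norm (f s) * exp (- e * Re (h s))) \<longlongrightarrow> norm (f s) * exp (- 0 * Re (h s))) (at_right 0)"
    by (intro tendsto_intros)
  moreover have "eventually (\<lambda>e. norm (f s) * exp (- e * Re (h s)) \<le> M) (at_right 0)"
    using eventually_at_right_less[of "0::real"] by eventually_elim (rule main)
  ultimately have "norm (f s) * exp (- 0 * Re (h s)) \<le> M"
    by (rule tendsto_upperbound) simp
  then show ?thesis by simp
qed

text \<open>Compactness extends the growth bound from a neighbourhood of infinity to the whole
  plane, and the exponent is made positive, as the Phragmen-Lindelof argument requires.\<close>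

lemma selberg_class_entire:
  assumes "F \<in> selberg_class"
  obtains m :: nat and G where "G holomorphic_on UNIV" "\<And>s. s \<noteq> 1 \<Longrightarrow> G s = (s - 1) ^ m * F s"
    "F holomorphic_on - {1}" "\<exists>\<rho> C. \<rho> > 0 \<and> (\<forall>s. norm (G s) \<le> C * exp (norm s powr \<rho>))"
proof -
  obtain m G where G: "entire_of_finite_order G" "\<And>s. s \<noteq> 1 \<Longrightarrow> G s = (s - 1) ^ m * F s"
    using assms by (auto simp: selberg_class_def has_selberg_continuation_def)
  have Gh: "G holomorphic_on UNIV" using G(1) by (simp add: entire_of_finite_order_def)
  have "(\<lambda>s. G s / (s - 1) ^ m) holomorphic_on - {1}"
    by (intro holomorphic_intros holomorphic_on_subset[OF Gh]) auto
  then have Fh: "F holomorphic_on - {1}"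
    by (rule holomorphic_transform) (auto simp: G(2))
  obtain \<rho> where \<rho>: "(\<lambda>s. norm (G s)) \<in> O[at_infinity](\<lambda>s. exp (norm s powr \<rho>))"
    using G(1) by (auto simp: entire_of_finite_order_def)
  obtain c where c: "c > 0" "eventually (\<lambda>s. norm (norm (G s)) \<le> c * norm (exp (norm s powr \<rho>))) at_infinity"
    using landau_o.bigE[OF \<rho>] by blast
  then obtain b where b: "\<And>s. norm s \<ge> b \<Longrightarrow> norm (G s) \<le> c * exp (norm s powr \<rho>)"
    by (auto simp: eventually_at_infinity)
  define \<rho>' where "\<rho>' = max \<rho> 1"
  have "compact (G ` cball 0 (max b 1))"
    by (intro compact_continuous_image continuous_on_subset[OF holomorphic_on_imp_continuous_on[OF Gh]]) auto
  then obtain K where K: "\<And>s. norm s \<le> max b 1 \<Longrightarrow> norm (G s) \<le> K"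
    by (meson bounded_iff compact_imp_bounded image_eqI mem_cball_0)
  have "norm (G s) \<le> (c + \<bar>K\<bar>) * exp (norm s powr \<rho>')" for s
  proof (cases "norm s \<le> max b 1")
    case True
    have "\<bar>K\<bar> * 1 \<le> (c + \<bar>K\<bar>) * exp (norm s powr \<rho>')" using c(1) by (intro mult_mono) auto
    then show ?thesis using K[OF True] by linarith
  next
    case False
    then have "norm (G s) \<le> c * exp (norm s powr \<rho>)" by (intro b) auto
    also have "\<dots> \<le> (c + \<bar>K\<bar>) * exp (norm s powr \<rho>')"
      using c(1) False unfolding \<rho>'_def by (intro mult_mono) (auto intro!: powr_mono)
    finally show ?thesis .
  qed
  moreover have "\<rho>' > 0" by (simp add: \<rho>'_def)
  ultimately have ex: "\<exists>\<rho> C. \<rho> > 0 \<and> (\<forall>s. norm (G s) \<le> C * exp (norm s powr \<rho>))" by blast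
  show ?thesis by (rule that[OF Gh G(2) Fh ex])
qed

text \<open>Absolute convergence bounds F on Re s = 2, the functional equation bounds it on Re s =
  -A, and Phragmen-Lindelof fills the strip. Some exponent is enough, so nothing is interpolated
  between the two edges.\<close>

lemma selberg_class_polynomial_growth:
  assumes F: "F \<in> selberg_class" and fe: "selberg_functional_equation F \<omega> Q r lam mu" and A: "A \<ge> 1"
  obtains B C where "B \<ge> 0" "C > 0" "\<And>s. -A \<le> Re s \<Longrightarrow> \<bar>Im s\<bar> \<ge> 1 \<Longrightarrow> norm (F s) \<le> C * \<bar>Im s\<bar> powr B"
proof -
  obtain a where a: "ram (a :: nat \<Rightarrow> complex)" "\<And>s. Re s > 1 \<Longrightarrow> F s = dirsum a s"
    using selberg_class_coefficients[OF F] by metis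
  define K2 where "K2 = dnorm a 2 + 1"
  have dab: "dabs a 2" by (rule ram_dabs[OF a(1)]) simp
  have F2: "norm (F s) \<le> K2" if "Re s \<ge> 2" for s
    using a(2)[of s] norm_dirsum_le[OF dab that] that by (simp add: K2_def)
  have K2: "K2 > 0" unfolding K2_def dnorm_def by (intro add_nonneg_pos infsum_nonneg) auto
  obtain m G where G: "G holomorphic_on UNIV" "\<And>s. s \<noteq> 1 \<Longrightarrow> G s = (s - 1) ^ m * F s"
    and gr: "\<exists>\<rho> C. \<rho> > 0 \<and> (\<forall>s. norm (G s) \<le> C * exp (norm s powr \<rho>))"
    using selberg_class_entire[OF F] by metis
  obtain \<rho> Cg where \<rho>: "\<rho> > 0" "\<And>s. norm (G s) \<le> Cg * exp (norm s powr \<rho>)" using gr by blast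
  define \<Lambda> where "\<Lambda> = (\<Sum>j=1..r. lam j)"
  obtain t1 where t1: "t1 \<ge> 1"
    "\<And>s. \<bar>Im s\<bar> \<ge> t1 \<Longrightarrow> F s = gamma_ratio \<omega> Q r lam mu s * cnj (F (1 - cnj s))"
    "\<forall>A\<ge>0. \<exists>C>0. \<forall>s. \<bar>Im s\<bar> \<ge> t1 \<longrightarrow> -A \<le> Re s \<longrightarrow> Re s \<le> 1/2 \<longrightarrow> 
        norm (gamma_ratio \<omega> Q r lam mu s) \<le> C * \<bar>Im s\<bar> powr (\<Lambda> * (1 - 2 * Re s))"
    using selberg_functional_equation_ratio[OF fe, folded \<Lambda>_def] by blast
  obtain C1 where C1: "C1 > 0" "\<And>s. \<bar>Im s\<bar> \<ge> t1 \<Longrightarrow> -A \<le> Re s \<Longrightarrow> Re s \<le> 1/2 \<Longrightarrow> 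
        norm (gamma_ratio \<omega> Q r lam mu s) \<le> C1 * \<bar>Im s\<bar> powr (\<Lambda> * (1 - 2 * Re s))"
    using t1(3)[rule_format, of A] A by auto
  \<comment> \<open>On Re s = -A the gamma quotient is at most a constant times
    \<open>\<bar>Im s\<bar> powr (\<Lambda> * (1 + 2 * A))\<close>.\<close>
  define N where "N = nat \<lceil>\<Lambda> * (1 + 2 * A)\<rceil>"
  have N: "\<Lambda> * (1 + 2 * A) \<le> real N" unfolding N_def by linarith
  \<comment> \<open>Throughout Re s \<ge> -A the modulus of w is at least 1. Dividing by a power of
    w makes G bounded on both edges and creates no pole.\<close>
  define w where "w s = s + of_real (A + 1)" for s :: complex
  have w1: "1 \<le> norm (w s)" and w2: "norm (s - 1) \<le> (A + 3) * norm (w s)" and w3: "\<bar>Im s\<bar> \<le> norm (w s)" if "-A \<le> Re s" for s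
  proof -
    show w1: "1 \<le> norm (w s)" using abs_Re_le_cmod[of "w s"] that by (simp add: w_def)
    have "s - 1 = w s - of_real (A + 2)" by (simp add: w_def complex_eq_iff)
    then have "norm (s - 1) \<le> norm (w s) + norm (of_real (A + 2) :: complex)" by (metis norm_triangle_ineq4)
    also have "norm (of_real (A + 2) :: complex) = A + 2" using A by (simp only: norm_of_real)
    also have "A + 2 \<le> (A + 2) * norm (w s)" using w1 A by simp
    finally show "norm (s - 1) \<le> (A + 3) * norm (w s)" by (simp add: algebra_simps)
    show "\<bar>Im s\<bar> \<le> norm (w s)" using abs_Im_le_cmod[of "w s"] by (simp add: w_def)
  qed
  have "compact (G ` cbox (Complex (-A) (-t1)) (Complex 2 t1))"
    by (intro compact_continuous_image continuous_on_subset[OF holomorphic_on_imp_continuous_on[OF G(1)]]) auto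
  then obtain K3 where K3: "\<And>s. s \<in> cbox (Complex (-A) (-t1)) (Complex 2 t1) \<Longrightarrow> norm (G s) \<le> K3"
    by (meson bounded_iff compact_imp_bounded image_eqI)
  define K where "K = \<bar>K3\<bar> + (A + 3) ^ m * (K2 + C1 * K2)"
  have K: "K > 0" unfolding K_def using A K2 C1 by (intro add_nonneg_pos mult_pos_pos add_pos_pos) auto
  have Kle: "\<bar>K3\<bar> \<le> K" "(A + 3) ^ m * K2 \<le> K" "(A + 3) ^ m * (C1 * K2) \<le> K"
    unfolding K_def using A K2 C1 by (auto simp: distrib_left)
  define f where "f s = G s / w s ^ (m + N)" for s
  have nf: "norm (f s) \<le> K" if s: "-A \<le> Re s" and G_le: "norm (G s) \<le> K * norm (w s) ^ (m + N)" for s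
  proof -
    have p: "0 < norm (w s) ^ (m + N)" using w1[OF s] by (intro zero_less_power) linarith
    show ?thesis unfolding f_def norm_divide norm_power pos_divide_le_eq[OF p] by (rule G_le)
  qed
  have wpow: "1 \<le> norm (w s) ^ k" if "-A \<le> Re s" for s k using w1[OF that] by (rule one_le_power)
  have strip: "norm (f s) \<le> K" if s: "-A \<le> Re s" "Re s \<le> 2" for s
  proof (rule phragmen_lindelof_strip[where f = f and s = s and M = K and \<alpha> = "-A" and \<beta> = 2 and \<rho> = \<rho> and C = "\<bar>Cg\<bar>"])
    have w0: "w z \<noteq> 0" if "-A \<le> Re z" for z using w1[OF that] by auto
    show "continuous_on {s. -A \<le> Re s \<and> Re s \<le> 2} f"
      unfolding f_def by (intro continuous_intros continuous_on_subset[OF holomorphic_on_imp_continuous_on[OF G(1)]]) (use w0 in \<open>auto simp: w_def intro!: continuous_intros\<close>)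
    show "f holomorphic_on {s. -A < Re s \<and> Re s < 2}"
      unfolding f_def w_def by (intro holomorphic_intros holomorphic_on_subset[OF G(1)]) (use w0 in \<open>auto simp: w_def less_imp_le\<close>)
    show "norm (f z) \<le> \<bar>Cg\<bar> * exp (norm z powr \<rho>)" if z: "-A \<le> Re z" "Re z \<le> 2" for z
    proof -
      have "norm (f z) \<le> norm (G z) / 1"
        unfolding f_def norm_divide norm_power using wpow[OF z(1), of "m + N"] by (intro divide_left_mono) auto
      then have "norm (f z) \<le> norm (G z)" by simp
      also have "\<dots> \<le> Cg * exp (norm z powr \<rho>)" by (rule \<rho>(2))
      also have "\<dots> \<le> \<bar>Cg\<bar> * exp (norm z powr \<rho>)" by (intro mult_right_mono) auto
      finally show ?thesis .
    qed
    show "norm (f z) \<le> K" if z: "Re z = -A \<or> Re z = 2" for z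
    proof (rule nf)
      show zA: "-A \<le> Re z" using z A by auto
      have wN: "norm (w z) ^ m * c \<le> norm (w z) ^ (m + N) * d" if "c \<le> d * norm (w z) ^ N" for c d
        using mult_left_mono[OF that, of "norm (w z) ^ m"] by (simp add: power_add mult_ac)
      show "norm (G z) \<le> K * norm (w z) ^ (m + N)"
      proof (cases "Re z = 2")
        case True
        then have "z \<noteq> 1" by auto
        then have "norm (G z) = norm (z - 1) ^ m * norm (F z)" by (simp add: G(2) norm_mult norm_power)
        also have "\<dots> \<le> ((A + 3) * norm (w z)) ^ m * (K2 * norm (w z) ^ N)"
        proof (intro mult_mono power_mono w2[OF zA])
          have "norm (F z) \<le> K2 * 1" using F2[of z] True by simp
          also have "\<dots> \<le> K2 * norm (w z) ^ N" using K2 wpow[OF zA] by (intro mult_left_mono) auto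
          finally show "norm (F z) \<le> K2 * norm (w z) ^ N" .
        qed (use A in auto)
        also have "\<dots> = ((A + 3) ^ m * K2) * norm (w z) ^ (m + N)" by (simp add: power_mult_distrib power_add mult_ac)
        also have "\<dots> \<le> K * norm (w z) ^ (m + N)" using Kle by (intro mult_right_mono) auto
        finally show ?thesis .
      next
        case False
        then have zA': "Re z = -A" using z by simp
        show ?thesis
        proof (cases "\<bar>Im z\<bar> \<ge> t1")
          case True
          have "z \<noteq> 1" using zA' A by auto
          then have "norm (G z) = norm (z - 1) ^ m * norm (F z)" by (simp add: G(2) norm_mult norm_power)
          also have "\<dots> \<le> ((A + 3) * norm (w z)) ^ m * (C1 * norm (w z) ^ N * K2)"
          proof (intro mult_mono power_mono w2[OF zA])
            have "norm (F z) = norm (gamma_ratio \<omega> Q r lam mu z) * norm (F (1 - cnj z))"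
              using t1(2)[OF True] by (simp add: norm_mult)
            also have "\<dots> \<le> (C1 * norm (w z) ^ N) * K2"
            proof (intro mult_mono F2)
              have "norm (gamma_ratio \<omega> Q r lam mu z) \<le> C1 * \<bar>Im z\<bar> powr (\<Lambda> * (1 - 2 * Re z))"
                using zA' A True by (intro C1(2)) auto
              also have "\<dots> \<le> C1 * \<bar>Im z\<bar> powr real N"
                using N True t1(1) C1(1) zA' by (intro mult_left_mono powr_mono) auto
              also have "\<bar>Im z\<bar> powr real N = \<bar>Im z\<bar> ^ N" using True t1(1) by (intro powr_realpow) auto
              also have "C1 * \<bar>Im z\<bar> ^ N \<le> C1 * norm (w z) ^ N"
                using C1(1) w3[OF zA] by (intro mult_left_mono power_mono) auto
              finally show "norm (gamma_ratio \<omega> Q r lam mu z) \<le> C1 * norm (w z) ^ N" .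
            qed (use zA' A C1(1) in auto)
            finally show "norm (F z) \<le> C1 * norm (w z) ^ N * K2" .
          qed (use A in auto)
          also have "\<dots> = ((A + 3) ^ m * (C1 * K2)) * norm (w z) ^ (m + N)" by (simp add: power_mult_distrib power_add mult_ac)
          also have "\<dots> \<le> K * norm (w z) ^ (m + N)" using Kle by (intro mult_right_mono) auto
          finally show ?thesis .
        next
          case False
          then have "-t1 \<le> Im z" "Im z \<le> t1" by linarith+
          then have "norm (G z) \<le> K3" using zA' A by (intro K3) (auto simp: in_cbox_complex_iff)
          then have "norm (G z) \<le> \<bar>K3\<bar> * 1" by linarith
          also have "\<dots> \<le> K * norm (w z) ^ (m + N)" using Kle K wpow[OF zA] by (intro mult_mono) auto
          finally show ?thesis .
        qed
      qed
    qed
  qed (use A \<rho> K s in auto)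
  show ?thesis
  proof (rule that[of "real (m + N)" "max K2 (K * (A + 4) ^ (m + N))"])
    show "max K2 (K * (A + 4) ^ (m + N)) > 0" using K2 by simp
    fix s :: complex assume s: "-A \<le> Re s" "\<bar>Im s\<bar> \<ge> 1"
    have t: "\<bar>Im s\<bar> powr real (m + N) = \<bar>Im s\<bar> ^ (m + N)" using s by (intro powr_realpow) auto
    have tge: "1 \<le> \<bar>Im s\<bar> ^ (m + N)" using s by (intro one_le_power)
    show "norm (F s) \<le> max K2 (K * (A + 4) ^ (m + N)) * \<bar>Im s\<bar> powr real (m + N)"
    proof (cases "Re s \<ge> 2")
      case True
      have "K2 * 1 \<le> max K2 (K * (A + 4) ^ (m + N)) * \<bar>Im s\<bar> ^ (m + N)"
        using tge K2 by (intro mult_mono) auto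
      then show ?thesis using F2[OF True] unfolding t by linarith
    next
      case False
      have s1: "s \<noteq> 1" using s by auto
      have "1 \<le> norm (s - 1)" using abs_Im_le_cmod[of "s - 1"] s by simp
      then have "1 \<le> norm (s - 1) ^ m" by (rule one_le_power)
      then have "norm (F s) \<le> norm (s - 1) ^ m * norm (F s)" by (simp add: mult_le_cancel_right1)
      also have "\<dots> = norm (G s)" using s1 by (simp add: G(2) norm_mult norm_power)
      also have "\<dots> = norm (f s) * norm (w s) ^ (m + N)"
        using w1[OF s(1)] by (auto simp: f_def norm_divide norm_power)
      also have "\<dots> \<le> K * ((A + 4) * \<bar>Im s\<bar>) ^ (m + N)"
      proof (intro mult_mono power_mono)
        show "norm (f s) \<le> K" using strip[OF s(1)] False by simp
        have "norm (w s) \<le> \<bar>Re (w s)\<bar> + \<bar>Im (w s)\<bar>" by (rule cmod_le)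
        also have "\<dots> \<le> (A + 3) * 1 + \<bar>Im s\<bar>" using s False A by (simp add: w_def)
        also have "\<dots> \<le> (A + 3) * \<bar>Im s\<bar> + \<bar>Im s\<bar>" using s A by (intro add_right_mono mult_left_mono) auto
        finally show "norm (w s) \<le> (A + 4) * \<bar>Im s\<bar>" by (simp add: algebra_simps)
      qed (use K in auto)
      also have "\<dots> = (K * (A + 4) ^ (m + N)) * \<bar>Im s\<bar> ^ (m + N)" by (simp add: power_mult_distrib)
      also have "\<dots> \<le> max K2 (K * (A + 4) ^ (m + N)) * \<bar>Im s\<bar> ^ (m + N)" by (intro mult_right_mono) auto
      finally show ?thesis unfolding t .
    qed
  qed simp
qed

section \<open>Local zero counts\<close>

text \<open>The quotient is holomorphic away from \<rho> and agrees with g near \<rho>.\<close>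

lemma extract_zero:
  fixes f g :: "complex \<Rightarrow> complex"
  assumes U: "open U" "f holomorphic_on U" and W: "open W" "\<rho> \<in> W" "W \<subseteq> U" "g holomorphic_on W"
    and eq: "\<And>z. z \<in> W \<Longrightarrow> f z = (z - \<rho>) ^ n * g z"
  shows "\<exists>h. h holomorphic_on U \<and> (\<forall>z\<in>U. f z = (z - \<rho>) ^ n * h z)"
proof -
  define h where "h z = (if z = \<rho> then g \<rho> else f z / (z - \<rho>) ^ n)" for z
  have "(\<lambda>z. f z / (z - \<rho>) ^ n) holomorphic_on (U - {\<rho>})"
    by (intro holomorphic_intros holomorphic_on_subset[OF U(2)]) auto
  then have h1: "h holomorphic_on (U - {\<rho>})"
    by (rule holomorphic_transform) (auto simp: h_def)
  have h2: "h holomorphic_on W"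
    by (rule holomorphic_transform[OF W(4)]) (auto simp: h_def eq)
  have "h holomorphic_on ((U - {\<rho>}) \<union> W)"
    using h1 h2 U(1) W(1) by (intro holomorphic_on_Un) auto
  moreover have "(U - {\<rho>}) \<union> W = U" using W by auto
  moreover have "f z = (z - \<rho>) ^ n * h z" if "z \<in> U" for z
    using eq[OF W(2)] by (auto simp: h_def)
  ultimately show ?thesis by auto
qed

text \<open>Induction over Z: near the next zero the product already split off does not vanish, so
  the remaining quotient still contains the full power of z - \<rho>.\<close>

lemma extract_zeros:
  fixes f :: "complex \<Rightarrow> complex"
  assumes U: "open U" "f holomorphic_on U" and Z: "finite Z" "Z \<subseteq> U"
    and ex: "\<And>\<rho>. \<rho> \<in> Z \<Longrightarrow> \<exists>h. h holomorphic_on U \<and> (\<forall>z\<in>U. f z = (z - \<rho>) ^ n \<rho> * h z)"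
  shows "\<exists>g. g holomorphic_on U \<and> (\<forall>z\<in>U. f z = (\<Prod>\<rho>\<in>Z. (z - \<rho>) ^ n \<rho>) * g z)"
  using Z ex
proof (induction Z rule: finite_induct)
  case empty
  then show ?case using U by auto
next
  case (insert \<rho> Z)
  then obtain g where g: "g holomorphic_on U" "\<And>z. z \<in> U \<Longrightarrow> f z = (\<Prod>\<rho>\<in>Z. (z - \<rho>) ^ n \<rho>) * g z" by auto
  obtain h where h: "h holomorphic_on U" "\<And>z. z \<in> U \<Longrightarrow> f z = (z - \<rho>) ^ n \<rho> * h z" using insert.prems(2)[of \<rho>] by blast
  define P where "P z = (\<Prod>\<rho>\<in>Z. (z - \<rho>) ^ n \<rho>)" for z
  define W where "W = U - Z"
  have W: "open W" using U insert by (auto simp: W_def intro: open_Diff finite_imp_closed)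
  have P0: "P z \<noteq> 0" if "z \<in> W" for z using that insert.hyps by (auto simp: P_def W_def)
  have "\<exists>k. k holomorphic_on U \<and> (\<forall>z\<in>U. g z = (z - \<rho>) ^ n \<rho> * k z)"
  proof (rule extract_zero[OF U(1) g(1) W])
    show "(\<lambda>z. h z / P z) holomorphic_on W"
      using P0 by (intro holomorphic_intros holomorphic_on_subset[OF h(1)]) (auto simp: P_def W_def intro!: holomorphic_intros)
    show "g z = (z - \<rho>) ^ n \<rho> * (h z / P z)" if "z \<in> W" for z
    proof -
      have "P z * g z = (z - \<rho>) ^ n \<rho> * h z" using g(2)[of z] h(2)[of z] that by (simp add: P_def W_def)
      then show ?thesis using P0[OF that] by (simp add: field_simps)
    qed
  qed (use insert in \<open>auto simp: W_def\<close>)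
  then obtain k where k: "k holomorphic_on U" "\<And>z. z \<in> U \<Longrightarrow> g z = (z - \<rho>) ^ n \<rho> * k z" by auto
  have "f z = (\<Prod>\<rho>\<in>insert \<rho> Z. (z - \<rho>) ^ n \<rho>) * k z" if "z \<in> U" for z
    using g(2)[OF that] k(2)[OF that] insert.hyps by (simp add: mult_ac)
  then show ?case using k(1) by blast
qed

text \<open>Jensen's bound, by dividing out the zeros and applying the maximum principle.\<close>

lemma zeros_in_disc_bound:
  fixes f :: "complex \<Rightarrow> complex"
  assumes U: "open U" "connected U" "f holomorphic_on U" and R: "cball z0 R \<subseteq> U" "0 < r" "2 * r < R"
    and Z: "finite Z" "Z \<subseteq> cball z0 r" and bd: "\<And>z. z \<in> cball z0 R \<Longrightarrow> norm (f z) \<le> B"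
    and c: "0 < c" "c \<le> norm (f z0)"
  shows "((R - r) / r) ^ (\<Sum>\<rho>\<in>Z. nat (zorder f \<rho>)) \<le> B / c"
proof -
  define n where "n \<rho> = nat (zorder f \<rho>)" for \<rho>
  have z0U: "z0 \<in> U" using R by auto
  have ZU: "Z \<subseteq> U" using Z R subset_cball[of r R z0] by auto
  have "\<exists>h. h holomorphic_on U \<and> (\<forall>z\<in>U. f z = (z - \<rho>) ^ n \<rho> * h z)" if "\<rho> \<in> Z" for \<rho>
  proof -
    have \<rho>U: "\<rho> \<in> U" using that ZU by auto
    have "\<exists>w\<in>U. f w \<noteq> 0" using c z0U by (intro bexI[of _ z0]) auto
    from zorder_exist_zero[OF U(3,1,2) \<rho>U this]
    obtain e where e: "e > 0" "cball \<rho> e \<subseteq> U" "zor_poly f \<rho> holomorphic_on cball \<rho> e"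
      "\<forall>w\<in>cball \<rho> e. f w = zor_poly f \<rho> w * (w - \<rho>) ^ n \<rho> \<and> zor_poly f \<rho> w \<noteq> 0"
      by (auto simp: n_def)
    show ?thesis
      by (rule extract_zero[OF U(1,3), of "ball \<rho> e" \<rho> "zor_poly f \<rho>"])
         (use e in \<open>auto intro: holomorphic_on_subset\<close>)
  qed
  from extract_zeros[OF U(1,3) Z(1) ZU this]
  obtain g where g: "g holomorphic_on U" "\<And>z. z \<in> U \<Longrightarrow> f z = (\<Prod>\<rho>\<in>Z. (z - \<rho>) ^ n \<rho>) * g z" by auto
  define N where "N = (\<Sum>\<rho>\<in>Z. n \<rho>)"
  have dist: "norm (\<rho> - z0) \<le> r" if "\<rho> \<in> Z" for \<rho> using that Z by (auto simp: dist_norm norm_minus_commute)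
  \<comment> \<open>On the circle of radius R every zero is at distance at least R - r, while from
    the centre it is at distance at most r.\<close>
  have "norm (g z0) \<le> B / (R - r) ^ N"
  proof (rule maximum_modulus_frontier[of g "cball z0 R"])
    show "g holomorphic_on interior (cball z0 R)" using R by (intro holomorphic_on_subset[OF g(1)]) auto
    show "continuous_on (closure (cball z0 R)) g" using R
      by (intro continuous_on_subset[OF holomorphic_on_imp_continuous_on[OF g(1)]]) auto
    fix z assume "z \<in> frontier (cball z0 R)"
    then have z: "norm (z - z0) = R" using R by (simp add: dist_norm norm_minus_commute)
    then have zU: "z \<in> U" and zR: "z \<in> cball z0 R" using R by (auto simp: dist_norm norm_minus_commute)
    have "(R - r) ^ N = (\<Prod>\<rho>\<in>Z. (R - r) ^ n \<rho>)" by (simp add: N_def power_sum)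
    also have "\<dots> \<le> (\<Prod>\<rho>\<in>Z. norm ((z - \<rho>) ^ n \<rho>))"
    proof (rule prod_mono, intro conjI)
      fix \<rho> assume \<rho>: "\<rho> \<in> Z"
      have "R - r \<le> norm (z - \<rho>)" using norm_triangle_ineq2[of "z - z0" "\<rho> - z0"] z dist[OF \<rho>] by simp
      then show "(R - r) ^ n \<rho> \<le> norm ((z - \<rho>) ^ n \<rho>)" using R by (simp add: norm_power power_mono)
    qed (use R in simp)
    finally have "(R - r) ^ N * norm (g z) \<le> (\<Prod>\<rho>\<in>Z. norm ((z - \<rho>) ^ n \<rho>)) * norm (g z)" by (intro mult_right_mono) auto
    also have "\<dots> = norm (f z)" using g(2)[OF zU] by (simp add: norm_mult prod_norm)
    also have "\<dots> \<le> B" by (rule bd[OF zR])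
    finally show "norm (g z) \<le> B / (R - r) ^ N" using R by (simp add: field_simps)
  qed (use R in auto)
  then have "norm (g z0) * r ^ N \<le> B / (R - r) ^ N * r ^ N" using R by (intro mult_right_mono) auto
  moreover have "c \<le> norm (g z0) * r ^ N"
  proof -
    have "norm (f z0) = (\<Prod>\<rho>\<in>Z. norm ((z0 - \<rho>) ^ n \<rho>)) * norm (g z0)" using g(2)[OF z0U] by (simp add: norm_mult prod_norm)
    also have "\<dots> \<le> (\<Prod>\<rho>\<in>Z. r ^ n \<rho>) * norm (g z0)"
    proof (intro mult_right_mono prod_mono conjI)
      fix \<rho> assume \<rho>: "\<rho> \<in> Z"
      have "norm (z0 - \<rho>) \<le> r" using dist[OF \<rho>] by (simp add: norm_minus_commute)
      then show "norm ((z0 - \<rho>) ^ n \<rho>) \<le> r ^ n \<rho>" by (simp add: norm_power power_mono)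
    qed auto
    also have "(\<Prod>\<rho>\<in>Z. r ^ n \<rho>) = r ^ N" by (simp add: N_def power_sum)
    finally show ?thesis using c by (simp add: mult.commute)
  qed
  ultimately have "c \<le> B / (R - r) ^ N * r ^ N" by linarith
  then have "c * ((R - r) ^ N / r ^ N) \<le> B" using R by (simp add: field_simps)
  then show ?thesis using c by (simp add: N_def n_def power_divide field_simps)
qed

text \<open>The box lies in the disc of radius 13/10 about 2 + it, since 121/100 + 1/4 is below
  169/100. At the centre |F| is bounded below; the disc of radius 4 keeps away from the pole, and F
  grows polynomially there. As (4 - 13/10) / (13/10) exceeds 2, a power of 2 counting the zeros is
  at most a power of |t|.\<close>

lemma selberg_class_local_zero_count:
  assumes F: "F \<in> selberg_class" and fe: "selberg_functional_equation F \<omega> Q r lam mu"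
  obtains C where "C > 0" "\<And>t Z. \<bar>t\<bar> \<ge> 7 \<Longrightarrow> finite Z \<Longrightarrow> Z \<subseteq> {\<rho>. 9/10 \<le> Re \<rho> \<and> Re \<rho> \<le> 1 \<and> \<bar>Im \<rho> - t\<bar> \<le> 1/2} \<Longrightarrow>
     real (\<Sum>\<rho>\<in>Z. nat (zorder F \<rho>)) \<le> C * ln \<bar>t\<bar>"
proof -
  obtain B C where BC: "B \<ge> 0" "C > 0" "\<And>s. -2 \<le> Re s \<Longrightarrow> \<bar>Im s\<bar> \<ge> 1 \<Longrightarrow> norm (F s) \<le> C * \<bar>Im s\<bar> powr B"
    by (rule selberg_class_polynomial_growth[OF F fe, of 2]) auto
  obtain c1 where c1: "c1 > 0" "\<And>s. Re s \<ge> 2 \<Longrightarrow> c1 \<le> norm (F s)"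
    by (rule selberg_class_coefficients[OF F]) blast
  have Fh: "F holomorphic_on - {1}" by (rule selberg_class_entire[OF F])
  define K where "K = \<bar>ln (C / c1)\<bar> + 2 * B + 1"
  have K: "K > 0" using BC by (simp add: K_def)
  have "real (\<Sum>\<rho>\<in>Z. nat (zorder F \<rho>)) \<le> 2 * K * ln \<bar>t\<bar>"
    if t: "\<bar>t\<bar> \<ge> 7" and Z: "finite Z" "Z \<subseteq> {\<rho>. 9/10 \<le> Re \<rho> \<and> Re \<rho> \<le> 1 \<and> \<bar>Im \<rho> - t\<bar> \<le> 1/2}" for t Z
  proof -
    define z0 where "z0 = Complex 2 t"
    define N where "N = (\<Sum>\<rho>\<in>Z. nat (zorder F \<rho>))"
    have ln1: "ln \<bar>t\<bar> \<ge> 1"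
    proof -
      have "exp 1 \<le> \<bar>t\<bar>" using exp_le t by linarith
      then show ?thesis using ln_ge_iff[of "\<bar>t\<bar>" 1] t by simp
    qed
    have near: "\<bar>Im z\<bar> \<ge> \<bar>t\<bar> - 5" "\<bar>Im z\<bar> \<le> \<bar>t\<bar> + e" "-2 \<le> Re z" if "dist z0 z \<le> e" "e \<le> 4" for z e
    proof -
      have "\<bar>t - Im z\<bar> \<le> e" "\<bar>2 - Re z\<bar> \<le> e" using abs_Im_le_cmod[of "z0 - z"] abs_Re_le_cmod[of "z0 - z"] that by (auto simp: dist_norm z0_def)
      then show "\<bar>Im z\<bar> \<ge> \<bar>t\<bar> - 5" "\<bar>Im z\<bar> \<le> \<bar>t\<bar> + e" "-2 \<le> Re z" using that by linarith+
    qed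
    have one: "1 \<notin> ball z0 5"
      using abs_Im_le_cmod[of "z0 - 1"] t by (auto simp: dist_norm z0_def)
    have "((4 - 13/10) / (13/10)) ^ N \<le> (C * (\<bar>t\<bar> + 4) powr B) / c1"
      unfolding N_def
    proof (rule zeros_in_disc_bound[where U = "ball z0 5" and ?z0.0 = z0])
      show "F holomorphic_on ball z0 5" by (rule holomorphic_on_subset[OF Fh]) (use one in auto)
      show "cball z0 4 \<subseteq> ball z0 5" by auto
      show "Z \<subseteq> cball z0 (13/10)"
      proof
        fix \<rho> assume "\<rho> \<in> Z"
        then have \<rho>: "9/10 \<le> Re \<rho>" "Re \<rho> \<le> 1" "\<bar>Im \<rho> - t\<bar> \<le> 1/2" using Z by auto
        have "(Re (z0 - \<rho>))^2 \<le> (11/10)^2" using \<rho> by (intro power_mono) (auto simp: z0_def)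
        moreover have "\<bar>Im (z0 - \<rho>)\<bar>^2 \<le> (1/2)^2" using \<rho> by (intro power_mono) (auto simp: z0_def abs_minus_commute)
        moreover have "norm (z0 - \<rho>) ^ 2 = (Re (z0 - \<rho>))^2 + \<bar>Im (z0 - \<rho>)\<bar>^2" by (simp only: cmod_power2 power2_abs)
        moreover have "(11/10)^2 + (1/2)^2 \<le> ((13/10)^2 :: real)" by (simp add: power2_eq_square)
        ultimately have "norm (z0 - \<rho>) ^ 2 \<le> (13/10)^2" by linarith
        then show "\<rho> \<in> cball z0 (13/10)" using power2_le_imp_le[of "norm (z0 - \<rho>)" "13/10"] by (simp add: dist_norm)
      qed
      fix z assume "z \<in> cball z0 4"
      then have z: "dist z0 z \<le> 4" by simp
      have "norm (F z) \<le> C * \<bar>Im z\<bar> powr B" using near[OF z] t by (intro BC(3)) auto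
      also have "\<dots> \<le> C * (\<bar>t\<bar> + 4) powr B" using near[OF z] BC by (intro mult_left_mono powr_mono2) auto
      finally show "norm (F z) \<le> C * (\<bar>t\<bar> + 4) powr B" .
    qed (use c1 Z in \<open>auto simp: z0_def\<close>)
    moreover have "(2::real) ^ N \<le> ((4 - 13/10) / (13/10)) ^ N" by (intro power_mono) auto
    moreover have "(C * (\<bar>t\<bar> + 4) powr B) / c1 = (C / c1) * (\<bar>t\<bar> + 4) powr B" by simp
    moreover have "(C / c1) * (\<bar>t\<bar> + 4) powr B \<le> (C / c1) * (\<bar>t\<bar> ^ 2) powr B"
    proof -
      have "\<bar>t\<bar> * 7 \<le> \<bar>t\<bar> * \<bar>t\<bar>" using t by (intro mult_left_mono) auto
      then have "\<bar>t\<bar> + 4 \<le> \<bar>t\<bar> ^ 2" using t unfolding power2_eq_square by linarith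
      then show ?thesis using BC c1 t by (intro mult_left_mono powr_mono2) auto
    qed
    ultimately have "(2::real) ^ N \<le> (C / c1) * (\<bar>t\<bar> ^ 2) powr B" by linarith
    then have "ln ((2::real) ^ N) \<le> ln ((C / c1) * (\<bar>t\<bar> ^ 2) powr B)" by (intro ln_mono) auto
    also have "ln ((C / c1) * (\<bar>t\<bar> ^ 2) powr B) = ln (C / c1) + B * (2 * ln \<bar>t\<bar>)"
    proof -
      have "ln (k * (x ^ 2) powr B) = ln k + B * (2 * ln x)" if "x > 0" "k > 0" for x k :: real
        using that by (simp add: ln_mult ln_powr ln_realpow)
      from this[of "\<bar>t\<bar>" "C / c1"] show ?thesis using BC c1 t by simp
    qed
    also have "\<dots> \<le> \<bar>ln (C / c1)\<bar> * ln \<bar>t\<bar> + B * (2 * ln \<bar>t\<bar>)"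
      using mult_left_mono[OF ln1, of "\<bar>ln (C / c1)\<bar>"] by simp
    also have "\<dots> \<le> K * ln \<bar>t\<bar>" using ln1 by (simp add: K_def algebra_simps)
    finally have "real N * ln 2 \<le> K * ln \<bar>t\<bar>" by (simp add: ln_realpow)
    moreover have "real N * (1/2) \<le> real N * ln 2" using ln2_ge_two_thirds by (intro mult_left_mono) auto
    ultimately show ?thesis by (simp add: N_def)
  qed
  then show ?thesis using that[of "2 * K"] K by auto
qed

section \<open>Large values of Dirichlet polynomials\<close>

text \<open>Summation by parts; for decreasing weights the variation and the last weight add up to
  \<open>w a\<close>.\<close>

lemma abel_summation_bound:
  fixes z :: "nat \<Rightarrow> complex" and w :: "nat \<Rightarrow> real"
  assumes ab: "a \<le> b" and w0: "\<And>n. a \<le> n \<Longrightarrow> n \<le> b \<Longrightarrow> 0 \<le> w n"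
    and dec: "\<And>n. a \<le> n \<Longrightarrow> n < b \<Longrightarrow> w (Suc n) \<le> w n"
    and bd: "\<And>k. a \<le> k \<Longrightarrow> k \<le> b \<Longrightarrow> norm (\<Sum>n=a..k. z n) \<le> B"
  shows "norm (\<Sum>n=a..b. of_real (w n) * z n) \<le> w a * B"
proof -
  define S where "S k = (\<Sum>n=a..k. z n)" for k
  have "norm ((\<Sum>n=a..k. of_real (w n) * z n) - of_real (w k) * S k) \<le> (w a - w k) * B" if "a \<le> k" "k \<le> b" for k
    using that
  proof (induction k rule: dec_induct)
    case base
    show ?case by (simp add: S_def)
  next
    case (step k)
    have "(\<Sum>n=a..Suc k. of_real (w n) * z n) - of_real (w (Suc k)) * S (Suc k) =
      ((\<Sum>n=a..k. of_real (w n) * z n) - of_real (w k) * S k) + of_real (w k - w (Suc k)) * S k"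
      using step.hyps by (simp add: S_def algebra_simps)
    also have "norm \<dots> \<le> (w a - w k) * B + (w k - w (Suc k)) * B"
    proof (intro norm_triangle_mono)
      show "norm ((\<Sum>n=a..k. of_real (w n) * z n) - of_real (w k) * S k) \<le> (w a - w k) * B"
        using step by simp
      have d: "w (Suc k) \<le> w k" using dec[of k] step by simp
      show "norm (of_real (w k - w (Suc k)) * S k) \<le> (w k - w (Suc k)) * B"
        unfolding norm_mult norm_of_real using d bd[of k] step by (intro mult_mono) (auto simp: S_def)
    qed
    finally show ?case by (simp add: algebra_simps)
  qed
  from this[of b] have 1: "norm ((\<Sum>n=a..b. of_real (w n) * z n) - of_real (w b) * S b) \<le> (w a - w b) * B" using ab by simp
  have 2: "norm (of_real (w b) * S b) \<le> w b * B"
    unfolding norm_mult norm_of_real using w0[of b] bd[of b] ab by (intro mult_mono) (auto simp: S_def)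
  have "norm (\<Sum>n=a..b. of_real (w n) * z n) \<le> norm ((\<Sum>n=a..b. of_real (w n) * z n) - of_real (w b) * S b) + norm (of_real (w b) * S b)"
    using norm_triangle_ineq[of "(\<Sum>n=a..b. of_real (w n) * z n) - of_real (w b) * S b" "of_real (w b) * S b"] by simp
  then show ?thesis using 1 2 by (simp add: algebra_simps)
qed

lemma harmonic_sum_le: "n \<ge> 1 \<Longrightarrow> (\<Sum>k=1..n. 1 / real k) \<le> 1 + ln (real n)"
proof (induction n rule: dec_induct)
  case (step n)
  have "1 / (real n + 1) \<le> ln (real n + 1) - ln (real n)" using step.hyps by (intro ln_Suc_diff_bounds) auto
  then show ?case using step by (simp add: add.commute)
qed simp

lemma of_nat_powr_cis:
  assumes "n \<ge> 1"
  shows "(of_nat n :: complex) powr (-s) = of_real (real n powr (- Re s)) * cis (- (Im s * ln (real n)))"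
proof -
  have "(of_nat n :: complex) powr (-s) = exp (- s * of_real (ln (real n)))"
    using assms by (simp add: powr_def Ln_of_nat)
  also have "- s * of_real (ln (real n)) = of_real (- Re s * ln (real n)) + \<i> * of_real (- (Im s * ln (real n)))"
    by (simp add: complex_eq_iff)
  also have "exp \<dots> = of_real (exp (- Re s * ln (real n))) * cis (- (Im s * ln (real n)))"
    by (simp only: exp_add cis_conv_exp exp_of_real)
  also have "exp (- Re s * ln (real n)) = real n powr (- Re s)" using assms by (simp add: powr_def)
  finally show ?thesis .
qed

text \<open>The diagonal contributes 2T, an off-diagonal pair at most 2 / |ln m - ln n| \<le> 2N /
  |m - n|. Replacing products of two coefficients by their squares leaves harmonic sums, at the
  price of a logarithm that the application can afford.\<close>

lemma mean_value_dirichlet_polynomial: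
  fixes \<alpha> :: "nat \<Rightarrow> complex"
  assumes N: "N \<ge> 1" and T: "T \<ge> 0"
  shows "integral {-T..T} (\<lambda>u. (norm (\<Sum>n=1..N. \<alpha> n * cis (u * ln (real n))))\<^sup>2)
           \<le> (2 * T + 4 * real N * (1 + ln (real N))) * (\<Sum>n=1..N. (norm (\<alpha> n))\<^sup>2)"
proof -
  define l where "l m n = ln (real m) - ln (real n)" for m n :: nat
  define I where "I m n = integral {-T..T} (\<lambda>u. cis (u * l m n))" for m n
  define f where "f u = (\<Sum>m=1..N. \<Sum>n=1..N. \<alpha> m * cnj (\<alpha> n) * cis (u * l m n))" for u
  have f_eq: "of_real ((norm (\<Sum>n=1..N. \<alpha> n * cis (u * ln (real n))))\<^sup>2) = f u" for u
    unfolding complex_norm_square f_def cnj_sum sum_product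
    by (intro sum.cong refl) (simp add: cis_cnj cis_mult l_def algebra_simps mult_ac)
  have cont: "continuous_on A (\<lambda>u. cis (u * l m n))" for A m n
    by (intro continuous_intros)
  have hI: "((\<lambda>u. cis (u * l m n)) has_integral I m n) {-T..T}" for m n
    unfolding I_def by (intro integrable_integral integrable_continuous_interval cont)
  have "(f has_integral (\<Sum>m=1..N. \<Sum>n=1..N. \<alpha> m * cnj (\<alpha> n) * I m n)) {-T..T}"
    unfolding f_def by (intro has_integral_sum has_integral_mult_right hI) auto
  then have int_f: "integral {-T..T} f = (\<Sum>m=1..N. \<Sum>n=1..N. \<alpha> m * cnj (\<alpha> n) * I m n)" by (rule integral_unique)
  define J where "J = integral {-T..T} (\<lambda>u. (norm (\<Sum>n=1..N. \<alpha> n * cis (u * ln (real n))))\<^sup>2)"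
  have hJ: "((\<lambda>u. (norm (\<Sum>n=1..N. \<alpha> n * cis (u * ln (real n))))\<^sup>2) has_integral J) {-T..T}"
    unfolding J_def by (intro integrable_integral integrable_continuous_interval continuous_intros)
  have "(complex_of_real \<circ> (\<lambda>u. (norm (\<Sum>n=1..N. \<alpha> n * cis (u * ln (real n))))\<^sup>2) has_integral complex_of_real J) {-T..T}"
    by (rule has_integral_linear[OF hJ bounded_linear_of_real])
  then have "(f has_integral complex_of_real J) {-T..T}" unfolding o_def f_eq .
  then have J_eq: "of_real J = (\<Sum>m=1..N. \<Sum>n=1..N. \<alpha> m * cnj (\<alpha> n) * I m n)"
    using int_f by (simp add: integral_unique)
  have I_diag: "I m m = of_real (2 * T)" for m using T by (simp add: I_def l_def scaleR_conv_of_real)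
  have I_off: "norm (I m n) \<le> 2 * real N / \<bar>real m - real n\<bar>" if "m \<in> {1..N}" "n \<in> {1..N}" "m \<noteq> n" for m n
  proof -
    have lb: "\<bar>real m - real n\<bar> / real N \<le> \<bar>l m n\<bar>"
    proof -
      have *: "(real b - real a) / real N \<le> ln (real b) - ln (real a)" if "1 \<le> a" "a < b" "b \<le> N" for a b :: nat
      proof -
        have "ln (real a / real b) \<le> real a / real b - 1" using that by (intro ln_le_minus_one) auto
        then have "(real b - real a) / real b \<le> ln (real b) - ln (real a)" using that by (simp add: ln_div field_simps)
        moreover have "(real b - real a) / real N \<le> (real b - real a) / real b" using that by (intro divide_left_mono) auto
        ultimately show ?thesis by linarith
      qed
      show ?thesis
      proof (cases "m < n")
        case True
        have "(real n - real m) / real N \<le> ln (real n) - ln (real m)" using *[of m n] True that by auto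
        then show ?thesis using True by (simp add: l_def abs_if)
      next
        case False
        then have "n < m" using that by simp
        moreover have "(real m - real n) / real N \<le> ln (real m) - ln (real n)" using *[of n m] \<open>n < m\<close> that by auto
        ultimately show ?thesis by (simp add: l_def abs_if)
      qed
    qed
    have mn: "\<bar>real m - real n\<bar> > 0" using that by simp
    have l0: "\<bar>l m n\<bar> > 0" using lb mn N by (intro less_le_trans[OF _ lb]) auto
    have "((\<lambda>u. cis (u * l m n)) has_integral (- \<i> / of_real (l m n) * cis (T * l m n) - - \<i> / of_real (l m n) * cis (-T * l m n))) {-T..T}"
    proof (rule fundamental_theorem_of_calculus)
      fix x assume "x \<in> {-T..T}"
      show "((\<lambda>u. - \<i> / of_real (l m n) * cis (u * l m n)) has_vector_derivative cis (x * l m n)) (at x within {-T..T})"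
      proof -
        have "((\<lambda>z. - \<i> / of_real (l m n) * exp (\<i> * (z * of_real (l m n)))) has_field_derivative exp (\<i> * (of_real x * of_real (l m n)))) (at (of_real x))"
          using l0 by (auto intro!: derivative_eq_intros)
        from has_vector_derivative_real_field[OF this, of "{-T..T}"] show ?thesis by (simp add: cis_conv_exp)
      qed
    qed (use T in auto)
    then have "I m n = - \<i> / of_real (l m n) * cis (T * l m n) - - \<i> / of_real (l m n) * cis (-T * l m n)"
      unfolding I_def by (rule integral_unique)
    also have "norm \<dots> \<le> 1 / \<bar>l m n\<bar> + 1 / \<bar>l m n\<bar>"
      by (rule order_trans[OF norm_triangle_ineq4]) (simp add: norm_mult norm_divide)
    also have "\<dots> = 2 / \<bar>l m n\<bar>" by simp
    also have "\<dots> \<le> 2 / (\<bar>real m - real n\<bar> / real N)"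
      using lb mn l0 N by (intro divide_left_mono mult_pos_pos) auto
    finally show ?thesis by simp
  qed
  have harm_row: "(\<Sum>n\<in>{1..N}-{m}. 1 / \<bar>real m - real n\<bar>) \<le> 2 * (1 + ln (real N))" if m: "m \<in> {1..N}" for m
  proof -
    have hN: "(\<Sum>k=1..N. 1 / real k) \<le> 1 + ln (real N)"
      by (rule harmonic_sum_le[OF N])
    have split: "{1..N}-{m} = {1..<m} \<union> {m<..N}" using m by auto
    have "(\<Sum>n\<in>{1..N}-{m}. 1 / \<bar>real m - real n\<bar>) = (\<Sum>n\<in>{1..<m}. 1 / \<bar>real m - real n\<bar>) + (\<Sum>n\<in>{m<..N}. 1 / \<bar>real m - real n\<bar>)"
      unfolding split by (rule sum.union_disjoint) auto
    also have "(\<Sum>n\<in>{1..<m}. 1 / \<bar>real m - real n\<bar>) = (\<Sum>k\<in>{1..<m}. 1 / real k)"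
      by (rule sum.reindex_bij_witness[of _ "\<lambda>k. m - k" "\<lambda>n. m - n"]) (auto simp: of_nat_diff)
    also have "(\<Sum>n\<in>{m<..N}. 1 / \<bar>real m - real n\<bar>) = (\<Sum>k\<in>{1..N-m}. 1 / real k)"
      by (rule sum.reindex_bij_witness[of _ "\<lambda>k. m + k" "\<lambda>n. n - m"]) (auto simp: of_nat_diff)
    also have "(\<Sum>k\<in>{1..<m}. 1 / real k) + (\<Sum>k\<in>{1..N-m}. 1 / real k) \<le> (\<Sum>k=1..N. 1 / real k) + (\<Sum>k=1..N. 1 / real k)"
      using m by (intro add_mono sum_mono2) auto
    finally show ?thesis using hN by simp
  qed
  define G where "G = (\<Sum>n=1..N. (norm (\<alpha> n))\<^sup>2)"
  have "J \<le> norm (of_real J :: complex)" by simp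
  also have "\<dots> \<le> (\<Sum>m=1..N. \<Sum>n=1..N. norm (\<alpha> m) * norm (\<alpha> n) * norm (I m n))"
    unfolding J_eq by (rule order_trans[OF norm_sum], rule sum_mono, rule order_trans[OF norm_sum], rule sum_mono) (simp add: norm_mult)
  also have "\<dots> = (\<Sum>m=1..N. (norm (\<alpha> m))\<^sup>2 * (2 * T) + (\<Sum>n\<in>{1..N}-{m}. norm (\<alpha> m) * norm (\<alpha> n) * norm (I m n)))"
    using T by (intro sum.cong refl) (subst sum.remove, auto simp: I_diag power2_eq_square)
  also have "\<dots> = 2 * T * G + (\<Sum>m=1..N. \<Sum>n\<in>{1..N}-{m}. norm (\<alpha> m) * norm (\<alpha> n) * norm (I m n))"
    by (simp add: sum.distrib G_def sum_distrib_left mult_ac)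
  also have "(\<Sum>m=1..N. \<Sum>n\<in>{1..N}-{m}. norm (\<alpha> m) * norm (\<alpha> n) * norm (I m n)) \<le>
     (\<Sum>m=1..N. \<Sum>n\<in>{1..N}-{m}. ((norm (\<alpha> m))\<^sup>2 + (norm (\<alpha> n))\<^sup>2) * (real N / \<bar>real m - real n\<bar>))"
  proof (intro sum_mono)
    fix m n assume mn: "m \<in> {1..N}" "n \<in> {1..N}-{m}"
    have "2 * (norm (\<alpha> m) * norm (\<alpha> n)) \<le> (norm (\<alpha> m))\<^sup>2 + (norm (\<alpha> n))\<^sup>2"
      using sum_squares_bound[of "norm (\<alpha> m)" "norm (\<alpha> n)"] by simp
    then have am: "norm (\<alpha> m) * norm (\<alpha> n) \<le> ((norm (\<alpha> m))\<^sup>2 + (norm (\<alpha> n))\<^sup>2) / 2" by simp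
    have "norm (\<alpha> m) * norm (\<alpha> n) * norm (I m n) \<le> ((norm (\<alpha> m))\<^sup>2 + (norm (\<alpha> n))\<^sup>2) / 2 * (2 * real N / \<bar>real m - real n\<bar>)"
      using mn by (intro mult_mono am I_off) auto
    then show "norm (\<alpha> m) * norm (\<alpha> n) * norm (I m n) \<le> ((norm (\<alpha> m))\<^sup>2 + (norm (\<alpha> n))\<^sup>2) * (real N / \<bar>real m - real n\<bar>)" by simp
  qed
  also have "\<dots> = (\<Sum>m=1..N. \<Sum>n\<in>{1..N}-{m}. (norm (\<alpha> m))\<^sup>2 * (real N / \<bar>real m - real n\<bar>)) +
       (\<Sum>m=1..N. \<Sum>n\<in>{1..N}-{m}. (norm (\<alpha> n))\<^sup>2 * (real N / \<bar>real m - real n\<bar>))"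
    by (simp only: distrib_right sum.distrib)
  also have "(\<Sum>m=1..N. \<Sum>n\<in>{1..N}-{m}. (norm (\<alpha> n))\<^sup>2 * (real N / \<bar>real m - real n\<bar>)) =
       (\<Sum>n=1..N. \<Sum>m\<in>{1..N}-{n}. (norm (\<alpha> n))\<^sup>2 * (real N / \<bar>real m - real n\<bar>))"
  proof -
    have "(\<Sum>m=1..N. \<Sum>n\<in>{1..N}-{m}. g m n) = (\<Sum>n=1..N. \<Sum>m\<in>{1..N}-{n}. g m n)" for g :: "nat \<Rightarrow> nat \<Rightarrow> real"
    proof -
      have e: "{1..N}-{m} = {n \<in> {1..N}. m \<noteq> n}" "{1..N}-{m} = {n \<in> {1..N}. n \<noteq> m}" for m by auto
      show ?thesis unfolding e(1) by (subst sum.swap_restrict) (auto simp: e(2) intro!: sum.cong)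
    qed
    then show ?thesis .
  qed
  also have "\<dots> = (\<Sum>m=1..N. \<Sum>n\<in>{1..N}-{m}. (norm (\<alpha> m))\<^sup>2 * (real N / \<bar>real m - real n\<bar>))"
    by (simp add: abs_minus_commute)
  also have "(\<Sum>m=1..N. \<Sum>n\<in>{1..N}-{m}. (norm (\<alpha> m))\<^sup>2 * (real N / \<bar>real m - real n\<bar>)) \<le> (\<Sum>m=1..N. (norm (\<alpha> m))\<^sup>2 * (real N * (2 * (1 + ln (real N)))))"
  proof (rule sum_mono)
    fix m assume m: "m \<in> {1..N}"
    have "(\<Sum>n\<in>{1..N}-{m}. (norm (\<alpha> m))\<^sup>2 * (real N / \<bar>real m - real n\<bar>)) = (norm (\<alpha> m))\<^sup>2 * (real N * (\<Sum>n\<in>{1..N}-{m}. 1 / \<bar>real m - real n\<bar>))"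
      by (simp add: sum_distrib_left)
    also have "\<dots> \<le> (norm (\<alpha> m))\<^sup>2 * (real N * (2 * (1 + ln (real N))))"
      by (intro mult_left_mono harm_row m) auto
    finally show "(\<Sum>n\<in>{1..N}-{m}. (norm (\<alpha> m))\<^sup>2 * (real N / \<bar>real m - real n\<bar>)) \<le> (norm (\<alpha> m))\<^sup>2 * (real N * (2 * (1 + ln (real N))))" .
  qed
  also have "(\<Sum>m=1..N. (norm (\<alpha> m))\<^sup>2 * (real N * (2 * (1 + ln (real N))))) = G * (real N * (2 * (1 + ln (real N))))"
    by (simp add: G_def sum_distrib_right)
  finally have "J \<le> 2 * T * G + (G * (real N * (2 * (1 + ln (real N)))) + G * (real N * (2 * (1 + ln (real N)))))" by simp
  then show ?thesis unfolding J_def G_def by (simp add: algebra_simps)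
qed

section \<open>Large values on dyadic blocks\<close>

definition dyadic :: "real \<Rightarrow> nat set" where
  "dyadic M = {n. M < real n \<and> real n \<le> 2 * M}"

lemma dyadic_eq: "M \<ge> 0 \<Longrightarrow> dyadic M = {nat \<lfloor>M\<rfloor> + 1..nat \<lfloor>2 * M\<rfloor>}"
  unfolding dyadic_def by (auto simp: nat_le_iff le_nat_iff le_floor_iff floor_less_iff Suc_le_eq nat_less_iff)

lemma finite_dyadic: "finite (dyadic M)"
  by (rule finite_subset[of _ "{..nat \<lfloor>2 * M\<rfloor>}"]) (auto simp: dyadic_def le_nat_floor)

lemma card_dyadic: "M \<ge> 1 \<Longrightarrow> real (card (dyadic M)) \<le> 2 * M"
  by (subst dyadic_eq) (auto, linarith)

text \<open>Summation by parts removes the decreasing weight; conjugation reduces negative ordinates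
  to positive ones.\<close>

lemma kernel_bound_weighted:
  assumes M: "1 \<le> M" and s: "Re s \<ge> 2 * \<sigma>" "\<sigma> \<ge> 0" and t: "\<bar>Im s\<bar> \<ge> 1"
  shows "norm (\<Sum>n\<in>dyadic M. of_nat n powr (-s) :: complex) \<le> 113 * M powr (- 2 * \<sigma>) * (M / \<bar>Im s\<bar> + M powr (1/2) * \<bar>Im s\<bar> powr (1/6))"
proof -
  define a b where "a = nat \<lfloor>M\<rfloor> + 1" and "b = nat \<lfloor>2 * M\<rfloor>"
  define B where "B = 113 * (M / \<bar>Im s\<bar> + M powr (1/2) * \<bar>Im s\<bar> powr (1/6))"
  have B0: "B \<ge> 0" using M by (simp add: B_def)
  have D: "dyadic M = {a..b}" using M by (simp add: dyadic_eq a_def b_def)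
  have aM: "M \<le> real a" "a \<ge> 1" and bM: "real b \<le> 2 * M" using M unfolding a_def b_def by (simp_all, linarith+)
  show ?thesis
  proof (cases "a \<le> b")
    case True
    define w where "w n = real n powr (- Re s)" for n
    define z where "z n = cis (- (Im s * ln (real n)))" for n
    have bd: "norm (\<Sum>n=a..k. z n) \<le> B" if "a \<le> k" "k \<le> b" for k
    proof (cases "Im s > 0")
      case True
      show ?thesis using kernel_bound[OF M t aM(1), of k] that bM True by (simp add: z_def B_def)
    next
      case False
      have "(\<Sum>n=a..k. z n) = cnj (\<Sum>n=a..k. cis (- (\<bar>Im s\<bar> * ln (real n))))"
        using False by (simp add: z_def cis_cnj)
      then have "norm (\<Sum>n=a..k. z n) = norm (\<Sum>n=a..k. cis (- (\<bar>Im s\<bar> * ln (real n))))" by (simp only: complex_mod_cnj)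
      then show ?thesis using kernel_bound[OF M t aM(1), of k] that bM by (simp add: B_def)
    qed
    have "(\<Sum>n\<in>dyadic M. of_nat n powr (-s) :: complex) = (\<Sum>n=a..b. of_real (w n) * z n)"
      unfolding D w_def z_def using aM(2) by (intro sum.cong refl of_nat_powr_cis) auto
    also have "norm \<dots> \<le> w a * B"
    proof (rule abel_summation_bound[OF True _ _ bd])
      show "w (Suc n) \<le> w n" if "a \<le> n" for n
        unfolding w_def using that aM(2) s by (intro powr_mono2') auto
    qed (auto simp: w_def)
    also have "w a * B \<le> M powr (- 2 * \<sigma>) * B"
    proof (rule mult_right_mono[OF _ B0])
      have "w a \<le> M powr (- Re s)" unfolding w_def using aM M s by (intro powr_mono2') auto
      also have "\<dots> \<le> M powr (- 2 * \<sigma>)" using M s by (intro powr_mono) auto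
      finally show "w a \<le> M powr (- 2 * \<sigma>)" .
    qed
    finally show ?thesis by (simp only: B_def mult_ac)
  next
    case False
    then show ?thesis using M by (simp add: D)
  qed
qed

lemma card_le_fibres:
  fixes f :: "'a \<Rightarrow> int"
  assumes fin: "finite R" and rng: "\<And>x. x \<in> R \<Longrightarrow> a \<le> f x \<and> f x \<le> b" and ab: "a \<le> b"
    and fib: "\<And>j. real (card {x \<in> R. f x = j}) \<le> B"
  shows "real (card R) \<le> real_of_int (b - a + 1) * B"
proof -
  have "R = (\<Union>j\<in>{a..b}. {x \<in> R. f x = j})" using rng by auto
  then have "card R \<le> (\<Sum>j\<in>{a..b}. card {x \<in> R. f x = j})" using card_UN_le[of "{a..b}" "\<lambda>j. {x \<in> R. f x = j}"] by simp
  then have "real (card R) \<le> (\<Sum>j\<in>{a..b}. real (card {x \<in> R. f x = j}))" unfolding of_nat_sum[symmetric] by (rule of_nat_mono)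
  also have "\<dots> \<le> (\<Sum>j\<in>{a..b}. B)" by (intro sum_mono fib)
  also have "\<dots> = real_of_int (b - a + 1) * B" using ab by simp
  finally show ?thesis .
qed

text \<open>On each side of x the integer parts of the distances are distinct, so the reciprocals
  are dominated by a harmonic sum.\<close>

lemma sum_inverse_spaced:
  fixes R :: "complex set"
  assumes fin: "finite R" and spaced: "\<And>x y. x \<in> R \<Longrightarrow> y \<in> R \<Longrightarrow> x \<noteq> y \<Longrightarrow> 1 \<le> \<bar>Im x - Im y\<bar> \<and> \<bar>Im x - Im y\<bar> \<le> T"
    and x: "x \<in> R" and T: "T \<ge> 1"
  shows "(\<Sum>y\<in>R - {x}. 1 / \<bar>Im x - Im y\<bar>) \<le> 2 * (1 + ln T)"
proof -
  define L where "L = nat \<lfloor>T\<rfloor>"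
  have L: "L \<ge> 1" "real L \<le> T" using T by (auto simp: L_def le_nat_floor)
  have harmL: "(\<Sum>k=1..L. 1 / real k) \<le> 1 + ln T"
  proof -
    have "(\<Sum>k=1..L. 1 / real k) \<le> ln (real L) + 1"
      using harmonic_sum_le[of L] L by simp
    also have "ln (real L) \<le> ln T" using L by (intro ln_mono) auto
    finally show ?thesis by simp
  qed
  have half: "(\<Sum>y\<in>S. 1 / \<bar>Im x - Im y\<bar>) \<le> 1 + ln T"
    if S: "S \<subseteq> R - {x}" and side: "(\<forall>y\<in>S. Im y > Im x) \<or> (\<forall>y\<in>S. Im y < Im x)" for S
  proof -
    define f where "f y = nat \<lfloor>\<bar>Im x - Im y\<bar>\<rfloor>" for y
    have sp: "1 \<le> \<bar>Im x - Im y\<bar>" "\<bar>Im x - Im y\<bar> \<le> T" if "y \<in> S" for y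
      using spaced[OF x, of y] S that by auto
    have fb: "1 \<le> f y" "f y \<le> L" "real (f y) \<le> \<bar>Im x - Im y\<bar>" if "y \<in> S" for y
      using sp[OF that] by (auto simp: f_def L_def le_nat_floor intro!: nat_mono floor_mono)
    have inj: "inj_on f S"
    proof (rule inj_onI, rule ccontr)
      fix y z assume yz: "y \<in> S" "z \<in> S" "f y = f z" "y \<noteq> z"
      have "1 \<le> \<bar>Im y - Im z\<bar>" using spaced[of y z] yz S by auto
      moreover have "\<bar>\<bar>Im x - Im y\<bar> - \<bar>Im x - Im z\<bar>\<bar> = \<bar>Im y - Im z\<bar>" using side yz by (auto simp: abs_if)
      moreover have "\<lfloor>\<bar>Im x - Im y\<bar>\<rfloor> = \<lfloor>\<bar>Im x - Im z\<bar>\<rfloor>"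
        using yz(3) unfolding f_def by (subst (asm) eq_nat_nat_iff) auto
      then have "\<bar>\<bar>Im x - Im y\<bar> - \<bar>Im x - Im z\<bar>\<bar> < 1" by linarith
      ultimately show False by linarith
    qed
    have "(\<Sum>y\<in>S. 1 / \<bar>Im x - Im y\<bar>) \<le> (\<Sum>y\<in>S. 1 / real (f y))"
    proof (rule sum_mono)
      fix y assume "y \<in> S"
      then show "1 / \<bar>Im x - Im y\<bar> \<le> 1 / real (f y)" using fb[of y] by (intro divide_left_mono) auto
    qed
    also have "\<dots> = (\<Sum>k\<in>f ` S. 1 / real k)" by (simp add: sum.reindex[OF inj])
    also have "\<dots> \<le> (\<Sum>k=1..L. 1 / real k)" using fb by (intro sum_mono2) auto
    finally show ?thesis using harmL by simp
  qed
  define S1 S2 where "S1 = {y \<in> R - {x}. Im y > Im x}" and "S2 = {y \<in> R - {x}. Im y < Im x}"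
  have "Im y \<noteq> Im x" if "y \<in> R - {x}" for y using spaced[OF x, of y] that by auto
  then have "R - {x} = S1 \<union> S2" by (fastforce simp: S1_def S2_def)
  moreover have "S1 \<inter> S2 = {}" "finite S1" "finite S2" using fin by (auto simp: S1_def S2_def)
  ultimately have "(\<Sum>y\<in>R - {x}. 1 / \<bar>Im x - Im y\<bar>) = (\<Sum>y\<in>S1. 1 / \<bar>Im x - Im y\<bar>) + (\<Sum>y\<in>S2. 1 / \<bar>Im x - Im y\<bar>)"
    by (simp only: sum.union_disjoint)
  then show ?thesis unfolding mult_2
    by (simp only:) (intro add_mono half, auto simp: S1_def S2_def)
qed

text \<open>Duality: unimodular factors align the values, Cauchy-Schwarz over n separates the
  coefficients, and the opened square is a sum of kernel sums over pairs of points. Distances are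
  bounded twice because T1 enters only through a logarithm, whereas T0, the window length, limits
  the term with exponent 1/6.\<close>

lemma halasz_montgomery:
  fixes R :: "complex set" and \<alpha> :: "nat \<Rightarrow> complex"
  assumes fin: "finite R" and M: "1 \<le> M" and \<sigma>: "0 \<le> \<sigma>" and V: "0 \<le> V"
    and Re: "\<And>x. x \<in> R \<Longrightarrow> \<sigma> \<le> Re x"
    and spaced: "\<And>x y. x \<in> R \<Longrightarrow> y \<in> R \<Longrightarrow> x \<noteq> y \<Longrightarrow> 1 \<le> \<bar>Im x - Im y\<bar> \<and> \<bar>Im x - Im y\<bar> \<le> T1 \<and> \<bar>Im x - Im y\<bar> \<le> T0"
    and T1: "T1 \<ge> 1"
    and large: "\<And>x. x \<in> R \<Longrightarrow> V \<le> norm (\<Sum>n\<in>dyadic M. \<alpha> n * of_nat n powr (-x))"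
  shows "real (card R) * V\<^sup>2 \<le> (\<Sum>n\<in>dyadic M. (norm (\<alpha> n))\<^sup>2) * M powr (-2 * \<sigma>) *
           (228 * M * (1 + ln T1) + 113 * real (card R) * (M powr (1/2) * T0 powr (1/6)))"
proof (cases "R = {}")
  case True
  then show ?thesis using M T1 by (auto intro!: mult_nonneg_nonneg sum_nonneg)
next
  case False
  define D where "D = dyadic M"
  have Dpos: "n \<ge> 1" if "n \<in> D" for n using that M by (auto simp: D_def dyadic_def Suc_le_eq)
  define Q where "Q x = (\<Sum>n\<in>D. \<alpha> n * of_nat n powr (-x))" for x :: complex
  \<comment> \<open>The value 1 is a filler for points with \<open>Q x = 0\<close>, where any number
    of modulus 1 will do.\<close>
  define \<theta> where "\<theta> x = (if Q x = 0 then 1 else cnj (Q x) / norm (Q x))" for x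
  have \<theta>: "norm (\<theta> x) = 1" "\<theta> x * Q x = of_real (norm (Q x))" for x
    using complex_norm_square[of "Q x"] by (auto simp: \<theta>_def norm_divide power2_eq_square field_simps)
  define Y where "Y n = (\<Sum>x\<in>R. \<theta> x * of_nat n powr (-x))" for n :: nat
  define K where "K x y = (\<Sum>n\<in>D. of_nat n powr (-(x + cnj y)) :: complex)" for x y
  define G where "G = (\<Sum>n\<in>D. (norm (\<alpha> n))\<^sup>2)"
  define r where "r = real (card R)"
  have r0: "r > 0" using False fin by (simp add: r_def card_gt_0_iff)
  have G0: "G \<ge> 0" by (simp add: G_def sum_nonneg)
  have "of_real (\<Sum>x\<in>R. norm (Q x)) = (\<Sum>x\<in>R. \<theta> x * Q x)" by (simp add: \<theta>(2))
  also have "\<dots> = (\<Sum>n\<in>D. \<alpha> n * Y n)"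
    unfolding Q_def Y_def sum_distrib_left by (subst sum.swap) (simp add: mult_ac)
  finally have eq: "of_real (\<Sum>x\<in>R. norm (Q x)) = (\<Sum>n\<in>D. \<alpha> n * Y n)" .
  have "r * V \<le> (\<Sum>x\<in>R. norm (Q x))"
    using sum_mono[of R "\<lambda>_. V" "\<lambda>x. norm (Q x)"] large by (simp add: r_def Q_def D_def)
  also have "\<dots> = norm (of_real (\<Sum>x\<in>R. norm (Q x)) :: complex)" by (simp only: norm_of_real) (simp add: sum_nonneg)
  also have "\<dots> \<le> (\<Sum>n\<in>D. norm (\<alpha> n) * norm (Y n))"
    unfolding eq by (rule order_trans[OF norm_sum]) (simp add: norm_mult)
  finally have "(r * V)\<^sup>2 \<le> (\<Sum>n\<in>D. norm (\<alpha> n) * norm (Y n))\<^sup>2" using r0 V by (intro power_mono) auto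
  also have "\<dots> \<le> G * (\<Sum>n\<in>D. (norm (Y n))\<^sup>2)" unfolding G_def by (rule Cauchy_Schwarz_ineq_sum)
  finally have 1: "(r * V)\<^sup>2 \<le> G * (\<Sum>n\<in>D. (norm (Y n))\<^sup>2)" .
  define m2 where "m2 = M powr (-2 * \<sigma>)"
  define E where "E = M powr (1/2) * T0 powr (1/6)"
  have nonneg: "m2 \<ge> 0" "E \<ge> 0" by (auto simp: m2_def E_def)
  have diag: "norm (K x x) \<le> m2 * (2 * M)" if "x \<in> R" for x
  proof -
    have "norm (K x x) \<le> (\<Sum>n\<in>D. m2)"
      unfolding K_def
    proof (rule sum_norm_le)
      fix n assume n: "n \<in> D"
      have "norm (of_nat n powr (-(x + cnj x)) :: complex) = real n powr (- (2 * Re x))"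
        by (subst norm_of_nat_powr) simp
      also have "\<dots> \<le> real n powr (-2 * \<sigma>)" using Re[OF that] Dpos[OF n] by (intro powr_mono) auto
      also have "\<dots> \<le> m2" unfolding m2_def using n M \<sigma> by (intro powr_mono2') (auto simp: D_def dyadic_def)
      finally show "norm (of_nat n powr (-(x + cnj x)) :: complex) \<le> m2" .
    qed
    also have "\<dots> = real (card D) * m2" by simp
    also have "\<dots> \<le> (2 * M) * m2" using card_dyadic[OF M] nonneg by (intro mult_right_mono) (auto simp: D_def)
    finally show ?thesis by (simp add: mult.commute)
  qed
  have off: "norm (K x y) \<le> m2 * (113 * M * (1 / \<bar>Im x - Im y\<bar>) + 113 * E)" if xy: "x \<in> R" "y \<in> R" "x \<noteq> y" for x y
  proof -
    have sp: "1 \<le> \<bar>Im x - Im y\<bar>" "\<bar>Im x - Im y\<bar> \<le> T0" using spaced[OF xy] by auto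
    have "norm (K x y) \<le> 113 * M powr (- 2 * \<sigma>) * (M / \<bar>Im (x + cnj y)\<bar> + M powr (1/2) * \<bar>Im (x + cnj y)\<bar> powr (1/6))"
      unfolding K_def D_def
      by (rule kernel_bound_weighted[OF M]) (use Re[OF xy(1)] Re[OF xy(2)] \<sigma> sp in auto)
    also have "\<dots> = m2 * (113 * M * (1 / \<bar>Im x - Im y\<bar>) + 113 * (M powr (1/2) * \<bar>Im x - Im y\<bar> powr (1/6)))"
      by (simp add: m2_def algebra_simps)
    also have "\<dots> \<le> m2 * (113 * M * (1 / \<bar>Im x - Im y\<bar>) + 113 * E)"
      unfolding E_def using sp nonneg by (intro mult_left_mono add_left_mono powr_mono2) auto
    finally show ?thesis .
  qed
  have "(\<Sum>n\<in>D. (norm (Y n))\<^sup>2) \<le> r * (m2 * (228 * M * (1 + ln T1) + 113 * r * E))"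
  proof -
    have "complex_of_real (\<Sum>n\<in>D. (norm (Y n))\<^sup>2) = (\<Sum>n\<in>D. Y n * cnj (Y n))"
      by (simp only: of_real_sum complex_norm_square)
    also have "\<dots> = (\<Sum>n\<in>D. \<Sum>x\<in>R. \<Sum>y\<in>R. \<theta> x * cnj (\<theta> y) * of_nat n powr (-(x + cnj y)))"
    proof (intro sum.cong refl)
      fix n assume n: "n \<in> D"
      have cn: "cnj (of_nat n powr (-y)) = of_nat n powr (- cnj y)" for y
        using Dpos[OF n] by (simp add: powr_def Ln_of_nat exp_cnj)
      have pn: "(of_nat n :: complex) powr (-(x + cnj y)) = of_nat n powr (-x) * of_nat n powr (- cnj y)" for x y
        using powr_add[of "of_nat n :: complex" "-x" "- cnj y"] by simp
      show "Y n * cnj (Y n) = (\<Sum>x\<in>R. \<Sum>y\<in>R. \<theta> x * cnj (\<theta> y) * of_nat n powr (-(x + cnj y)))"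
        unfolding Y_def cnj_sum sum_product
        by (intro sum.cong refl) (simp only: pn, simp add: cn mult_ac)
    qed
    also have "\<dots> = (\<Sum>x\<in>R. \<Sum>y\<in>R. \<theta> x * cnj (\<theta> y) * K x y)"
      unfolding K_def sum_distrib_left by (subst sum.swap, intro sum.cong refl, rule sum.swap)
    finally have eq2: "complex_of_real (\<Sum>n\<in>D. (norm (Y n))\<^sup>2) = (\<Sum>x\<in>R. \<Sum>y\<in>R. \<theta> x * cnj (\<theta> y) * K x y)" .
    have "(\<Sum>n\<in>D. (norm (Y n))\<^sup>2) = norm (complex_of_real (\<Sum>n\<in>D. (norm (Y n))\<^sup>2))"
      by (simp only: norm_of_real) (simp add: sum_nonneg)
    also have "\<dots> \<le> (\<Sum>x\<in>R. \<Sum>y\<in>R. norm (K x y))"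
      unfolding eq2 by (rule order_trans[OF norm_sum], rule sum_mono, rule order_trans[OF norm_sum], rule sum_mono) (simp add: norm_mult \<theta>)
    also have "\<dots> \<le> (\<Sum>x\<in>R. m2 * (228 * M * (1 + ln T1) + 113 * r * E))"
    proof (rule sum_mono)
      fix x assume x: "x \<in> R"
      have "(\<Sum>y\<in>R. norm (K x y)) = norm (K x x) + (\<Sum>y\<in>R - {x}. norm (K x y))"
        using x fin by (simp add: sum.remove)
      also have "\<dots> \<le> m2 * (2 * M) + (\<Sum>y\<in>R - {x}. m2 * (113 * M * (1 / \<bar>Im x - Im y\<bar>) + 113 * E))"
        using x by (intro add_mono diag sum_mono off) auto
      also have "(\<Sum>y\<in>R - {x}. m2 * (113 * M * (1 / \<bar>Im x - Im y\<bar>) + 113 * E)) =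
          m2 * (113 * M * (\<Sum>y\<in>R - {x}. 1 / \<bar>Im x - Im y\<bar>) + real (card (R - {x})) * (113 * E))"
        by (simp only: sum_distrib_left[symmetric] sum.distrib sum_constant of_nat_mult mult.assoc) (simp only: mult.left_commute)
      also have "m2 * (2 * M) + \<dots> \<le> m2 * (2 * M) + m2 * (113 * M * (2 * (1 + ln T1)) + r * (113 * E))"
        using nonneg M fin spaced x T1 unfolding r_def
        by (intro add_left_mono mult_left_mono add_mono sum_inverse_spaced[of R T1 x] mult_right_mono) (auto intro!: card_mono)
      also have "\<dots> = m2 * (2 * M + 226 * M * (1 + ln T1) + 113 * r * E)" by (simp add: algebra_simps)
      \<comment> \<open>The constant 228 is 2 from the diagonal plus twice 113 from the
        pairs.\<close>
      also have "\<dots> \<le> m2 * (228 * M * (1 + ln T1) + 113 * r * E)"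
      proof (rule mult_left_mono)
        have "2 * M * 1 \<le> 2 * M * (1 + ln T1)" using M T1 by (intro mult_left_mono) auto
        then show "2 * M + 226 * M * (1 + ln T1) + 113 * r * E \<le> 228 * M * (1 + ln T1) + 113 * r * E" by (simp add: algebra_simps)
      qed (rule nonneg)
      finally show "(\<Sum>y\<in>R. norm (K x y)) \<le> m2 * (228 * M * (1 + ln T1) + 113 * r * E)" .
    qed
    finally show ?thesis by (simp add: r_def)
  qed
  then have "(r * V)\<^sup>2 \<le> G * (r * (m2 * (228 * M * (1 + ln T1) + 113 * r * E)))"
    using 1 G0 by (meson mult_left_mono order_trans)
  then have "r * (r * V\<^sup>2) \<le> r * (G * m2 * (228 * M * (1 + ln T1) + 113 * r * E))"
    by (simp add: power2_eq_square mult_ac)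
  then have "r * V\<^sup>2 \<le> G * m2 * (228 * M * (1 + ln T1) + 113 * r * E)" using r0 by simp
  then show ?thesis by (simp only: r_def G_def m2_def E_def D_def)
qed

text \<open>Huxley's subdivision: the ordinates are cut into windows of length T0, each of which
  holds about \<open>M powr (2 - 2 * \<sigma>)\<close> points; the number of windows is about 1 + T
  / T0, and the quotient produces the second term.\<close>

lemma large_values_spaced:
  fixes \<kappa> :: real
  assumes \<kappa>: "0 < \<kappa>" "\<kappa> \<le> 1/100"
  shows "\<exists>Ts\<ge>1. \<forall>T\<ge>Ts. \<forall>M \<sigma> R \<alpha>. T powr (1/2) \<le> M \<longrightarrow> 9/10 \<le> \<sigma> \<longrightarrow> \<sigma> \<le> 1 \<longrightarrow> finite R \<longrightarrow>
     (\<forall>x\<in>R. \<sigma> \<le> Re x \<and> \<bar>Im x\<bar> \<le> T) \<longrightarrow> (\<forall>x\<in>R. \<forall>y\<in>R. x \<noteq> y \<longrightarrow> 1 \<le> \<bar>Im x - Im y\<bar>) \<longrightarrow>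
     (\<forall>n\<in>dyadic M. norm (\<alpha> n :: complex) \<le> T powr \<kappa>) \<longrightarrow>
     (\<forall>x\<in>R. T powr (-\<kappa>) \<le> norm (\<Sum>n\<in>dyadic M. \<alpha> n * of_nat n powr (-x))) \<longrightarrow>
     real (card R) \<le> 1824 * T powr (5 * \<kappa>) * (M powr (2 - 2 * \<sigma>) + T powr (1 + 30 * \<kappa>) * M powr (11 - 14 * \<sigma>))"
proof -
  have "eventually (\<lambda>T::real. 1 + ln (2 * T) \<le> T powr \<kappa>) at_top" using \<kappa> by real_asymp
  moreover have "eventually (\<lambda>T::real. 226 * T powr (-\<kappa>) \<le> 1/2) at_top" using \<kappa> by real_asymp
  ultimately have "eventually (\<lambda>T::real. 1 + ln (2 * T) \<le> T powr \<kappa> \<and> 226 * T powr (-\<kappa>) \<le> 1/2) at_top" by (rule eventually_conj)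
  then obtain Ts0 where Ts0: "\<And>T::real. T \<ge> Ts0 \<Longrightarrow> 1 + ln (2 * T) \<le> T powr \<kappa> \<and> 226 * T powr (-\<kappa>) \<le> 1/2"
    by (auto simp: eventually_at_top_linorder)
  show ?thesis
  proof (rule exI[of _ "max Ts0 1"], intro conjI allI impI)
    fix T M \<sigma> :: real and R :: "complex set" and \<alpha> :: "nat \<Rightarrow> complex"
    assume TT: "max Ts0 1 \<le> T" and M: "T powr (1/2) \<le> M" and \<sigma>: "9/10 \<le> \<sigma>" "\<sigma> \<le> 1" and fin: "finite R"
      and R: "\<forall>x\<in>R. \<sigma> \<le> Re x \<and> \<bar>Im x\<bar> \<le> T" and sp: "\<forall>x\<in>R. \<forall>y\<in>R. x \<noteq> y \<longrightarrow> 1 \<le> \<bar>Im x - Im y\<bar>"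
      and \<alpha>: "\<forall>n\<in>dyadic M. norm (\<alpha> n) \<le> T powr \<kappa>"
      and large: "\<forall>x\<in>R. T powr (-\<kappa>) \<le> norm (\<Sum>n\<in>dyadic M. \<alpha> n * of_nat n powr (-x))"
    have T: "T \<ge> 1" "1 + ln (2 * T) \<le> T powr \<kappa>" "226 * T powr (-\<kappa>) \<le> 1/2" using TT Ts0[of T] by auto
    have "1 \<le> T powr (1/2)" using T by (simp add: ge_one_powr_ge_zero)
    then have M1: "M \<ge> 1" using M by linarith
    text \<open>This window length makes the off-diagonal terms an arbitrarily small proportion of the left-hand side.\<close>
    define T0 where "T0 = M powr (12 * \<sigma> - 9) * T powr (- 30 * \<kappa>)"
    have T0pos: "T0 > 0" using M1 T by (simp add: T0_def)
    define B where "B = 912 * T powr (5 * \<kappa>) * M powr (2 - 2 * \<sigma>)"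
    have B0: "B \<ge> 0" by (simp add: B_def)
    have T0root: "T0 powr (1/6) = M powr (2 * \<sigma> - 3/2) * T powr (-5 * \<kappa>)"
      using M1 T by (simp add: T0_def powr_mult powr_powr diff_divide_distrib)
    have fibre: "real (card {x \<in> R. \<lfloor>Im x / T0\<rfloor> = j}) \<le> B" for j
    proof -
      define S where "S = {x \<in> R. \<lfloor>Im x / T0\<rfloor> = j}"
      define n where "n = real (card S)"
      have finS: "finite S" using fin by (simp add: S_def)
      have "real (card S) * (T powr (-\<kappa>))\<^sup>2 \<le> (\<Sum>n\<in>dyadic M. (norm (\<alpha> n))\<^sup>2) * M powr (-2 * \<sigma>) *
           (228 * M * (1 + ln (2 * T)) + 113 * real (card S) * (M powr (1/2) * T0 powr (1/6)))"
      proof (rule halasz_montgomery[OF finS M1])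
        fix x y assume xy: "x \<in> S" "y \<in> S" "x \<noteq> y"
        have "\<bar>Im x / T0 - Im y / T0\<bar> < 1" using xy by (auto simp: S_def) linarith
        then have "\<bar>Im x - Im y\<bar> / T0 < 1" using T0pos by (simp add: diff_divide_distrib[symmetric] abs_divide)
        then have "\<bar>Im x - Im y\<bar> \<le> T0" using T0pos by (simp add: field_simps)
        moreover have "\<bar>Im x\<bar> \<le> T" "\<bar>Im y\<bar> \<le> T" using xy R by (auto simp: S_def)
        then have "\<bar>Im x - Im y\<bar> \<le> 2 * T" by linarith
        ultimately show "1 \<le> \<bar>Im x - Im y\<bar> \<and> \<bar>Im x - Im y\<bar> \<le> 2 * T \<and> \<bar>Im x - Im y\<bar> \<le> T0"
          using xy sp by (auto simp: S_def)
      qed (use \<sigma> R large T in \<open>auto simp: S_def\<close>)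
      also have "\<dots> \<le> (2 * M * T powr (2 * \<kappa>)) * M powr (-2 * \<sigma>) *
           (228 * M * T powr \<kappa> + 113 * n * (M powr (1/2) * T0 powr (1/6)))"
      proof (intro mult_mono add_mono mult_right_mono)
        have "(\<Sum>n\<in>dyadic M. (norm (\<alpha> n))\<^sup>2) \<le> (\<Sum>n\<in>dyadic M. (T powr \<kappa>)\<^sup>2)"
          using \<alpha> by (intro sum_mono power_mono) auto
        also have "\<dots> = real (card (dyadic M)) * T powr (2 * \<kappa>)" using T by (simp add: powr_power mult.commute)
        also have "\<dots> \<le> 2 * M * T powr (2 * \<kappa>)" using card_dyadic[OF M1] by (intro mult_right_mono) auto
        finally show "(\<Sum>n\<in>dyadic M. (norm (\<alpha> n))\<^sup>2) \<le> 2 * M * T powr (2 * \<kappa>)" .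
        show "0 \<le> 228 * M * (1 + ln (2 * T)) + 113 * real (card S) * (M powr (1/2) * T0 powr (1/6))"
          using M1 T by (intro add_nonneg_nonneg mult_nonneg_nonneg) auto
      qed (use M1 T in \<open>auto simp: n_def\<close>)
      also have "\<dots> = 456 * (M powr (2 - 2 * \<sigma>) * T powr (3 * \<kappa>)) + 226 * n * T powr (-3 * \<kappa>)"
      proof -
        have M1': "M = M powr 1" using M1 by simp
        have e1: "M * M powr (-2 * \<sigma>) * M = M powr (2 - 2 * \<sigma>)"
          using M1 by (subst (1 3) M1') (simp only: powr_add[symmetric], simp)
        have e2: "M * M powr (-2 * \<sigma>) * (M powr (1/2) * M powr (2 * \<sigma> - 3/2)) = 1"
          using M1 by (subst (1) M1') (simp only: powr_add[symmetric], simp)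
        have e3: "T powr (2 * \<kappa>) * T powr \<kappa> = T powr (3 * \<kappa>)" "T powr (2 * \<kappa>) * T powr (-5 * \<kappa>) = T powr (-3 * \<kappa>)"
          by (simp_all add: powr_add[symmetric])
        have "(2 * M * T powr (2 * \<kappa>)) * M powr (-2 * \<sigma>) * (228 * M * T powr \<kappa> + 113 * n * (M powr (1/2) * T0 powr (1/6)))
          = 456 * ((M * M powr (-2 * \<sigma>) * M) * (T powr (2 * \<kappa>) * T powr \<kappa>)) +
            226 * n * ((M * M powr (-2 * \<sigma>) * (M powr (1/2) * M powr (2 * \<sigma> - 3/2))) * (T powr (2 * \<kappa>) * T powr (-5 * \<kappa>)))"
          unfolding T0root by (simp add: distrib_left mult_ac)
        then show ?thesis unfolding e1 e2 e3 by simp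
      qed
      finally have "T powr (2 * \<kappa>) * (n * (T powr (-\<kappa>))\<^sup>2) \<le> T powr (2 * \<kappa>) * (456 * (M powr (2 - 2 * \<sigma>) * T powr (3 * \<kappa>)) + 226 * n * T powr (-3 * \<kappa>))"
        unfolding n_def by (rule mult_left_mono) simp
      moreover have "T powr (2 * \<kappa>) * (n * (T powr (-\<kappa>))\<^sup>2) = n"
        using T by (simp add: powr_power powr_add[symmetric])
      moreover have "T powr (2 * \<kappa>) * (456 * (M powr (2 - 2 * \<sigma>) * T powr (3 * \<kappa>)) + 226 * n * T powr (-3 * \<kappa>)) =
         456 * M powr (2 - 2 * \<sigma>) * (T powr (2 * \<kappa>) * T powr (3 * \<kappa>)) + n * (226 * (T powr (2 * \<kappa>) * T powr (-3 * \<kappa>)))"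
        by (simp only: distrib_left mult_ac)
      moreover have "T powr (2 * \<kappa>) * T powr (3 * \<kappa>) = T powr (5 * \<kappa>)" "T powr (2 * \<kappa>) * T powr (-3 * \<kappa>) = T powr (-\<kappa>)"
        by (simp_all add: powr_add[symmetric])
      ultimately have "n \<le> 456 * M powr (2 - 2 * \<sigma>) * T powr (5 * \<kappa>) + n * (226 * T powr (-\<kappa>))" by simp
      also have "n * (226 * T powr (-\<kappa>)) \<le> n * (1/2)" using T(3) by (intro mult_left_mono) (auto simp: n_def)
      finally have "n \<le> 912 * M powr (2 - 2 * \<sigma>) * T powr (5 * \<kappa>)" by simp
      then show ?thesis by (simp add: n_def S_def B_def mult_ac)
    qed
    have T0ge: "T0 powr (-1) = M powr (9 - 12 * \<sigma>) * T powr (30 * \<kappa>)"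
    proof -
      have "T0 * (M powr (9 - 12 * \<sigma>) * T powr (30 * \<kappa>)) = M powr ((12 * \<sigma> - 9) + (9 - 12 * \<sigma>)) * T powr (- 30 * \<kappa> + 30 * \<kappa>)"
        by (simp only: T0_def powr_add mult_ac)
      also have "\<dots> = 1" using M1 T by simp
      finally show ?thesis using T0pos by (simp add: powr_minus_divide divide_eq_eq mult.commute)
    qed
    have "real (card R) \<le> real_of_int (\<lfloor>T / T0\<rfloor> - \<lfloor>- T / T0\<rfloor> + 1) * B"
    proof (rule card_le_fibres[OF fin _ _ fibre])
      fix x assume "x \<in> R"
      then have "\<bar>Im x\<bar> \<le> T" using R by auto
      then show "\<lfloor>- T / T0\<rfloor> \<le> \<lfloor>Im x / T0\<rfloor> \<and> \<lfloor>Im x / T0\<rfloor> \<le> \<lfloor>T / T0\<rfloor>"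
        using T0pos by (intro conjI floor_mono divide_right_mono) auto
    qed (use T T0pos in \<open>auto intro!: floor_mono divide_right_mono\<close>)
    also have "\<dots> \<le> (2 * (T / T0) + 2) * B"
    proof (rule mult_right_mono[OF _ B0])
      have "real_of_int \<lfloor>y\<rfloor> - real_of_int \<lfloor>-y\<rfloor> \<le> 1 + 2 * y" for y :: real by linarith
      from this[of "T / T0"] show "real_of_int (\<lfloor>T / T0\<rfloor> - \<lfloor>- T / T0\<rfloor> + 1) \<le> 2 * (T / T0) + 2" by simp
    qed
    also have "\<dots> = 1824 * T powr (5 * \<kappa>) * (M powr (2 - 2 * \<sigma>) + (T * T0 powr (-1)) * M powr (2 - 2 * \<sigma>))"
      using T0pos by (simp add: B_def algebra_simps powr_minus_divide)
    also have "(T * T0 powr (-1)) * M powr (2 - 2 * \<sigma>) = T powr (1 + 30 * \<kappa>) * M powr (11 - 14 * \<sigma>)"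
    proof -
      have "T powr (1 + 30 * \<kappa>) = T * T powr (30 * \<kappa>)" using T by (simp add: powr_add)
      moreover have "M powr (9 - 12 * \<sigma>) * M powr (2 - 2 * \<sigma>) = M powr (11 - 14 * \<sigma>)" by (simp add: powr_add[symmetric])
      ultimately show ?thesis unfolding T0ge by (simp add: mult_ac)
    qed
    finally show "real (card R) \<le> 1824 * T powr (5 * \<kappa>) * (M powr (2 - 2 * \<sigma>) + T powr (1 + 30 * \<kappa>) * M powr (11 - 14 * \<sigma>))" .
  qed simp
qed

section \<open>Dyadic decomposition and powers of blocks\<close>

lemma dyadic_split:
  assumes "A > 0"
  shows "(\<Sum>n | A < real n \<and> real n \<le> 2 ^ I * A. f n) = (\<Sum>i<I. \<Sum>n\<in>dyadic (2 ^ i * A). f n :: 'a::comm_monoid_add)"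
proof (induction I)
  case 0
  have "{n. A < real n \<and> real n \<le> 2 ^ 0 * A} = {}" by auto
  then show ?case by (simp only: sum.empty lessThan_0)
next
  case (Suc I)
  have le: "A \<le> 2 ^ I * A" using assms by (simp add: mult_le_cancel_right1)
  have eq: "{n. A < real n \<and> real n \<le> 2 ^ Suc I * A} = {n. A < real n \<and> real n \<le> 2 ^ I * A} \<union> dyadic (2 ^ I * A)"
  proof (intro set_eqI iffI)
    fix n assume n: "n \<in> {n. A < real n \<and> real n \<le> 2 ^ I * A} \<union> dyadic (2 ^ I * A)"
    have "2 ^ I * A \<le> 2 * (2 ^ I * A)" using assms by simp
    then show "n \<in> {n. A < real n \<and> real n \<le> 2 ^ Suc I * A}" using n le by (auto simp: dyadic_def)
  qed (auto simp: dyadic_def)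
  have fin: "finite {n. A < real n \<and> real n \<le> 2 ^ I * A}"
    by (rule finite_subset[of _ "{..nat \<lfloor>2 ^ I * A\<rfloor>}"]) (auto simp: le_nat_floor)
  have "{n. A < real n \<and> real n \<le> 2 ^ I * A} \<inter> dyadic (2 ^ I * A) = {}" by (auto simp: dyadic_def)
  then show ?case unfolding eq using Suc.IH by (subst sum.union_disjoint[OF fin finite_dyadic]) auto
qed

lemma norm_sum_pigeonhole:
  assumes "c \<le> norm (\<Sum>i<I. z i :: 'a::real_normed_vector)" "c > 0"
  shows "\<exists>i<I. c / real I \<le> norm (z i)"
proof (rule ccontr)
  assume "\<not> ?thesis"
  then have lt: "norm (z i) < c / real I" if "i < I" for i using that by force
  have I: "I > 0" using assms by (cases I) auto
  have "norm (\<Sum>i<I. z i) \<le> (\<Sum>i<I. norm (z i))" by (rule norm_sum)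
  also have "\<dots> < (\<Sum>i<I. c / real I)" using I lt by (intro sum_strict_mono) auto
  also have "\<dots> = c" using I by simp
  finally show False using assms by simp
qed

text \<open>For k = 0 the only index is 1, which equals \<open>N ^ 0\<close>; strictness begins with
  k = 1.\<close>

lemma dpow_support:
  assumes N: "N \<ge> 0" and supp: "\<And>n. q n \<noteq> 0 \<Longrightarrow> n \<in> dyadic N" and "dpow q k n \<noteq> (0::complex)"
  shows "N ^ k \<le> real n \<and> real n \<le> 2 ^ k * N ^ k \<and> (k \<ge> 1 \<longrightarrow> N ^ k < real n)"
  using assms(3)
proof (induction k arbitrary: n)
  case 0
  then show ?case by (auto split: if_splits)
next
  case (Suc k)
  obtain d where d: "d dvd n" "q d * dpow q k (n div d) \<noteq> 0"
    using Suc.prems sum.neutral[of "{d. d dvd n}" "\<lambda>d. q d * dpow q k (n div d)"] by (auto simp: dconv_def)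
  define e where "e = n div d"
  have n: "real n = real d * real e" using d(1) by (simp add: e_def flip: of_nat_mult)
  have dd: "N < real d" "real d \<le> 2 * N" using supp[of d] d by (auto simp: dyadic_def)
  have ee: "N ^ k \<le> real e" "real e \<le> 2 ^ k * N ^ k" using Suc.IH[of e] d by (auto simp: e_def)
  have e0: "real e > 0" using Suc.prems n by (cases "e = 0") auto
  have "N * N ^ k \<le> N * real e" using ee N by (intro mult_left_mono) auto
  also have "\<dots> < real d * real e" using dd e0 by (intro mult_strict_right_mono)
  finally have 1: "N ^ Suc k < real n" unfolding n by simp
  have "real d * real e \<le> (2 * N) * (2 ^ k * N ^ k)" using dd ee N by (intro mult_mono) auto
  then have 2: "real n \<le> 2 ^ Suc k * N ^ Suc k" unfolding n by (simp add: mult_ac)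
  show ?case using 1 2 by auto
qed

lemma norm_dpow_le:
  assumes "\<And>n. norm (q n :: complex) \<le> (g n :: real)"
  shows "norm (dpow q k n) \<le> dpow g k n"
proof (induction k arbitrary: n)
  case (Suc k)
  have g0: "g n \<ge> 0" for n using assms[of n] norm_ge_zero order_trans by blast
  show ?case unfolding dpow.simps dconv_def
    by (rule sum_norm_le) (auto simp: norm_mult intro!: mult_mono assms Suc.IH g0)
qed simp

lemma dirsum_finite_support:
  assumes fin: "finite S" and S: "\<And>n. f n \<noteq> 0 \<Longrightarrow> n \<in> S" "0 \<notin> S"
  shows "dirsum f s = (\<Sum>n\<in>S. f n * of_nat n powr (-s))" "dabs f \<sigma>"
proof -
  have "infsum (dirichlet_term f s) {1..} = infsum (dirichlet_term f s) S"
    by (rule infsum_cong_neutral) (use S in \<open>auto simp: dirichlet_term_def Suc_le_eq intro!: Nat.gr0I\<close>)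
  then show "dirsum f s = (\<Sum>n\<in>S. f n * of_nat n powr (-s))"
    using fin by (simp add: dirsum_def dirichlet_term_def)
  have "(\<lambda>n. norm (f n) * real n powr (-\<sigma>)) summable_on S" using fin by simp
  then show "dabs f \<sigma>" unfolding dabs_def
    by (rule summable_on_cong_neutral[THEN iffD1, rotated -1]) (use S in \<open>auto simp: Suc_le_eq intro!: Nat.gr0I\<close>)
qed

text \<open>Multiplying k indices from (N, 2N] lands between \<open>N ^ k\<close> and
  \<open>2 ^ k * N ^ k\<close>, which is a union of k dyadic blocks.\<close>

lemma dirichlet_block_power:
  fixes q :: "nat \<Rightarrow> complex"
  assumes N: "N > 0" and supp: "\<And>n. q n \<noteq> 0 \<Longrightarrow> n \<in> dyadic N" and k: "k \<ge> 1"
  shows "(\<Sum>n\<in>dyadic N. q n * of_nat n powr (-x)) ^ k =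
    (\<Sum>j<k. \<Sum>n\<in>dyadic (2 ^ j * N ^ k). dpow q k n * of_nat n powr (-x))"
proof -
  define S where "S = {n. N ^ k < real n \<and> real n \<le> 2 ^ k * N ^ k}"
  have finS: "finite S" unfolding S_def
    by (rule finite_subset[of _ "{..nat \<lfloor>2 ^ k * N ^ k\<rfloor>}"]) (auto simp: le_nat_floor)
  have nN: "0 \<notin> dyadic N" using N by (simp add: dyadic_def)
  have nS: "0 \<notin> S" using N by (simp add: S_def not_less)
  have "(\<Sum>n\<in>dyadic N. q n * of_nat n powr (-x)) ^ k = dirsum q x ^ k"
    using dirsum_finite_support(1)[of "dyadic N" q x] supp nN by (simp add: finite_dyadic)
  also have "\<dots> = dirsum (dpow q k) x"
    using dpow_props[OF dirsum_finite_support(2)[of "dyadic N" q "Re x"], of k] supp nN by (simp add: finite_dyadic)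
  also have "\<dots> = (\<Sum>n\<in>S. dpow q k n * of_nat n powr (-x))"
    by (rule dirsum_finite_support(1)[OF finS _ nS]) (use dpow_support[of N q k] N supp k in \<open>auto simp: S_def\<close>)
  also have "\<dots> = (\<Sum>j<k. \<Sum>n\<in>dyadic (2 ^ j * N ^ k). dpow q k n * of_nat n powr (-x))"
    unfolding S_def by (rule dyadic_split) (use N in simp)
  finally show ?thesis .
qed

lemma card_le_sum_pigeonhole:
  assumes "finite R" "\<And>x. x \<in> R \<Longrightarrow> \<exists>i<I. P i x" "\<And>i. i < I \<Longrightarrow> real (card {x \<in> R. P i x}) \<le> B"
  shows "real (card R) \<le> real I * B"
proof -
  have "R = (\<Union>i<I. {x \<in> R. P i x})" using assms(2) by auto
  then have "card R \<le> (\<Sum>i<I. card {x \<in> R. P i x})" using card_UN_le[of "{..<I}" "\<lambda>i. {x \<in> R. P i x}"] by simp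
  then have "real (card R) \<le> (\<Sum>i<I. real (card {x \<in> R. P i x}))" unfolding of_nat_sum[symmetric] by (rule of_nat_mono)
  also have "\<dots> \<le> (\<Sum>i<I. B)" by (intro sum_mono assms) auto
  finally show ?thesis by simp
qed

text \<open>Two pigeonhole steps: at each x some dyadic block of q has size at least
  \<open>c' / L T\<close>, and some dyadic piece of its k-th power has size at least
  \<open>T powr (-\<kappa>)\<close>. The first choice costs a logarithm, the second only a constant,
  since k never exceeds K.\<close>

lemma large_polynomial_count:
  fixes g :: "nat \<Rightarrow> real"
  assumes g: "ram g" and c: "c > 0" and \<delta>: "\<delta> > 0" and E: "E \<ge> 1" and \<epsilon>: "\<epsilon> > 0"
  shows "\<exists>C>0. \<exists>Ts\<ge>1. \<forall>T\<ge>Ts. \<forall>\<sigma> q R. 9/10 \<le> \<sigma> \<longrightarrow> \<sigma> \<le> 1 \<longrightarrow> finite R \<longrightarrow> (\<forall>n. norm (q n :: complex) \<le> g n) \<longrightarrow>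
     (\<forall>n. q n \<noteq> 0 \<longrightarrow> T powr \<delta> < real n \<and> real n \<le> T powr E) \<longrightarrow>
     (\<forall>x\<in>R. \<sigma> \<le> Re x \<and> \<bar>Im x\<bar> \<le> T) \<longrightarrow> (\<forall>x\<in>R. \<forall>y\<in>R. x \<noteq> y \<longrightarrow> 1 \<le> \<bar>Im x - Im y\<bar>) \<longrightarrow>
     (\<forall>x\<in>R. c \<le> norm (\<Sum>n\<in>{1..nat \<lfloor>T powr E\<rfloor>}. q n * of_nat n powr (-x))) \<longrightarrow>
     real (card R) \<le> C * T powr (2 * E * (1 - \<sigma>) + \<epsilon>)"
proof -
  \<comment> \<open>The final exponent loses \<open>36 * \<kappa>\<close>: 35 from the large values
    bound and 1 from the number of dyadic blocks.\<close>
  define \<kappa> where "\<kappa> = min (1/100) (\<epsilon> / 40)"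
  have \<kappa>: "0 < \<kappa>" "\<kappa> \<le> 1/100" "36 * \<kappa> \<le> \<epsilon>" using \<epsilon> by (auto simp: \<kappa>_def)
  \<comment> \<open>K-th powers of blocks beyond \<open>T powr \<delta>\<close> reach length
    \<open>T powr (1/2)\<close>.\<close>
  define K where "K = nat \<lceil>1 / (2 * \<delta>)\<rceil> + 1"
  have K1: "K \<ge> 1" by (simp add: K_def)
  have K\<delta>: "1/2 \<le> \<delta> * real K"
  proof -
    have "1 / (2 * \<delta>) \<le> real K" unfolding K_def by linarith
    then show ?thesis using \<delta> by (simp add: field_simps)
  qed
  \<comment> \<open>Capping at 1 makes the powers of \<open>c' / L T\<close> decrease, so the bound
    for the exponent K serves every k \<le> K.\<close>
  define c' where "c' = min c 1"
  have c': "c' > 0" "c' \<le> c" "c' \<le> 1" using c by (auto simp: c'_def)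
  \<comment> \<open>The indices reach up to \<open>2 ^ K * T powr E\<close>, so this exponent yields
    \<open>T powr (\<kappa> / 2)\<close>; the other half of \<kappa> absorbs the constant
    \<open>C2\<close>.\<close>
  have "\<exists>C. \<forall>n\<ge>1. norm (dpow g k n) \<le> C * real n powr (\<kappa> / (2 * E))" for k
    using ram_dpow[OF g, of k] \<kappa> E unfolding ram_def by simp
  then obtain Cg where Cg: "\<And>k n. n \<ge> 1 \<Longrightarrow> norm (dpow g k n) \<le> Cg k * real n powr (\<kappa> / (2 * E))" by metis
  define C2 where "C2 = (\<Sum>k\<le>K. \<bar>Cg k\<bar>) * 2 powr K + 1"
  have C2: "C2 > 0" by (simp add: C2_def add_nonneg_pos sum_nonneg)
  define L where "L T = E * log 2 T + 2" for T :: real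
  obtain Ts0 where Ts0: "Ts0 \<ge> 1" and LVS: "\<forall>T\<ge>Ts0. \<forall>M \<sigma> R \<alpha>. T powr (1/2) \<le> M \<longrightarrow> 9/10 \<le> \<sigma> \<longrightarrow> \<sigma> \<le> 1 \<longrightarrow> finite R \<longrightarrow>
     (\<forall>x\<in>R. \<sigma> \<le> Re x \<and> \<bar>Im x\<bar> \<le> T) \<longrightarrow> (\<forall>x\<in>R. \<forall>y\<in>R. x \<noteq> y \<longrightarrow> 1 \<le> \<bar>Im x - Im y\<bar>) \<longrightarrow>
     (\<forall>n\<in>dyadic M. norm (\<alpha> n :: complex) \<le> T powr \<kappa>) \<longrightarrow>
     (\<forall>x\<in>R. T powr (-\<kappa>) \<le> norm (\<Sum>n\<in>dyadic M. \<alpha> n * of_nat n powr (-x))) \<longrightarrow>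
     real (card R) \<le> 1824 * T powr (5 * \<kappa>) * (M powr (2 - 2 * \<sigma>) + T powr (1 + 30 * \<kappa>) * M powr (11 - 14 * \<sigma>))"
    using large_values_spaced[OF \<kappa>(1,2)] by blast
  have "eventually (\<lambda>T::real. T powr (-\<kappa> / (2 * real K)) \<le> c' / L T) at_top"
    unfolding L_def using \<kappa> K1 c' E by real_asymp
  moreover have "eventually (\<lambda>T::real. T powr (-\<kappa>) \<le> T powr (-\<kappa> / 2) / real K) at_top"
    using \<kappa> K1 by real_asymp
  moreover have "eventually (\<lambda>T::real. C2 \<le> T powr (\<kappa> / 2)) at_top"
    using \<kappa> C2 by real_asymp
  moreover have "eventually (\<lambda>T::real. L T \<le> T powr \<kappa>) at_top"
    unfolding L_def using \<kappa> E by real_asymp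
  ultimately have "eventually (\<lambda>T::real. T powr (-\<kappa> / (2 * real K)) \<le> c' / L T \<and> T powr (-\<kappa>) \<le> T powr (-\<kappa> / 2) / real K \<and>
      C2 \<le> T powr (\<kappa> / 2) \<and> L T \<le> T powr \<kappa>) at_top" by eventually_elim auto
  then obtain Ts1 where Ts1: "\<And>T::real. T \<ge> Ts1 \<Longrightarrow> T powr (-\<kappa> / (2 * real K)) \<le> c' / L T \<and> T powr (-\<kappa>) \<le> T powr (-\<kappa> / 2) / real K \<and>
      C2 \<le> T powr (\<kappa> / 2) \<and> L T \<le> T powr \<kappa>"
    by (auto simp: eventually_at_top_linorder)
  define C where "C = real K * (1824 * (2 ^ K + 1))"
  have C0: "C > 0" using K1 by (simp add: C_def add_pos_pos)
  show ?thesis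
  proof (rule exI[of _ C], rule conjI[OF C0], rule exI[of _ "max Ts0 Ts1"], intro conjI allI impI)
    fix T \<sigma> :: real and q :: "nat \<Rightarrow> complex" and R :: "complex set"
    assume TT: "max Ts0 Ts1 \<le> T" and \<sigma>: "9/10 \<le> \<sigma>" "\<sigma> \<le> 1" and fin: "finite R"
      and qg: "\<forall>n. norm (q n) \<le> g n"
      and qs: "\<forall>n. q n \<noteq> 0 \<longrightarrow> T powr \<delta> < real n \<and> real n \<le> T powr E"
      and R: "\<forall>x\<in>R. \<sigma> \<le> Re x \<and> \<bar>Im x\<bar> \<le> T" and sp: "\<forall>x\<in>R. \<forall>y\<in>R. x \<noteq> y \<longrightarrow> 1 \<le> \<bar>Im x - Im y\<bar>"
      and large: "\<forall>x\<in>R. c \<le> norm (\<Sum>n\<in>{1..nat \<lfloor>T powr E\<rfloor>}. q n * of_nat n powr (-x))"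
    have T1: "T \<ge> 1" and TTs: "T \<ge> Ts0" using TT Ts0 by auto
    have Te: "T powr (-\<kappa> / (2 * real K)) \<le> c' / L T" "T powr (-\<kappa>) \<le> T powr (-\<kappa> / 2) / real K"
      "C2 \<le> T powr (\<kappa> / 2)" "L T \<le> T powr \<kappa>" using Ts1[of T] TT by auto
    define A where "A = T powr \<delta>"
    have A1: "A \<ge> 1" unfolding A_def using T1 \<delta> by (simp add: ge_one_powr_ge_zero)
    have TE: "T \<le> T powr E" using powr_mono[of 1 E T] T1 E by simp
    define Bd where "Bd = 1824 * (2 ^ K + 1) * T powr (35 * \<kappa> + 2 * E * (1 - \<sigma>))"
    have Bd0: "Bd \<ge> 0" by (simp add: Bd_def)
    define I where "I = nat \<lceil>E * log 2 T\<rceil> + 1"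
    have logT: "log 2 T \<ge> 0" using T1 by simp
    have I: "real I \<le> L T" "E * log 2 T \<le> real I" "I > 0"
      using logT E unfolding I_def L_def by (auto simp: mult_nonneg_nonneg) linarith+
    have dbl: "real (card R') \<le> Bd"
      if R': "R' \<subseteq> R" and M: "T powr (1/2) \<le> M" "M \<le> 2 ^ K * T powr E"
        and \<alpha>: "\<And>n. n \<in> dyadic M \<Longrightarrow> norm (\<alpha> n :: complex) \<le> T powr \<kappa>"
        and lg: "\<And>x. x \<in> R' \<Longrightarrow> T powr (-\<kappa>) \<le> norm (\<Sum>n\<in>dyadic M. \<alpha> n * of_nat n powr (-x))"
      for R' M \<alpha>
    proof -
      have M1: "M \<ge> 1" using M(1) T1 ge_one_powr_ge_zero[of T "1/2"] by linarith
      have finR': "finite R'" by (rule finite_subset[OF R' fin])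
      have R1: "\<forall>x\<in>R'. \<sigma> \<le> Re x \<and> \<bar>Im x\<bar> \<le> T" using R R' by blast
      have sp1: "\<forall>x\<in>R'. \<forall>y\<in>R'. x \<noteq> y \<longrightarrow> 1 \<le> \<bar>Im x - Im y\<bar>" using sp R' by blast
      have \<alpha>1: "\<forall>n\<in>dyadic M. norm (\<alpha> n) \<le> T powr \<kappa>" using \<alpha> by blast
      have lg1: "\<forall>x\<in>R'. T powr (-\<kappa>) \<le> norm (\<Sum>n\<in>dyadic M. \<alpha> n * of_nat n powr (-x))" using lg by blast
      have main: "real (card R') \<le> 1824 * T powr (5 * \<kappa>) * (M powr (2 - 2 * \<sigma>) + T powr (1 + 30 * \<kappa>) * M powr (11 - 14 * \<sigma>))"
        using LVS[rule_format, OF TTs M(1) \<sigma> finR'] R1 sp1 \<alpha>1 lg1 by blast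
      have b1: "M powr (2 - 2 * \<sigma>) \<le> 2 ^ K * T powr (30 * \<kappa> + 2 * E * (1 - \<sigma>))"
      proof -
        have "M powr (2 - 2 * \<sigma>) \<le> (2 ^ K * T powr E) powr (2 - 2 * \<sigma>)" using M M1 \<sigma> by (intro powr_mono2) auto
        also have "\<dots> = (2 ^ K) powr (2 - 2 * \<sigma>) * T powr (2 * E * (1 - \<sigma>))"
          by (simp add: powr_mult powr_powr algebra_simps)
        also have "\<dots> \<le> 2 ^ K * T powr (30 * \<kappa> + 2 * E * (1 - \<sigma>))"
        proof (intro mult_mono)
          have "((2::real) ^ K) powr (2 - 2 * \<sigma>) \<le> (2 ^ K) powr 1" using \<sigma> by (intro powr_mono) auto
          then show "((2::real) ^ K) powr (2 - 2 * \<sigma>) \<le> 2 ^ K" by simp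
        qed (use T1 \<kappa> in \<open>auto intro!: powr_mono\<close>)
        finally show ?thesis .
      qed
      have b2: "T powr (1 + 30 * \<kappa>) * M powr (11 - 14 * \<sigma>) \<le> T powr (30 * \<kappa> + 2 * E * (1 - \<sigma>))"
      proof -
        have "M powr (11 - 14 * \<sigma>) \<le> (T powr (1/2)) powr (11 - 14 * \<sigma>)" using M(1) \<sigma> T1 by (intro powr_mono2') auto
        then have "T powr (1 + 30 * \<kappa>) * M powr (11 - 14 * \<sigma>) \<le> T powr (1 + 30 * \<kappa>) * T powr (1/2 * (11 - 14 * \<sigma>))"
          by (intro mult_left_mono) (simp_all add: powr_powr)
        also have "\<dots> = T powr (1 + 30 * \<kappa> + 1/2 * (11 - 14 * \<sigma>))" by (simp only: powr_add)
        also have "\<dots> \<le> T powr (30 * \<kappa> + 2 * E * (1 - \<sigma>))"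
        proof (rule powr_mono)
          \<comment> \<open>By E \<ge> 1 the exponent 2(1 - \<sigma>) is at most 2E(1 -
            \<sigma>).\<close>
          have "1 * (1 - \<sigma>) \<le> E * (1 - \<sigma>)" using E \<sigma> by (intro mult_right_mono) auto
          moreover have "2 * E * (1 - \<sigma>) = 2 * (E * (1 - \<sigma>))" by simp
          ultimately show "1 + 30 * \<kappa> + 1/2 * (11 - 14 * \<sigma>) \<le> 30 * \<kappa> + 2 * E * (1 - \<sigma>)" using \<sigma> by argo
        qed (use T1 in auto)
        finally show ?thesis .
      qed
      have "real (card R') \<le> 1824 * T powr (5 * \<kappa>) * (2 ^ K * T powr (30 * \<kappa> + 2 * E * (1 - \<sigma>)) + T powr (30 * \<kappa> + 2 * E * (1 - \<sigma>)))"
        by (rule order_trans[OF main]) (intro mult_left_mono add_mono b1 b2, simp)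
      also have "\<dots> = 1824 * (2 ^ K + 1) * (T powr (5 * \<kappa>) * T powr (30 * \<kappa> + 2 * E * (1 - \<sigma>)))" by (simp add: algebra_simps)
      also have "T powr (5 * \<kappa>) * T powr (30 * \<kappa> + 2 * E * (1 - \<sigma>)) = T powr (35 * \<kappa> + 2 * E * (1 - \<sigma>))"
        by (simp add: powr_add[symmetric])
      finally show ?thesis by (simp add: Bd_def)
    qed
    have block: "real (card R') \<le> real K * Bd"
      if R': "R' \<subseteq> R" and N: "A \<le> N" "N \<le> T powr E" and q': "\<And>n. norm (q' n :: complex) \<le> g n"
        and supp: "\<And>n. q' n \<noteq> 0 \<Longrightarrow> n \<in> dyadic N"
        and lg: "\<And>x. x \<in> R' \<Longrightarrow> c' / L T \<le> norm (\<Sum>n\<in>dyadic N. q' n * of_nat n powr (-x))"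
      for R' N q'
    proof -
      have N1: "N \<ge> 1" using N A1 by simp
      text \<open>Minimality keeps \<open>N ^ k\<close> below \<open>max N T\<close>.\<close>
      define k where "k = (LEAST k. k \<ge> 1 \<and> T powr (1/2) \<le> N ^ k)"
      have ex: "K \<ge> 1 \<and> T powr (1/2) \<le> N ^ K"
      proof
        have "T powr (1/2) \<le> T powr (\<delta> * real K)" using K\<delta> T1 by (intro powr_mono) auto
        also have "\<dots> = A ^ K" using T1 A1 by (simp add: A_def powr_powr[symmetric] powr_realpow)
        also have "\<dots> \<le> N ^ K" using N A1 by (intro power_mono) auto
        finally show "T powr (1/2) \<le> N ^ K" .
      qed (rule K1)
      have k: "k \<ge> 1" "T powr (1/2) \<le> N ^ k" using LeastI[of "\<lambda>k. k \<ge> 1 \<and> T powr (1/2) \<le> N ^ k", OF ex] by (auto simp: k_def)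
      have kK: "k \<le> K" unfolding k_def by (rule Least_le[of "\<lambda>k. k \<ge> 1 \<and> T powr (1/2) \<le> N ^ k", OF ex])
      have NkE: "N ^ k \<le> T powr E"
      proof (cases "k = 1")
        case True then show ?thesis using N by simp
      next
        case False
        define m where "m = k - 1"
        have m: "m \<ge> 1" "k = Suc m" using False k by (auto simp: m_def)
        have "\<not> T powr (1/2) \<le> N ^ m"
        proof
          assume "T powr (1/2) \<le> N ^ m"
          then have "k \<le> m" unfolding k_def using m by (intro Least_le) auto
          then show False using m by simp
        qed
        then have Nm: "N ^ m \<le> T powr (1/2)" by simp
        have "N \<le> N ^ m" using m N1 self_le_power[of N m] by simp
        then have "N * N ^ m \<le> T powr (1/2) * T powr (1/2)" using Nm N1 by (intro mult_mono) auto
        also have "\<dots> = T" using T1 by (simp add: powr_add[symmetric])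
        finally show ?thesis using m TE by simp
      qed
      have kd: "norm (dpow q' k n) \<le> T powr \<kappa>" if n: "1 \<le> n" "real n \<le> 2 ^ K * T powr E" for n
      proof -
        have "norm (dpow q' k n) \<le> dpow g k n" by (rule norm_dpow_le[OF q'])
        also have "\<dots> \<le> Cg k * real n powr (\<kappa> / (2 * E))" using Cg[OF n(1), of k] by simp
        also have "\<dots> \<le> (\<Sum>k\<le>K. \<bar>Cg k\<bar>) * (2 powr K * T powr (\<kappa> / 2))"
        proof (intro mult_mono)
          have "\<bar>Cg k\<bar> \<le> (\<Sum>k\<le>K. \<bar>Cg k\<bar>)" using kK by (intro member_le_sum) auto
          then show "Cg k \<le> (\<Sum>k\<le>K. \<bar>Cg k\<bar>)" by simp
          have "real n powr (\<kappa> / (2 * E)) \<le> (2 ^ K * T powr E) powr (\<kappa> / (2 * E))" using n \<kappa> E by (intro powr_mono2) auto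
          also have "\<dots> = (2 ^ K) powr (\<kappa> / (2 * E)) * T powr (\<kappa> / 2)" using E by (simp add: powr_mult powr_powr)
          also have "\<dots> \<le> 2 powr K * T powr (\<kappa> / 2)"
          proof (rule mult_right_mono)
            have "\<kappa> / (2 * E) \<le> 1" using \<kappa> E by simp
            then have "((2::real) ^ K) powr (\<kappa> / (2 * E)) \<le> (2 ^ K) powr 1" by (intro powr_mono) auto
            then show "((2::real) ^ K) powr (\<kappa> / (2 * E)) \<le> 2 powr K" by (simp add: powr_realpow)
          qed simp
          finally show "real n powr (\<kappa> / (2 * E)) \<le> 2 powr K * T powr (\<kappa> / 2)" .
        qed (auto intro!: sum_nonneg)
        also have "\<dots> \<le> C2 * T powr (\<kappa> / 2)" unfolding C2_def by (simp add: algebra_simps)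
        also have "\<dots> \<le> T powr (\<kappa> / 2) * T powr (\<kappa> / 2)" using Te(3) by (intro mult_right_mono) auto
        also have "\<dots> = T powr \<kappa>" by (simp add: powr_add[symmetric])
        finally show ?thesis .
      qed
      define Z where "Z x j = (\<Sum>n\<in>dyadic (2 ^ j * N ^ k). dpow q' k n * of_nat n powr (-x))" for x :: complex and j
      have ph: "\<exists>j<k. T powr (-\<kappa>) \<le> norm (Z x j)" if x: "x \<in> R'" for x
      proof -
        have L0: "0 < c' / L T" using c' I by (intro divide_pos_pos) auto
        have le1: "c' / L T \<le> 1" using c' I by simp
        have "T powr (-\<kappa> / 2) = (T powr (-\<kappa> / (2 * real K))) ^ K"
          using T1 K1 by (simp add: powr_power)
        also have "\<dots> \<le> (c' / L T) ^ K" using Te(1) by (intro power_mono) auto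
        also have "\<dots> \<le> (c' / L T) ^ k" using kK L0 le1 by (intro power_decreasing) auto
        also have "\<dots> \<le> norm (\<Sum>n\<in>dyadic N. q' n * of_nat n powr (-x)) ^ k"
          using lg[OF x] L0 by (intro power_mono) auto
        also have "\<dots> = norm (\<Sum>j<k. Z x j)"
          unfolding Z_def using dirichlet_block_power[of N q' k x] N1 supp k by (simp add: norm_power[symmetric])
        finally obtain j where j: "j < k" "T powr (-\<kappa> / 2) / real k \<le> norm (Z x j)"
          using norm_sum_pigeonhole[of "T powr (-\<kappa> / 2)" "Z x" k] T1 by auto
        have "T powr (-\<kappa> / 2) / real K \<le> T powr (-\<kappa> / 2) / real k" using kK k by (intro divide_left_mono) auto
        then show ?thesis using j Te(2) by (intro exI[of _ j]) auto
      qed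
      have "real (card R') \<le> real k * Bd"
      proof (rule card_le_sum_pigeonhole[OF _ ph])
        show "finite R'" by (rule finite_subset[OF R' fin])
        fix j assume j: "j < k"
        have pw: "(2::real) ^ Suc j \<le> 2 ^ K" using j kK by (intro power_increasing) auto
        show "real (card {x \<in> R'. T powr (-\<kappa>) \<le> norm (Z x j)}) \<le> Bd"
        proof (rule dbl[of _ "2 ^ j * N ^ k" "dpow q' k"])
          have "1 * N ^ k \<le> 2 ^ j * N ^ k" using N1 by (intro mult_right_mono) auto
          then show "T powr (1/2) \<le> 2 ^ j * N ^ k" using k by simp
          have big: "2 * (2 ^ j * N ^ k) \<le> 2 ^ K * T powr E"
            using mult_mono[OF pw NkE] N1 by (simp add: mult.assoc)
          moreover have "0 \<le> 2 ^ j * N ^ k" using N1 by simp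
          ultimately show "2 ^ j * N ^ k \<le> 2 ^ K * T powr E" by linarith
          fix n assume n: "n \<in> dyadic (2 ^ j * N ^ k)"
          have "0 < 2 ^ j * N ^ k" using N1 by simp
          then show "norm (dpow q' k n) \<le> T powr \<kappa>" using n big
            by (intro kd) (auto simp: dyadic_def Suc_le_eq intro!: Nat.gr0I)
        qed (use R' in \<open>auto simp: Z_def\<close>)
      qed
      also have "\<dots> \<le> real K * Bd" using kK Bd0 by (intro mult_right_mono) auto
      finally show ?thesis .
    qed
    define Y where "Y x i = (\<Sum>n\<in>dyadic (2 ^ i * A). q n * of_nat n powr (-x))" for x :: complex and i
    have pwI: "T powr E \<le> 2 ^ I * A"
    proof -
      have "T powr E = 2 powr (E * log 2 T)" using T1 by (simp add: powr_def log_def)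
      also have "\<dots> \<le> 2 powr real I" using I by (intro powr_mono) auto
      also have "\<dots> = 2 ^ I" by (simp add: powr_realpow)
      also have "\<dots> \<le> 2 ^ I * A" using A1 by (simp add: mult_le_cancel_left1)
      finally show ?thesis .
    qed
    have ph: "\<exists>i<I. c' / L T \<le> norm (Y x i)" if x: "x \<in> R" for x
    proof -
      have "(\<Sum>n\<in>{1..nat \<lfloor>T powr E\<rfloor>}. q n * of_nat n powr (-x)) = (\<Sum>n | A < real n \<and> real n \<le> 2 ^ I * A. q n * of_nat n powr (-x))"
      proof (rule sum.mono_neutral_cong)
        show "finite {n. A < real n \<and> real n \<le> 2 ^ I * A}"
          by (rule finite_subset[of _ "{..nat \<lfloor>2 ^ I * A\<rfloor>}"]) (auto simp: le_nat_floor)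
        fix n assume n: "n \<in> {n. A < real n \<and> real n \<le> 2 ^ I * A} - {1..nat \<lfloor>T powr E\<rfloor>}"
        then have "\<not> (real n \<le> T powr E)" using A1 by (auto simp: le_nat_floor Suc_le_eq)
        then show "q n * of_nat n powr (-x) = 0" using qs by auto
      next
        fix n assume n: "n \<in> {1..nat \<lfloor>T powr E\<rfloor>} - {n. A < real n \<and> real n \<le> 2 ^ I * A}"
        then have "\<not> (T powr \<delta> < real n \<and> real n \<le> T powr E)" using pwI by (auto simp: A_def)
        then show "q n * of_nat n powr (-x) = 0" using qs by auto
      qed auto
      also have "\<dots> = (\<Sum>i<I. Y x i)" unfolding Y_def by (rule dyadic_split) (use A1 in simp)
      finally have "c \<le> norm (\<Sum>i<I. Y x i)" using bspec[OF large x] by simp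
      then obtain i where i: "i < I" "c / real I \<le> norm (Y x i)" using norm_sum_pigeonhole[of c "Y x" I] c by auto
      have "c' / L T \<le> c / real I" using I c' c by (intro frac_le) auto
      then show ?thesis using i by (intro exI[of _ i]) auto
    qed
    have cL: "0 < c' / L T" using c' I by (intro divide_pos_pos) auto
    have KB: "0 \<le> real K * Bd" using Bd0 by simp
    have "real (card R) \<le> real I * (real K * Bd)"
    proof (rule card_le_sum_pigeonhole[OF fin ph])
      fix i assume "i < I"
      define N where "N = 2 ^ i * A"
      have AN: "A \<le> N" using A1 by (simp add: N_def mult_le_cancel_right1)
      show "real (card {x \<in> R. c' / L T \<le> norm (Y x i)}) \<le> real K * Bd"
      proof (cases "N \<le> T powr E")
        case True
        define q' where "q' n = (if n \<in> dyadic N then q n else 0)" for n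
        show ?thesis
        proof (rule block[OF _ AN True, of _ q'])
          fix n
          have "g n \<ge> 0" by (rule order_trans[OF norm_ge_zero[of "q n"]]) (use qg in simp)
          then show "norm (q' n) \<le> g n" using qg by (simp add: q'_def)
          show "n \<in> dyadic N" if "q' n \<noteq> 0" using that by (simp add: q'_def split: if_splits)
        next
          fix x assume "x \<in> {x \<in> R. c' / L T \<le> norm (Y x i)}"
          moreover have "Y x i = (\<Sum>n\<in>dyadic N. q' n * of_nat n powr (-x))" unfolding Y_def N_def[symmetric] by (intro sum.cong) (auto simp: q'_def)
          ultimately show "c' / L T \<le> norm (\<Sum>n\<in>dyadic N. q' n * of_nat n powr (-x))" by simp
        qed auto
      next
        case False
        \<comment> \<open>A block that starts beyond \<open>T powr E\<close> carries no
          coefficients.\<close>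
        have "q n = 0" if "n \<in> dyadic N" for n using that qs False by (force simp: dyadic_def)
        then have "Y x i = 0" for x unfolding Y_def N_def[symmetric] by (intro sum.neutral) auto
        then have "{x \<in> R. c' / L T \<le> norm (Y x i)} = {}" using cL by auto
        then show ?thesis using KB by (simp only: card.empty of_nat_0)
      qed
    qed
    also have "\<dots> \<le> T powr \<kappa> * (real K * Bd)" using I Te(4) KB by (intro mult_right_mono) auto
    also have "\<dots> = C * (T powr \<kappa> * T powr (35 * \<kappa> + 2 * E * (1 - \<sigma>)))" by (simp add: C_def Bd_def mult_ac)
    also have "\<dots> = C * T powr (36 * \<kappa> + 2 * E * (1 - \<sigma>))" by (simp add: powr_add[symmetric])
    also have "\<dots> \<le> C * T powr (2 * E * (1 - \<sigma>) + \<epsilon>)" using C0 T1 \<kappa> by (intro mult_left_mono powr_mono) auto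
    finally show "real (card R) \<le> C * T powr (2 * E * (1 - \<sigma>) + \<epsilon>)" .
  qed (use Ts0 in auto)
qed

section \<open>Zero detection\<close>

text \<open>The contour integral along the vertical segment, without the factor i that its
  parametrisation brings.\<close>

definition vint :: "(complex \<Rightarrow> complex) \<Rightarrow> real \<Rightarrow> real \<Rightarrow> complex" where
  "vint f x V = integral {-V..V} (\<lambda>v. f (Complex x v))"

lemma continuous_on_Complex_line: "continuous_on A (\<lambda>v. Complex x v)"
  unfolding Complex_eq by (intro continuous_intros)

lemma vint_integrable:
  assumes "f holomorphic_on S" "\<And>v. \<bar>v\<bar> \<le> V \<Longrightarrow> Complex x v \<in> S"
  shows "(\<lambda>v. f (Complex x v)) integrable_on {-V..V}" "continuous_on {-V..V} (\<lambda>v. f (Complex x v))"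
proof -
  show "continuous_on {-V..V} (\<lambda>v. f (Complex x v))"
    by (rule continuous_on_compose2[OF holomorphic_on_imp_continuous_on[OF assms(1)] continuous_on_Complex_line])
       (use assms(2) in auto)
  then show "(\<lambda>v. f (Complex x v)) integrable_on {-V..V}" by (rule integrable_continuous_interval)
qed

text \<open>The vertical sides give the two integrals; the horizontal ones have length x1 - x0 each
  and are bounded by E.\<close>

lemma vint_rectangle:
  assumes x: "x0 < x1" and V: "V > 0"
    and I: "(f has_contour_integral I) (rectpath (Complex x0 (-V)) (Complex x1 V))"
    and cont: "continuous_on (path_image (rectpath (Complex x0 (-V)) (Complex x1 V))) f"
    and E: "\<And>x. x0 \<le> x \<Longrightarrow> x \<le> x1 \<Longrightarrow> norm (f (Complex x V)) \<le> E \<and> norm (f (Complex x (-V))) \<le> E"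
  shows "norm (I - \<i> * (vint f x1 V - vint f x0 V)) \<le> 2 * E * (x1 - x0)"
proof -
  define a1 a2 a3 a4 where "a1 = Complex x0 (-V)" and "a2 = Complex x1 (-V)" and "a3 = Complex x1 V" and "a4 = Complex x0 V"
  note defs = a1_def a2_def a3_def a4_def
  have rp: "rectpath a1 a3 = linepath a1 a2 +++ linepath a2 a3 +++ linepath a3 a4 +++ linepath a4 a1"
    by (simp add: rectpath_def defs Let_def)
  have pimg: "path_image (rectpath a1 a3) = closed_segment a1 a2 \<union> closed_segment a2 a3 \<union> closed_segment a3 a4 \<union> closed_segment a4 a1"
    unfolding rp by (simp add: path_image_join Un_assoc)
  have ci: "f contour_integrable_on (linepath a1 a2)" "f contour_integrable_on (linepath a2 a3)"
    "f contour_integrable_on (linepath a3 a4)" "f contour_integrable_on (linepath a4 a1)"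
    using cont unfolding defs[symmetric] pimg
    by (auto intro!: contour_integrable_continuous_linepath elim: continuous_on_subset)
  have "I = contour_integral (rectpath a1 a3) f" using I by (simp add: defs contour_integral_unique)
  also have "\<dots> = contour_integral (linepath a1 a2) f + (contour_integral (linepath a2 a3) f + (contour_integral (linepath a3 a4) f + contour_integral (linepath a4 a1) f))"
    unfolding rp using ci by (simp add: contour_integrable_joinI)
  also have "contour_integral (linepath a2 a3) f = \<i> * vint f x1 V"
    unfolding vint_def by (rule contour_integral_linepath_same_Re) (use V in \<open>auto simp: defs\<close>)
  also have "contour_integral (linepath a4 a1) f = - contour_integral (linepath a1 a4) f"
    using contour_integral_reversepath[of "linepath a1 a4" f] by simp
  also have "contour_integral (linepath a1 a4) f = \<i> * vint f x0 V"
    unfolding vint_def by (rule contour_integral_linepath_same_Re) (use V in \<open>auto simp: defs\<close>)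
  finally have "I - \<i> * (vint f x1 V - vint f x0 V) = contour_integral (linepath a1 a2) f + contour_integral (linepath a3 a4) f"
    by (simp add: algebra_simps)
  moreover have E0: "E \<ge> 0" using E[of x0] x norm_ge_zero[of "f (Complex x0 V)"] by linarith
  have "norm (contour_integral (linepath a1 a2) f) \<le> E * norm (a2 - a1)"
    by (rule contour_integral_bound_linepath[OF ci(1) E0])
       (use x E in \<open>auto simp: defs closed_segment_same_Im closed_segment_eq_real_ivl complex_eq_iff\<close>, metis complex_surj)
  moreover have "norm (contour_integral (linepath a3 a4) f) \<le> E * norm (a4 - a3)"
    by (rule contour_integral_bound_linepath[OF ci(3) E0])
       (use x E in \<open>auto simp: defs closed_segment_same_Im closed_segment_eq_real_ivl complex_eq_iff\<close>, metis complex_surj)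
  moreover have "norm (a2 - a1) = x1 - x0" "norm (a4 - a3) = x1 - x0"
    using x by (auto simp: defs cmod_def)
  ultimately show ?thesis using norm_triangle_ineq[of "contour_integral (linepath a1 a2) f" "contour_integral (linepath a3 a4) f"] by simp
qed

lemma vint_shift:
  assumes x: "x0 < x1" and V: "V > 0"
    and hol: "f holomorphic_on cbox (Complex x0 (-V)) (Complex x1 V)"
    and E: "\<And>x. x0 \<le> x \<Longrightarrow> x \<le> x1 \<Longrightarrow> norm (f (Complex x V)) \<le> E \<and> norm (f (Complex x (-V))) \<le> E"
  shows "norm (vint f x1 V - vint f x0 V) \<le> 2 * E * (x1 - x0)"
proof -
  have sub: "path_image (rectpath (Complex x0 (-V)) (Complex x1 V)) \<subseteq> cbox (Complex x0 (-V)) (Complex x1 V)"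
    by (rule path_image_rectpath_subset_cbox) (use x V in auto)
  have "(f has_contour_integral 0) (rectpath (Complex x0 (-V)) (Complex x1 V))"
    by (rule Cauchy_theorem_convex_simple[OF hol convex_box(1) _ sub]) auto
  from vint_rectangle[OF x V this continuous_on_subset[OF holomorphic_on_imp_continuous_on[OF hol] sub] E]
  show ?thesis by (simp add: norm_mult)
qed

text \<open>Cauchy's integral formula gives 2 pi i f(0), and the factor i cancels against the one
  left out of \<open>vint\<close>.\<close>

lemma vint_shift_pole:
  assumes x: "x0 < 0" "0 < x1" and V: "V > 0"
    and hol: "f holomorphic_on cbox (Complex x0 (-V)) (Complex x1 V)"
    and E: "\<And>x. x0 \<le> x \<Longrightarrow> x \<le> x1 \<Longrightarrow> norm (f (Complex x V) / Complex x V) \<le> E \<and> norm (f (Complex x (-V)) / Complex x (-V)) \<le> E"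
  shows "norm (2 * of_real pi * f 0 - (vint (\<lambda>w. f w / w) x1 V - vint (\<lambda>w. f w / w) x0 V)) \<le> 2 * E * (x1 - x0)"
proof -
  define a b where "a = Complex x0 (-V)" and "b = Complex x1 V"
  have ab: "Re a \<le> Re b" "Im a \<le> Im b" using x V by (auto simp: a_def b_def)
  have z: "0 \<in> box a b" using x V by (simp add: a_def b_def in_box_complex_iff)
  have sub: "path_image (rectpath a b) \<subseteq> cbox a b - {0}"
    using path_image_rectpath_subset_cbox[OF ab] path_image_rectpath_inter_box[OF ab] z by auto
  have hol': "f holomorphic_on cbox a b" using hol by (simp add: a_def b_def)
  have 1: "((\<lambda>w. f w / (w - 0)) has_contour_integral (2 * pi * \<i> * winding_number (rectpath a b) 0 * f 0)) (rectpath a b)"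
    by (rule Cauchy_integral_formula_convex_simple[OF convex_box(1) hol' _ _ sub]) (use z in \<open>auto simp: interior_cbox\<close>)
  have 2: "((\<lambda>w. f w / w) has_contour_integral (2 * pi * \<i> * f 0)) (rectpath a b)"
    using 1 winding_number_rectpath[OF z] by simp
  have "continuous_on (path_image (rectpath a b)) (\<lambda>w. f w / w)"
    using sub by (intro continuous_intros continuous_on_subset[OF holomorphic_on_imp_continuous_on[OF hol']]) auto
  from vint_rectangle[OF _ V 2[unfolded a_def b_def] this[unfolded a_def b_def] E]
  have "norm (2 * pi * \<i> * f 0 - \<i> * (vint (\<lambda>w. f w / w) x1 V - vint (\<lambda>w. f w / w) x0 V)) \<le> 2 * E * (x1 - x0)"
    using x by simp
  also have "2 * pi * \<i> * f 0 - \<i> * (vint (\<lambda>w. f w / w) x1 V - vint (\<lambda>w. f w / w) x0 V)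
     = \<i> * (2 * of_real pi * f 0 - (vint (\<lambda>w. f w / w) x1 V - vint (\<lambda>w. f w / w) x0 V))" by (simp add: algebra_simps)
  finally show ?thesis by (simp add: norm_mult)
qed

text \<open>The Gaussian is at most 1 / (1 + v^2), whose integral is an arctangent; this gives pi
  uniformly in V.\<close>

lemma gaussian_integral_le:
  fixes u :: "real \<Rightarrow> complex"
  assumes u: "u integrable_on {-V..V}" and V: "V \<ge> 0" and B: "B \<ge> 0" "\<And>v. \<bar>v\<bar> \<le> V \<Longrightarrow> norm (u v) \<le> B * exp (- v\<^sup>2)"
  shows "norm (integral {-V..V} u) \<le> pi * B"
proof -
  have hi: "((\<lambda>v. B * (1 / (1 + v\<^sup>2))) has_integral B * (arctan V - arctan (-V))) {-V..V}"
  proof (intro has_integral_mult_right fundamental_theorem_of_calculus)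
    fix v :: real
    have "(arctan has_real_derivative inverse (1 + v\<^sup>2)) (at v within {-V..V})"
      by (rule has_field_derivative_at_within[OF DERIV_arctan])
    then show "(arctan has_vector_derivative 1 / (1 + v\<^sup>2)) (at v within {-V..V})"
      by (simp add: has_real_derivative_iff_has_vector_derivative inverse_eq_divide)
  qed (use V in auto)
  have "norm (integral {-V..V} u) \<le> integral {-V..V} (\<lambda>v. B * (1 / (1 + v\<^sup>2)))"
  proof (rule integral_norm_bound_integral[OF u])
    show "(\<lambda>v. B * (1 / (1 + v\<^sup>2))) integrable_on {-V..V}" using hi by blast
    fix v assume "v \<in> {-V..V}"
    then have "norm (u v) \<le> B * exp (- v\<^sup>2)" using B(2)[of v] by auto
    also have "exp (- v\<^sup>2) \<le> 1 / (1 + v\<^sup>2)"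
    proof -
      have "1 + v\<^sup>2 \<le> exp (v\<^sup>2)" by (rule exp_ge_add_one_self)
      moreover have "0 < 1 + v\<^sup>2" by (simp add: add_pos_nonneg)
      ultimately show ?thesis by (simp add: exp_minus field_simps)
    qed
    finally show "norm (u v) \<le> B * (1 / (1 + v\<^sup>2))" using B(1) by (simp add: mult_left_mono)
  qed
  also have "\<dots> = B * (2 * arctan V)" using hi by (simp add: integral_unique arctan_minus)
  also have "\<dots> \<le> B * pi" using B(1) arctan_ubound[of V] by (intro mult_left_mono) auto
  finally show ?thesis by (simp add: mult.commute)
qed

lemma norm_vint_le_gaussian:
  assumes f: "f holomorphic_on S" "\<And>v. \<bar>v\<bar> \<le> V \<Longrightarrow> Complex x v \<in> S" and V: "V \<ge> 0"
    and B: "B \<ge> 0" "\<And>v. \<bar>v\<bar> \<le> V \<Longrightarrow> norm (f (Complex x v)) \<le> B * exp (- v\<^sup>2)"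
  shows "norm (vint f x V) \<le> pi * B"
  unfolding vint_def by (rule gaussian_integral_le[OF vint_integrable(1)[of f S, OF f] V B])

text \<open>The Gaussian factor makes the truncation of the integral at height \<open>V\<close> harmless.\<close>

definition smooth_kernel :: "real \<Rightarrow> complex \<Rightarrow> complex" where
  "smooth_kernel y w = exp (of_real (ln y) * w + w\<^sup>2)"

lemma norm_smooth_kernel:
  assumes "y > 0"
  shows "norm (smooth_kernel y w) = y powr (Re w) * exp ((Re w)\<^sup>2 - (Im w)\<^sup>2)"
  using assms by (simp add: smooth_kernel_def powr_def exp_add[symmetric] power2_eq_square mult.commute)

lemma holomorphic_smooth_kernel [holomorphic_intros]:
  "f holomorphic_on S \<Longrightarrow> (\<lambda>w. smooth_kernel y (f w)) holomorphic_on S"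
  unfolding smooth_kernel_def by (intro holomorphic_intros)

lemma smooth_kernel_0 [simp]: "smooth_kernel y 0 = 1"
  by (simp add: smooth_kernel_def)

section \<open>Smooth cutoff weights\<close>

text \<open>A truncated inverse Mellin integral, a smooth version of the indicator of y > 1. The
  divisor is 2 pi rather than 2 pi i because \<open>vint\<close> omits the factor i.\<close>

definition weight :: "real \<Rightarrow> real \<Rightarrow> real \<Rightarrow> complex" where
  "weight A V y = vint (\<lambda>w. smooth_kernel y w / w) A V / (2 * of_real pi)"

lemma abs_Re_le_norm_line: "\<bar>x\<bar> \<le> norm (Complex x v)" "\<bar>v\<bar> \<le> norm (Complex x v)"
  using abs_Re_le_cmod[of "Complex x v"] abs_Im_le_cmod[of "Complex x v"] by auto

text \<open>The estimate on the line Re w = A itself, meant for y \<le> 1, where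
  \<open>y powr A\<close> is at most 1.\<close>

lemma norm_weight_le:
  assumes A: "A \<ge> 1" and V: "V \<ge> 0" and y: "y > 0"
  shows "norm (weight A V y) \<le> y powr A * exp (A\<^sup>2)"
proof -
  have "norm (vint (\<lambda>w. smooth_kernel y w / w) A V) \<le> pi * (y powr A * exp (A\<^sup>2))"
  proof (rule norm_vint_le_gaussian[where S = "- {0}"])
    fix v :: real
    have "norm (smooth_kernel y (Complex A v) / Complex A v) = y powr A * exp (A\<^sup>2 - v\<^sup>2) / norm (Complex A v)"
      using y by (simp add: norm_divide norm_smooth_kernel)
    also have "\<dots> \<le> y powr A * exp (A\<^sup>2 - v\<^sup>2) / 1"
      using abs_Re_le_norm_line(1)[of A v] A by (intro divide_left_mono) auto
    finally show "norm (smooth_kernel y (Complex A v) / Complex A v) \<le> y powr A * exp (A\<^sup>2) * exp (- v\<^sup>2)"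
      by (simp add: exp_diff exp_minus field_simps)
  qed (use A V in \<open>auto intro!: holomorphic_intros simp: complex_eq_iff\<close>)
  then have le: "norm (vint (\<lambda>w. smooth_kernel y w / w) A V) / (2 * pi) \<le> pi * (y powr A * exp (A\<^sup>2)) / (2 * pi)"
    by (intro divide_right_mono) auto
  have "norm (weight A V y) = norm (vint (\<lambda>w. smooth_kernel y w / w) A V) / (2 * pi)"
    unfolding weight_def by (simp add: norm_divide norm_mult)
  also note le
  also have "pi * (y powr A * exp (A\<^sup>2)) / (2 * pi) \<le> y powr A * exp (A\<^sup>2)" by simp
  finally show ?thesis .
qed

text \<open>Moving the line from A to -1 crosses the simple pole at 0 with residue 1. The new line
  gives the term with 1 / y, the horizontal sides give the rest.\<close>

lemma norm_weight_minus_1_le: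
  assumes A: "A \<ge> 1" and V: "V \<ge> 1" and y: "y \<ge> 1"
  shows "norm (weight A V y - 1) \<le> exp 1 / y + (A + 1) * (y powr A * exp (A\<^sup>2 - V\<^sup>2))"
proof -
  define E where "E = y powr A * exp (A\<^sup>2 - V\<^sup>2)"
  define R L where "R = vint (\<lambda>w. smooth_kernel y w / w) A V" and "L = vint (\<lambda>w. smooth_kernel y w / w) (-1) V"
  have "norm (2 * of_real pi * smooth_kernel y 0 - (R - L)) \<le> 2 * E * (A - (-1))"
    unfolding R_def L_def
  proof (rule vint_shift_pole)
    fix x assume x: "-1 \<le> x" "x \<le> A"
    have "norm (smooth_kernel y (Complex x v) / Complex x v) \<le> E" if "v = V \<or> v = -V" for v
    proof -
      have "norm (smooth_kernel y (Complex x v) / Complex x v) = y powr x * exp (x\<^sup>2 - V\<^sup>2) / norm (Complex x v)"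
        using y that by (auto simp: norm_divide norm_smooth_kernel)
      also have "\<dots> \<le> y powr x * exp (x\<^sup>2 - V\<^sup>2) / 1"
        using abs_Re_le_norm_line(2)[of v x] V that by (intro divide_left_mono) auto
      also have "\<dots> \<le> E"
      proof -
        have "\<bar>x\<bar> \<le> \<bar>A\<bar>" using x A by auto
        then have "x\<^sup>2 \<le> A\<^sup>2" by (rule abs_le_square_iff[THEN iffD1])
        then show ?thesis unfolding E_def using x y by (auto intro!: mult_mono powr_mono)
      qed
      finally show ?thesis .
    qed
    then show "norm (smooth_kernel y (Complex x V) / Complex x V) \<le> E \<and> norm (smooth_kernel y (Complex x (- V)) / Complex x (- V)) \<le> E"
      by blast
  qed (use A V in \<open>auto intro!: holomorphic_intros\<close>)
  moreover have "norm L \<le> pi * (exp 1 / y)"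
    unfolding L_def
  proof (rule norm_vint_le_gaussian[where S = "- {0}"])
    fix v :: real
    have "norm (smooth_kernel y (Complex (-1) v) / Complex (-1) v) = y powr (-1) * exp (1 - v\<^sup>2) / norm (Complex (-1) v)"
      using y by (simp add: norm_divide norm_smooth_kernel)
    also have "\<dots> \<le> y powr (-1) * exp (1 - v\<^sup>2) / 1"
      using abs_Re_le_norm_line(1)[of "-1" v] by (intro divide_left_mono) auto
    finally show "norm (smooth_kernel y (Complex (-1) v) / Complex (-1) v) \<le> exp 1 / y * exp (- v\<^sup>2)"
      using y by (simp add: exp_diff exp_minus field_simps powr_minus)
  qed (use y V in \<open>auto intro!: holomorphic_intros simp: complex_eq_iff\<close>)
  moreover have "2 * of_real pi * (weight A V y - 1) = - (2 * of_real pi * smooth_kernel y 0 - (R - L)) + L"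
    unfolding weight_def R_def[symmetric] by (simp add: algebra_simps)
  then have "2 * pi * norm (weight A V y - 1) \<le> norm (2 * of_real pi * smooth_kernel y 0 - (R - L)) + norm L"
  proof -
    have "2 * pi * norm (weight A V y - 1) = norm (2 * of_real pi * (weight A V y - 1))" by (simp add: norm_mult)
    also have "\<dots> \<le> norm (- (2 * of_real pi * smooth_kernel y 0 - (R - L))) + norm L"
      unfolding \<open>2 * of_real pi * (weight A V y - 1) = - (2 * of_real pi * smooth_kernel y 0 - (R - L)) + L\<close> by (rule norm_triangle_ineq)
    finally show ?thesis by (simp only: norm_minus_cancel)
  qed
  ultimately have "2 * pi * norm (weight A V y - 1) \<le> 2 * E * (A + 1) + pi * (exp 1 / y)" by simp
  also have "\<dots> \<le> 2 * pi * ((A + 1) * E) + 2 * pi * (exp 1 / y)"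
  proof (rule add_mono)
    have "2 * (1 * ((A + 1) * E)) \<le> 2 * (pi * ((A + 1) * E))" using pi_gt3 A by (intro mult_left_mono mult_right_mono) (auto simp: E_def)
    then show "2 * E * (A + 1) \<le> 2 * pi * ((A + 1) * E)" by (simp only: mult_1 mult.assoc mult.commute mult.left_commute)
    show "pi * (exp 1 / y) \<le> 2 * pi * (exp 1 / y)" using y by (intro mult_right_mono) auto
  qed
  also have "\<dots> = 2 * pi * (exp 1 / y + (A + 1) * E)" by (simp add: distrib_left)
  finally show ?thesis unfolding E_def by (rule mult_left_le_imp_le) simp
qed

section \<open>Truncated Dirichlet series\<close>

definition partial_dirsum :: "(nat \<Rightarrow> complex) \<Rightarrow> real \<Rightarrow> complex \<Rightarrow> complex" where
  "partial_dirsum f U s = (\<Sum>n\<in>{1..nat \<lfloor>U\<rfloor>}. f n * of_nat n powr (-s))"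

lemma le_nat_floor_iff: "U \<ge> 0 \<Longrightarrow> n \<le> nat \<lfloor>U\<rfloor> \<longleftrightarrow> real n \<le> U"
  by (simp add: le_nat_iff le_floor_iff)

lemma holomorphic_partial_dirsum [holomorphic_intros]:
  assumes "k holomorphic_on S"
  shows "(\<lambda>w. partial_dirsum f U (k w)) holomorphic_on S"
  unfolding partial_dirsum_def by (intro holomorphic_intros assms) auto

text \<open>Rankin's trick: beyond U the decreasing power \<open>n powr (\<sigma> - Re s)\<close> is
  at most its value at U.\<close>

lemma norm_dirsum_tail_le:
  assumes f: "dabs f \<sigma>" and s: "\<sigma> \<le> Re s" and U: "U > 0"
  shows "norm (dirsum f s - partial_dirsum f U s) \<le> U powr (\<sigma> - Re s) * dnorm f \<sigma>"
proof -
  define S where "S = {1..nat \<lfloor>U\<rfloor>}"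
  have hs: "(dirichlet_term f s has_sum dirsum f s) {1..}" by (rule dirsum_has_sum[OF f s])
  have hf: "(dirichlet_term f s has_sum partial_dirsum f U s) S"
    using has_sum_finite[of S "dirichlet_term f s"] by (simp add: S_def partial_dirsum_def dirichlet_term_def)
  have t: "(dirichlet_term f s has_sum (dirsum f s - partial_dirsum f U s)) ({1..} - S)"
    by (rule has_sum_Diff[OF hs hf]) (auto simp: S_def)
  have sm: "(\<lambda>n. norm (f n) * real n powr (-\<sigma>)) summable_on {1..}" using f by (simp add: dabs_def)
  have hd: "((\<lambda>n. norm (f n) * real n powr (-\<sigma>)) has_sum dnorm f \<sigma>) {1..}"
    unfolding dnorm_def by (rule has_sum_infsum[OF sm])
  have sm': "(\<lambda>n. norm (f n) * real n powr (-\<sigma>)) summable_on ({1..} - S)" by (rule summable_on_subset_banach[OF sm]) auto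
  have le: "norm (dirichlet_term f s n) \<le> U powr (\<sigma> - Re s) * (norm (f n) * real n powr (-\<sigma>))" if "n \<in> {1..} - S" for n
  proof -
    have n: "real n > U" "n \<ge> 1" using that U by (auto simp: S_def le_nat_floor_iff)
    have "real n powr (- Re s) = real n powr (\<sigma> - Re s) * real n powr (-\<sigma>)" by (simp add: powr_add[symmetric])
    also have "\<dots> \<le> U powr (\<sigma> - Re s) * real n powr (-\<sigma>)" using n U s by (intro mult_right_mono powr_mono2') auto
    finally have "norm (f n) * real n powr (- Re s) \<le> norm (f n) * (U powr (\<sigma> - Re s) * real n powr (-\<sigma>))" by (rule mult_left_mono) simp
    then show ?thesis by (simp add: norm_dirichlet_term mult_ac)
  qed
  have sg: "(\<lambda>n. U powr (\<sigma> - Re s) * (norm (f n) * real n powr (-\<sigma>))) summable_on ({1..} - S)" by (rule summable_on_cmult_right[OF sm'])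
  have "norm (dirsum f s - partial_dirsum f U s) = norm (infsum (dirichlet_term f s) ({1..} - S))" using t by (simp add: infsumI)
  also have "\<dots> \<le> infsum (\<lambda>n. U powr (\<sigma> - Re s) * (norm (f n) * real n powr (-\<sigma>))) ({1..} - S)"
    by (rule norm_infsum_le[OF has_sum_infsum[OF has_sum_imp_summable[OF t]] has_sum_infsum[OF sg] le])
  also have "\<dots> = U powr (\<sigma> - Re s) * infsum (\<lambda>n. norm (f n) * real n powr (-\<sigma>)) ({1..} - S)" by (rule infsum_cmult_right')
  also have "\<dots> \<le> U powr (\<sigma> - Re s) * dnorm f \<sigma>"
    unfolding dnorm_def by (intro mult_left_mono infsum_mono2[OF sm' sm]) auto
  finally show ?thesis .
qed

text \<open>The same comparison for an increasing power, which up to U is largest at U.\<close>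

lemma norm_partial_dirsum_le:
  assumes f: "dabs f \<sigma>" and s: "- \<alpha> \<le> Re s" "0 \<le> \<alpha> + \<sigma>" and U: "U \<ge> 1"
  shows "norm (partial_dirsum f U s) \<le> U powr (\<alpha> + \<sigma>) * dnorm f \<sigma>"
proof -
  have sm: "(\<lambda>n. norm (f n) * real n powr (-\<sigma>)) summable_on {1..}" using f by (simp add: dabs_def)
  have "norm (partial_dirsum f U s) \<le> (\<Sum>n\<in>{1..nat \<lfloor>U\<rfloor>}. U powr (\<alpha> + \<sigma>) * (norm (f n) * real n powr (-\<sigma>)))"
    unfolding partial_dirsum_def
  proof (rule sum_norm_le)
    fix n assume "n \<in> {1..nat \<lfloor>U\<rfloor>}"
    then have n: "n \<ge> 1" "real n \<le> U" using U by (auto simp: le_nat_floor_iff)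
    have "real n powr (- Re s) \<le> real n powr (\<alpha> + \<sigma> + (-\<sigma>))" using n s by (intro powr_mono) auto
    also have "\<dots> = real n powr (\<alpha> + \<sigma>) * real n powr (-\<sigma>)" by (rule powr_add)
    also have "\<dots> \<le> U powr (\<alpha> + \<sigma>) * real n powr (-\<sigma>)" using n s by (intro mult_right_mono powr_mono2) auto
    finally have "norm (f n) * real n powr (- Re s) \<le> norm (f n) * (U powr (\<alpha> + \<sigma>) * real n powr (-\<sigma>))" by (rule mult_left_mono) simp
    then show "norm (f n * of_nat n powr (-s)) \<le> U powr (\<alpha> + \<sigma>) * (norm (f n) * real n powr (-\<sigma>))"
      by (simp add: norm_mult norm_of_nat_powr mult_ac)
  qed
  also have "\<dots> = U powr (\<alpha> + \<sigma>) * (\<Sum>n\<in>{1..nat \<lfloor>U\<rfloor>}. norm (f n) * real n powr (-\<sigma>))" by (simp add: sum_distrib_left)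
  also have "\<dots> \<le> U powr (\<alpha> + \<sigma>) * dnorm f \<sigma>"
    unfolding dnorm_def by (intro mult_left_mono finite_sum_le_infsum[OF sm]) auto
  finally show ?thesis .
qed

lemma dnorm_nonneg: "dnorm f \<sigma> \<ge> 0"
  unfolding dnorm_def by (intro infsum_nonneg) auto

text \<open>Moves n into the kernel, so that the line integral of a partial sum becomes a sum of
  weights at Y / n.\<close>

lemma of_nat_powr_smooth_kernel:
  assumes "n \<ge> 1" "Y > 0"
  shows "of_nat n powr (-(\<rho> + w)) * smooth_kernel Y w = of_nat n powr (-\<rho>) * smooth_kernel (Y / real n) w"
  using assms by (simp add: smooth_kernel_def powr_def Ln_of_nat ln_div exp_add[symmetric] algebra_simps)

lemma vint_diff:
  assumes "f holomorphic_on S" "h holomorphic_on S" "\<And>v. \<bar>v\<bar> \<le> V \<Longrightarrow> Complex x v \<in> S"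
  shows "vint (\<lambda>w. f w - h w) x V = vint f x V - vint h x V"
  unfolding vint_def by (intro integral_diff vint_integrable(1)[of _ S] assms)

lemma vint_sum:
  assumes "finite I" "\<And>n. n \<in> I \<Longrightarrow> p n holomorphic_on S" "\<And>v. \<bar>v\<bar> \<le> V \<Longrightarrow> Complex x v \<in> S"
  shows "vint (\<lambda>w. \<Sum>n\<in>I. k n * p n w) x V = (\<Sum>n\<in>I. k n * vint (p n) x V)"
proof -
  have "vint (\<lambda>w. \<Sum>n\<in>I. k n * p n w) x V = (\<Sum>n\<in>I. vint (\<lambda>w. k n * p n w) x V)"
    unfolding vint_def
    by (intro integral_sum assms(1)) (rule vint_integrable(1)[of _ S], intro holomorphic_intros assms(2), auto simp: assms(3))
  also have "\<dots> = (\<Sum>n\<in>I. k n * vint (p n) x V)"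
    unfolding vint_def by (simp add: integral_mult_right)
  finally show ?thesis .
qed

lemma dirsum_cnj: "dirsum (\<lambda>n. cnj (a n)) (cnj s) = cnj (dirsum a s)"
proof -
  have "dirichlet_term (\<lambda>n. cnj (a n)) (cnj s) n = cnj (dirichlet_term a s n)" if "n \<in> {1..}" for n
    using that by (simp add: dirichlet_term_def powr_def Ln_of_nat exp_cnj)
  then have "dirsum (\<lambda>n. cnj (a n)) (cnj s) = infsum (\<lambda>n. cnj (dirichlet_term a s n)) {1..}"
    unfolding dirsum_def by (rule infsum_cong)
  then show ?thesis by (simp add: dirsum_def infsum_cnj)
qed

lemma dabs_cnj [simp]: "dabs (\<lambda>n. cnj (a n)) \<sigma> \<longleftrightarrow> dabs a \<sigma>" and dnorm_cnj [simp]: "dnorm (\<lambda>n. cnj (a n)) \<sigma> = dnorm a \<sigma>"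
  by (simp_all add: dabs_def dnorm_def)

text \<open>The truncation of \<open>partial_dirsum\<close> as a coefficient sequence, so that it
  can be convolved.\<close>

definition truncate_at :: "real \<Rightarrow> (nat \<Rightarrow> complex) \<Rightarrow> nat \<Rightarrow> complex" where
  "truncate_at X g n = (if 1 \<le> n \<and> real n \<le> X then g n else 0)"

lemma dirsum_truncate_at:
  assumes "X \<ge> 0"
  shows "dirsum (truncate_at X g) s = partial_dirsum g X s" "dabs (truncate_at X g) \<sigma>"
proof -
  have *: "finite {1..nat \<lfloor>X\<rfloor>}" "\<And>n. truncate_at X g n \<noteq> 0 \<Longrightarrow> n \<in> {1..nat \<lfloor>X\<rfloor>}" "0 \<notin> {1..nat \<lfloor>X\<rfloor>}"
    using assms by (auto simp: truncate_at_def le_nat_floor_iff split: if_splits)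
  show "dabs (truncate_at X g) \<sigma>" by (rule dirsum_finite_support(2)[OF *])
  have "dirsum (truncate_at X g) s = (\<Sum>n\<in>{1..nat \<lfloor>X\<rfloor>}. truncate_at X g n * of_nat n powr (-s))"
    by (rule dirsum_finite_support(1)[OF *])
  then show "dirsum (truncate_at X g) s = partial_dirsum g X s"
    unfolding partial_dirsum_def
    using assms by (simp add: truncate_at_def le_nat_floor_iff)
qed

lemma dnorm_truncate_at_le:
  assumes "dabs g \<sigma>" "X \<ge> 0"
  shows "dnorm (truncate_at X g) \<sigma> \<le> dnorm g \<sigma>"
  unfolding dnorm_def
  by (rule infsum_mono) (use assms dirsum_truncate_at(2)[OF assms(2), of g \<sigma>] in \<open>auto simp: dabs_def truncate_at_def\<close>)

section \<open>The detection argument\<close>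

text \<open>The five terms are, in order: the horizontal sides of the shift from A to the far left,
  the tail of the Dirichlet series beyond U on the right line, the tail of the dual series beyond Z
  on the left line, the horizontal sides of the shift back, and the integral on the critical line.
  The restriction |Im w| \<le> V keeps all ordinates at least t1 in modulus, away from the pole of F
  and from the gamma poles.\<close>

lemma detection_inequality:
  fixes F \<psi> :: "complex \<Rightarrow> complex" and a g :: "nat \<Rightarrow> complex" and A H V X Y Z U t1 KF K\<psi> :: real and \<rho> :: complex
  assumes hol: "F holomorphic_on - {1}" and F\<rho>: "F \<rho> = 0" and \<beta>: "9/10 \<le> Re \<rho>" "Re \<rho> \<le> 1"
    and ser: "\<And>s. Re s > 1 \<Longrightarrow> F s = dirsum a s" and a: "dabs a 2" and g: "dabs g 2"
    and t1: "t1 \<ge> 1" and fe: "\<And>s. \<bar>Im s\<bar> \<ge> t1 \<Longrightarrow> F s = \<psi> s * cnj (F (1 - cnj s))"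
    and \<psi>hol: "\<And>S. S \<subseteq> {s. \<bar>Im s\<bar> \<ge> t1} \<Longrightarrow> \<psi> holomorphic_on S"
    and \<psi>1: "\<And>s. \<bar>Im s\<bar> \<ge> t1 \<Longrightarrow> Re s = 1/2 \<Longrightarrow> norm (\<psi> s) = 1"
    and A: "A \<ge> 2"
    and \<psi>b: "\<And>s. \<bar>Im s\<bar> \<ge> t1 \<Longrightarrow> \<bar>Im s\<bar> \<le> H \<Longrightarrow> -A \<le> Re s \<Longrightarrow> Re s \<le> 1/2 \<Longrightarrow> norm (\<psi> s) \<le> K\<psi>"
    and Fb: "\<And>s. \<bar>Im s\<bar> \<ge> t1 \<Longrightarrow> \<bar>Im s\<bar> \<le> H \<Longrightarrow> -A \<le> Re s \<Longrightarrow> norm (F s) \<le> KF"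
    and V: "V \<ge> 1" and \<gamma>: "\<bar>Im \<rho>\<bar> \<ge> t1 + V" "\<bar>Im \<rho>\<bar> + V \<le> H"
    and XY: "X \<ge> 1" "Y \<ge> 1" "Z \<ge> 1" "U \<ge> 1"
  defines "c \<equiv> dconv a (truncate_at X g)" and "P \<equiv> (\<lambda>s. partial_dirsum (\<lambda>n. cnj (a n)) Z (1 - s))"
    and "MX \<equiv> X powr (A + 2) * dnorm g 2" and "G \<equiv> exp ((A + 1)\<^sup>2)" and "GV \<equiv> exp ((A + 1)\<^sup>2 - V\<^sup>2)"
  shows "norm (\<Sum>n\<in>{1..nat \<lfloor>U\<rfloor>}. c n * of_nat n powr (-\<rho>) * weight A V (Y / real n))
     \<le> (2 * A + 1) * (KF * MX * Y powr A * GV)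
       + U powr (2 - A) * (dnorm a 2 * dnorm g 2) * Y powr A * G
       + K\<psi> * (Z powr (1 - A) * dnorm a 2) * MX * Y powr (-A) * G
       + (A + 2) * (K\<psi> * (Z powr 2 * dnorm a 2) * MX * GV)
       + 2 * (X powr 2 * dnorm g 2 * Y powr (1/2 - Re \<rho>)) * integral {-V..V} (\<lambda>v. norm (P (Complex (1/2) (Im \<rho> + v))))"
proof -
  define S where "S = {w. \<bar>Im w\<bar> \<le> V}"
  have ImS: "t1 \<le> \<bar>Im (\<rho> + w)\<bar>" "\<bar>Im (\<rho> + w)\<bar> \<le> H" if "w \<in> S" for w
    using that \<gamma> by (auto simp: S_def)
  have SC: "Complex x v \<in> S" if "\<bar>v\<bar> \<le> V" for x v using that by (simp add: S_def)
  have Sne: "\<rho> + w \<noteq> 1" if "w \<in> S" for w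
  proof
    assume "\<rho> + w = 1"
    then have "Im (\<rho> + w) = 0" by (simp only: one_complex.simps)
    then show False using ImS[OF that] t1 by (simp only: abs_zero)
  qed
  define M where "M = partial_dirsum g X"
  define a' where "a' = (\<lambda>n. cnj (a n))"
  define E where "E = smooth_kernel Y"
  have a': "dabs a' 2" "dnorm a' 2 = dnorm a 2" using a by (simp_all add: a'_def)
  have Y0: "Y > 0" and X0: "X \<ge> 0" using XY by auto
  define f where "f w = F (\<rho> + w) * M (\<rho> + w) * E w" for w
  define q where "q w = \<psi> (\<rho> + w) * P (\<rho> + w) * M (\<rho> + w) * E w / w" for w
  have Fh: "(\<lambda>w. F (\<rho> + w)) holomorphic_on S"
  proof -
    have h: "(\<lambda>w. \<rho> + w) holomorphic_on S" by (intro holomorphic_intros)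
    have sub: "(\<lambda>w. \<rho> + w) ` S \<subseteq> - {1}" using Sne by auto
    from holomorphic_on_compose_gen[OF h hol sub] show ?thesis by (simp only: o_def)
  qed
  have \<psi>h: "(\<lambda>w. \<psi> (\<rho> + w)) holomorphic_on S"
  proof -
    have h: "(\<lambda>w. \<rho> + w) holomorphic_on S" by (intro holomorphic_intros)
    have sub: "(\<lambda>w. \<rho> + w) ` S \<subseteq> {s. \<bar>Im s\<bar> \<ge> t1}" using ImS(1) by auto
    from holomorphic_on_compose_gen[OF h \<psi>hol[OF order_refl] sub] show ?thesis by (simp only: o_def)
  qed
  have fh: "f holomorphic_on S" unfolding f_def M_def E_def by (intro holomorphic_intros Fh)
  have fwh: "(\<lambda>w. f w / w) holomorphic_on S - {0}" by (intro holomorphic_intros holomorphic_on_subset[OF fh]) auto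
  have qh: "q holomorphic_on S - {0}"
    unfolding q_def P_def M_def E_def by (intro holomorphic_intros holomorphic_on_subset[OF \<psi>h]) auto
  have f0: "f 0 = 0" by (simp add: f_def F\<rho>)
  have nE: "norm (E (Complex x v)) = Y powr x * exp (x\<^sup>2 - v\<^sup>2)" for x v
    unfolding E_def using norm_smooth_kernel[OF Y0, of "Complex x v"] by simp
  have nN: "dnorm g 2 \<ge> 0" "dnorm a 2 \<ge> 0" "MX \<ge> 0" by (auto simp: dnorm_nonneg MX_def)
  \<comment> \<open>This bound serves the whole strip and costs a high power of X. On the critical
    line the loss enters the count of zeros, so a cheaper bound is kept for it.\<close>
  have Mb: "norm (M s) \<le> MX" if "-A \<le> Re s" for s
    unfolding M_def MX_def using norm_partial_dirsum_le[OF g that] A XY by simp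
  have Mb2: "norm (M s) \<le> X powr 2 * dnorm g 2" if "0 \<le> Re s" for s
    unfolding M_def using norm_partial_dirsum_le[OF g, of 0 s] that XY by simp
  \<comment> \<open>At Re w = x0 the point s = \<rho> + w has real part -A, and
    \<open>1 - cnj s\<close> lies in the half-plane of absolute convergence.\<close>
  define x0 where "x0 = - A - Re \<rho>"
  have x0: "x0 \<le> - A" "\<bar>x0\<bar> \<le> A + 1" "x0 \<le> -1" using \<beta> A by (auto simp: x0_def)
  have KF0: "KF \<ge> 0" by (rule order_trans[OF norm_ge_zero Fb[of \<rho>]]) (use ImS[of 0] V \<beta> A in \<open>auto simp: S_def\<close>)
  have K\<psi>0: "K\<psi> \<ge> 0"
    by (rule order_trans[OF norm_ge_zero \<psi>b[of "Complex 0 (Im \<rho>)"]]) (use ImS[of 0] V A in \<open>auto simp: S_def\<close>)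
  have sq: "x\<^sup>2 \<le> (A + 1)\<^sup>2" if "\<bar>x\<bar> \<le> A + 1" for x
    using that A by (intro abs_le_square_iff[THEN iffD1]) auto
  have Vs: "v\<^sup>2 = V\<^sup>2" if "v = V \<or> v = -V" for v using that by auto

  text \<open>The pole of \<open>f w / w\<close> at \<open>0\<close> is cancelled by the zero of \<open>F\<close>.\<close>
  define R L where "R = vint (\<lambda>w. f w / w) A V" and "L = vint (\<lambda>w. f w / w) x0 V"
  define Eh where "Eh = KF * MX * Y powr A * GV"
  have RL: "norm (R - L) \<le> 2 * Eh * (A - x0)"
  proof -
    have "norm (2 * of_real pi * f 0 - (R - L)) \<le> 2 * Eh * (A - x0)"
      unfolding R_def L_def
    proof (rule vint_shift_pole)
      show "f holomorphic_on cbox (Complex x0 (- V)) (Complex A V)"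
        by (rule holomorphic_on_subset[OF fh]) (auto simp: S_def in_cbox_complex_iff)
      fix x assume x: "x0 \<le> x" "x \<le> A"
      have "norm (f (Complex x v) / Complex x v) \<le> Eh" if v: "v = V \<or> v = -V" for v
      proof -
        have vS: "Complex x v \<in> S" using v V by (intro SC) auto
        have Rx: "- A \<le> Re (\<rho> + Complex x v)" using x by (simp add: x0_def)
        have "norm (f (Complex x v)) \<le> KF * MX * (Y powr A * GV)"
          unfolding f_def norm_mult
        proof (intro mult_mono Fb ImS[OF vS] Rx Mb)
          have "x\<^sup>2 \<le> (A + 1)\<^sup>2" using x x0 A by (intro sq) auto
          then show "norm (E (Complex x v)) \<le> Y powr A * GV"
            unfolding nE GV_def Vs[OF v] using x XY by (intro mult_mono powr_mono) auto
        qed (use KF0 nN in auto)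
        moreover have "1 \<le> norm (Complex x v)" using abs_Re_le_norm_line(2)[of v x] v V by auto
        ultimately have "norm (f (Complex x v)) / norm (Complex x v) \<le> KF * MX * (Y powr A * GV) / 1"
          by (intro frac_le) (use KF0 nN in \<open>auto simp: GV_def\<close>)
        then show ?thesis by (simp add: norm_divide Eh_def mult.assoc)
      qed
      then show "norm (f (Complex x V) / Complex x V) \<le> Eh \<and> norm (f (Complex x (- V)) / Complex x (- V)) \<le> Eh" by blast
    qed (use x0 A V in auto)
    then show ?thesis using f0 by (simp add: norm_minus_commute)
  qed

  define W where "W = (\<Sum>n\<in>{1..nat \<lfloor>U\<rfloor>}. c n * of_nat n powr (-\<rho>) * weight A V (Y / real n))"
  have tr: "dabs (truncate_at X g) 2" by (rule dirsum_truncate_at(2)[OF X0])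
  have cd: "dabs c 2" unfolding c_def by (rule dabs_dconv[OF a tr])
  have cn: "dnorm c 2 \<le> dnorm a 2 * dnorm g 2"
    unfolding c_def using dabs_dconv(2)[OF a tr] mult_left_mono[OF dnorm_truncate_at_le[OF g X0] nN(2)] by linarith
  define ER where "ER = U powr (2 - A) * (dnorm a 2 * dnorm g 2) * Y powr A * G"
  \<comment> \<open>On the right line F times the truncated factor is the series of c, and its terms
    up to U integrate to the weights.\<close>
  have Rb: "norm (R - 2 * of_real pi * W) \<le> pi * ER"
  proof -
    define h where "h w = partial_dirsum c U (\<rho> + w) * E w / w" for w
    have hh: "h holomorphic_on S - {0}" unfolding h_def E_def by (intro holomorphic_intros) auto
    have LA: "Complex A v \<in> S - {0}" if "\<bar>v\<bar> \<le> V" for v using SC[OF that] A by (auto simp: complex_eq_iff)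
    have h_eq: "h w = (\<Sum>n\<in>{1..nat \<lfloor>U\<rfloor>}. (c n * of_nat n powr (-\<rho>)) * (smooth_kernel (Y / real n) w / w))" for w
      unfolding h_def partial_dirsum_def sum_distrib_right sum_divide_distrib
    proof (intro sum.cong refl)
      fix n assume "n \<in> {1..nat \<lfloor>U\<rfloor>}"
      then have n: "n \<ge> 1" by simp
      have "c n * of_nat n powr (-(\<rho> + w)) * E w / w = c n * (of_nat n powr (-(\<rho> + w)) * smooth_kernel Y w) / w"
        by (simp add: E_def mult.assoc)
      also have "\<dots> = (c n * of_nat n powr (-\<rho>)) * (smooth_kernel (Y / real n) w / w)"
        unfolding of_nat_powr_smooth_kernel[OF n Y0] by (simp add: mult.assoc)
      finally show "c n * of_nat n powr (-(\<rho> + w)) * E w / w = (c n * of_nat n powr (-\<rho>)) * (smooth_kernel (Y / real n) w / w)" .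
    qed
    have "vint h A V = (\<Sum>n\<in>{1..nat \<lfloor>U\<rfloor>}. (c n * of_nat n powr (-\<rho>)) * vint (\<lambda>w. smooth_kernel (Y / real n) w / w) A V)"
      unfolding h_eq[abs_def]
      by (rule vint_sum[where S = "S - {0}"]) (use LA in \<open>auto intro!: holomorphic_intros\<close>)
    also have "\<dots> = 2 * of_real pi * W"
      unfolding W_def weight_def sum_distrib_left by (intro sum.cong refl) simp
    finally have hW: "vint h A V = 2 * of_real pi * W" .
    have "R - 2 * of_real pi * W = vint (\<lambda>w. f w / w - h w) A V"
      unfolding R_def hW[symmetric] by (rule vint_diff[OF fwh hh, symmetric]) (rule LA)
    also have "norm \<dots> \<le> pi * ER"
    proof (rule norm_vint_le_gaussian[where S = "S - {0}"])
      fix v assume v: "\<bar>v\<bar> \<le> V"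
      define s where "s = \<rho> + Complex A v"
      have Res: "Re s \<ge> 2" "Re s \<ge> A" using A \<beta> by (auto simp: s_def)
      have "F s * M s = dirsum c s"
        unfolding c_def M_def using dirsum_dconv[OF a tr Res(1)] dirsum_truncate_at(1)[OF X0, of g s] ser[of s] Res by simp
      then have "f (Complex A v) / Complex A v - h (Complex A v) = (dirsum c s - partial_dirsum c U s) * E (Complex A v) / Complex A v"
        by (simp add: f_def h_def s_def[symmetric] left_diff_distrib diff_divide_distrib)
      also have "norm \<dots> \<le> (U powr (2 - A) * (dnorm a 2 * dnorm g 2)) * (Y powr A * exp (A\<^sup>2 - v\<^sup>2)) / 1"
        unfolding norm_divide norm_mult nE
      proof (intro frac_le mult_mono)
        have "norm (dirsum c s - partial_dirsum c U s) \<le> U powr (2 - Re s) * dnorm c 2"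
          by (rule norm_dirsum_tail_le[OF cd Res(1)]) (use XY in simp)
        also have "\<dots> \<le> U powr (2 - A) * (dnorm a 2 * dnorm g 2)"
          using XY Res cn dnorm_nonneg by (intro mult_mono powr_mono) auto
        finally show "norm (dirsum c s - partial_dirsum c U s) \<le> U powr (2 - A) * (dnorm a 2 * dnorm g 2)" .
        show "1 \<le> norm (Complex A v)" using abs_Re_le_norm_line(1)[of A v] A by simp
      qed (use nN in auto)
      also have "\<dots> \<le> ER * exp (- v\<^sup>2)"
      proof -
        have "A\<^sup>2 \<le> (A + 1)\<^sup>2" using A by (intro sq) auto
        then have "exp (A\<^sup>2 - v\<^sup>2) \<le> G * exp (- v\<^sup>2)" unfolding G_def by (simp add: exp_add[symmetric])
        then have "(U powr (2 - A) * (dnorm a 2 * dnorm g 2) * Y powr A) * exp (A\<^sup>2 - v\<^sup>2) \<le> (U powr (2 - A) * (dnorm a 2 * dnorm g 2) * Y powr A) * (G * exp (- v\<^sup>2))"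
          by (rule mult_left_mono) (use nN in auto)
        then show ?thesis by (simp add: ER_def mult.assoc)
      qed
      finally show "norm (f (Complex A v) / Complex A v - h (Complex A v)) \<le> ER * exp (- v\<^sup>2)" .
    qed (use LA V nN in \<open>auto intro!: holomorphic_on_diff fwh hh simp: ER_def G_def\<close>)
    finally show ?thesis .
  qed

  define EL where "EL = K\<psi> * (Z powr (1 - A) * dnorm a 2) * MX * Y powr (-A) * G"
  define QL where "QL = vint q x0 V"
  have Lx: "Complex x0 v \<in> S - {0}" if "\<bar>v\<bar> \<le> V" for v using SC[OF that] x0 A by (auto simp: complex_eq_iff)
  \<comment> \<open>On the left line the functional equation turns F into \<psi> times the dual
    series, of which the terms up to Z are kept.\<close>
  have Lb: "norm (L - QL) \<le> pi * EL"
  proof -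
    have "L - QL = vint (\<lambda>w. f w / w - q w) x0 V"
      unfolding L_def QL_def by (rule vint_diff[OF fwh qh, symmetric]) (rule Lx)
    also have "norm \<dots> \<le> pi * EL"
    proof (rule norm_vint_le_gaussian[where S = "S - {0}"])
      fix v assume v: "\<bar>v\<bar> \<le> V"
      define w where "w = Complex x0 v"
      define s where "s = \<rho> + w"
      have wS: "w \<in> S" unfolding w_def by (rule SC[OF v])
      have Res: "Re s = - A" by (simp add: s_def w_def x0_def)
      have "F s = \<psi> s * cnj (F (1 - cnj s))" using ImS(1)[OF wS] by (intro fe) (simp add: s_def)
      also have "F (1 - cnj s) = dirsum a (1 - cnj s)" using Res A by (intro ser) simp
      also have "cnj (dirsum a (1 - cnj s)) = dirsum a' (1 - s)" unfolding a'_def using dirsum_cnj[of a "1 - cnj s"] by simp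
      finally have Fs: "F s = \<psi> s * dirsum a' (1 - s)" .
      have "f w / w - q w = \<psi> s * (dirsum a' (1 - s) - partial_dirsum a' Z (1 - s)) * M s * E w / w"
        by (simp add: f_def q_def s_def[symmetric] Fs P_def a'_def left_diff_distrib right_diff_distrib diff_divide_distrib)
      also have "norm \<dots> \<le> K\<psi> * (Z powr (1 - A) * dnorm a 2) * MX * (Y powr (-A) * exp (x0\<^sup>2 - v\<^sup>2)) / 1"
        unfolding norm_divide norm_mult
      proof (intro frac_le mult_mono)
        show "norm (\<psi> s) \<le> K\<psi>" using ImS[OF wS] Res A by (intro \<psi>b) (auto simp: s_def)
        have "norm (dirsum a' (1 - s) - partial_dirsum a' Z (1 - s)) \<le> Z powr (2 - Re (1 - s)) * dnorm a' 2"
          by (rule norm_dirsum_tail_le[OF a'(1)]) (use Res A XY in auto)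
        then show "norm (dirsum a' (1 - s) - partial_dirsum a' Z (1 - s)) \<le> Z powr (1 - A) * dnorm a 2" using Res a' by simp
        show "norm (M s) \<le> MX" using Res by (intro Mb) simp
        show "norm (E w) \<le> Y powr (-A) * exp (x0\<^sup>2 - v\<^sup>2)"
          unfolding w_def nE using x0 XY by (intro mult_right_mono powr_mono) auto
        show "1 \<le> norm w" using abs_Re_le_norm_line(1)[of x0 v] x0 by (simp add: w_def)
      qed (use nN K\<psi>0 in auto)
      also have "\<dots> \<le> EL * exp (- v\<^sup>2)"
      proof -
        have "x0\<^sup>2 \<le> (A + 1)\<^sup>2" using x0 by (intro sq)
        then have "exp (x0\<^sup>2 - v\<^sup>2) \<le> G * exp (- v\<^sup>2)" unfolding G_def by (simp add: exp_add[symmetric])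
        then have "(K\<psi> * (Z powr (1 - A) * dnorm a 2) * MX * Y powr (-A)) * exp (x0\<^sup>2 - v\<^sup>2) \<le> (K\<psi> * (Z powr (1 - A) * dnorm a 2) * MX * Y powr (-A)) * (G * exp (- v\<^sup>2))"
          by (rule mult_left_mono) (use nN K\<psi>0 in auto)
        then show ?thesis by (simp add: EL_def mult.assoc)
      qed
      finally show "norm (f (Complex x0 v) / Complex x0 v - q (Complex x0 v)) \<le> EL * exp (- v\<^sup>2)" by (simp add: w_def)
    qed (use Lx V nN K\<psi>0 in \<open>auto intro!: holomorphic_on_diff fwh qh simp: EL_def G_def\<close>)
    finally show ?thesis .
  qed

  \<comment> \<open>At Re w = x1 the point \<rho> + w is on the critical line, where \<psi> has
    modulus 1. The pole of 1/w is not crossed, as x1 \<le> -2/5.\<close>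
  define x1 where "x1 = 1/2 - Re \<rho>"
  have x1: "x1 \<le> - 2/5" "-1/2 \<le> x1" using \<beta> by (auto simp: x1_def)
  define QR where "QR = vint q x1 V"
  define Ep where "Ep = K\<psi> * (Z powr 2 * dnorm a 2) * MX * GV"
  have Qs: "norm (QR - QL) \<le> 2 * Ep * (x1 - x0)"
    unfolding QR_def QL_def
  proof (rule vint_shift)
    show "q holomorphic_on cbox (Complex x0 (- V)) (Complex x1 V)"
      by (rule holomorphic_on_subset[OF qh]) (use x1 in \<open>auto simp: S_def in_cbox_complex_iff\<close>)
    fix x assume x: "x0 \<le> x" "x \<le> x1"
    have "norm (q (Complex x v)) \<le> Ep" if v: "v = V \<or> v = -V" for v
    proof -
      define w where "w = Complex x v"
      have wS: "w \<in> S" unfolding w_def using v V by (intro SC) auto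
      have Rx: "- A \<le> Re (\<rho> + w)" "Re (\<rho> + w) \<le> 1/2" using x by (auto simp: x0_def x1_def w_def)
      have "norm (q w) \<le> K\<psi> * (Z powr 2 * dnorm a 2) * MX * GV / 1"
        unfolding q_def norm_divide norm_mult
      proof (intro frac_le mult_mono)
        show "norm (\<psi> (\<rho> + w)) \<le> K\<psi>" by (intro \<psi>b ImS[OF wS] Rx)
        show "norm (P (\<rho> + w)) \<le> Z powr 2 * dnorm a 2"
          unfolding P_def a'_def[symmetric] using norm_partial_dirsum_le[OF a'(1), of 0 "1 - (\<rho> + w)" Z] Rx XY a'(2) by simp
        show "norm (M (\<rho> + w)) \<le> MX" by (rule Mb[OF Rx(1)])
        have "x\<^sup>2 \<le> (A + 1)\<^sup>2" using x x0 x1 A by (intro sq) auto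
        moreover have "Y powr x \<le> Y powr 0" using x x1 XY by (intro powr_mono) auto
        ultimately have "Y powr x * exp (x\<^sup>2 - V\<^sup>2) \<le> 1 * GV" unfolding GV_def using XY by (intro mult_mono) auto
        then show "norm (E w) \<le> GV" unfolding w_def nE Vs[OF v] by simp
        show "1 \<le> norm w" unfolding w_def using abs_Re_le_norm_line(2)[of v x] v V by auto
      qed (use nN K\<psi>0 in \<open>auto simp: GV_def\<close>)
      then show ?thesis by (simp add: w_def Ep_def)
    qed
    then show "norm (q (Complex x V)) \<le> Ep \<and> norm (q (Complex x (- V))) \<le> Ep" by blast
  qed (use x0 x1 A V in auto)

  define k where "k = X powr 2 * dnorm g 2 * Y powr x1"
  define J where "J = integral {-V..V} (\<lambda>v. norm (P (Complex (1/2) (Im \<rho> + v))))"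
  have k0: "k \<ge> 0" using nN by (simp add: k_def)
  have Pc: "continuous_on {-V..V} (\<lambda>v. norm (P (Complex (1/2) (Im \<rho> + v))))"
  proof -
    have "P holomorphic_on UNIV" unfolding P_def by (intro holomorphic_intros)
    then have PU: "continuous_on UNIV P" by (rule holomorphic_on_imp_continuous_on)
    have l: "continuous_on {-V..V} (\<lambda>v. Complex (1/2) (Im \<rho> + v))"
      unfolding Complex_eq by (intro continuous_intros)
    show ?thesis by (rule continuous_on_norm, rule continuous_on_compose2[OF PU l]) auto
  qed
  have QRb: "norm QR \<le> 15/2 * k * J"
  proof -
    have "norm QR \<le> integral {-V..V} (\<lambda>v. 15/2 * k * norm (P (Complex (1/2) (Im \<rho> + v))))"
      unfolding QR_def vint_def
    proof (rule integral_norm_bound_integral)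
      show "(\<lambda>v. q (Complex x1 v)) integrable_on {-V..V}"
        by (rule vint_integrable(1)[OF qh]) (use SC x1 in \<open>auto simp: complex_eq_iff\<close>)
      show "(\<lambda>v. 15/2 * k * norm (P (Complex (1/2) (Im \<rho> + v)))) integrable_on {-V..V}"
        by (intro integrable_continuous_interval continuous_intros Pc)
      fix v assume v: "v \<in> {-V..V}"
      define w where "w = Complex x1 v"
      have wS: "w \<in> S" unfolding w_def using v by (intro SC) auto
      have rw: "\<rho> + w = Complex (1/2) (Im \<rho> + v)" by (simp add: w_def x1_def complex_eq_iff)
      \<comment> \<open>Here 2/5 bounds |w| from below on this line, and 3 bounds the exponential;
        their quotient is the 15/2.\<close>
      have "norm (q w) \<le> 1 * norm (P (\<rho> + w)) * (X powr 2 * dnorm g 2) * (Y powr x1 * 3) / (2/5)"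
        unfolding q_def norm_divide norm_mult
      proof (intro frac_le mult_mono)
        show "norm (\<psi> (\<rho> + w)) \<le> 1" using \<psi>1[OF ImS(1)[OF wS]] by (simp add: rw)
        show "norm (M (\<rho> + w)) \<le> X powr 2 * dnorm g 2" by (rule Mb2) (simp add: rw)
        have "\<bar>x1\<bar> \<le> \<bar>1\<bar>" using x1 by auto
        then have "x1\<^sup>2 \<le> 1\<^sup>2" by (rule abs_le_square_iff[THEN iffD1])
        then have "x1\<^sup>2 - v\<^sup>2 \<le> 1" using zero_le_power2[of v] unfolding one_power2 by linarith
        then have "exp (x1\<^sup>2 - v\<^sup>2) \<le> exp 1" by simp
        also have "\<dots> \<le> 3" by (rule exp_le)
        finally show "norm (E w) \<le> Y powr x1 * 3" unfolding w_def nE by (intro mult_left_mono) auto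
        show "2/5 \<le> norm w" using abs_Re_le_norm_line(1)[of x1 v] x1 by (simp add: w_def)
      qed (use nN in auto)
      then show "norm (q (Complex x1 v)) \<le> 15/2 * k * norm (P (Complex (1/2) (Im \<rho> + v)))"
        unfolding rw by (simp add: w_def k_def mult_ac)
    qed
    also have "\<dots> = 15/2 * k * J" unfolding J_def by (rule integral_mult_right)
    finally show ?thesis .
  qed

  have nn: "Eh \<ge> 0" "ER \<ge> 0" "EL \<ge> 0" "Ep \<ge> 0" using KF0 K\<psi>0 nN by (auto simp: Eh_def ER_def EL_def Ep_def G_def GV_def)
  have J0: "k * J \<ge> 0" unfolding J_def using k0 by (intro mult_nonneg_nonneg integral_nonneg integrable_continuous_interval Pc) auto
  have "2 * pi * norm W = norm (2 * of_real pi * W)" by (simp add: norm_mult)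
  \<comment> \<open>Each bracket has been estimated: crossing to the left, passing to the dual
    polynomial, returning to the critical line, and comparing the right line with the
    weights.\<close>
  also have "2 * of_real pi * W = (R - L) + (L - QL) + QR - (QR - QL) - (R - 2 * of_real pi * W)" by simp
  also have "norm \<dots> \<le> norm (R - L) + norm (L - QL) + norm QR + norm (QR - QL) + norm (R - 2 * of_real pi * W)"
    by (intro order_trans[OF norm_triangle_ineq4] order_trans[OF norm_triangle_ineq] add_mono order_refl)
  also have "\<dots> \<le> 2 * Eh * (A - x0) + pi * EL + 15/2 * k * J + 2 * Ep * (x1 - x0) + pi * ER"
    by (intro add_mono RL Lb QRb Qs Rb)
  also have "\<dots> \<le> 2 * pi * ((2 * A + 1) * Eh) + 2 * pi * EL + 2 * pi * (2 * k * J) + 2 * pi * ((A + 2) * Ep) + 2 * pi * ER"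
  proof (intro add_mono)
    have "2 * (Eh * (A - x0)) \<le> (2 * pi) * (Eh * (2 * A + 1))"
      using nn x0 A pi_gt3 by (intro mult_mono) auto
    then show "2 * Eh * (A - x0) \<le> 2 * pi * ((2 * A + 1) * Eh)" by (simp add: mult_ac)
    have "2 * (Ep * (x1 - x0)) \<le> (2 * pi) * (Ep * (A + 2))"
      using nn x0 x1 A pi_gt3 by (intro mult_mono) auto
    then show "2 * Ep * (x1 - x0) \<le> 2 * pi * ((A + 2) * Ep)" by (simp add: mult_ac)
    have "15/2 * (k * J) \<le> (4 * pi) * (k * J)" using J0 pi_gt3 by (intro mult_right_mono) auto
    then show "15/2 * k * J \<le> 2 * pi * (2 * k * J)" by (simp add: mult_ac)
  qed (use nn pi_gt3 in \<open>auto intro!: mult_right_mono\<close>)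
  also have "\<dots> = 2 * pi * ((2 * A + 1) * Eh + ER + EL + (A + 2) * Ep + 2 * k * J)" by (simp only: distrib_left add_ac)
  finally have "norm W \<le> (2 * A + 1) * Eh + ER + EL + (A + 2) * Ep + 2 * k * J" by (rule mult_left_le_imp_le) simp
  then show ?thesis unfolding W_def Eh_def ER_def EL_def Ep_def k_def J_def x1_def .
qed

text \<open>All divisors of n are at most n, hence at most X, so the truncation is not felt.\<close>

lemma dconv_truncate_at:
  assumes "real n \<le> X" "n \<ge> 1"
  shows "dconv a (truncate_at X g) n = dconv a g n"
  unfolding dconv_def
proof (intro sum.cong refl)
  fix d assume "d \<in> {d. d dvd n}"
  then have "1 \<le> n div d" using div_ge_1 assms by blast
  moreover have "real (n div d) \<le> X" by (rule order_trans[OF _ assms(1)]) simp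
  ultimately show "a d * truncate_at X g (n div d) = a d * g (n div d)" using assms by (simp add: truncate_at_def)
qed

text \<open>Up to X the convolution agrees with h and the weights are near 1, so that part of the
  sum is close to \<open>dirsum h \<rho>\<close> and has modulus at least 3/4 of c0. The whole sum
  is small apart from the critical line integral; hence the terms beyond X or that integral must
  compensate. The weights W depend on T but not on \<rho>, so one polynomial serves all zeros and
  large values estimates apply to it.\<close>

lemma zero_detection:
  fixes F :: "complex \<Rightarrow> complex" and D \<delta> :: real and a g h :: "nat \<Rightarrow> complex"
  assumes F: "F \<in> selberg_class" and fe: "selberg_functional_equation F \<omega> Q r lam mu"
    and D: "D \<ge> 1" "(\<Sum>j=1..r. lam j) \<le> D" and \<delta>: "0 < \<delta>" "\<delta> \<le> 1/10"
    and a: "ram a" and g: "ram g" and ser: "\<And>s. Re s > 1 \<Longrightarrow> F s = dirsum a s"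
    and ag: "\<And>n. n \<ge> 1 \<Longrightarrow> dconv a g n = h n" and h: "dabs h (4/5)"
    and c0: "c0 > 0" "\<And>s. Re s \<ge> 4/5 \<Longrightarrow> c0 \<le> norm (dirsum h s)"
  shows "\<exists>CW>0. \<exists>c2>0. \<exists>Ts\<ge>1. \<forall>T\<ge>Ts. \<exists>W :: nat \<Rightarrow> complex. (\<forall>n. norm (W n) \<le> CW) \<and>
    (\<forall>\<rho>. F \<rho> = 0 \<longrightarrow> 9/10 \<le> Re \<rho> \<longrightarrow> Re \<rho> \<le> 1 \<longrightarrow> 2 * T powr \<delta> \<le> \<bar>Im \<rho>\<bar> \<longrightarrow> \<bar>Im \<rho>\<bar> \<le> T \<longrightarrow>
      c0 / 4 \<le> norm (\<Sum>n\<in>{1..nat \<lfloor>T powr (D + \<delta>)\<rfloor>}.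
         (if real n \<le> T powr \<delta> then 0 else dconv a (truncate_at (T powr \<delta>) g) n * W n) * of_nat n powr (-\<rho>)) \<or>
      c2 * T powr (D * (Re \<rho> - 1/2) - 2 * \<delta>) \<le> integral {- (T powr \<delta>)..T powr \<delta>}
         (\<lambda>v. norm (partial_dirsum (\<lambda>n. cnj (a n)) (T powr (D + 2 * \<delta>)) (1 - Complex (1/2) (Im \<rho> + v)))))"
proof -
  text \<open>Each of the two tails carries a factor \<open>T powr (- \<delta> * A)\<close>, which has to beat \<open>T powr (2 * D)\<close>.\<close>
  define A where "A = (2 * D + 5) / \<delta>"
  have \<delta>A: "\<delta> * A = 2 * D + 5" using \<delta> by (simp add: A_def)
  have A: "A \<ge> 2" using \<delta> D by (simp add: A_def field_simps)
  define \<psi> where "\<psi> = gamma_ratio \<omega> Q r lam mu"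
  obtain t1 where t1: "t1 \<ge> 1"
    and fe': "\<And>s. \<bar>Im s\<bar> \<ge> t1 \<Longrightarrow> F s = \<psi> s * cnj (F (1 - cnj s))"
    and \<psi>hol: "\<And>S. S \<subseteq> {s. \<bar>Im s\<bar> \<ge> t1} \<Longrightarrow> \<psi> holomorphic_on S"
    and \<psi>1: "\<And>s. \<bar>Im s\<bar> \<ge> t1 \<Longrightarrow> Re s = 1/2 \<Longrightarrow> norm (\<psi> s) = 1"
    and \<psi>A: "\<And>A. A \<ge> 0 \<Longrightarrow> \<exists>C>0. \<forall>s. \<bar>Im s\<bar> \<ge> t1 \<longrightarrow> -A \<le> Re s \<longrightarrow> Re s \<le> 1/2 \<longrightarrow>
        norm (\<psi> s) \<le> C * \<bar>Im s\<bar> powr ((\<Sum>j=1..r. lam j) * (1 - 2 * Re s))"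
    using selberg_functional_equation_ratio[OF fe] unfolding \<psi>_def by blast
  obtain C\<psi> where C\<psi>: "C\<psi> > 0" "\<And>s. \<bar>Im s\<bar> \<ge> t1 \<Longrightarrow> -A \<le> Re s \<Longrightarrow> Re s \<le> 1/2 \<Longrightarrow>
        norm (\<psi> s) \<le> C\<psi> * \<bar>Im s\<bar> powr ((\<Sum>j=1..r. lam j) * (1 - 2 * Re s))"
    using \<psi>A[of A] A by auto
  have A1: "A \<ge> 1" using A by simp
  obtain B CF where B: "B \<ge> 0" and CF: "CF > 0" "\<And>s. -A \<le> Re s \<Longrightarrow> \<bar>Im s\<bar> \<ge> 1 \<Longrightarrow> norm (F s) \<le> CF * \<bar>Im s\<bar> powr B"
    by (rule selberg_class_polynomial_growth[OF F fe A1]) blast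
  have hol: "F holomorphic_on - {1}" by (rule selberg_class_entire[OF F]) blast
  have da: "dabs a 2" and dg: "dabs g 2" using ram_dabs[OF a, of 2] ram_dabs[OF g, of 2] by auto
  define Na Ng Nh where "Na = dnorm a 2" and "Ng = dnorm g 2" and "Nh = dnorm h (4/5)"
  have N0: "Na \<ge> 0" "Ng \<ge> 0" "Nh \<ge> 0" by (auto simp: Na_def Ng_def Nh_def dnorm_nonneg)
  define Lm where "Lm = D * (1 + 2 * A)"
  define G where "G = exp ((A + 1)\<^sup>2)"

  \<comment> \<open>With V = \<open>T powr \<delta>\<close> the Gaussian beats every power of T;
    this disposes of all horizontal sides, including those behind the weights.\<close>
  have tiny: "eventually (\<lambda>T::real. K * (T powr p * exp (- (T powr \<delta>)\<^sup>2)) \<le> e) at_top" if "e > 0" for K p e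
  proof -
    have "((\<lambda>T::real. T powr p * exp (- (T powr \<delta>)\<^sup>2)) \<longlongrightarrow> 0) at_top" using \<delta> by real_asymp
    then have "((\<lambda>T::real. K * (T powr p * exp (- (T powr \<delta>)\<^sup>2))) \<longlongrightarrow> K * 0) at_top" by (rule tendsto_mult_left)
    then have "eventually (\<lambda>T::real. K * (T powr p * exp (- (T powr \<delta>)\<^sup>2)) < e) at_top" using that by (intro order_tendstoD(2)) auto
    then show ?thesis by eventually_elim simp
  qed
  have decay: "eventually (\<lambda>T::real. K * T powr (-p) \<le> e) at_top" if "e > 0" "p > 0" for K p e
  proof -
    have "((\<lambda>T::real. T powr (-p)) \<longlongrightarrow> 0) at_top" using that by real_asymp
    then have "((\<lambda>T::real. K * T powr (-p)) \<longlongrightarrow> K * 0) at_top" by (rule tendsto_mult_left)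
    then have "eventually (\<lambda>T::real. K * T powr (-p) < e) at_top" using that by (intro order_tendstoD(2)) auto
    then show ?thesis by eventually_elim simp
  qed
  define K1 where "K1 = (2 * A + 1) * CF * 2 powr B * Ng * G"
  define p1 where "p1 = B + \<delta> * (A + 2) + D * A"
  define K2 where "K2 = Na * Ng * G"
  define K3 where "K3 = C\<psi> * 2 powr Lm * Na * Ng * G"
  define K4 where "K4 = (A + 2) * C\<psi> * 2 powr Lm * Na * Ng * G"
  define p4 where "p4 = Lm + (D + 2 * \<delta>) * 2 + \<delta> * (A + 2)"
  define K5 where "K5 = (A + 1) * exp (A\<^sup>2)"
  have "eventually (\<lambda>T::real. T powr \<delta> \<ge> t1) at_top" using \<delta> by real_asymp
  moreover have "eventually (\<lambda>T::real. K1 * (T powr p1 * exp (- (T powr \<delta>)\<^sup>2)) \<le> c0 / 32) at_top" using c0 by (intro tiny) auto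
  moreover have "eventually (\<lambda>T::real. K2 * T powr (- (5 - 2 * \<delta>)) \<le> c0 / 32) at_top" using c0 \<delta> by (intro decay) auto
  moreover have "eventually (\<lambda>T::real. K3 * T powr (- (5 - 4 * \<delta>)) \<le> c0 / 32) at_top" using c0 \<delta> by (intro decay) auto
  moreover have "eventually (\<lambda>T::real. K4 * (T powr p4 * exp (- (T powr \<delta>)\<^sup>2)) \<le> c0 / 32) at_top" using c0 by (intro tiny) auto
  moreover have "eventually (\<lambda>T::real. Nh * T powr (- (\<delta> / 10)) \<le> c0 / 8) at_top" using c0 \<delta> by (intro decay) auto
  moreover have "eventually (\<lambda>T::real. (3 * Nh) * T powr (- (D - \<delta>)) \<le> c0 / 16) at_top" using c0 \<delta> D by (intro decay) auto
  moreover have "eventually (\<lambda>T::real. (Nh * K5) * (T powr (D * A) * exp (- (T powr \<delta>)\<^sup>2)) \<le> c0 / 16) at_top" using c0 by (intro tiny) auto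
  moreover have "eventually (\<lambda>T::real. K5 * (T powr (D * A) * exp (- (T powr \<delta>)\<^sup>2)) \<le> 1) at_top" by (intro tiny) auto
  ultimately have "eventually (\<lambda>T::real. T powr \<delta> \<ge> t1 \<and> K1 * (T powr p1 * exp (- (T powr \<delta>)\<^sup>2)) \<le> c0 / 32 \<and>
     K2 * T powr (- (5 - 2 * \<delta>)) \<le> c0 / 32 \<and> K3 * T powr (- (5 - 4 * \<delta>)) \<le> c0 / 32 \<and> K4 * (T powr p4 * exp (- (T powr \<delta>)\<^sup>2)) \<le> c0 / 32 \<and>
     Nh * T powr (- (\<delta> / 10)) \<le> c0 / 8 \<and> (3 * Nh) * T powr (- (D - \<delta>)) \<le> c0 / 16 \<and>
     (Nh * K5) * (T powr (D * A) * exp (- (T powr \<delta>)\<^sup>2)) \<le> c0 / 16 \<and> K5 * (T powr (D * A) * exp (- (T powr \<delta>)\<^sup>2)) \<le> 1) at_top"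
    by eventually_elim (intro conjI)
  then obtain Ts0 where Ts0: "\<And>T::real. T \<ge> Ts0 \<Longrightarrow> T powr \<delta> \<ge> t1 \<and> K1 * (T powr p1 * exp (- (T powr \<delta>)\<^sup>2)) \<le> c0 / 32 \<and>
     K2 * T powr (- (5 - 2 * \<delta>)) \<le> c0 / 32 \<and> K3 * T powr (- (5 - 4 * \<delta>)) \<le> c0 / 32 \<and> K4 * (T powr p4 * exp (- (T powr \<delta>)\<^sup>2)) \<le> c0 / 32 \<and>
     Nh * T powr (- (\<delta> / 10)) \<le> c0 / 8 \<and> (3 * Nh) * T powr (- (D - \<delta>)) \<le> c0 / 16 \<and>
     (Nh * K5) * (T powr (D * A) * exp (- (T powr \<delta>)\<^sup>2)) \<le> c0 / 16 \<and> K5 * (T powr (D * A) * exp (- (T powr \<delta>)\<^sup>2)) \<le> 1"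
    unfolding eventually_at_top_linorder by blast
  \<comment> \<open>For n \<le> Y the weight is within 4 of 1, which gives 5; for n > Y it is at
    most the exponential.\<close>
  define CW where "CW = 5 + exp (A\<^sup>2)"
  define c2 where "c2 = c0 / (8 * (Ng + 1))"
  have c2: "c2 > 0" using c0 N0 by (simp add: c2_def)
  have CW: "CW > 0" by (simp add: CW_def add_pos_pos)
  show ?thesis
  proof (rule exI[of _ CW], rule conjI[OF CW], rule exI[of _ c2], rule conjI[OF c2], rule exI[of _ "max Ts0 1"], rule conjI, simp, intro allI impI)
    fix T :: real assume TT: "max Ts0 1 \<le> T"
    have T: "T \<ge> 1" "T > 0" using TT by auto
    \<comment> \<open>Y and Z multiply to about \<open>T powr (2 * D)\<close>, the size of the
      conductor. U exceeds Y by one factor X for the sake of the right tail. Z needs two, one of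
      which pays for the size \<open>X powr (A + 2)\<close> of the truncated factor on the left
      line.\<close>
    define X Y Z U V where "X = T powr \<delta>" and "Y = T powr D" and "Z = T powr (D + 2 * \<delta>)" and "U = T powr (D + \<delta>)" and "V = T powr \<delta>"
    note XYdefs = X_def Y_def Z_def U_def V_def
    have ge1: "X \<ge> 1" "Y \<ge> 1" "Z \<ge> 1" "U \<ge> 1" "V \<ge> 1" using T \<delta> D by (auto simp: XYdefs intro!: ge_one_powr_ge_zero)
    have XU: "X \<le> U" "X \<le> Y" unfolding XYdefs using T \<delta> D by (auto intro!: powr_mono)
    have VT: "V \<le> T" unfolding XYdefs using powr_mono[of \<delta> 1 T] T \<delta> by simp
    have ev: "X \<ge> t1" "K1 * (T powr p1 * exp (- V\<^sup>2)) \<le> c0 / 32"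
     "K2 * T powr (- (5 - 2 * \<delta>)) \<le> c0 / 32" "K3 * T powr (- (5 - 4 * \<delta>)) \<le> c0 / 32" "K4 * (T powr p4 * exp (- V\<^sup>2)) \<le> c0 / 32"
     "Nh * T powr (- (\<delta> / 10)) \<le> c0 / 8" "(3 * Nh) * T powr (- (D - \<delta>)) \<le> c0 / 16"
     "(Nh * K5) * (T powr (D * A) * exp (- V\<^sup>2)) \<le> c0 / 16" "K5 * (T powr (D * A) * exp (- V\<^sup>2)) \<le> 1"
      using Ts0[of T] TT unfolding X_def V_def by auto
    define W where "W n = (if 1 \<le> n \<and> real n \<le> U then weight A V (Y / real n) else 0)" for n
    define \<theta> where "\<theta> = (A + 1) * (Y powr A * exp (A\<^sup>2 - V\<^sup>2))"
    have \<theta>_eq: "\<theta> = K5 * (T powr (D * A) * exp (- V\<^sup>2))"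
      using T by (simp add: \<theta>_def K5_def Y_def powr_powr exp_diff exp_minus field_simps)
    have W1: "norm (W n - 1) \<le> 3 * (real n / Y) + \<theta>" if n: "1 \<le> n" "real n \<le> Y" "real n \<le> U" for n
    proof -
      have y1: "Y / real n \<ge> 1" using n by simp
      have "norm (W n - 1) \<le> exp 1 / (Y / real n) + (A + 1) * ((Y / real n) powr A * exp (A\<^sup>2 - V\<^sup>2))"
        using norm_weight_minus_1_le[OF A1 ge1(5) y1] n by (simp add: W_def)
      also have "\<dots> \<le> 3 * (real n / Y) + \<theta>"
      proof (rule add_mono)
        have "exp 1 * (real n / Y) \<le> 3 * (real n / Y)" using exp_le ge1 by (intro mult_right_mono) auto
        then show "exp 1 / (Y / real n) \<le> 3 * (real n / Y)" by simp
        have "Y / real n \<le> Y / 1" using n ge1 by (intro divide_left_mono) auto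
        then have "(Y / real n) powr A \<le> Y powr A" using A y1 by (intro powr_mono2) auto
        then show "(A + 1) * ((Y / real n) powr A * exp (A\<^sup>2 - V\<^sup>2)) \<le> \<theta>"
          unfolding \<theta>_def using A by (intro mult_left_mono mult_right_mono) auto
      qed
      finally show ?thesis .
    qed
    have WC: "norm (W n) \<le> CW" for n
    proof (cases "1 \<le> n \<and> real n \<le> U")
      case True
      show ?thesis
      proof (cases "real n \<le> Y")
        case le: True
        have "norm (W n - 1) \<le> 3 * (real n / Y) + \<theta>" using True le by (intro W1) auto
        also have "\<dots> \<le> 3 * 1 + 1" using le ge1 ev(9) unfolding \<theta>_eq by (intro add_mono mult_left_mono) auto
        finally have "norm (W n - 1) \<le> 4" by simp
        then have "norm (W n) \<le> 5" using norm_triangle_ineq[of "W n - 1" 1] by simp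
        then show ?thesis unfolding CW_def by (simp add: add_increasing2)
      next
        case False
        have y0: "Y / real n > 0" "Y / real n \<le> 1" using False True ge1 by auto
        have "norm (W n) \<le> (Y / real n) powr A * exp (A\<^sup>2)"
          using norm_weight_le[OF A1 _ y0(1), of V] ge1 True by (simp add: W_def)
        also have "\<dots> \<le> 1 * exp (A\<^sup>2)"
        proof (rule mult_right_mono)
          have "(Y / real n) powr A \<le> 1 powr A" using y0 A by (intro powr_mono2) auto
          then show "(Y / real n) powr A \<le> 1" by simp
        qed simp
        finally show ?thesis by (simp add: CW_def)
      qed
    next
      case False
      then have "W n = 0" by (auto simp: W_def)
      then show ?thesis using CW by simp
    qed
    define c where "c = dconv a (truncate_at X g)"
    define P where "P s = partial_dirsum (\<lambda>n. cnj (a n)) Z (1 - s)" for s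
    have main: "c0 / 4 \<le> norm (\<Sum>n\<in>{1..nat \<lfloor>U\<rfloor>}. (if real n \<le> X then 0 else c n * W n) * of_nat n powr (-\<rho>)) \<or>
      c2 * T powr (D * (Re \<rho> - 1/2) - 2 * \<delta>) \<le> integral {-V..V} (\<lambda>v. norm (P (Complex (1/2) (Im \<rho> + v))))"
      if F\<rho>: "F \<rho> = 0" and \<beta>: "9/10 \<le> Re \<rho>" "Re \<rho> \<le> 1" and \<gamma>: "2 * X \<le> \<bar>Im \<rho>\<bar>" "\<bar>Im \<rho>\<bar> \<le> T" for \<rho>
    proof -
      define S1 where "S1 = (\<Sum>n\<in>{1..nat \<lfloor>X\<rfloor>}. h n * of_nat n powr (-\<rho>) * W n)"
      define S2 where "S2 = (\<Sum>n\<in>{1..nat \<lfloor>U\<rfloor>}. (if real n \<le> X then 0 else c n * W n) * of_nat n powr (-\<rho>))"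
      define J where "J = integral {-V..V} (\<lambda>v. norm (P (Complex (1/2) (Im \<rho> + v))))"
      define k where "k = X powr 2 * Ng * Y powr (1/2 - Re \<rho>)"
      have split: "(\<Sum>n\<in>{1..nat \<lfloor>U\<rfloor>}. c n * of_nat n powr (-\<rho>) * weight A V (Y / real n)) = S1 + S2"
      proof -
        have "(\<Sum>n\<in>{1..nat \<lfloor>U\<rfloor>}. c n * of_nat n powr (-\<rho>) * weight A V (Y / real n)) =
          (\<Sum>n\<in>{1..nat \<lfloor>U\<rfloor>}. (if real n \<le> X then h n * of_nat n powr (-\<rho>) * W n else 0) + (if real n \<le> X then 0 else c n * W n) * of_nat n powr (-\<rho>))"
        proof (intro sum.cong refl)
          fix n assume "n \<in> {1..nat \<lfloor>U\<rfloor>}"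
          then have n: "n \<ge> 1" "real n \<le> U" using ge1 by (auto simp: le_nat_floor_iff)
          have "c n = h n" if "real n \<le> X" unfolding c_def using dconv_truncate_at[OF that n(1)] ag[OF n(1)] by simp
          then show "c n * of_nat n powr (-\<rho>) * weight A V (Y / real n) = (if real n \<le> X then h n * of_nat n powr (-\<rho>) * W n else 0) + (if real n \<le> X then 0 else c n * W n) * of_nat n powr (-\<rho>)"
            using n by (simp add: W_def)
        qed
        also have "\<dots> = (\<Sum>n\<in>{1..nat \<lfloor>U\<rfloor>}. (if real n \<le> X then h n * of_nat n powr (-\<rho>) * W n else 0)) + S2"
          by (simp only: sum.distrib S2_def)
        also have "(\<Sum>n\<in>{1..nat \<lfloor>U\<rfloor>}. (if real n \<le> X then h n * of_nat n powr (-\<rho>) * W n else 0)) = S1"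
          unfolding S1_def
        proof (rule sum.mono_neutral_cong_right)
          show "{1..nat \<lfloor>X\<rfloor>} \<subseteq> {1..nat \<lfloor>U\<rfloor>}" using XU by (auto intro!: nat_mono floor_mono elim!: order_trans)
        qed (use ge1 in \<open>auto simp: le_nat_floor_iff\<close>)
        finally show ?thesis .
      qed
      have hsum: "(\<Sum>n\<in>{1..nat \<lfloor>X\<rfloor>}. norm (h n) * real n powr (-(4/5))) \<le> Nh"
        unfolding Nh_def dnorm_def by (rule finite_sum_le_infsum) (use h in \<open>auto simp: dabs_def\<close>)
      have S1b: "norm (S1 - partial_dirsum h X \<rho>) \<le> c0 / 8"
      proof -
        define \<theta>' where "\<theta>' = 3 * (X / Y) + \<theta>"
        have "S1 - partial_dirsum h X \<rho> = (\<Sum>n\<in>{1..nat \<lfloor>X\<rfloor>}. h n * of_nat n powr (-\<rho>) * (W n - 1))"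
          by (simp add: S1_def partial_dirsum_def sum_subtractf[symmetric] algebra_simps)
        also have "norm \<dots> \<le> (\<Sum>n\<in>{1..nat \<lfloor>X\<rfloor>}. (norm (h n) * real n powr (-(4/5))) * \<theta>')"
        proof (rule sum_norm_le)
          fix n assume "n \<in> {1..nat \<lfloor>X\<rfloor>}"
          then have n: "1 \<le> n" "real n \<le> X" using ge1 by (auto simp: le_nat_floor_iff)
          have "norm (W n - 1) \<le> 3 * (real n / Y) + \<theta>" using n XU by (intro W1) auto
          also have "\<dots> \<le> \<theta>'" unfolding \<theta>'_def using n ge1 by (intro add_right_mono mult_left_mono divide_right_mono) auto
          finally have w: "norm (W n - 1) \<le> \<theta>'" .
          show "norm (h n * of_nat n powr (-\<rho>) * (W n - 1)) \<le> (norm (h n) * real n powr (-(4/5))) * \<theta>'"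
            unfolding norm_mult norm_of_nat_powr using n \<beta> w by (intro mult_mono powr_mono) auto
        qed
        also have "\<dots> = (\<Sum>n\<in>{1..nat \<lfloor>X\<rfloor>}. norm (h n) * real n powr (-(4/5))) * \<theta>'" by (rule sum_distrib_right[symmetric])
        also have "\<dots> \<le> Nh * \<theta>'"
          using hsum ge1 A by (intro mult_right_mono) (auto simp: \<theta>'_def \<theta>_def)
        also have "\<dots> = (3 * Nh) * T powr (- (D - \<delta>)) + (Nh * K5) * (T powr (D * A) * exp (- V\<^sup>2))"
        proof -
          have "X / Y = T powr (- (D - \<delta>))" unfolding X_def Y_def by (simp add: powr_diff[symmetric])
          then show ?thesis unfolding \<theta>'_def \<theta>_eq by (simp add: distrib_left mult_ac)
        qed
        also have "\<dots> \<le> c0 / 16 + c0 / 16" by (intro add_mono ev)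
        finally show ?thesis by simp
      qed
      have tail: "norm (dirsum h \<rho> - partial_dirsum h X \<rho>) \<le> c0 / 8"
      proof -
        have "norm (dirsum h \<rho> - partial_dirsum h X \<rho>) \<le> X powr (4/5 - Re \<rho>) * Nh"
          unfolding Nh_def by (rule norm_dirsum_tail_le[OF h]) (use \<beta> ge1 in auto)
        also have "\<dots> \<le> X powr (-1/10) * Nh" using ge1 \<beta> N0 by (intro mult_right_mono powr_mono) auto
        also have "X powr (-1/10) = T powr (- (\<delta> / 10))" unfolding X_def by (simp add: powr_powr)
        finally show ?thesis using ev(6) by (simp add: mult.commute)
      qed
      have "c0 \<le> norm (dirsum h \<rho>)" by (rule c0(2)) (use \<beta> in simp)
      also have "dirsum h \<rho> = (dirsum h \<rho> - partial_dirsum h X \<rho>) - (S1 - partial_dirsum h X \<rho>) + S1" by simp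
      also have "norm \<dots> \<le> norm (dirsum h \<rho> - partial_dirsum h X \<rho>) + norm (S1 - partial_dirsum h X \<rho>) + norm S1"
        by (intro order_trans[OF norm_triangle_ineq4] order_trans[OF norm_triangle_ineq] add_mono order_refl)
      finally have S1: "3 * c0 / 4 \<le> norm S1" using S1b tail by linarith
      have "norm (S1 + S2) \<le> (2 * A + 1) * ((CF * (2 * T) powr B) * (X powr (A + 2) * Ng) * Y powr A * exp ((A + 1)\<^sup>2 - V\<^sup>2))
       + U powr (2 - A) * (Na * Ng) * Y powr A * exp ((A + 1)\<^sup>2)
       + (C\<psi> * (2 * T) powr Lm) * (Z powr (1 - A) * Na) * (X powr (A + 2) * Ng) * Y powr (-A) * exp ((A + 1)\<^sup>2)
       + (A + 2) * ((C\<psi> * (2 * T) powr Lm) * (Z powr 2 * Na) * (X powr (A + 2) * Ng) * exp ((A + 1)\<^sup>2 - V\<^sup>2))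
       + 2 * k * J"
        unfolding split[symmetric] c_def P_def J_def k_def Na_def Ng_def
      proof (rule detection_inequality[OF hol F\<rho> \<beta> ser da dg t1 fe' \<psi>hol \<psi>1 A])
        fix s assume s: "t1 \<le> \<bar>Im s\<bar>" "\<bar>Im s\<bar> \<le> 2 * T" "-A \<le> Re s"
        show "norm (F s) \<le> CF * (2 * T) powr B"
        proof -
          have "norm (F s) \<le> CF * \<bar>Im s\<bar> powr B" using s t1 by (intro CF(2)) auto
          also have "\<dots> \<le> CF * (2 * T) powr B" using s CF B by (intro mult_left_mono powr_mono2) auto
          finally show ?thesis .
        qed
        assume s2: "Re s \<le> 1/2"
        have "(\<Sum>j=1..r. lam j) * (1 - 2 * Re s) \<le> Lm"
        proof -
          have "(\<Sum>j=1..r. lam j) * (1 - 2 * Re s) \<le> D * (1 - 2 * Re s)" using D s2 by (intro mult_right_mono) auto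
          also have "\<dots> \<le> Lm" unfolding Lm_def using D s by (intro mult_left_mono) auto
          finally show ?thesis .
        qed
        then have "\<bar>Im s\<bar> powr ((\<Sum>j=1..r. lam j) * (1 - 2 * Re s)) \<le> \<bar>Im s\<bar> powr Lm" using s t1 by (intro powr_mono) auto
        also have "\<dots> \<le> (2 * T) powr Lm" using s D A by (intro powr_mono2) (auto simp: Lm_def)
        finally have "C\<psi> * \<bar>Im s\<bar> powr ((\<Sum>j=1..r. lam j) * (1 - 2 * Re s)) \<le> C\<psi> * (2 * T) powr Lm" using C\<psi>(1) by (intro mult_left_mono) auto
        then show "norm (\<psi> s) \<le> C\<psi> * (2 * T) powr Lm" using C\<psi>(2)[OF s(1) s(3) s2] by linarith
      next
        show "t1 + V \<le> \<bar>Im \<rho>\<bar>" using ev(1) \<gamma> by (simp add: X_def V_def)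
        show "\<bar>Im \<rho>\<bar> + V \<le> 2 * T" using VT \<gamma> by simp
      qed (use ge1 in auto)
      also have "(2 * A + 1) * ((CF * (2 * T) powr B) * (X powr (A + 2) * Ng) * Y powr A * exp ((A + 1)\<^sup>2 - V\<^sup>2)) = K1 * (T powr p1 * exp (- V\<^sup>2))"
        unfolding K1_def p1_def G_def X_def Y_def using T
        by (simp add: powr_mult powr_powr powr_add exp_diff exp_minus field_simps)
      also have "U powr (2 - A) * (Na * Ng) * Y powr A * exp ((A + 1)\<^sup>2) = K2 * T powr (- (5 - 2 * \<delta>))"
      proof -
        have ex: "(D + \<delta>) * (2 - A) + D * A = - (5 - 2 * \<delta>)" using \<delta>A by (simp add: algebra_simps)
        have "U powr (2 - A) * (Na * Ng) * Y powr A * exp ((A + 1)\<^sup>2) = K2 * (T powr ((D + \<delta>) * (2 - A)) * T powr (D * A))"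
          unfolding K2_def G_def U_def Y_def by (simp add: powr_powr mult_ac)
        then show ?thesis unfolding powr_add[symmetric] ex .
      qed
      also have "(C\<psi> * (2 * T) powr Lm) * (Z powr (1 - A) * Na) * (X powr (A + 2) * Ng) * Y powr (-A) * exp ((A + 1)\<^sup>2) = K3 * T powr (- (5 - 4 * \<delta>))"
      proof -
        have ex: "Lm + (D + 2 * \<delta>) * (1 - A) + \<delta> * (A + 2) + D * (-A) = - (5 - 4 * \<delta>)"
          using \<delta>A unfolding Lm_def by (simp add: algebra_simps)
        have "(C\<psi> * (2 * T) powr Lm) * (Z powr (1 - A) * Na) * (X powr (A + 2) * Ng) * Y powr (-A) * exp ((A + 1)\<^sup>2)
          = K3 * (T powr Lm * T powr ((D + 2 * \<delta>) * (1 - A)) * T powr (\<delta> * (A + 2)) * T powr (D * (-A)))"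
          unfolding K3_def G_def Z_def X_def Y_def using T by (simp add: powr_powr powr_mult mult_ac)
        then show ?thesis unfolding powr_add[symmetric] ex .
      qed
      also have "(A + 2) * ((C\<psi> * (2 * T) powr Lm) * (Z powr 2 * Na) * (X powr (A + 2) * Ng) * exp ((A + 1)\<^sup>2 - V\<^sup>2)) = K4 * (T powr p4 * exp (- V\<^sup>2))"
      proof -
        have "(A + 2) * ((C\<psi> * (2 * T) powr Lm) * (Z powr 2 * Na) * (X powr (A + 2) * Ng) * exp ((A + 1)\<^sup>2 - V\<^sup>2))
          = K4 * ((T powr Lm * T powr ((D + 2 * \<delta>) * 2) * T powr (\<delta> * (A + 2))) * exp (- V\<^sup>2))"
          unfolding K4_def G_def Z_def X_def using T by (simp add: powr_powr powr_mult exp_diff exp_minus field_simps)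
        then show ?thesis unfolding p4_def powr_add .
      qed
      finally have S12: "norm (S1 + S2) \<le> c0 / 8 + 2 * k * J" using ev(2-5) by linarith
      show ?thesis
      proof (cases "c0 / 4 \<le> norm S2")
        case True then show ?thesis unfolding S2_def by blast
      next
        case False
        have "norm S1 \<le> norm (S1 + S2) + norm S2" using norm_triangle_ineq4[of "S1 + S2" S2] by simp
        then have kJ: "c0 / 8 \<le> k * J" using S1 S12 False c0 by linarith
        \<comment> \<open>Taking \<open>Ng + 1\<close> instead of \<open>Ng\<close> makes the
          divisor positive.\<close>
        define k' where "k' = (Ng + 1) * T powr (2 * \<delta> + D * (1/2 - Re \<rho>))"
        have "k = Ng * T powr (2 * \<delta> + D * (1/2 - Re \<rho>))"
          unfolding k_def X_def Y_def by (simp add: powr_powr powr_add mult_ac)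
        then have kk: "k \<le> k'" unfolding k'_def using N0 by (simp add: mult_right_mono)
        have k'0: "k' > 0" using N0 T by (simp add: k'_def)
        have k0: "k \<ge> 0" using N0 by (simp add: k_def)
        have J0: "J \<ge> 0"
        proof (rule ccontr)
          assume "\<not> J \<ge> 0"
          then have "k * J \<le> 0" using k0 by (intro mult_nonneg_nonpos) auto
          then show False using kJ c0 by linarith
        qed
        have "c0 / 8 \<le> k' * J" using kJ mult_right_mono[OF kk J0] by linarith
        then have "c0 / 8 / k' \<le> J" using k'0 by (simp add: field_simps)
        moreover have "c2 * T powr (D * (Re \<rho> - 1/2) - 2 * \<delta>) = c0 / 8 / k'"
        proof -
          have "T powr (D * (Re \<rho> - 1/2) - 2 * \<delta>) * T powr (2 * \<delta> + D * (1/2 - Re \<rho>)) = 1"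
            using T by (simp add: powr_add[symmetric] algebra_simps)
          then have "T powr (D * (Re \<rho> - 1/2) - 2 * \<delta>) = 1 / T powr (2 * \<delta> + D * (1/2 - Re \<rho>))" using T by (simp add: field_simps)
          then show ?thesis by (simp add: c2_def k'_def)
        qed
        ultimately show ?thesis unfolding J_def by linarith
      qed
    qed
    show "\<exists>W. (\<forall>n. norm (W n) \<le> CW) \<and>
       (\<forall>\<rho>. F \<rho> = 0 \<longrightarrow> 9/10 \<le> Re \<rho> \<longrightarrow> Re \<rho> \<le> 1 \<longrightarrow> 2 * T powr \<delta> \<le> \<bar>Im \<rho>\<bar> \<longrightarrow> \<bar>Im \<rho>\<bar> \<le> T \<longrightarrow>
      c0 / 4 \<le> norm (\<Sum>n\<in>{1..nat \<lfloor>T powr (D + \<delta>)\<rfloor>}.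
         (if real n \<le> T powr \<delta> then 0 else dconv a (truncate_at (T powr \<delta>) g) n * W n) * of_nat n powr (-\<rho>)) \<or>
      c2 * T powr (D * (Re \<rho> - 1/2) - 2 * \<delta>) \<le> integral {- (T powr \<delta>)..T powr \<delta>}
         (\<lambda>v. norm (partial_dirsum (\<lambda>n. cnj (a n)) (T powr (D + 2 * \<delta>)) (1 - Complex (1/2) (Im \<rho> + v)))))"
      using WC main unfolding X_def U_def V_def Z_def c_def P_def by (intro exI[of _ W]) blast
  qed
qed

section \<open>Counting the zeros\<close>

text \<open>Cauchy-Schwarz, obtained by integrating
  \<open>2 * f v * \<mu> \<le> (f v)^2 + \<mu>^2\<close> for the constant \<mu> = L / (2V).\<close>

lemma integral_square_ge:
  fixes f :: "real \<Rightarrow> real"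
  assumes f: "continuous_on {-V..V} f" and V: "V > 0" and L: "L > 0" "L \<le> integral {-V..V} f"
  shows "L\<^sup>2 / (2 * V) \<le> integral {-V..V} (\<lambda>v. (f v)\<^sup>2)"
proof -
  define \<mu> where "\<mu> = L / (2 * V)"
  have \<mu>: "\<mu> > 0" using L V by (simp add: \<mu>_def)
  define J where "J = integral {-V..V} (\<lambda>v. (f v)\<^sup>2)"
  have hJ: "((\<lambda>v. (f v)\<^sup>2) has_integral J) {-V..V}"
    unfolding J_def by (intro integrable_integral integrable_continuous_interval continuous_intros f)
  have hc: "((\<lambda>v. \<mu> / 2) has_integral \<mu> / 2 * (2 * V)) {-V..V}"
    using has_integral_const_real[of "\<mu> / 2" "-V" V] V by (simp add: mult.commute)
  have h2: "((\<lambda>v. (f v)\<^sup>2 * (1 / (2 * \<mu>)) + \<mu> / 2) has_integral J * (1 / (2 * \<mu>)) + \<mu> / 2 * (2 * V)) {-V..V}"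
    by (intro has_integral_add has_integral_mult_left hJ hc)
  have "integral {-V..V} f \<le> J * (1 / (2 * \<mu>)) + \<mu> / 2 * (2 * V)"
  proof (rule has_integral_le[OF integrable_integral[OF integrable_continuous_interval[OF f]] h2])
    fix v assume "v \<in> {-V..V}"
    have "2 * f v * \<mu> \<le> (f v)\<^sup>2 + \<mu>\<^sup>2" by (rule sum_squares_bound)
    then show "f v \<le> (f v)\<^sup>2 * (1 / (2 * \<mu>)) + \<mu> / 2" using \<mu> by (simp add: field_simps power2_eq_square)
  qed
  moreover have "J * (1 / (2 * \<mu>)) = J * (V / L)" "\<mu> / 2 * (2 * V) = L / 2" using L V by (simp_all add: \<mu>_def)
  ultimately have "L / 2 \<le> J * (V / L)" using L(2) by linarith
  then have "L / 2 * L \<le> J * (V / L) * L" using L by (intro mult_right_mono) auto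
  also have "J * (V / L) * L = J * V" using L by simp
  finally have "L\<^sup>2 \<le> J * (2 * V)" by (simp add: power2_eq_square)
  then show ?thesis unfolding J_def using V by (subst pos_divide_le_eq) auto
qed

text \<open>Centres at distance at least 2V have windows that meet in endpoints at most, a
  negligible set.\<close>

lemma sum_window_integrals_le:
  fixes f :: "real \<Rightarrow> real" and R :: "complex set"
  assumes f: "continuous_on UNIV f" "\<And>u. f u \<ge> 0" and fin: "finite R" and V: "V > 0"
    and R: "\<And>x. x \<in> R \<Longrightarrow> \<bar>Im x\<bar> + V \<le> T"
    and sp: "\<And>x y. x \<in> R \<Longrightarrow> y \<in> R \<Longrightarrow> x \<noteq> y \<Longrightarrow> 2 * V \<le> \<bar>Im x - Im y\<bar>"
  shows "(\<Sum>x\<in>R. integral {-V..V} (\<lambda>v. f (Im x + v))) \<le> integral {-T..T} f"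
proof -
  define I where "I x = {Im x - V..Im x + V}" for x
  have cf: "f integrable_on {a..b}" for a b by (rule integrable_continuous_interval[OF continuous_on_subset[OF f(1)]]) simp
  have eq: "integral {-V..V} (\<lambda>v. f (Im x + v)) = integral (I x) f" for x
  proof -
    have "(f has_integral integral (I x) f) (cbox (Im x - V) (Im x + V))"
      unfolding I_def using integrable_integral[OF cf] by simp
    from has_integral_affinity'[OF this, of 1 "Im x"]
    have "((\<lambda>v. f (v + Im x)) has_integral integral (I x) f) {-V..V}" by simp
    then show ?thesis by (simp add: integral_unique add.commute)
  qed
  have "(f has_integral (\<Sum>x\<in>R. integral (I x) f)) (\<Union>x\<in>R. I x)"
  proof (rule has_integral_UN[OF fin])
    show "(f has_integral integral (I x) f) (I x)" for x unfolding I_def by (rule integrable_integral[OF cf])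
    show "pairwise (\<lambda>x y. negligible (I x \<inter> I y)) R"
    proof (rule pairwiseI)
      fix x y assume xy: "x \<in> R" "y \<in> R" "x \<noteq> y"
      have "I x \<inter> I y \<subseteq> {Im x - V, Im x + V}" using sp[OF xy] by (auto simp: I_def abs_if split: if_splits)
      then show "negligible (I x \<inter> I y)" by (rule negligible_subset[rotated]) (simp add: negligible_finite)
    qed
  qed
  then have "(\<Sum>x\<in>R. integral (I x) f) \<le> integral {-T..T} f"
  proof (rule has_integral_subset_le[rotated])
    show "(f has_integral integral {-T..T} f) {-T..T}" by (rule integrable_integral[OF cf])
    show "(\<Union>x\<in>R. I x) \<subseteq> {-T..T}" using R by (fastforce simp: I_def abs_if split: if_splits)
  qed (use f(2) in auto)
  then show ?thesis by (simp only: eq)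
qed

text \<open>In each window the square has integral at least L^2 / (2V). Over [-2T, 2T] the total is
  about \<open>T powr D\<close>, since the polynomial has length at least T and its squared
  coefficients sum to a small power. Up to multiples of \<delta> the quotient has exponent D -
  2D(\<sigma> - 1/2) = 2D(1 - \<sigma>).\<close>

lemma dual_large_values_count:
  assumes a: "ram (a :: nat \<Rightarrow> complex)" and D: "D \<ge> 1" and \<delta>: "0 < \<delta>" "\<delta> \<le> 1/10" and c2: "c2 > 0"
  shows "\<exists>C>0. \<exists>Ts\<ge>1. \<forall>T\<ge>Ts. \<forall>\<sigma> R. 9/10 \<le> \<sigma> \<longrightarrow> \<sigma> \<le> 1 \<longrightarrow> finite R \<longrightarrow> (\<forall>x\<in>R. \<sigma> \<le> Re x \<and> \<bar>Im x\<bar> \<le> T) \<longrightarrow>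
     (\<forall>x\<in>R. \<forall>y\<in>R. x \<noteq> y \<longrightarrow> 2 * T powr \<delta> \<le> \<bar>Im x - Im y\<bar>) \<longrightarrow>
     (\<forall>x\<in>R. c2 * T powr (D * (Re x - 1/2) - 2 * \<delta>) \<le> integral {- (T powr \<delta>)..T powr \<delta>}
         (\<lambda>v. norm (partial_dirsum (\<lambda>n. cnj (a n)) (T powr (D + 2 * \<delta>)) (1 - Complex (1/2) (Im x + v))))) \<longrightarrow>
     real (card R) \<le> C * T powr (2 * D * (1 - \<sigma>) + 11 * \<delta>)"
proof -
  \<comment> \<open>By 2\<delta> \<le> 1, the power \<open>Z powr \<kappa>\<close> of the length is
    at most \<open>T powr \<delta>\<close>.\<close>
  define \<kappa> where "\<kappa> = \<delta> / (D + 1)"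
  have \<kappa>: "\<kappa> > 0" using \<delta> D by (simp add: \<kappa>_def)
  obtain Ca where Ca: "Ca > 0" "\<And>n. n \<ge> 1 \<Longrightarrow> norm (a n) \<le> Ca * real n powr \<kappa>" using ramE[OF a \<kappa>] by metis
  define C where "C = 16 * Ca\<^sup>2 / c2\<^sup>2"
  have C: "C > 0" using Ca c2 by (simp add: C_def)
  have "eventually (\<lambda>T::real. 1 + (D + 2 * \<delta>) * ln T \<le> T powr \<delta>) at_top" using \<delta> D by real_asymp
  then obtain Ts0 where Ts0: "\<And>T::real. T \<ge> Ts0 \<Longrightarrow> 1 + (D + 2 * \<delta>) * ln T \<le> T powr \<delta>"
    unfolding eventually_at_top_linorder by blast
  show ?thesis
  proof (rule exI[of _ C], rule conjI[OF C], rule exI[of _ "max Ts0 1"], rule conjI, simp, intro allI impI)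
    fix T \<sigma> :: real and R :: "complex set"
    assume TT: "max Ts0 1 \<le> T" and \<sigma>: "9/10 \<le> \<sigma>" "\<sigma> \<le> 1" and fin: "finite R"
      and R: "\<forall>x\<in>R. \<sigma> \<le> Re x \<and> \<bar>Im x\<bar> \<le> T" and sp: "\<forall>x\<in>R. \<forall>y\<in>R. x \<noteq> y \<longrightarrow> 2 * T powr \<delta> \<le> \<bar>Im x - Im y\<bar>"
      and large: "\<forall>x\<in>R. c2 * T powr (D * (Re x - 1/2) - 2 * \<delta>) \<le> integral {- (T powr \<delta>)..T powr \<delta>}
         (\<lambda>v. norm (partial_dirsum (\<lambda>n. cnj (a n)) (T powr (D + 2 * \<delta>)) (1 - Complex (1/2) (Im x + v))))"
    have T: "T \<ge> 1" "T > 0" using TT by auto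
    define V Z where "V = T powr \<delta>" and "Z = T powr (D + 2 * \<delta>)"
    define N where "N = nat \<lfloor>Z\<rfloor>"
    have ge1: "V \<ge> 1" "Z \<ge> 1" using T \<delta> D by (auto simp: V_def Z_def intro!: ge_one_powr_ge_zero)
    have VT: "V \<le> T" unfolding V_def using powr_mono[of \<delta> 1 T] T \<delta> by simp
    have TZ: "T \<le> Z" unfolding Z_def using powr_mono[of 1 "D + 2 * \<delta>" T] T \<delta> D by simp
    have N1: "N \<ge> 1" "real N \<le> Z" using ge1 le_nat_floor_iff[of Z 1] le_nat_floor_iff[of Z N] by (auto simp: N_def)
    have lnN: "1 + ln (real N) \<le> V"
    proof -
      have "ln (real N) \<le> ln Z" using N1 by (intro ln_mono) auto
      also have "\<dots> = (D + 2 * \<delta>) * ln T" using T by (simp add: Z_def ln_powr)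
      finally show ?thesis using Ts0[of T] TT unfolding V_def by simp
    qed
    \<comment> \<open>At 1 - (1/2 + iu) = 1/2 - iu the n-th term has modulus factor
      \<open>n powr (-1/2)\<close>, which goes into the coefficient, and phase
      \<open>u * ln n\<close>.\<close>
    define \<alpha> where "\<alpha> n = cnj (a n) * of_real (real n powr (-1/2))" for n
    define p where "p u = (\<Sum>n=1..N. \<alpha> n * cis (u * ln (real n)))" for u
    have pc: "continuous_on A p" for A unfolding p_def by (intro continuous_intros)
    have p_eq: "partial_dirsum (\<lambda>n. cnj (a n)) Z (1 - Complex (1/2) u) = p u" for u
      unfolding partial_dirsum_def p_def N_def[symmetric]
    proof (intro sum.cong refl)
      fix n assume "n \<in> {1..N}"
      then have n: "n \<ge> 1" by simp
      show "cnj (a n) * of_nat n powr (- (1 - Complex (1/2) u)) = \<alpha> n * cis (u * ln (real n))"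
        unfolding of_nat_powr_cis[OF n] by (simp add: \<alpha>_def mult.assoc)
    qed
    define L where "L = c2 * T powr (D * (\<sigma> - 1/2) - 2 * \<delta>)"
    have L0: "L > 0" using c2 T by (simp add: L_def)
    have win: "L\<^sup>2 / (2 * V) \<le> integral {-V..V} (\<lambda>v. (norm (p (Im x + v)))\<^sup>2)" if x: "x \<in> R" for x
    proof (rule integral_square_ge)
      show "continuous_on {-V..V} (\<lambda>v. norm (p (Im x + v)))"
        by (intro continuous_on_norm continuous_on_compose2[OF pc[of UNIV]] continuous_intros) auto
      have "L \<le> c2 * T powr (D * (Re x - 1/2) - 2 * \<delta>)"
        unfolding L_def using c2 T R x D by (intro mult_left_mono powr_mono diff_right_mono) auto
      also have "\<dots> \<le> integral {-V..V} (\<lambda>v. norm (p (Im x + v)))"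
        using bspec[OF large x] unfolding V_def[symmetric] Z_def[symmetric] p_eq .
      finally show "L \<le> integral {-V..V} (\<lambda>v. norm (p (Im x + v)))" .
    qed (use ge1 L0 in auto)
    have sqa: "(\<Sum>n=1..N. (norm (\<alpha> n))\<^sup>2) \<le> Ca\<^sup>2 * T powr (3 * \<delta>)"
    proof -
      have "(\<Sum>n=1..N. (norm (\<alpha> n))\<^sup>2) \<le> (\<Sum>n=1..N. Ca\<^sup>2 * T powr (2 * \<delta>) * (1 / real n))"
      proof (rule sum_mono)
        fix n assume "n \<in> {1..N}"
        then have n: "n \<ge> 1" "real n \<le> Z" using N1 by auto
        have "norm (a n) \<le> Ca * real n powr \<kappa>" by (rule Ca(2)[OF n(1)])
        also have "\<dots> \<le> Ca * Z powr \<kappa>" using n Ca \<kappa> by (intro mult_left_mono powr_mono2) auto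
        also have "\<dots> \<le> Ca * T powr \<delta>"
        proof (rule mult_left_mono)
          have "(D + 2 * \<delta>) * \<kappa> \<le> (D + 1) * \<kappa>" using \<kappa> \<delta> by (intro mult_right_mono) auto
          also have "\<dots> = \<delta>" using D by (simp add: \<kappa>_def)
          finally show "Z powr \<kappa> \<le> T powr \<delta>" unfolding Z_def powr_powr using T by (intro powr_mono) auto
        qed (use Ca in simp)
        finally have "(norm (a n))\<^sup>2 \<le> (Ca * T powr \<delta>)\<^sup>2" by (intro power_mono) auto
        also have "\<dots> = Ca\<^sup>2 * T powr (2 * \<delta>)" using T by (simp add: power_mult_distrib powr_power mult.commute)
        finally have 1: "(norm (a n))\<^sup>2 * (1 / real n) \<le> Ca\<^sup>2 * T powr (2 * \<delta>) * (1 / real n)" by (intro mult_right_mono) auto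
        have "(norm (\<alpha> n))\<^sup>2 = (norm (a n))\<^sup>2 * (real n powr (-1/2))\<^sup>2" by (simp add: \<alpha>_def norm_mult power_mult_distrib)
        also have "(real n powr (-1/2))\<^sup>2 = real n powr (-1)" using n by (simp add: powr_power)
        also have "\<dots> = 1 / real n" using n by (simp add: powr_minus_divide)
        finally show "(norm (\<alpha> n))\<^sup>2 \<le> Ca\<^sup>2 * T powr (2 * \<delta>) * (1 / real n)" using 1 by simp
      qed
      also have "\<dots> = Ca\<^sup>2 * T powr (2 * \<delta>) * (\<Sum>n=1..N. 1 / real n)" by (rule sum_distrib_left[symmetric])
      also have "\<dots> \<le> Ca\<^sup>2 * T powr (2 * \<delta>) * V"
        using harmonic_sum_le[OF N1(1)] lnN by (intro mult_left_mono) auto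
      also have "\<dots> = Ca\<^sup>2 * T powr (3 * \<delta>)" unfolding V_def by (simp add: powr_add[symmetric] mult.assoc)
      finally show ?thesis .
    qed
    have "real (card R) * (L\<^sup>2 / (2 * V)) = (\<Sum>x\<in>R. L\<^sup>2 / (2 * V))" by simp
    also have "\<dots> \<le> (\<Sum>x\<in>R. integral {-V..V} (\<lambda>v. (norm (p (Im x + v)))\<^sup>2))" by (rule sum_mono[OF win])
    also have "\<dots> \<le> integral {-(2*T)..2*T} (\<lambda>u. (norm (p u))\<^sup>2)"
    proof (rule sum_window_integrals_le[OF _ _ fin])
      show "continuous_on UNIV (\<lambda>u. (norm (p u))\<^sup>2)" by (intro continuous_intros pc)
      show "\<bar>Im x\<bar> + V \<le> 2 * T" if "x \<in> R" for x using bspec[OF R that] VT by linarith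
      show "2 * V \<le> \<bar>Im x - Im y\<bar>" if "x \<in> R" "y \<in> R" "x \<noteq> y" for x y using sp that unfolding V_def by blast
    qed (use ge1 in auto)
    also have "\<dots> \<le> (2 * (2 * T) + 4 * real N * (1 + ln (real N))) * (\<Sum>n=1..N. (norm (\<alpha> n))\<^sup>2)"
      unfolding p_def using mean_value_dirichlet_polynomial[OF N1(1), of "2 * T" \<alpha>] T by simp
    also have "\<dots> \<le> (8 * (Z * V)) * (Ca\<^sup>2 * T powr (3 * \<delta>))"
    proof (rule mult_mono[OF _ sqa])
      have "T * 1 \<le> Z * V" using TZ ge1 T by (intro mult_mono) auto
      moreover have "real N * (1 + ln (real N)) \<le> Z * V" using N1 lnN ge1 by (intro mult_mono) auto
      ultimately show "2 * (2 * T) + 4 * real N * (1 + ln (real N)) \<le> 8 * (Z * V)" by (simp add: mult.assoc)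
    qed (use ge1 in \<open>auto intro!: sum_nonneg\<close>)
    finally have "real (card R) * (L\<^sup>2 / (2 * V)) \<le> (8 * (Z * V)) * (Ca\<^sup>2 * T powr (3 * \<delta>))" .
    then have "real (card R) * L\<^sup>2 \<le> (8 * (Z * V)) * (Ca\<^sup>2 * T powr (3 * \<delta>)) * (2 * V)" using ge1 by (simp add: field_simps)
    also have "\<dots> = 16 * Ca\<^sup>2 * (Z * V * V * T powr (3 * \<delta>))" by (simp add: mult_ac)
    \<comment> \<open>The 7 is 2 from Z, 2 from the two factors V and 3 from the coefficients; the 4
      lost in L^2 brings it to 11.\<close>
    also have "Z * V * V * T powr (3 * \<delta>) = T powr (D + 7 * \<delta>)" unfolding Z_def V_def powr_add[symmetric]
      by (rule arg_cong[where f = "\<lambda>e. T powr e"]) simp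
    finally have "real (card R) * L\<^sup>2 \<le> 16 * Ca\<^sup>2 * T powr (D + 7 * \<delta>)" .
    then have "real (card R) \<le> 16 * Ca\<^sup>2 * T powr (D + 7 * \<delta>) / L\<^sup>2" using L0 by (simp add: pos_le_divide_eq)
    also have "L\<^sup>2 = c2\<^sup>2 * T powr (2 * (D * (\<sigma> - 1/2) - 2 * \<delta>))" using T unfolding L_def by (simp add: power_mult_distrib powr_power mult.commute)
    also have "16 * Ca\<^sup>2 * T powr (D + 7 * \<delta>) / (c2\<^sup>2 * T powr (2 * (D * (\<sigma> - 1/2) - 2 * \<delta>))) = C * (T powr (D + 7 * \<delta>) / T powr (2 * (D * (\<sigma> - 1/2) - 2 * \<delta>)))"
      by (simp add: C_def)
    also have "T powr (D + 7 * \<delta>) / T powr (2 * (D * (\<sigma> - 1/2) - 2 * \<delta>)) = T powr (2 * D * (1 - \<sigma>) + 11 * \<delta>)"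
    proof -
      have "(D + 7 * \<delta>) - 2 * (D * (\<sigma> - 1/2) - 2 * \<delta>) = 2 * D * (1 - \<sigma>) + 11 * \<delta>" by (simp add: algebra_simps)
      then show ?thesis by (simp only: powr_diff[symmetric])
    qed
    finally show "real (card R) \<le> C * T powr (2 * D * (1 - \<sigma>) + 11 * \<delta>)" .
  qed
qed

text \<open>Each alternative of the detection is counted by its own estimate. The spacing makes the
  integration windows of the second one disjoint and is more than the first one requires.\<close>

lemma spaced_zeros_count:
  assumes F: "F \<in> selberg_class" and fe: "selberg_functional_equation F \<omega> Q r lam mu"
    and D: "D \<ge> 1" "(\<Sum>j=1..r. lam j) \<le> D" and \<delta>: "0 < \<delta>" "\<delta> \<le> 1/10"
  shows "\<exists>C>0. \<exists>Ts\<ge>1. \<forall>T\<ge>Ts. \<forall>\<sigma> R. 9/10 \<le> \<sigma> \<longrightarrow> \<sigma> \<le> 1 \<longrightarrow> finite R \<longrightarrow>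
     (\<forall>x\<in>R. F x = 0 \<and> \<sigma> \<le> Re x \<and> Re x \<le> 1 \<and> 2 * T powr \<delta> \<le> \<bar>Im x\<bar> \<and> \<bar>Im x\<bar> \<le> T) \<longrightarrow>
     (\<forall>x\<in>R. \<forall>y\<in>R. x \<noteq> y \<longrightarrow> 2 * T powr \<delta> \<le> \<bar>Im x - Im y\<bar>) \<longrightarrow>
     real (card R) \<le> C * T powr (2 * D * (1 - \<sigma>) + 11 * \<delta>)"
proof -
  obtain a g h c0 where a: "ram a" and g: "ram g" and ser: "\<And>s. Re s > 1 \<Longrightarrow> F s = dirsum a s"
    and ag: "\<And>n. n \<ge> 1 \<Longrightarrow> dconv a g n = h n" and h: "dabs h (4/5)"
    and c0: "c0 > 0" "\<And>s. Re s \<ge> 4/5 \<Longrightarrow> c0 \<le> norm (dirsum h s)"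
    by (rule selberg_class_coefficients[OF F]) blast
  obtain CW c2 Ts0 where CW: "CW > 0" and c2: "c2 > 0" and det: "\<forall>T\<ge>Ts0. \<exists>W :: nat \<Rightarrow> complex. (\<forall>n. norm (W n) \<le> CW) \<and>
    (\<forall>\<rho>. F \<rho> = 0 \<longrightarrow> 9/10 \<le> Re \<rho> \<longrightarrow> Re \<rho> \<le> 1 \<longrightarrow> 2 * T powr \<delta> \<le> \<bar>Im \<rho>\<bar> \<longrightarrow> \<bar>Im \<rho>\<bar> \<le> T \<longrightarrow>
      c0 / 4 \<le> norm (\<Sum>n\<in>{1..nat \<lfloor>T powr (D + \<delta>)\<rfloor>}.
         (if real n \<le> T powr \<delta> then 0 else dconv a (truncate_at (T powr \<delta>) g) n * W n) * of_nat n powr (-\<rho>)) \<or>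
      c2 * T powr (D * (Re \<rho> - 1/2) - 2 * \<delta>) \<le> integral {- (T powr \<delta>)..T powr \<delta>}
         (\<lambda>v. norm (partial_dirsum (\<lambda>n. cnj (a n)) (T powr (D + 2 * \<delta>)) (1 - Complex (1/2) (Im \<rho> + v)))))"
    using zero_detection[OF F fe D \<delta> a g ser ag h c0] by blast
  \<comment> \<open>The coefficients of the detecting polynomial vary with T through the truncation
    and the weights; a majorant independent of T keeps the constants uniform.\<close>
  define g1 where "g1 n = CW * dconv (\<lambda>n. norm (a n)) (\<lambda>n. norm (g n)) n" for n
  have "ram (\<lambda>n. norm (a n))" "ram (\<lambda>n. norm (g n))" using a g by (simp_all add: ram_def)
  then have r: "ram (dconv (\<lambda>n. norm (a n)) (\<lambda>n. norm (g n)))" by (rule ram_dconv)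
  have g1: "ram g1" unfolding ram_def
  proof (intro allI impI)
    fix \<epsilon> :: real assume "\<epsilon> > 0"
    then obtain C where C: "\<And>n. n \<ge> 1 \<Longrightarrow> norm (dconv (\<lambda>n. norm (a n)) (\<lambda>n. norm (g n)) n) \<le> C * real n powr \<epsilon>"
      using r unfolding ram_def by blast
    have "norm (g1 n) \<le> CW * C * real n powr \<epsilon>" if "n \<ge> 1" for n
      using mult_left_mono[OF C[OF that], of CW] CW by (simp add: g1_def abs_mult mult.assoc)
    then show "\<exists>C. \<forall>n\<ge>1. norm (g1 n) \<le> C * real n powr \<epsilon>" by blast
  qed
  have c04: "c0 / 4 > 0" and E1: "D + \<delta> \<ge> 1" using c0 D \<delta> by auto
  obtain C1 Ts1 where C1: "C1 > 0" and cl1: "\<forall>T\<ge>Ts1. \<forall>\<sigma> q R. 9/10 \<le> \<sigma> \<longrightarrow> \<sigma> \<le> 1 \<longrightarrow> finite R \<longrightarrow> (\<forall>n. norm (q n :: complex) \<le> g1 n) \<longrightarrow>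
     (\<forall>n. q n \<noteq> 0 \<longrightarrow> T powr \<delta> < real n \<and> real n \<le> T powr (D + \<delta>)) \<longrightarrow>
     (\<forall>x\<in>R. \<sigma> \<le> Re x \<and> \<bar>Im x\<bar> \<le> T) \<longrightarrow> (\<forall>x\<in>R. \<forall>y\<in>R. x \<noteq> y \<longrightarrow> 1 \<le> \<bar>Im x - Im y\<bar>) \<longrightarrow>
     (\<forall>x\<in>R. c0 / 4 \<le> norm (\<Sum>n\<in>{1..nat \<lfloor>T powr (D + \<delta>)\<rfloor>}. q n * of_nat n powr (-x))) \<longrightarrow>
     real (card R) \<le> C1 * T powr (2 * (D + \<delta>) * (1 - \<sigma>) + \<delta>)"
    using large_polynomial_count[OF g1 c04 \<delta>(1) E1 \<delta>(1)] by blast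
  obtain C2 Ts2 where C2: "C2 > 0" and cl2: "\<forall>T\<ge>Ts2. \<forall>\<sigma> R. 9/10 \<le> \<sigma> \<longrightarrow> \<sigma> \<le> 1 \<longrightarrow> finite R \<longrightarrow> (\<forall>x\<in>R. \<sigma> \<le> Re x \<and> \<bar>Im x\<bar> \<le> T) \<longrightarrow>
     (\<forall>x\<in>R. \<forall>y\<in>R. x \<noteq> y \<longrightarrow> 2 * T powr \<delta> \<le> \<bar>Im x - Im y\<bar>) \<longrightarrow>
     (\<forall>x\<in>R. c2 * T powr (D * (Re x - 1/2) - 2 * \<delta>) \<le> integral {- (T powr \<delta>)..T powr \<delta>}
         (\<lambda>v. norm (partial_dirsum (\<lambda>n. cnj (a n)) (T powr (D + 2 * \<delta>)) (1 - Complex (1/2) (Im x + v))))) \<longrightarrow>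
     real (card R) \<le> C2 * T powr (2 * D * (1 - \<sigma>) + 11 * \<delta>)"
    using dual_large_values_count[OF a D(1) \<delta> c2] by blast
  have C12: "C1 + C2 > 0" using C1 C2 by simp
  show ?thesis
  proof (rule exI[of _ "C1 + C2"], rule conjI[OF C12], rule exI[of _ "max 1 (max Ts0 (max Ts1 Ts2))"], rule conjI, simp, intro allI impI)
    fix T \<sigma> :: real and R :: "complex set"
    assume TT: "max 1 (max Ts0 (max Ts1 Ts2)) \<le> T" and \<sigma>: "9/10 \<le> \<sigma>" "\<sigma> \<le> 1" and fin: "finite R"
      and R: "\<forall>x\<in>R. F x = 0 \<and> \<sigma> \<le> Re x \<and> Re x \<le> 1 \<and> 2 * T powr \<delta> \<le> \<bar>Im x\<bar> \<and> \<bar>Im x\<bar> \<le> T"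
      and sp: "\<forall>x\<in>R. \<forall>y\<in>R. x \<noteq> y \<longrightarrow> 2 * T powr \<delta> \<le> \<bar>Im x - Im y\<bar>"
    have T: "T \<ge> 1" and Ts: "Ts0 \<le> T" "Ts1 \<le> T" "Ts2 \<le> T" using TT by auto
    have V1: "T powr \<delta> \<ge> 1" using T \<delta> by (intro ge_one_powr_ge_zero) auto
    obtain W :: "nat \<Rightarrow> complex" where W: "\<And>n. norm (W n) \<le> CW"
      and dt: "\<And>\<rho>. F \<rho> = 0 \<Longrightarrow> 9/10 \<le> Re \<rho> \<Longrightarrow> Re \<rho> \<le> 1 \<Longrightarrow> 2 * T powr \<delta> \<le> \<bar>Im \<rho>\<bar> \<Longrightarrow> \<bar>Im \<rho>\<bar> \<le> T \<Longrightarrow>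
      c0 / 4 \<le> norm (\<Sum>n\<in>{1..nat \<lfloor>T powr (D + \<delta>)\<rfloor>}.
         (if real n \<le> T powr \<delta> then 0 else dconv a (truncate_at (T powr \<delta>) g) n * W n) * of_nat n powr (-\<rho>)) \<or>
      c2 * T powr (D * (Re \<rho> - 1/2) - 2 * \<delta>) \<le> integral {- (T powr \<delta>)..T powr \<delta>}
         (\<lambda>v. norm (partial_dirsum (\<lambda>n. cnj (a n)) (T powr (D + 2 * \<delta>)) (1 - Complex (1/2) (Im \<rho> + v))))"
      using det[rule_format, OF Ts(1)] by blast
    \<comment> \<open>Cutting off beyond \<open>T powr (D + \<delta>)\<close> does not change the
      sum and gives q the required support.\<close>
    define q where "q n = (if real n \<le> T powr \<delta> \<or> real n > T powr (D + \<delta>) then 0 else dconv a (truncate_at (T powr \<delta>) g) n * W n)" for n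
    have qs: "\<forall>n. q n \<noteq> 0 \<longrightarrow> T powr \<delta> < real n \<and> real n \<le> T powr (D + \<delta>)" by (auto simp: q_def split: if_splits)
    have qg: "\<forall>n. norm (q n) \<le> g1 n"
    proof
      fix n
      have nn: "0 \<le> dconv (\<lambda>n. norm (a n)) (\<lambda>n. norm (g n)) n" unfolding dconv_def by (intro sum_nonneg) auto
      have "norm (dconv a (truncate_at (T powr \<delta>) g) n) \<le> dconv (\<lambda>n. norm (a n)) (\<lambda>n. norm (g n)) n"
        unfolding dconv_def by (rule sum_norm_le) (auto simp: norm_mult truncate_at_def)
      then have "norm (dconv a (truncate_at (T powr \<delta>) g) n * W n) \<le> dconv (\<lambda>n. norm (a n)) (\<lambda>n. norm (g n)) n * CW"
        unfolding norm_mult using W nn by (intro mult_mono) auto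
      then show "norm (q n) \<le> g1 n" using nn CW by (auto simp: q_def g1_def mult.commute)
    qed
    define P where "P x = (\<Sum>n\<in>{1..nat \<lfloor>T powr (D + \<delta>)\<rfloor>}. q n * of_nat n powr (-x))" for x :: complex
    have P_eq: "(\<Sum>n\<in>{1..nat \<lfloor>T powr (D + \<delta>)\<rfloor>}.
         (if real n \<le> T powr \<delta> then 0 else dconv a (truncate_at (T powr \<delta>) g) n * W n) * of_nat n powr (-x)) = P x" for x
      unfolding P_def by (intro sum.cong refl) (auto simp: q_def le_nat_floor_iff)
    define R1 where "R1 = {x \<in> R. c0 / 4 \<le> norm (P x)}"
    define R2 where "R2 = {x \<in> R. c2 * T powr (D * (Re x - 1/2) - 2 * \<delta>) \<le> integral {- (T powr \<delta>)..T powr \<delta>}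
         (\<lambda>v. norm (partial_dirsum (\<lambda>n. cnj (a n)) (T powr (D + 2 * \<delta>)) (1 - Complex (1/2) (Im x + v))))}"
    have RR: "R \<subseteq> R1 \<union> R2"
    proof
      fix x assume x: "x \<in> R"
      have "F x = 0" "9/10 \<le> Re x" "Re x \<le> 1" "2 * T powr \<delta> \<le> \<bar>Im x\<bar>" "\<bar>Im x\<bar> \<le> T" using bspec[OF R x] \<sigma> by auto
      from dt[OF this] show "x \<in> R1 \<union> R2" using x unfolding R1_def R2_def P_eq by blast
    qed
    have b1: "real (card R1) \<le> C1 * T powr (2 * (D + \<delta>) * (1 - \<sigma>) + \<delta>)"
    proof (rule cl1[rule_format, OF Ts(2) \<sigma>, of _ q])
      show "1 \<le> \<bar>Im x - Im y\<bar>" if "x \<in> R1" "y \<in> R1" "x \<noteq> y" for x y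
      proof -
        have "2 * T powr \<delta> \<le> \<bar>Im x - Im y\<bar>" using sp that unfolding R1_def by blast
        then show ?thesis using V1 by linarith
      qed
    qed (use fin R qs qg in \<open>auto simp: R1_def P_def\<close>)
    have b2: "real (card R2) \<le> C2 * T powr (2 * D * (1 - \<sigma>) + 11 * \<delta>)"
      by (rule cl2[rule_format, OF Ts(3) \<sigma>]) (use fin R sp in \<open>auto simp: R2_def\<close>)
    have fin12: "finite (R1 \<union> R2)" using fin by (auto simp: R1_def R2_def)
    have "card R \<le> card (R1 \<union> R2)" by (rule card_mono[OF fin12 RR])
    also have "\<dots> \<le> card R1 + card R2" by (rule card_Un_le)
    finally have "real (card R) \<le> real (card R1) + real (card R2)" by simp
    also have "\<dots> \<le> C1 * T powr (2 * D * (1 - \<sigma>) + 11 * \<delta>) + C2 * T powr (2 * D * (1 - \<sigma>) + 11 * \<delta>)"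
    proof (rule add_mono[OF order_trans[OF b1] b2], rule mult_left_mono, rule powr_mono)
      have "\<delta> * (1 - \<sigma>) \<le> \<delta> * 1" using \<delta> \<sigma> by (intro mult_left_mono) auto
      moreover have "2 * (D + \<delta>) * (1 - \<sigma>) + \<delta> = 2 * D * (1 - \<sigma>) + 2 * (\<delta> * (1 - \<sigma>)) + \<delta>" by (simp add: algebra_simps)
      ultimately show "2 * (D + \<delta>) * (1 - \<sigma>) + \<delta> \<le> 2 * D * (1 - \<sigma>) + 11 * \<delta>" using \<delta> by linarith
    qed (use T C1 in auto)
    finally show "real (card R) \<le> (C1 + C2) * T powr (2 * D * (1 - \<sigma>) + 11 * \<delta>)" by (simp add: distrib_right)
  qed
qed

lemma sum_le_card_times:
  fixes \<mu> :: "'a \<Rightarrow> real" and f :: "'a \<Rightarrow> int"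
  assumes "finite S" "\<And>j. j \<in> f ` S \<Longrightarrow> (\<Sum>x\<in>{x \<in> S. f x = j}. \<mu> x) \<le> B"
  shows "(\<Sum>x\<in>S. \<mu> x) \<le> real (card (f ` S)) * B"
proof -
  have "(\<Sum>x\<in>S. \<mu> x) = (\<Sum>j\<in>f ` S. \<Sum>x\<in>{x \<in> S. f x = j}. \<mu> x)"
    using assms(1) by (intro sum.group[symmetric]) auto
  also have "\<dots> \<le> (\<Sum>j\<in>f ` S. B)" by (intro sum_mono assms)
  finally show ?thesis by simp
qed

text \<open>The local bound is applied once per unit interval of ordinates, of which a window of
  length l meets at most l + 2.\<close>

lemma zeros_in_interval_count:
  assumes F: "F \<in> selberg_class" and fe: "selberg_functional_equation F \<omega> Q r lam mu"
  obtains C where "C > 0" "\<And>T S u l. T \<ge> 1 \<Longrightarrow> l \<ge> 0 \<Longrightarrow> finite S \<Longrightarrow>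
     (\<And>\<rho>. \<rho> \<in> S \<Longrightarrow> 9/10 \<le> Re \<rho> \<and> Re \<rho> \<le> 1 \<and> 8 \<le> \<bar>Im \<rho>\<bar> \<and> \<bar>Im \<rho>\<bar> \<le> T \<and> u \<le> Im \<rho> \<and> Im \<rho> \<le> u + l) \<Longrightarrow>
     (\<Sum>\<rho>\<in>S. real (nat (zorder F \<rho>))) \<le> (l + 2) * (C * ln (2 * T))"
proof -
  obtain C where C: "C > 0" and loc: "\<And>t Z. \<bar>t\<bar> \<ge> 7 \<Longrightarrow> finite Z \<Longrightarrow> Z \<subseteq> {\<rho>. 9/10 \<le> Re \<rho> \<and> Re \<rho> \<le> 1 \<and> \<bar>Im \<rho> - t\<bar> \<le> 1/2} \<Longrightarrow>
     real (\<Sum>\<rho>\<in>Z. nat (zorder F \<rho>)) \<le> C * ln \<bar>t\<bar>"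
    by (rule selberg_class_local_zero_count[OF F fe]) blast
  have "(\<Sum>\<rho>\<in>S. real (nat (zorder F \<rho>))) \<le> (l + 2) * (C * ln (2 * T))"
    if T: "T \<ge> 1" and l: "l \<ge> 0" and fin: "finite S" and S: "\<And>\<rho>. \<rho> \<in> S \<Longrightarrow> 9/10 \<le> Re \<rho> \<and> Re \<rho> \<le> 1 \<and> 8 \<le> \<bar>Im \<rho>\<bar> \<and> \<bar>Im \<rho>\<bar> \<le> T \<and> u \<le> Im \<rho> \<and> Im \<rho> \<le> u + l"
    for T S u l
  proof -
    define B where "B = C * ln (2 * T)"
    have B0: "B \<ge> 0" using C T by (simp add: B_def)
    have "(\<Sum>\<rho>\<in>S. real (nat (zorder F \<rho>))) \<le> real (card ((\<lambda>\<rho>. \<lfloor>Im \<rho>\<rfloor>) ` S)) * B"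
    proof (rule sum_le_card_times[OF fin])
      fix j assume "j \<in> (\<lambda>\<rho>. \<lfloor>Im \<rho>\<rfloor>) ` S"
      then obtain \<rho>0 where r0: "\<rho>0 \<in> S" "j = \<lfloor>Im \<rho>0\<rfloor>" by blast
      \<comment> \<open>The midpoint is within 1/2 of every ordinate with integer part j, and |t|
        \<ge> 7 because one of these ordinates has modulus at least 8.\<close>
      define t where "t = real_of_int j + 1/2"
      have near: "\<bar>Im \<rho> - t\<bar> \<le> 1/2" if "\<lfloor>Im \<rho>\<rfloor> = j" for \<rho>
        unfolding t_def that[symmetric] by linarith
      have n0: "\<bar>Im \<rho>0 - t\<bar> \<le> 1/2" by (rule near) (simp add: r0)
      have t7: "\<bar>t\<bar> \<ge> 7" and tT: "\<bar>t\<bar> \<le> 2 * T" using n0 S[OF r0(1)] T by linarith+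
      have "(\<Sum>\<rho>\<in>{x \<in> S. \<lfloor>Im x\<rfloor> = j}. real (nat (zorder F \<rho>))) \<le> C * ln \<bar>t\<bar>"
        using loc[OF t7, of "{x \<in> S. \<lfloor>Im x\<rfloor> = j}"] fin S near by auto
      also have "\<dots> \<le> B" unfolding B_def using C t7 tT by (intro mult_left_mono ln_mono) auto
      finally show "(\<Sum>\<rho>\<in>{x \<in> S. \<lfloor>Im x\<rfloor> = j}. real (nat (zorder F \<rho>))) \<le> B" .
    qed
    also have "\<dots> \<le> (l + 2) * B"
    proof (rule mult_right_mono[OF _ B0])
      have "(\<lambda>\<rho>. \<lfloor>Im \<rho>\<rfloor>) ` S \<subseteq> {\<lfloor>u\<rfloor>..\<lfloor>u + l\<rfloor>}" using S by (auto intro!: floor_mono)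
      then have "card ((\<lambda>\<rho>. \<lfloor>Im \<rho>\<rfloor>) ` S) \<le> card {\<lfloor>u\<rfloor>..\<lfloor>u + l\<rfloor>}" by (intro card_mono) auto
      then have "real (card ((\<lambda>\<rho>. \<lfloor>Im \<rho>\<rfloor>) ` S)) \<le> real (nat (\<lfloor>u + l\<rfloor> - \<lfloor>u\<rfloor> + 1))" by simp
      also have "\<dots> \<le> l + 2" using l by linarith
      finally show "real (card ((\<lambda>\<rho>. \<lfloor>Im \<rho>\<rfloor>) ` S)) \<le> l + 2" .
    qed
    finally show ?thesis by (simp add: B_def)
  qed
  from that[OF C this] show ?thesis .
qed

lemma zero_count_mono:
  assumes F: "F \<in> selberg_class" and "\<sigma>' \<le> \<sigma>" "T \<le> T'"
  shows "zero_count F \<sigma> T \<le> zero_count F \<sigma>' T'"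
  unfolding zero_count_def using assms by (intro sum_mono2 finite_counted_zeros) auto

text \<open>What remains is the passage from spaced zeros to all zeros with multiplicity. A window
  of length \<open>2 * T powr \<delta>\<close> that contains a zero is represented by one of them
  and holds, by the local count, at most a constant times \<open>T powr (2 * \<delta>)\<close>
  zeros.\<close>

theorem mainTheorem1:
  fixes F :: "complex \<Rightarrow> complex" and d \<epsilon> :: real
  assumes "F \<in> selberg_class"
    and "has_selberg_degree F d"
    and "\<epsilon> > 0"
  shows "\<exists>C::real. \<forall>T\<ge>2. \<forall>\<eta>::real. 0 < \<eta> \<and> \<eta> \<le> 1/10 \<longrightarrow>
           real (zero_count F (1 - \<eta>) T) \<le> C * T powr (max d 2 * \<eta> + \<epsilon>)"
proof -
  note F = assms(1)
  obtain \<omega> Q r lam mu where fe: "selberg_functional_equation F \<omega> Q r lam mu" and d: "d = 2 * (\<Sum>j=1..r. lam j)"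
    using assms(2) unfolding has_selberg_degree_def by blast
  define D where "D = max d 2 / 2"
  have D: "D \<ge> 1" "(\<Sum>j=1..r. lam j) \<le> D" "max d 2 = 2 * D" using d by (auto simp: D_def)
  \<comment> \<open>The total loss is \<open>13 * \<delta>\<close>: 11 from the spaced zeros and 2
    from the zeros within one window.\<close>
  define \<delta> where "\<delta> = min (1/10) (\<epsilon> / 30)"
  have \<delta>: "0 < \<delta>" "\<delta> \<le> 1/10" "13 * \<delta> \<le> \<epsilon>" using assms(3) by (auto simp: \<delta>_def)
  obtain C1 Ts1 where C1: "C1 > 0" and sz: "\<forall>T\<ge>Ts1. \<forall>\<sigma> R. 9/10 \<le> \<sigma> \<longrightarrow> \<sigma> \<le> 1 \<longrightarrow> finite R \<longrightarrow>
     (\<forall>x\<in>R. F x = 0 \<and> \<sigma> \<le> Re x \<and> Re x \<le> 1 \<and> 2 * T powr \<delta> \<le> \<bar>Im x\<bar> \<and> \<bar>Im x\<bar> \<le> T) \<longrightarrow>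
     (\<forall>x\<in>R. \<forall>y\<in>R. x \<noteq> y \<longrightarrow> 2 * T powr \<delta> \<le> \<bar>Im x - Im y\<bar>) \<longrightarrow>
     real (card R) \<le> C1 * T powr (2 * D * (1 - \<sigma>) + 11 * \<delta>)"
    using spaced_zeros_count[OF F fe D(1,2) \<delta>(1,2)] by blast
  obtain C2 where C2: "C2 > 0" and zi: "\<And>T S u l. T \<ge> 1 \<Longrightarrow> l \<ge> 0 \<Longrightarrow> finite S \<Longrightarrow>
     (\<And>\<rho>. \<rho> \<in> S \<Longrightarrow> 9/10 \<le> Re \<rho> \<and> Re \<rho> \<le> 1 \<and> 8 \<le> \<bar>Im \<rho>\<bar> \<and> \<bar>Im \<rho>\<bar> \<le> T \<and> u \<le> Im \<rho> \<and> Im \<rho> \<le> u + l) \<Longrightarrow>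
     (\<Sum>\<rho>\<in>S. real (nat (zorder F \<rho>))) \<le> (l + 2) * (C2 * ln (2 * T))"
    by (rule zeros_in_interval_count[OF F fe]) blast
  have "eventually (\<lambda>T::real. ln (2 * T) \<le> T powr \<delta>) at_top" using \<delta> by real_asymp
  moreover have "eventually (\<lambda>T::real. 8 \<le> T powr \<delta>) at_top" using \<delta> by real_asymp
  ultimately have "eventually (\<lambda>T::real. ln (2 * T) \<le> T powr \<delta> \<and> 8 \<le> T powr \<delta>) at_top" by (rule eventually_conj)
  then obtain Ts2 where Ts2: "\<And>T::real. T \<ge> Ts2 \<Longrightarrow> ln (2 * T) \<le> T powr \<delta> \<and> 8 \<le> T powr \<delta>"
    unfolding eventually_at_top_linorder by blast
  define Ts where "Ts = max 2 (max Ts1 Ts2)"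
  define K0 where "K0 = real (zero_count F (9/10) 8)"
  define C where "C = K0 + 5 * C2 + 6 * (C1 * C2)"
  define mu1 where "mu1 \<rho> = real (nat (zorder F \<rho>))" for \<rho>
  have mu0: "mu1 \<rho> \<ge> 0" for \<rho> by (simp add: mu1_def)
  have large: "real (zero_count F (1 - \<eta>) T) \<le> C * T powr (max d 2 * \<eta> + \<epsilon>)"
    if TT: "T \<ge> Ts" and \<eta>: "0 < \<eta>" "\<eta> \<le> 1/10" for T \<eta>
  proof -
    have T: "T \<ge> 2" "T \<ge> Ts1" "ln (2 * T) \<le> T powr \<delta>" "8 \<le> T powr \<delta>" using TT Ts2[of T] by (auto simp: Ts_def)
    define \<sigma> where "\<sigma> = 1 - \<eta>"
    have \<sigma>: "9/10 \<le> \<sigma>" "\<sigma> \<le> 1" using \<eta> by (auto simp: \<sigma>_def)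
    define l where "l = 2 * T powr \<delta>"
    have l: "l \<ge> 16" using T by (simp add: l_def)
    define Z0 where "Z0 = {\<rho>. \<rho> \<in> nontrivial_zeros F \<and> Re \<rho> \<ge> \<sigma> \<and> \<bar>Im \<rho>\<bar> \<le> T}"
    have finZ: "finite Z0" unfolding Z0_def by (rule finite_counted_zeros[OF F])
    have Z0: "F \<rho> = 0" "9/10 \<le> Re \<rho>" "\<sigma> \<le> Re \<rho>" "Re \<rho> \<le> 1" "\<bar>Im \<rho>\<bar> \<le> T" if "\<rho> \<in> Z0" for \<rho>
      using that \<sigma> by (auto simp: Z0_def nontrivial_zeros_def)
    \<comment> \<open>Zeros below height 8 contribute a constant, those below l are few by the local
      count, and only the others satisfy the height condition of the detection.\<close>
    define A1 A2 A3 where "A1 = {\<rho> \<in> Z0. \<bar>Im \<rho>\<bar> < 8}" and "A2 = {\<rho> \<in> Z0. 8 \<le> \<bar>Im \<rho>\<bar> \<and> \<bar>Im \<rho>\<bar> < l}" and "A3 = {\<rho> \<in> Z0. l \<le> \<bar>Im \<rho>\<bar>}"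
    have finA: "finite A1" "finite A2" "finite A3" using finZ by (auto simp: A1_def A2_def A3_def)
    have dis: "A1 \<inter> (A2 \<union> A3) = {}" "A2 \<inter> A3 = {}" using l by (auto simp: A1_def A2_def A3_def)
    have Zu: "Z0 = A1 \<union> (A2 \<union> A3)" using l by (auto simp: A1_def A2_def A3_def)
    have "(\<Sum>\<rho>\<in>Z0. mu1 \<rho>) = (\<Sum>\<rho>\<in>A1. mu1 \<rho>) + ((\<Sum>\<rho>\<in>A2. mu1 \<rho>) + (\<Sum>\<rho>\<in>A3. mu1 \<rho>))"
      unfolding Zu sum.union_disjoint[OF finA(1) finite_UnI[OF finA(2,3)] dis(1)] sum.union_disjoint[OF finA(2,3) dis(2)] ..
    moreover have "real (zero_count F \<sigma> T) = (\<Sum>\<rho>\<in>Z0. mu1 \<rho>)" by (simp add: zero_count_def Z0_def mu1_def)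
    ultimately have split: "real (zero_count F \<sigma> T) = (\<Sum>\<rho>\<in>A1. mu1 \<rho>) + ((\<Sum>\<rho>\<in>A2. mu1 \<rho>) + (\<Sum>\<rho>\<in>A3. mu1 \<rho>))" by simp
    have b1: "(\<Sum>\<rho>\<in>A1. mu1 \<rho>) \<le> K0"
    proof -
      have "(\<Sum>\<rho>\<in>A1. mu1 \<rho>) \<le> (\<Sum>\<rho> | \<rho> \<in> nontrivial_zeros F \<and> Re \<rho> \<ge> 9/10 \<and> \<bar>Im \<rho>\<bar> \<le> 8. mu1 \<rho>)"
      proof (rule sum_mono2[OF finite_counted_zeros[OF F]])
        show "A1 \<subseteq> {\<rho>. \<rho> \<in> nontrivial_zeros F \<and> Re \<rho> \<ge> 9/10 \<and> \<bar>Im \<rho>\<bar> \<le> 8}"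
          using \<sigma> by (auto simp: A1_def Z0_def)
      qed (rule mu0)
      then show ?thesis by (simp add: K0_def zero_count_def mu1_def)
    qed
    define V where "V = T powr \<delta>"
    have V8: "V \<ge> 8" "l = 2 * V" "ln (2 * T) \<le> V" using T by (auto simp: V_def l_def)
    have b2: "(\<Sum>\<rho>\<in>A2. mu1 \<rho>) \<le> 5 * C2 * (V * V)"
    proof -
      have "(\<Sum>\<rho>\<in>A2. mu1 \<rho>) \<le> (2 * l + 2) * (C2 * ln (2 * T))"
        unfolding mu1_def
      proof (rule zi[of T "2 * l" A2 "-l"])
        fix \<rho> assume r: "\<rho> \<in> A2"
        then have "\<bar>Im \<rho>\<bar> < l" "8 \<le> \<bar>Im \<rho>\<bar>" "\<rho> \<in> Z0" by (auto simp: A2_def)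
        then show "9/10 \<le> Re \<rho> \<and> Re \<rho> \<le> 1 \<and> 8 \<le> \<bar>Im \<rho>\<bar> \<and> \<bar>Im \<rho>\<bar> \<le> T \<and> -l \<le> Im \<rho> \<and> Im \<rho> \<le> -l + 2 * l"
          using Z0[of \<rho>] by auto
      qed (use T l finA in auto)
      also have "\<dots> \<le> (5 * V) * (C2 * V)" using V8 C2 T by (intro mult_mono mult_left_mono) auto
      finally show ?thesis by (simp add: mult_ac)
    qed
    define i where "i \<rho> = \<lfloor>Im \<rho> / l\<rfloor>" for \<rho> :: complex
    define Bd where "Bd = C1 * T powr (2 * D * (1 - \<sigma>) + 11 * \<delta>)"
    have Bd0: "Bd \<ge> 0" using C1 by (simp add: Bd_def)
    have il: "real_of_int (i \<rho>) * l \<le> Im \<rho>" "Im \<rho> < real_of_int (i \<rho>) * l + l" for \<rho>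
    proof -
      have "real_of_int (i \<rho>) \<le> Im \<rho> / l" "Im \<rho> / l < real_of_int (i \<rho>) + 1" unfolding i_def by linarith+
      then show "real_of_int (i \<rho>) * l \<le> Im \<rho>" "Im \<rho> < real_of_int (i \<rho>) * l + l" using l by (simp_all add: field_simps)
    qed
    \<comment> \<open>Windows with distinct indices of equal parity have at least one full window
      between them, so their representatives are spaced as required.\<close>
    have par: "real (card {j \<in> i ` A3. even j = b}) \<le> Bd" for b
    proof -
      define I where "I = {j \<in> i ` A3. even j = b}"
      have "\<exists>\<rho>. \<rho> \<in> A3 \<and> i \<rho> = j" if "j \<in> I" for j using that unfolding I_def by blast
      then obtain rep where rep: "\<And>j. j \<in> I \<Longrightarrow> rep j \<in> A3 \<and> i (rep j) = j" by metis
      have inj: "inj_on rep I" by (rule inj_on_inverseI[of _ i]) (use rep in auto)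
      have finI: "finite I" unfolding I_def using finA by simp
      have "real (card (rep ` I)) \<le> Bd"
        unfolding Bd_def
      proof (rule sz[rule_format, OF T(2) \<sigma>])
        show "finite (rep ` I)" using finI by simp
        fix x assume "x \<in> rep ` I"
        then have xA: "x \<in> A3" and xI: "i x \<in> I" "rep (i x) = x" using rep by auto
        show "F x = 0 \<and> \<sigma> \<le> Re x \<and> Re x \<le> 1 \<and> 2 * T powr \<delta> \<le> \<bar>Im x\<bar> \<and> \<bar>Im x\<bar> \<le> T"
          using xA Z0[of x] by (auto simp: A3_def l_def)
        fix y assume "y \<in> rep ` I" and xy: "x \<noteq> y"
        then have yI: "i y \<in> I" "rep (i y) = y" using rep by auto
        have ne: "i x \<noteq> i y" using xI yI xy by metis
        have ev: "even (i x - i y)" using xI(1) yI(1) by (auto simp: I_def)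
        have "i x - i y \<ge> 2 \<or> i x - i y \<le> -2"
        proof -
          obtain m where m: "i x - i y = 2 * m" using ev by blast
          then have "m \<noteq> 0" using ne by auto
          then show ?thesis using m by linarith
        qed
        then have "l \<le> \<bar>Im x - Im y\<bar>"
        proof
          assume "i x - i y \<ge> 2"
          then have "2 * l \<le> (real_of_int (i x) - real_of_int (i y)) * l" using l by (intro mult_right_mono) linarith+
          then show ?thesis using il[of x] il[of y] by (simp add: left_diff_distrib)
        next
          assume "i x - i y \<le> -2"
          then have "2 * l \<le> (real_of_int (i y) - real_of_int (i x)) * l" using l by (intro mult_right_mono) linarith+
          then show ?thesis using il[of x] il[of y] by (simp add: left_diff_distrib)
        qed
        then show "2 * T powr \<delta> \<le> \<bar>Im x - Im y\<bar>" by (simp add: l_def)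
      qed
      then show ?thesis using card_image[OF inj] by (simp add: I_def)
    qed
    have ci: "real (card (i ` A3)) \<le> 2 * Bd"
    proof -
      have "i ` A3 \<subseteq> {j \<in> i ` A3. even j = True} \<union> {j \<in> i ` A3. even j = False}" by blast
      then have "card (i ` A3) \<le> card ({j \<in> i ` A3. even j = True} \<union> {j \<in> i ` A3. even j = False})"
        using finA by (intro card_mono) auto
      also have "\<dots> \<le> card {j \<in> i ` A3. even j = True} + card {j \<in> i ` A3. even j = False}" by (rule card_Un_le)
      finally have "real (card (i ` A3)) \<le> real (card {j \<in> i ` A3. even j = True}) + real (card {j \<in> i ` A3. even j = False})" by linarith
      also have "\<dots> \<le> Bd + Bd" by (intro add_mono par)
      finally show ?thesis by simp
    qed
    have b3: "(\<Sum>\<rho>\<in>A3. mu1 \<rho>) \<le> 6 * C2 * (V * V) * Bd"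
    proof -
      have "(\<Sum>\<rho>\<in>A3. mu1 \<rho>) \<le> real (card (i ` A3)) * ((l + 2) * (C2 * ln (2 * T)))"
      proof (rule sum_le_card_times[OF finA(3)])
        fix j assume "j \<in> i ` A3"
        show "(\<Sum>\<rho>\<in>{\<rho> \<in> A3. i \<rho> = j}. mu1 \<rho>) \<le> (l + 2) * (C2 * ln (2 * T))"
          unfolding mu1_def
        proof (rule zi[of T l _ "real_of_int j * l"])
          fix \<rho> assume "\<rho> \<in> {\<rho> \<in> A3. i \<rho> = j}"
          then have "\<rho> \<in> Z0" "l \<le> \<bar>Im \<rho>\<bar>" "i \<rho> = j" by (auto simp: A3_def)
          then show "9/10 \<le> Re \<rho> \<and> Re \<rho> \<le> 1 \<and> 8 \<le> \<bar>Im \<rho>\<bar> \<and> \<bar>Im \<rho>\<bar> \<le> T \<and> real_of_int j * l \<le> Im \<rho> \<and> Im \<rho> \<le> real_of_int j * l + l"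
            using Z0[of \<rho>] il[of \<rho>] l by auto
        qed (use T l finA in auto)
      qed
      also have "\<dots> \<le> (2 * Bd) * ((3 * V) * (C2 * V))"
        using V8 C2 T Bd0 by (intro mult_mono mult_left_mono ci mult_nonneg_nonneg) auto
      finally show ?thesis by (simp add: mult_ac)
    qed
    define W where "W = T powr (2 * D * (1 - \<sigma>) + 13 * \<delta>)"
    have e0: "2 * D * (1 - \<sigma>) \<ge> 0" using D \<sigma> by simp
    have VV: "V * V = T powr (2 * \<delta>)" unfolding V_def by (simp add: powr_add[symmetric])
    have w1: "1 \<le> W" unfolding W_def using T e0 \<delta> by (intro ge_one_powr_ge_zero) auto
    have w2: "V * V \<le> W" unfolding VV W_def using T e0 \<delta> by (intro powr_mono) auto
    have w3: "(V * V) * Bd = C1 * W"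
    proof -
      have "T powr (2 * \<delta>) * T powr (2 * D * (1 - \<sigma>) + 11 * \<delta>) = W" unfolding W_def powr_add[symmetric]
        by (rule arg_cong[where f = "\<lambda>e. T powr e"]) simp
      then show ?thesis unfolding VV Bd_def by (simp add: mult.left_commute)
    qed
    have K00: "K0 \<ge> 0" by (simp add: K0_def)
    have "real (zero_count F \<sigma> T) \<le> K0 + (5 * C2 * (V * V) + 6 * C2 * (V * V) * Bd)"
      unfolding split by (intro add_mono b1 b2 b3)
    also have "6 * C2 * (V * V) * Bd = 6 * (C1 * C2) * W" using w3 by (simp add: mult_ac)
    finally have "real (zero_count F \<sigma> T) \<le> K0 * 1 + (5 * C2 * (V * V) + 6 * (C1 * C2) * W)" by simp
    also have "\<dots> \<le> K0 * W + (5 * C2 * W + 6 * (C1 * C2) * W)"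
      using K00 C2 w1 w2 by (intro add_mono mult_left_mono order_refl) auto
    also have "\<dots> = C * W" by (simp add: C_def distrib_right)
    also have "\<dots> \<le> C * T powr (max d 2 * \<eta> + \<epsilon>)"
    proof (rule mult_left_mono)
      show "W \<le> T powr (max d 2 * \<eta> + \<epsilon>)" unfolding W_def D(3) \<sigma>_def using T \<delta> by (intro powr_mono) auto
      show "0 \<le> C" using K00 C1 C2 by (simp add: C_def)
    qed
    finally show ?thesis by (simp add: \<sigma>_def)
  qed
  \<comment> \<open>Below Ts the monotonicity of the count in both arguments gives a bound
    independent of \<eta>.\<close>
  define C' where "C' = max C (real (zero_count F (9/10) Ts))"
  show ?thesis
  proof (intro exI[of _ C'] allI impI)
    fix T \<eta> :: real assume T: "2 \<le> T" and "0 < \<eta> \<and> \<eta> \<le> 1/10"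
    then have \<eta>: "0 < \<eta>" "\<eta> \<le> 1/10" by auto
    define P where "P = T powr (max d 2 * \<eta> + \<epsilon>)"
    have P1: "P \<ge> 1" unfolding P_def using T \<eta> assms(3) D by (intro ge_one_powr_ge_zero) auto
    show "real (zero_count F (1 - \<eta>) T) \<le> C' * T powr (max d 2 * \<eta> + \<epsilon>)"
    proof (cases "T \<ge> Ts")
      case True
      have "real (zero_count F (1 - \<eta>) T) \<le> C * P" unfolding P_def by (rule large[OF True \<eta>])
      also have "\<dots> \<le> C' * P" using P1 by (intro mult_right_mono) (auto simp: C'_def)
      finally show ?thesis by (simp add: P_def)
    next
      case False
      have "zero_count F (1 - \<eta>) T \<le> zero_count F (9/10) Ts" using False \<eta> by (intro zero_count_mono F) auto
      then have "real (zero_count F (1 - \<eta>) T) \<le> C' * 1" by (simp add: C'_def)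
      also have "\<dots> \<le> C' * P" using P1 by (intro mult_left_mono) (auto simp: C'_def le_max_iff_disj)
      finally show ?thesis by (simp add: P_def)
    qed
  qed
qed

end
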